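(* Let $K$ be either $\mathbb{Q}$ or an imaginary quadratic number field. For any $s \in \mathbb{C}$ with $\sigma = \operatorname{Re}(s) > 1$, there exists a real-valued $C^{\infty}$ function $M_{\sigma,1} : \mathbb{C} \to \mathbb{R}$ satisfying $M_{\sigma,1}(w) \geq 0$ for all $w \in \mathbb{C}$ and $\int_{\mathbb{C}} M_{\sigma,1}(w)\, |dw| = 1$, such that $$\mathrm{Avg}_\chi \, \Phi(\mathcal{L}'(s,\chi)) = \int_{\mathbb{C}} M_{\sigma,1}(w)\, \Phi(w)\, |dw|$$ holds for any continuous function $\Phi : \mathbb{C} \to \mathbb{C}$ (in particular, the limit defining the left-hand side exists).
   Context: Throughout, $|dw| = (2\pi)^{-1}\,dx\,dy$ for $w = x+iy$. Family of characters: $K$ has exactly one archimedean prime $\wp_\infty$. The variable $\chi$ runs over all (primitive) Dirichlet characters on $K$, i.e. ray class characters of $K$ (finite-order Hecke characters), whose conductor $\mathbf{f}_\chi$ (the non-archimedean part) is a prime divisor, i.e. a nonzero prime ideal of the ring of integers of $K$, and which satisfy $\chi(\wp_\infty)=1$, i.e. are trivial at the archimedean prime. For $K=\mathbb{Q}$ these are the even primitive Dirichlet characters of prime conductor. One sets $\chi(\wp)=0$ when $\wp = \mathbf{f}_\chi$. Average: for a complex-valued function $\phi(\chi)$ on this family, $$\mathrm{Avg}_\chi\, \phi(\chi) = \lim_{m\to\infty} \mathrm{Avg}_{N(\mathbf{f})\le m}\, \phi(\chi), \qquad \mathrm{Avg}_{N(\mathbf{f})\le m}\, \phi(\chi) =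 \frac{\sum_{N(\mathbf{f})\le m} \left( \sum_{\mathbf{f}_\chi=\mathbf{f}} \phi(\chi)\right) \big/ \left(\sum_{\mathbf{f}_\chi=\mathbf{f}} 1\right)}{\sum_{N(\mathbf{f})\le m} 1},$$ where $\mathbf{f}$ runs over prime divisors (nonzero prime ideals) of norm at most $m$, the finitely many $\mathbf{f}$ that are not the conductor of any character in the family being omitted. $L$-function: for $\operatorname{Re}(s)>1$, $L(s,\chi) = \prod_{\wp} (1-\chi(\wp) N\wp^{-s})^{-1}$, the product over all non-archimedean primes $\wp$ of $K$ with norm $N\wp$; $\mathcal{L}(s,\chi) = L'(s,\chi)/L(s,\chi)$, and $\mathcal{L}'(s,\chi) = \frac{d}{ds}\mathcal{L}(s,\chi)$. *)

theory Defs
  imports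
    "HOL-Analysis.Analysis"
    "HOL-Algebra.Ideal_Product"
    "HOL-Algebra.QuotRing"
    "HOL-Algebra.Multiplicative_Group"
    "HOL-Algebra.Algebraic_Closure_Type"
begin

section \<open>The base field\<close>

text \<open>
  The number field \<open>K\<close> is a type \<open>'k\<close> of class \<^class>\<open>field_char_0\<close>; as an HOL-Algebra ring it
  is \<^const>\<open>ring_of_type_algebra\<close>. Ideals, and characters as functions of ideals, live on \<open>'k set\<close>.
\<close>

definition real_embeddings :: "('k :: field_char_0 \<Rightarrow> real) set" where
  "real_embeddings = ring_hom ring_of_type_algebra ring_of_type_algebra"

definition imaginary_quadratic :: "'k :: field_char_0 itself \<Rightarrow> bool" where
  "imaginary_quadratic (_ :: 'k itself) \<longleftrightarrow>
     vector_space.dim (\<lambda>(q :: rat) (x :: 'k). of_rat q * x) UNIV = 2 \<and>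
     (real_embeddings :: ('k \<Rightarrow> real) set) = {}"

definition ring_of_integers :: "'k :: field_char_0 ring" where
  "ring_of_integers = ring_of_type_algebra\<lparr>carrier := {x. algebraic_int x}\<rparr>"

definition prime_divisors :: "'k :: field_char_0 set set" where
  "prime_divisors = {P. primeideal P ring_of_integers \<and> P \<noteq> {0}}"

definition ideal_norm :: "'k :: field_char_0 set \<Rightarrow> nat" where
  "ideal_norm I = card (carrier (ring_of_integers Quot I))"


section \<open>Ray class characters\<close>

definition coprime_ideal :: "'k :: field_char_0 set \<Rightarrow> 'k set \<Rightarrow> bool" where
  "coprime_ideal f A \<longleftrightarrow>
     ideal A ring_of_integers \<and> A \<noteq> {0} \<and>
     A <+>\<^bsub>ring_of_integers\<^esub> f = carrier ring_of_integers"

definition fractional_ideal :: "'k :: field_char_0 set \<Rightarrow> bool" where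
  "fractional_ideal J \<longleftrightarrow>
     additive_subgroup J ring_of_type_algebra \<and> J \<noteq> {0} \<and>
     (\<forall>a\<in>carrier ring_of_integers. \<forall>x\<in>J. a * x \<in> J) \<and>
     (\<exists>d\<in>carrier ring_of_integers. d \<noteq> 0 \<and> (\<forall>x\<in>J. d * x \<in> carrier ring_of_integers))"

definition principal_ideal :: "'k :: field_char_0 \<Rightarrow> 'k set" where
  "principal_ideal \<alpha> = (\<lambda>x. \<alpha> * x) ` carrier ring_of_integers"

text \<open>The group of fractional ideals \<open>J = A B\<^sup>-\<^sup>1\<close> with \<open>A\<close>, \<open>B\<close> integral and prime to \<open>f\<close>.\<close>

definition ideal_group :: "'k :: field_char_0 set \<Rightarrow> 'k set monoid" where
  "ideal_group f =
     \<lparr>carrier = {J. fractional_ideal J \<and>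
        (\<exists>A B. coprime_ideal f A \<and> coprime_ideal f B \<and> ideal_prod ring_of_type_algebra J B = A)},
      monoid.mult = ideal_prod ring_of_type_algebra,
      one = carrier ring_of_integers\<rparr>"

text \<open>The multiplicative congruence \<open>\<alpha> \<equiv> 1 (mod\<^sup>\<times> f)\<close> in \<open>K\<^sup>\<times>\<close>.\<close>

definition cong_one :: "'k :: field_char_0 set \<Rightarrow> 'k \<Rightarrow> bool" where
  "cong_one f \<alpha> \<longleftrightarrow>
     (\<exists>a\<in>carrier ring_of_integers. \<exists>b\<in>carrier ring_of_integers.
        coprime_ideal f (principal_ideal a) \<and> coprime_ideal f (principal_ideal b) \<and>
        a - b \<in> f \<and> \<alpha> = a / b)"

definition totally_positive :: "'k :: field_char_0 \<Rightarrow> bool" where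
  "totally_positive \<alpha> \<longleftrightarrow> (\<forall>\<tau>\<in>real_embeddings. \<tau> \<alpha> > 0)"

text \<open>
  Characters of the ray class group with modulus \<open>f\<close> times all real primes (the narrow ray class
  group), as functions of fractional ideals extended by \<open>0\<close> to all other sets. The extension makes
  a character a unique function and gives \<open>\<psi> P = 0\<close> for primes \<open>P\<close> dividing \<open>f\<close>. As ray class groups
  are finite, all these characters have finite order.
\<close>

definition ray_class_character ::
    "'k :: field_char_0 set \<Rightarrow> ('k set \<Rightarrow> complex) \<Rightarrow> bool" where
  "ray_class_character f \<psi> \<longleftrightarrow>
     \<psi> \<in> hom (ideal_group f) (mult_of ring_of_type_algebra) \<and>
     (\<forall>J. J \<notin> carrier (ideal_group f) \<longrightarrow> \<psi> J = 0) \<and>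
     (\<forall>\<alpha>. cong_one f \<alpha> \<and> totally_positive \<alpha> \<longrightarrow> \<psi> (principal_ideal \<alpha>) = 1)"

text \<open>\<open>f\<close> is the finite part of the conductor of \<open>\<psi>\<close>: no proper divisor of \<open>f\<close> is a modulus of \<open>\<psi>\<close>.\<close>

definition primitive_character ::
    "'k :: field_char_0 set \<Rightarrow> ('k set \<Rightarrow> complex) \<Rightarrow> bool" where
  "primitive_character f \<psi> \<longleftrightarrow>
     ray_class_character f \<psi> \<and>
     \<not> (\<exists>g \<psi>'. ideal g ring_of_integers \<and> f \<subset> g \<and> ray_class_character g \<psi>' \<and>
              (\<forall>J\<in>carrier (ideal_group f). \<psi> J = \<psi>' J))"

text \<open>
  The archimedean components of the idele class character belonging to \<open>\<psi>\<close> are read off from the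
  values \<open>\<psi> (\<alpha>)\<close> for \<open>\<alpha> \<equiv> 1 (mod\<^sup>\<times> f)\<close> of arbitrary signature. For \<open>K = \<rat>\<close> triviality means that
  the Dirichlet character is even; over an imaginary quadratic field it is automatic.
\<close>

definition trivial_at_infinity ::
    "'k :: field_char_0 set \<Rightarrow> ('k set \<Rightarrow> complex) \<Rightarrow> bool" where
  "trivial_at_infinity f \<psi> \<longleftrightarrow> (\<forall>\<alpha>. cong_one f \<alpha> \<longrightarrow> \<psi> (principal_ideal \<alpha>) = 1)"

definition char_family :: "'k :: field_char_0 set \<Rightarrow> ('k set \<Rightarrow> complex) set" where
  "char_family f = {\<psi>. primitive_character f \<psi> \<and> trivial_at_infinity f \<psi>}"


section \<open>Averages\<close>

definition conductors :: "nat \<Rightarrow> 'k :: field_char_0 set set" where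
  "conductors m = {f \<in> prime_divisors. ideal_norm f \<le> m \<and> char_family f \<noteq> {}}"

definition avg_upto :: "nat \<Rightarrow> (('k :: field_char_0 set \<Rightarrow> complex) \<Rightarrow> complex) \<Rightarrow> complex" where
  "avg_upto m \<phi> =
     (\<Sum>f\<in>conductors m. (\<Sum>\<psi>\<in>char_family f. \<phi> \<psi>) / of_nat (card (char_family f))) /
     of_nat (card (conductors m :: 'k set set))"


section \<open>L-functions\<close>

text \<open>The Euler product is the limit of the finite partial products, meaningful for \<open>Re s > 1\<close>.\<close>

definition L_function :: "complex \<Rightarrow> ('k :: field_char_0 set \<Rightarrow> complex) \<Rightarrow> complex" where
  "L_function s \<psi> =
     Lim (finite_subsets_at_top prime_divisors)
       (\<lambda>F. \<Prod>P\<in>F. inverse (1 - \<psi> P * of_nat (ideal_norm P) powr (- s)))"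

definition log_deriv_L :: "complex \<Rightarrow> ('k :: field_char_0 set \<Rightarrow> complex) \<Rightarrow> complex" where
  "log_deriv_L s \<psi> = deriv (\<lambda>z. L_function z \<psi>) s / L_function s \<psi>"

definition log_deriv_L' :: "complex \<Rightarrow> ('k :: field_char_0 set \<Rightarrow> complex) \<Rightarrow> complex" where
  "log_deriv_L' s \<psi> = deriv (\<lambda>z. log_deriv_L z \<psi>) s"


section \<open>Smooth functions and the measure on the plane\<close>

primrec C_k :: "nat \<Rightarrow> ('a :: euclidean_space \<Rightarrow> 'b :: real_normed_vector) \<Rightarrow> bool" where
  "C_k 0 f \<longleftrightarrow> continuous_on UNIV f"
| "C_k (Suc k) f \<longleftrightarrow>
     (\<forall>x. f differentiable (at x)) \<and> (\<forall>v. C_k k (\<lambda>x. frechet_derivative f (at x) v))"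

definition C_infinity :: "('a :: euclidean_space \<Rightarrow> 'b :: real_normed_vector) \<Rightarrow> bool" where
  "C_infinity f \<longleftrightarrow> (\<forall>k. C_k k f)"

text \<open>\<open>|dw| = (2\<pi>)\<^sup>-\<^sup>1 dx dy\<close>\<close>

definition abs_dw :: "complex measure" where
  "abs_dw = density lborel (\<lambda>_. ennreal (1 / (2 * pi)))"

end

theory Submission
  imports Defs "HOL-Probability.Probability" "HOL-Complex_Analysis.Complex_Analysis"
begin

text \<open>
  For \<open>Re s > 1\<close> the value \<open>\<L>'(s, \<chi>)\<close> is the absolutely convergent series of
  \<open>(log N\<wp>)\<^sup>2 k(\<chi>(\<wp>) N\<wp>\<^sup>-\<^sup>s)\<close> with \<open>k(z) = z / (1 - z)\<^sup>2\<close>, hence a continuous function of the vector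
  \<open>(\<chi>(\<wp>))\<^sub>\<wp>\<close> in a product of closed unit discs. As \<open>N(f)\<close> grows, these vectors become equidistributed
  on the product of the unit circles: a monomial in the \<open>\<chi>(\<wp>)\<close> and their conjugates is the value of
  \<open>\<chi>\<close> at a fractional ideal \<open>J\<close>. If \<open>J\<close> is not the unit ideal, it is nontrivial in the ray class group
  modulo \<open>f\<close> for all large \<open>f\<close>, so that the characters of modulus \<open>f\<close> sum to \<open>0\<close> at \<open>J\<close>. Those of them
  that are imprimitive have conductor \<open>1\<close> and form a negligible proportion. Stone-Weierstrass extends
  the convergence from monomials to continuous functions.

  The limit law is therefore that of \<open>\<Sum>\<^sub>\<wp> (log N\<wp>)\<^sup>2 k(N\<wp>\<^sup>-\<^sup>\<sigma> t\<^sub>\<wp>)\<close> with independent \<open>t\<^sub>\<wp>\<close>, uniform on the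
  unit circle; the unimodular part of \<open>N\<wp>\<^sup>-\<^sup>s\<close> is absorbed by rotation. Its characteristic function is a product
  over \<open>\<wp>\<close>. By a stationary phase estimate on the circle all but finitely many factors are
  \<open>O(|y|\<^sup>-\<^sup>1\<^sup>/\<^sup>2)\<close>, so that the product decays faster than any power of \<open>|y|\<close>, and Fourier inversion
  yields a smooth density.
\<close>


section \<open>Fourier integrals in the plane\<close>

text \<open>That \<open>K\<close> has a single archimedean prime enters where a fixed ideal
  \<open>J\<close> is shown to be nontrivial modulo all large \<open>f\<close>. If
  \<open>\<beta>\<close> generates \<open>J\<close>, triviality means that
  \<open>u * \<beta>\<close> is congruent to \<open>1\<close> modulo \<open>f\<close> for some unit
  \<open>u\<close>; finitely many units leave finitely many nonzero numbers
  \<open>1 - u * \<beta>\<close>, hence finitely many \<open>f\<close>. The same fact controls the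
  imprimitive characters: they are trivial at the ideals generated by \<open>1, ..., k\<close>,
  which lie in distinct ray classes for large \<open>f\<close>, so their proportion is at most
  \<open>1 / k\<close>. Conjugation stands in for general ideal theory: an ideal times its conjugate
  is generated by a positive integer, which yields inverses. Arbitrary continuous
  \<open>\<Phi>\<close> are reached because the series is bounded, so that the limit law has compact
  support. The stationary phase bound must hold for every direction of \<open>y\<close>, although
  the stationary points move with it; one integration by parts with a smoothed reciprocal of the
  phase derivative treats all directions at once.\<close>

lemma borel_measurable_cis [measurable]: "cis \<in> borel_measurable borel"
  by (intro borel_measurable_continuous_onI continuous_intros)

text \<open>Both measures give a box the product of its side lengths, which determines Lebesgue
  measure. The transfer makes Fubini on pairs of reals available for functions on the complex
  plane.\<close>

lemma lborel_complex:
  "(lborel :: complex measure) = distr (lborel \<Otimes>\<^sub>M lborel) borel (\<lambda>p. complex_of_real (fst p) + \<i> * of_real (snd p))"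
proof (rule lborel_eqI)
  have m[measurable]: "(\<lambda>p. complex_of_real (fst p) + \<i> * of_real (snd p)) \<in> borel_measurable (lborel \<Otimes>\<^sub>M lborel)"
    by measurable
  fix l u :: complex assume le: "\<And>b. b \<in> Basis \<Longrightarrow> l \<bullet> b \<le> u \<bullet> b"
  have le': "Re l \<le> Re u" "Im l \<le> Im u" using le[of 1] le[of \<i>] by (auto simp: Basis_complex_def)
  have "(\<lambda>p. complex_of_real (fst p) + \<i> * of_real (snd p)) -` box l u \<inter> space (lborel \<Otimes>\<^sub>M lborel)
     = {Re l<..<Re u} \<times> {Im l<..<Im u}"
    by (auto simp: box_def Basis_complex_def space_pair_measure)
  then have "emeasure (distr (lborel \<Otimes>\<^sub>M lborel) borel (\<lambda>p. complex_of_real (fst p) + \<i> * of_real (snd p))) (box l u)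
    = emeasure (lborel \<Otimes>\<^sub>M lborel) ({Re l<..<Re u} \<times> {Im l<..<Im u})"
    by (subst emeasure_distr) auto
  also have "\<dots> = emeasure lborel {Re l<..<Re u} * emeasure lborel {Im l<..<Im u}"
    by (rule lborel.emeasure_pair_measure_Times) auto
  also have "\<dots> = ennreal ((Re u - Re l) * (Im u - Im l))" using le' by (simp add: ennreal_mult')
  also have "\<dots> = ennreal (\<Prod>b\<in>Basis. (u - l) \<bullet> b)" by (simp add: Basis_complex_def)
  finally show "emeasure (distr (lborel \<Otimes>\<^sub>M lborel) borel (\<lambda>p. complex_of_real (fst p) + \<i> * of_real (snd p))) (box l u)
    = (\<Prod>b\<in>Basis. (u - l) \<bullet> b)" .
qed simp

lemma complex_product_integral:
  fixes f g :: "real \<Rightarrow> complex"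
  assumes f: "integrable lborel f" and g: "integrable lborel g"
  shows "integrable lborel (\<lambda>z. f (Re z) * g (Im z))"
    and "(LINT z|lborel. f (Re z) * g (Im z)) = (LINT x|lborel. f x) * (LINT y|lborel. g y)"
proof -
  have [measurable]: "f \<in> borel_measurable borel" "g \<in> borel_measurable borel"
    using f g by auto
  have int: "integrable (lborel \<Otimes>\<^sub>M lborel) (\<lambda>(x, y). f x * g y)"
  proof (rule lborel_pair.Fubini_integrable)
    show "integrable lborel (\<lambda>x. LINT y|lborel. norm (case (x, y) of (x, y) \<Rightarrow> f x * g y))"
      using f by (simp add: norm_mult)
    show "AE x in lborel. integrable lborel (\<lambda>y. case (x, y) of (x, y) \<Rightarrow> f x * g y)"
      using g by simp
  qed simp
  then have int': "integrable (lborel \<Otimes>\<^sub>M lborel) (\<lambda>p. f (fst p) * g (snd p))" by (simp add: case_prod_beta')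
  show "integrable lborel (\<lambda>z. f (Re z) * g (Im z))"
    unfolding lborel_complex by (subst integrable_distr_eq) (use int' in simp_all)
  have "(LINT z|lborel. f (Re z) * g (Im z)) = (LINT p|(lborel \<Otimes>\<^sub>M lborel). f (fst p) * g (snd p))"
    unfolding lborel_complex by (subst integral_distr) simp_all
  also have "\<dots> = (LINT x|lborel. LINT y|lborel. f x * g y)"
    using lborel_pair.integral_fst[OF int] by (simp add: case_prod_beta')
  finally show "(LINT z|lborel. f (Re z) * g (Im z)) = (LINT x|lborel. f x) * (LINT y|lborel. g y)" by simp
qed

lemma integrable_inverse_square_real: "integrable lborel (\<lambda>x :: real. inverse (1 + x\<^sup>2))"
  using integrable_inverse_1_plus_square by (simp add: set_integrable_def)

text \<open>The fourth power dominates the product of \<open>1 + (Re y)\<^sup>2\<close> and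
  \<open>1 + (Im y)\<^sup>2\<close>, whose reciprocal is integrable as a product of integrable
  functions of one variable.\<close>

lemma integrable_decay:
  fixes h :: "complex \<Rightarrow> 'b :: {banach, second_countable_topology}"
  assumes [measurable]: "h \<in> borel_measurable borel" and le: "\<And>y. (1 + norm y) ^ 4 * norm (h y) \<le> C"
  shows "integrable lborel h"
proof (rule Bochner_Integration.integrable_bound)
  have "integrable lborel (\<lambda>x. complex_of_real (inverse (1 + x\<^sup>2)))"
    using integrable_inverse_square_real by (rule integrable_of_real)
  from complex_product_integral(1)[OF this this]
  have "integrable lborel (\<lambda>z. norm (complex_of_real (inverse (1 + (Re z)\<^sup>2)) * complex_of_real (inverse (1 + (Im z)\<^sup>2))))"
    by (rule integrable_norm)
  moreover have "norm (complex_of_real (inverse (1 + a\<^sup>2)) * complex_of_real (inverse (1 + b\<^sup>2))) = inverse (1 + a\<^sup>2) * inverse (1 + b\<^sup>2)" for a b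
    unfolding norm_mult norm_of_real by (simp add: abs_of_nonneg)
  ultimately show "integrable lborel (\<lambda>z. C * (inverse (1 + (Re z)\<^sup>2) * inverse (1 + (Im z)\<^sup>2)))"
    by (intro integrable_mult_right) (simp only:)
  show "AE y in lborel. norm (h y) \<le> norm (C * (inverse (1 + (Re y)\<^sup>2) * inverse (1 + (Im y)\<^sup>2)))"
  proof (rule AE_I2)
    fix y :: complex
    have a: "1 + (Re y)\<^sup>2 \<le> (1 + norm y)\<^sup>2" "1 + (Im y)\<^sup>2 \<le> (1 + norm y)\<^sup>2"
      by (simp_all add: power2_sum cmod_power2 algebra_simps)
    have "(1 + (Re y)\<^sup>2) * (1 + (Im y)\<^sup>2) \<le> (1 + norm y)\<^sup>2 * (1 + norm y)\<^sup>2"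
      by (intro mult_mono a) auto
    also have "\<dots> = (1 + norm y) ^ 4" by (simp add: power2_eq_square power4_eq_xxxx mult_ac)
    finally have "(1 + (Re y)\<^sup>2) * (1 + (Im y)\<^sup>2) * norm (h y) \<le> C"
      using le[of y] by (meson mult_right_mono norm_ge_zero order_trans)
    moreover have "(1 + (Re y)\<^sup>2) * (1 + (Im y)\<^sup>2) > 0" by (intro mult_pos_pos) (auto simp: add_pos_nonneg)
    ultimately have "norm (h y) \<le> C / ((1 + (Re y)\<^sup>2) * (1 + (Im y)\<^sup>2))" by (simp add: pos_le_divide_eq mult.commute)
    then show "norm (h y) \<le> norm (C * (inverse (1 + (Re y)\<^sup>2) * inverse (1 + (Im y)\<^sup>2)))"
      by (simp add: divide_inverse)
  qed
qed simp

text \<open>The sign is opposite to that in \<open>cf\<close> and no factor is attached, so that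
  \<open>fourier cf\<close> is the inversion integral up to \<open>4 * pi\<^sup>2\<close>.\<close>

definition fourier :: "(complex \<Rightarrow> complex) \<Rightarrow> complex \<Rightarrow> complex" where
  "fourier h x = (LINT y|lborel. cis (x \<bullet> y) * h y)"

lemma integrable_cis_mult:
  assumes "integrable lborel h" shows "integrable lborel (\<lambda>y :: complex. cis (x \<bullet> y) * h y)"
proof -
  have [measurable]: "h \<in> borel_measurable borel" using assms by auto
  show ?thesis by (rule Bochner_Integration.integrable_bound[OF assms]) (auto simp: norm_mult)
qed

lemma continuous_fourier:
  assumes h: "integrable lborel h" shows "continuous_on UNIV (fourier h)"
proof -
  have [measurable]: "h \<in> borel_measurable borel" using h by auto
  show ?thesis
    unfolding continuous_on_sequentially fourier_def comp_def
  proof (intro allI ballI impI)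
    fix xs :: "nat \<Rightarrow> complex" and a assume "(\<forall>n. xs n \<in> UNIV) \<and> xs \<longlonglongrightarrow> a"
    then have xs: "xs \<longlonglongrightarrow> a" by simp
    show "(\<lambda>n. LINT y|lborel. cis (xs n \<bullet> y) * h y) \<longlonglongrightarrow> (LINT y|lborel. cis (a \<bullet> y) * h y)"
    proof (rule integral_dominated_convergence[where w="\<lambda>y. norm (h y)"])
      show "AE y in lborel. (\<lambda>n. cis (xs n \<bullet> y) * h y) \<longlonglongrightarrow> cis (a \<bullet> y) * h y"
        using xs by (intro AE_I2 tendsto_intros)
    qed (use h in \<open>auto simp: norm_mult\<close>)
  qed
qed

lemma cis_approx: "norm (cis x - 1 - \<i> * of_real x) \<le> x\<^sup>2"
proof -
  have "norm (iexp x - (\<Sum>k\<le>1. (\<i> * x) ^ k / fact k)) \<le> \<bar>x\<bar> ^ Suc 1 / fact (Suc 1)" by (rule iexp_approx1)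
  then have "norm (cis x - 1 - \<i> * of_real x) \<le> x\<^sup>2 / 2"
    by (simp add: cis_conv_exp diff_diff_eq power2_eq_square abs_mult_self_eq)
  then show ?thesis by (rule order_trans) simp
qed

text \<open>Differentiation under the integral: \<open>cis_approx\<close> bounds the remainder by
  \<open>(norm v)\<^sup>2\<close> times the second moment of \<open>h\<close>. The hypothesis speaks
  of all moments because in this form it is inherited by the derivative.\<close>

lemma fourier_has_derivative:
  assumes m [measurable]: "h \<in> borel_measurable borel"
    and h: "\<And>k::nat. integrable lborel (\<lambda>y. norm y ^ k * norm (h y))"
  shows "(fourier h has_derivative (\<lambda>v. fourier (\<lambda>y. \<i> * of_real (v \<bullet> y) * h y) x)) (at x)"
proof -
  let ?D = "\<lambda>v. fourier (\<lambda>y. \<i> * of_real (v \<bullet> y) * h y) x"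
  have h0: "integrable lborel h" using h[of 0] by (simp add: integrable_norm_iff)
  have iv: "integrable lborel (\<lambda>y. \<i> * of_real (v \<bullet> y) * h y)" for v
  proof (rule Bochner_Integration.integrable_bound)
    show "integrable lborel (\<lambda>y. norm v * (norm y ^ 1 * norm (h y)))" by (intro integrable_mult_right h)
    show "AE y in lborel. norm (\<i> * of_real (v \<bullet> y) * h y) \<le> norm (norm v * (norm y ^ 1 * norm (h y)))"
      using Cauchy_Schwarz_ineq2[of v] by (intro AE_I2) (simp add: norm_mult mult.assoc[symmetric] mult_right_mono)
  qed simp
  note ic = integrable_cis_mult[OF iv, of x]
  have lin: "linear ?D"
  proof (rule linearI)
    fix u v :: complex and r :: real
    show "?D (u + v) = ?D u + ?D v"
      unfolding fourier_def using Bochner_Integration.integral_add[OF ic[of u] ic[of v]]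
      by (simp add: inner_add_left algebra_simps)
    show "?D (r *\<^sub>R u) = r *\<^sub>R ?D u"
    proof -
      have "cis (x \<bullet> y) * (\<i> * of_real ((r *\<^sub>R u) \<bullet> y) * h y) = of_real r * (cis (x \<bullet> y) * (\<i> * of_real (u \<bullet> y) * h y))" for y
        unfolding inner_scaleR_left by simp
      then show ?thesis unfolding fourier_def by (simp only: Bochner_Integration.integral_mult_right_zero scaleR_conv_of_real)
    qed
  qed
  define K where "K = (LINT y|lborel. norm y ^ 2 * norm (h y))"
  have K0: "K \<ge> 0" unfolding K_def by (rule integral_nonneg_AE) simp
  have bound: "norm (fourier h (x + v) - fourier h x - ?D v) \<le> (norm v)\<^sup>2 * K" for v
  proof -
    note I1 = integrable_cis_mult[OF h0, of "x + v"] and I2 = integrable_cis_mult[OF h0, of x]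
    have e: "cis ((x + v) \<bullet> y) = cis (x \<bullet> y) * cis (v \<bullet> y)" for y by (simp add: inner_add_left cis_mult)
    have "fourier h (x + v) - fourier h x - ?D v =
      (LINT y|lborel. cis ((x + v) \<bullet> y) * h y - cis (x \<bullet> y) * h y - cis (x \<bullet> y) * (\<i> * of_real (v \<bullet> y) * h y))"
      unfolding fourier_def Bochner_Integration.integral_diff[OF I1 I2, symmetric]
      by (rule Bochner_Integration.integral_diff[OF Bochner_Integration.integrable_diff[OF I1 I2] ic, symmetric])
    also have "\<dots> = (LINT y|lborel. cis (x \<bullet> y) * ((cis (v \<bullet> y) - 1 - \<i> * of_real (v \<bullet> y)) * h y))"
      unfolding e by (intro Bochner_Integration.integral_cong refl) (simp only: left_diff_distrib right_diff_distrib mult_1_left mult.assoc)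
    also have "norm \<dots> \<le> (LINT y|lborel. (norm v)\<^sup>2 * (norm y ^ 2 * norm (h y)))"
    proof -
      let ?f = "\<lambda>y. cis (x \<bullet> y) * ((cis (v \<bullet> y) - 1 - \<i> * of_real (v \<bullet> y)) * h y)"
      have i2: "integrable lborel (\<lambda>y. (norm v)\<^sup>2 * (norm y ^ 2 * norm (h y)))" by (intro integrable_mult_right h)
      have le: "norm (?f y) \<le> (norm v)\<^sup>2 * (norm y ^ 2 * norm (h y))" for y
      proof -
        have "norm (cis (v \<bullet> y) - 1 - \<i> * of_real (v \<bullet> y)) \<le> (v \<bullet> y)\<^sup>2" by (rule cis_approx)
        also have "\<dots> \<le> (norm v * norm y)\<^sup>2" using Cauchy_Schwarz_ineq2[of v y] by (metis abs_ge_zero power2_abs power_mono)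
        finally have "norm (cis (v \<bullet> y) - 1 - \<i> * of_real (v \<bullet> y)) * norm (h y) \<le> (norm v * norm y)\<^sup>2 * norm (h y)"
          by (rule mult_right_mono) simp
        then show ?thesis by (simp add: norm_mult power_mult_distrib mult.assoc)
      qed
      have i1: "integrable lborel ?f"
        by (rule Bochner_Integration.integrable_bound[OF i2 _ AE_I2]) (use le in \<open>auto intro: order_trans[OF _ abs_ge_self]\<close>)
      have "norm (LINT y|lborel. ?f y) \<le> (LINT y|lborel. norm (?f y))" by (rule integral_norm_bound)
      also have "\<dots> \<le> (LINT y|lborel. (norm v)\<^sup>2 * (norm y ^ 2 * norm (h y)))"
        by (intro integral_mono integrable_norm i1 i2 le)
      finally show ?thesis .
    qed
    finally show ?thesis by (simp add: K_def)
  qed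
  show ?thesis
    unfolding has_derivative_at
  proof
    show "bounded_linear ?D" using lin by (simp add: linear_conv_bounded_linear)
    show "(\<lambda>v. norm (fourier h (x + v) - fourier h x - ?D v) / norm v) \<midarrow>0\<rightarrow> 0"
    proof (rule Lim_null_comparison)
      show "\<forall>\<^sub>F v in at 0. norm (norm (fourier h (x + v) - fourier h x - ?D v) / norm v) \<le> norm v * K"
        using bound by (intro always_eventually allI) (auto simp: divide_simps power2_eq_square mult_ac)
      show "(\<lambda>v. norm v * K) \<midarrow>0\<rightarrow> 0" by (rule tendsto_eq_intros | simp)+
    qed
  qed
qed

text \<open>A derivative in direction \<open>v\<close> only multiplies the integrand by
  \<open>\<i> * of_real (v \<bullet> y)\<close>, which keeps all moments finite. The induction on
  \<open>n\<close> therefore runs with \<open>h\<close> arbitrary.\<close>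

lemma C_k_Re_fourier:
  assumes "h \<in> borel_measurable borel" "\<And>k::nat. integrable lborel (\<lambda>y. norm y ^ k * norm (h y))"
  shows "C_k n (\<lambda>x. Re (fourier h x))"
  using assms
proof (induction n arbitrary: h)
  case 0
  have "integrable lborel h" using 0(2)[of 0] 0(1) by (simp add: integrable_norm_iff)
  then show ?case using continuous_fourier by (auto intro!: continuous_on_Re)
next
  case (Suc n)
  have d: "((\<lambda>x. Re (fourier h x)) has_derivative (\<lambda>v. Re (fourier (\<lambda>y. \<i> * of_real (v \<bullet> y) * h y) x))) (at x)" for x
    by (rule has_derivative_Re[OF fourier_has_derivative[OF Suc(2,3)]])
  have "C_k n (\<lambda>x. frechet_derivative (\<lambda>x. Re (fourier h x)) (at x) v)" for v
  proof -
    have [measurable]: "h \<in> borel_measurable borel" by (rule Suc(2))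
    have "C_k n (\<lambda>x. Re (fourier (\<lambda>y. \<i> * of_real (v \<bullet> y) * h y) x))"
    proof (rule Suc(1))
      show "integrable lborel (\<lambda>y. norm y ^ k * norm (\<i> * of_real (v \<bullet> y) * h y))" for k
      proof (rule Bochner_Integration.integrable_bound)
        show "integrable lborel (\<lambda>y. norm v * (norm y ^ Suc k * norm (h y)))" by (intro integrable_mult_right Suc)
        show "AE y in lborel. norm (norm y ^ k * norm (\<i> * of_real (v \<bullet> y) * h y)) \<le> norm (norm v * (norm y ^ Suc k * norm (h y)))"
        proof (rule AE_I2)
          fix y
          have "norm y ^ k * \<bar>v \<bullet> y\<bar> * norm (h y) \<le> norm y ^ k * (norm v * norm y) * norm (h y)"
            using Cauchy_Schwarz_ineq2[of v y] by (intro mult_right_mono mult_left_mono) auto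
          then show "norm (norm y ^ k * norm (\<i> * of_real (v \<bullet> y) * h y)) \<le> norm (norm v * (norm y ^ Suc k * norm (h y)))"
            by (simp add: norm_mult abs_mult mult_ac)
        qed
      qed simp
    qed simp
    moreover have "frechet_derivative (\<lambda>x. Re (fourier h x)) (at x) = (\<lambda>v. Re (fourier (\<lambda>y. \<i> * of_real (v \<bullet> y) * h y) x))" for x
      using frechet_derivative_at[OF d[of x]] by simp
    ultimately show ?thesis by simp
  qed
  then show ?case using d by (auto simp: differentiable_def)
qed

section \<open>Densities by Gaussian regularisation\<close>

definition gauss :: "real \<Rightarrow> complex \<Rightarrow> real" where
  "gauss \<epsilon> u = normal_density 0 \<epsilon> (Re u) * normal_density 0 \<epsilon> (Im u)"

lemma borel_measurable_gauss [measurable]: "gauss \<epsilon> \<in> borel_measurable borel"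
  unfolding gauss_def[abs_def] by measurable

lemma gauss_nonneg: "gauss \<epsilon> u \<ge> 0" by (simp add: gauss_def)

lemma gauss_integral: assumes "\<epsilon> > 0" shows "integrable lborel (gauss \<epsilon>)" "(LINT u|lborel. gauss \<epsilon> u) = 1"
proof -
  have n: "integrable lborel (\<lambda>x. complex_of_real (normal_density 0 \<epsilon> x))" using assms by (intro integrable_of_real) simp
  have "integrable lborel (\<lambda>u. complex_of_real (gauss \<epsilon> u))"
    using complex_product_integral(1)[OF n n] by (simp add: gauss_def)
  then show i: "integrable lborel (gauss \<epsilon>)" by (simp add: complex_of_real_integrable_eq)
  have "complex_of_real (LINT u|lborel. gauss \<epsilon> u) = (LINT u|lborel. complex_of_real (gauss \<epsilon> u))" by simp
  also have "\<dots> = 1" using complex_product_integral(2)[OF n n] assms by (simp add: gauss_def)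
  finally show "(LINT u|lborel. gauss \<epsilon> u) = 1" by simp
qed

lemma gauss_scale: "\<epsilon> > 0 \<Longrightarrow> \<epsilon>\<^sup>2 * gauss \<epsilon> (\<epsilon> *\<^sub>R t) = gauss 1 t"
  by (simp add: gauss_def normal_density_def real_sqrt_mult power_mult_distrib power2_eq_square)

text \<open>The characteristic function of the standard normal distribution, rescaled by
  \<open>\<epsilon>\<close> and read with the roles of the Gaussian and its transform
  exchanged.\<close>

lemma gauss_fourier_1:
  assumes e: "\<epsilon> > 0"
  shows "integrable lborel (\<lambda>t :: real. cis (u * t) * of_real (exp (- (\<epsilon> * t)\<^sup>2 / 2)))"
    "(LINT t|lborel. cis (u * t) * of_real (exp (- (\<epsilon> * t)\<^sup>2 / 2))) = of_real (2 * pi * normal_density 0 \<epsilon> u)"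
proof -
  have ch: "(LINT x|lborel. cis (w * x) * of_real (std_normal_density x)) = of_real (exp (- (w\<^sup>2) / 2))" for w
  proof -
    have "complex_of_real (exp (- (w\<^sup>2) / 2)) = char std_normal_distribution w" by (simp add: char_std_normal_distribution)
    also have "\<dots> = (LINT x|lborel. std_normal_density x *\<^sub>R iexp (w * x))"
      unfolding char_def by (subst integral_density) auto
    also have "\<dots> = (LINT x|lborel. cis (w * x) * of_real (std_normal_density x))"
      by (simp add: cis_conv_exp scaleR_conv_of_real mult.commute)
    finally show ?thesis by simp
  qed
  have sn: "exp (- x\<^sup>2 / 2) = sqrt (2 * pi) * std_normal_density x" for x by (simp add: std_normal_density_def)
  have i1: "integrable lborel (\<lambda>x. cis (w * x) * of_real (std_normal_density x))" for w
  proof (rule Bochner_Integration.integrable_bound)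
    show "integrable lborel (std_normal_density)" by simp
  qed (auto simp: norm_mult)
  let ?f = "\<lambda>t :: real. cis (u * t) * of_real (exp (- (\<epsilon> * t)\<^sup>2 / 2))"
  have eq: "?f (0 + (1 / \<epsilon>) * x) = of_real (sqrt (2 * pi)) * (cis (u / \<epsilon> * x) * of_real (std_normal_density x))" for x
    using e sn[of x] by (simp add: mult_ac)
  have "integrable lborel (\<lambda>x. ?f (0 + (1 / \<epsilon>) * x))" unfolding eq by (intro integrable_mult_right i1)
  then show "integrable lborel ?f" using e by (subst (asm) lborel_integrable_real_affine_iff) auto
  have "(LINT t|lborel. ?f t) = \<bar>1 / \<epsilon>\<bar> *\<^sub>R (LINT x|lborel. ?f (0 + (1 / \<epsilon>) * x))"
    using e by (intro lborel_integral_real_affine) auto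
  also have "\<dots> = \<bar>1 / \<epsilon>\<bar> *\<^sub>R (of_real (sqrt (2 * pi)) * of_real (exp (- ((u / \<epsilon>)\<^sup>2) / 2)))"
    unfolding eq by (subst Bochner_Integration.integral_mult_right_zero) (simp only: ch)
  also have "\<dots> = of_real (1 / \<epsilon> * (sqrt (2 * pi) * exp (- ((u / \<epsilon>)\<^sup>2) / 2)))"
    using e by (simp add: scaleR_conv_of_real)
  also have "1 / \<epsilon> * (sqrt (2 * pi) * exp (- ((u / \<epsilon>)\<^sup>2) / 2)) = 2 * pi * normal_density 0 \<epsilon> u"
  proof -
    have "sqrt (2 * pi * \<epsilon>\<^sup>2) = sqrt (2 * pi) * \<epsilon>" using e by (simp add: real_sqrt_mult)
    moreover have "2 * pi / sqrt (2 * pi) = sqrt (2 * pi)" by (rule real_div_sqrt) simp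
    ultimately have "2 * pi * (1 / sqrt (2 * pi * \<epsilon>\<^sup>2)) = sqrt (2 * pi) / \<epsilon>" using e by (metis (no_types) divide_divide_eq_left times_divide_eq_right mult.right_neutral)
    moreover have "2 * pi * normal_density 0 \<epsilon> u = (2 * pi * (1 / sqrt (2 * pi * \<epsilon>\<^sup>2))) * exp (- ((u / \<epsilon>)\<^sup>2) / 2)"
      by (simp add: normal_density_def power_divide mult.commute)
    ultimately show ?thesis by simp
  qed
  finally show "(LINT t|lborel. ?f t) = of_real (2 * pi * normal_density 0 \<epsilon> u)" .
qed

text \<open>The characteristic function of the planar Gaussian \<open>gauss \<epsilon>\<close>:
  adding independent Gaussian noise to a random variable multiplies its characteristic function by
  this factor.\<close>

definition damp :: "real \<Rightarrow> complex \<Rightarrow> real" where "damp \<epsilon> y = exp (- (\<epsilon> * norm y)\<^sup>2 / 2)"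

lemma damp_measurable [measurable]: "damp \<epsilon> \<in> borel_measurable borel"
  unfolding damp_def[abs_def] by measurable

lemma damp_bounds: "0 \<le> damp \<epsilon> y" "damp \<epsilon> y \<le> 1" by (simp_all add: damp_def)

lemma gauss_fourier:
  assumes e: "\<epsilon> > 0"
  shows "integrable lborel (damp \<epsilon>)" "(LINT y|lborel. cis (u \<bullet> y) * of_real (damp \<epsilon> y)) = of_real (4 * pi\<^sup>2 * gauss \<epsilon> u)"
proof -
  have eq: "cis (u \<bullet> y) * of_real (damp \<epsilon> y) =
    (cis (Re u * Re y) * of_real (exp (- (\<epsilon> * Re y)\<^sup>2 / 2))) * (cis (Im u * Im y) * of_real (exp (- (\<epsilon> * Im y)\<^sup>2 / 2)))" for u y
  proof -
    have "damp \<epsilon> y = exp (- (\<epsilon> * Re y)\<^sup>2 / 2) * exp (- (\<epsilon> * Im y)\<^sup>2 / 2)"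
      by (simp add: damp_def exp_add[symmetric] power_mult_distrib cmod_power2 field_simps)
    moreover have "cis (u \<bullet> y) = cis (Re u * Re y) * cis (Im u * Im y)" by (simp add: inner_complex_def cis_mult)
    ultimately show ?thesis by (simp add: mult_ac)
  qed
  have "integrable lborel (\<lambda>y. cis (0 \<bullet> y) * of_real (damp \<epsilon> y))"
    unfolding eq by (rule complex_product_integral(1)) (rule gauss_fourier_1(1)[OF e])+
  then show "integrable lborel (damp \<epsilon>)" by (simp add: complex_of_real_integrable_eq)
  have "(LINT y|lborel. cis (u \<bullet> y) * of_real (damp \<epsilon> y)) = of_real (2 * pi * normal_density 0 \<epsilon> (Re u)) * of_real (2 * pi * normal_density 0 \<epsilon> (Im u))"
    unfolding eq using complex_product_integral(2)[OF gauss_fourier_1(1)[OF e] gauss_fourier_1(1)[OF e]] gauss_fourier_1(2)[OF e] by metis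
  then show "(LINT y|lborel. cis (u \<bullet> y) * of_real (damp \<epsilon> y)) = of_real (4 * pi\<^sup>2 * gauss \<epsilon> u)"
    by (simp add: gauss_def power2_eq_square mult_ac)
qed

section \<open>A bounded random variable perturbed by Gaussian noise\<close>

locale bounded_variable = prob_space \<Omega> for \<Omega> :: "'a measure" +
  fixes Z :: "'a \<Rightarrow> complex" and R :: real
  assumes Z [measurable]: "Z \<in> borel_measurable \<Omega>"
    and Z_bound: "\<And>\<omega>. norm (Z \<omega>) \<le> R"
begin

definition cf :: "complex \<Rightarrow> complex" where "cf y = (LINT \<omega>|\<Omega>. cis (- (Z \<omega> \<bullet> y)))"

lemma cf_measurable [measurable]: "cf \<in> borel_measurable borel"
  unfolding cf_def[abs_def] by measurable

text \<open>The density of \<open>Z\<close> plus Gaussian noise, by Fubini after inserting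
  \<open>gauss_fourier\<close>. The factor \<open>damp \<epsilon>\<close> makes the double integral
  absolutely convergent before any decay of \<open>cf\<close> is known.\<close>

lemma gauss_average:
  assumes e: "\<epsilon> > 0"
  shows "complex_of_real (4 * pi\<^sup>2 * (LINT \<omega>|\<Omega>. gauss \<epsilon> (x - Z \<omega>))) = fourier (\<lambda>y. cf y * of_real (damp \<epsilon> y)) x"
proof -
  interpret pair_sigma_finite \<Omega> "lborel :: complex measure" ..
  let ?f = "\<lambda>\<omega> y. cis ((x - Z \<omega>) \<bullet> y) * of_real (damp \<epsilon> y)"
  have int: "integrable (\<Omega> \<Otimes>\<^sub>M lborel) (\<lambda>(\<omega>, y). ?f \<omega> y)"
  proof (rule Fubini_integrable)
    show "integrable \<Omega> (\<lambda>\<omega>. LINT y|lborel. norm (case (\<omega>, y) of (\<omega>, y) \<Rightarrow> ?f \<omega> y))"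
      by (simp add: norm_mult damp_bounds)
    show "AE \<omega> in \<Omega>. integrable lborel (\<lambda>y. case (\<omega>, y) of (\<omega>, y) \<Rightarrow> ?f \<omega> y)"
      using integrable_cis_mult[OF integrable_of_real[OF gauss_fourier(1)[OF e]]] by simp
  qed measurable
  have "complex_of_real (4 * pi\<^sup>2 * (LINT \<omega>|\<Omega>. gauss \<epsilon> (x - Z \<omega>))) = (LINT \<omega>|\<Omega>. complex_of_real (4 * pi\<^sup>2 * gauss \<epsilon> (x - Z \<omega>)))"
    by (simp only: integral_complex_of_real Bochner_Integration.integral_mult_right_zero)
  also have "\<dots> = (LINT \<omega>|\<Omega>. LINT y|lborel. ?f \<omega> y)" by (simp only: gauss_fourier(2)[OF e])
  also have "\<dots> = (LINT y|lborel. LINT \<omega>|\<Omega>. ?f \<omega> y)" by (rule Fubini_integral[OF int, symmetric])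
  also have "\<dots> = (LINT y|lborel. cis (x \<bullet> y) * (cf y * of_real (damp \<epsilon> y)))"
  proof (rule Bochner_Integration.integral_cong[OF refl])
    fix y
    have "?f \<omega> y = (cis (x \<bullet> y) * of_real (damp \<epsilon> y)) * cis (- (Z \<omega> \<bullet> y))" for \<omega>
    proof -
      have "cis ((x - Z \<omega>) \<bullet> y) = cis (x \<bullet> y) * cis (- (Z \<omega> \<bullet> y))" by (simp add: inner_diff_left cis_mult)
      then show ?thesis by simp
    qed
    then have "(LINT \<omega>|\<Omega>. ?f \<omega> y) = (LINT \<omega>|\<Omega>. (cis (x \<bullet> y) * of_real (damp \<epsilon> y)) * cis (- (Z \<omega> \<bullet> y)))" by presburger
    then show "(LINT \<omega>|\<Omega>. ?f \<omega> y) = cis (x \<bullet> y) * (cf y * of_real (damp \<epsilon> y))"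
      unfolding cf_def Bochner_Integration.integral_mult_right_zero by (simp add: mult_ac)
  qed
  finally show ?thesis by (simp add: fourier_def)
qed

text \<open>Substitution \<open>x = w + \<epsilon> *\<^sub>R t\<close>, whose Jacobian
  \<open>\<epsilon>\<^sup>2\<close> is absorbed by \<open>gauss_scale\<close>. It turns an average
  of \<open>\<Phi>\<close> over noise around \<open>w\<close> into an integral against a
  density.\<close>

lemma gauss_convolution:
  fixes \<Phi> :: "complex \<Rightarrow> complex"
  assumes e: "\<epsilon> > 0" and [measurable]: "\<Phi> \<in> borel_measurable borel"
  shows "(LINT t|lborel. \<Phi> (w + \<epsilon> *\<^sub>R t) * of_real (gauss 1 t)) = (LINT x|lborel. \<Phi> x * of_real (gauss \<epsilon> (x - w)))"
proof -
  let ?g = "\<lambda>x. \<Phi> x * of_real (gauss \<epsilon> (x - w))"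
  have "(LINT x|lborel. ?g x) = (LINT x|density (distr lborel borel (\<lambda>x. w + \<epsilon> *\<^sub>R x)) (\<lambda>_. ennreal (\<bar>\<epsilon>\<bar> ^ DIM(complex))). ?g x)"
    by (subst lborel_affine[of \<epsilon> w]) (use e in auto)
  also have "\<dots> = (LINT x|distr lborel borel (\<lambda>x. w + \<epsilon> *\<^sub>R x). \<epsilon>\<^sup>2 *\<^sub>R ?g x)"
    by (subst integral_density) (use e in auto)
  also have "\<dots> = (LINT t|lborel. \<epsilon>\<^sup>2 *\<^sub>R ?g (w + \<epsilon> *\<^sub>R t))"
    by (rule integral_distr) auto
  also have "\<dots> = (LINT t|lborel. \<Phi> (w + \<epsilon> *\<^sub>R t) * of_real (gauss 1 t))"
    by (simp add: gauss_scale[OF e, symmetric] scaleR_conv_of_real mult_ac)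
  finally show ?thesis by simp
qed

end

section \<open>The limit of vanishing noise\<close>

locale decaying_variable = bounded_variable +
  assumes decay: "\<And>k::nat. \<exists>C. \<forall>y. (1 + norm y) ^ k * norm (cf y) \<le> C"
begin

lemma integrable_cf_power: "integrable lborel (\<lambda>y. norm y ^ k * norm (cf y))"
proof -
  obtain C where C: "\<And>y. (1 + norm y) ^ (4 + k) * norm (cf y) \<le> C" using decay by blast
  show ?thesis
  proof (rule integrable_decay[of _ C])
    fix y :: complex
    have "(1 + norm y) ^ 4 * norm (norm y ^ k * norm (cf y)) \<le> (1 + norm y) ^ 4 * ((1 + norm y) ^ k * norm (cf y))"
      by (auto intro!: mult_left_mono mult_right_mono power_mono)
    also have "\<dots> \<le> C" using C[of y] by (simp add: power_add mult.assoc)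
    finally show "(1 + norm y) ^ 4 * norm (norm y ^ k * norm (cf y)) \<le> C" .
  qed simp
qed

lemma integrable_cf: "integrable lborel cf"
  using integrable_cf_power[of 0] by (simp add: integrable_norm_iff)

text \<open>The inversion integral, obtained as the limit of the smoothed densities in
  \<open>gauss_average\<close> when the noise vanishes.\<close>

definition dens :: "complex \<Rightarrow> real" where "dens x = Re (fourier cf x) / (4 * pi\<^sup>2)"

lemma damped_limit: "(\<lambda>n. fourier (\<lambda>y. cf y * of_real (damp (1 / Suc n) y)) x) \<longlonglongrightarrow> fourier cf x"
  unfolding fourier_def
proof (rule integral_dominated_convergence[where w="\<lambda>y. norm (cf y)"])
  show "AE y in lborel. (\<lambda>n. cis (x \<bullet> y) * (cf y * of_real (damp (1 / Suc n) y))) \<longlonglongrightarrow> cis (x \<bullet> y) * cf y"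
  proof (rule AE_I2)
    fix y
    have "(\<lambda>n. damp (1 / Suc n) y) \<longlonglongrightarrow> exp (- (0 * norm y)\<^sup>2 / 2)"
      unfolding damp_def by (intro tendsto_intros LIMSEQ_Suc[OF lim_1_over_n]) auto
    then have "(\<lambda>n. cis (x \<bullet> y) * (cf y * of_real (damp (1 / Suc n) y))) \<longlonglongrightarrow> cis (x \<bullet> y) * (cf y * of_real (exp (- (0 * norm y)\<^sup>2 / 2)))"
      by (intro tendsto_intros)
    then show "(\<lambda>n. cis (x \<bullet> y) * (cf y * of_real (damp (1 / Suc n) y))) \<longlonglongrightarrow> cis (x \<bullet> y) * cf y" by simp
  qed
  show "AE y in lborel. norm (cis (x \<bullet> y) * (cf y * of_real (damp (1 / Suc n) y))) \<le> norm (cf y)" for n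
    by (intro AE_I2) (simp add: norm_mult damp_bounds mult_left_le)
qed (use integrable_cf in auto)

lemma dens_limit: "(\<lambda>n. LINT \<omega>|\<Omega>. gauss (1 / Suc n) (x - Z \<omega>)) \<longlonglongrightarrow> dens x"
proof -
  have "(\<lambda>n. Re (fourier (\<lambda>y. cf y * of_real (damp (1 / Suc n) y)) x) / (4 * pi\<^sup>2)) \<longlonglongrightarrow> dens x"
    unfolding dens_def by (intro tendsto_intros tendsto_Re damped_limit) auto
  moreover have "Re (fourier (\<lambda>y. cf y * of_real (damp (1 / Suc n) y)) x) / (4 * pi\<^sup>2) = (LINT \<omega>|\<Omega>. gauss (1 / Suc n) (x - Z \<omega>))" for n
    by (subst gauss_average[symmetric]) auto
  ultimately show ?thesis by simp
qed

text \<open>Positivity is invisible in the inversion integral; it comes from the Gaussian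
  approximations, which are averages of nonnegative functions.\<close>

lemma dens_nonneg: "dens x \<ge> 0"
  by (rule LIMSEQ_le_const[OF dens_limit]) (auto intro!: exI[of _ 0] integral_nonneg_AE gauss_nonneg)

text \<open>Uniform in the noise level and in \<open>x\<close>; it serves as the dominating constant
  when the noise tends to zero.\<close>

lemma gauss_average_bound:
  "(LINT \<omega>|\<Omega>. gauss (1 / Suc n) (x - Z \<omega>)) \<le> (LINT y|lborel. norm (cf y)) / (4 * pi\<^sup>2)"
proof -
  have "4 * pi\<^sup>2 * (LINT \<omega>|\<Omega>. gauss (1 / Suc n) (x - Z \<omega>)) \<le> norm (complex_of_real (4 * pi\<^sup>2 * (LINT \<omega>|\<Omega>. gauss (1 / Suc n) (x - Z \<omega>))))"
    by (simp only: norm_of_real abs_ge_self)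
  also have "\<dots> = norm (fourier (\<lambda>y. cf y * of_real (damp (1 / Suc n) y)) x)" by (subst gauss_average) auto
  also have "\<dots> \<le> (LINT y|lborel. norm (cis (x \<bullet> y) * (cf y * of_real (damp (1 / Suc n) y))))"
    unfolding fourier_def by (rule integral_norm_bound)
  also have "\<dots> \<le> (LINT y|lborel. norm (cf y))"
  proof (rule integral_mono)
    show "integrable lborel (\<lambda>y. norm (cis (x \<bullet> y) * (cf y * of_real (damp (1 / Suc n) y))))"
      by (rule Bochner_Integration.integrable_bound[OF integrable_cf]) (auto simp: norm_mult damp_bounds mult_left_le)
  qed (use integrable_cf in \<open>auto simp: norm_mult damp_bounds mult_left_le\<close>)
  finally show ?thesis by (simp add: field_simps)
qed

lemma dens_C_k: "C_k n (\<lambda>x. c * dens x)"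
proof -
  define h where "h y = of_real (c / (4 * pi\<^sup>2)) * cf y" for y
  have [measurable]: "h \<in> borel_measurable borel" by (simp add: h_def[abs_def])
  have "integrable lborel (\<lambda>y. \<bar>c\<bar> / (4 * pi\<^sup>2) * (norm y ^ k * norm (cf y)))" for k
    by (intro integrable_mult_right integrable_cf_power)
  then have "integrable lborel (\<lambda>y. norm y ^ k * norm (h y))" for k
    by (simp add: h_def norm_mult norm_divide norm_power mult_ac)
  then have "C_k n (\<lambda>x. Re (fourier h x))" by (intro C_k_Re_fourier) auto
  moreover have "Re (fourier h x) = c * dens x" for x
  proof -
    have "fourier h x = of_real (c / (4 * pi\<^sup>2)) * fourier cf x"
      unfolding fourier_def h_def by (simp only: mult.left_commute[of "cis _"] Bochner_Integration.integral_mult_right_zero)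
    then show ?thesis by (simp add: dens_def Re_divide_of_real flip: of_real_mult of_real_power)
  qed
  ultimately show ?thesis by simp
qed

lemma dens_continuous: "continuous_on UNIV dens"
  using dens_C_k[of 0 1] by simp

lemma dens_measurable [measurable]: "dens \<in> borel_measurable borel"
  using dens_continuous by (rule borel_measurable_continuous_onI)

text \<open>The mean of \<open>\<Phi>\<close> at \<open>Z\<close> plus noise of size
  \<open>\<epsilon> n\<close> is evaluated twice. As the noise vanishes it tends to the mean of
  \<open>\<Phi> (Z \<omega>)\<close> by continuity; written by Fubini against the smoothed density
  it tends to the integral against \<open>dens\<close>.\<close>

lemma dens_expectation:
  fixes \<Phi> :: "complex \<Rightarrow> complex"
  assumes c: "continuous_on UNIV \<Phi>" and i: "integrable lborel \<Phi>" and b: "\<And>x. norm (\<Phi> x) \<le> B"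
  shows "(LINT \<omega>|\<Omega>. \<Phi> (Z \<omega>)) = (LINT x|lborel. \<Phi> x * of_real (dens x))"
proof -
  have [measurable]: "\<Phi> \<in> borel_measurable borel" using c by (rule borel_measurable_continuous_onI)
  interpret P: pair_sigma_finite \<Omega> "lborel :: complex measure" ..
  define \<epsilon> where "\<epsilon> n = 1 / real (Suc n)" for n
  have e: "\<epsilon> n > 0" for n by (simp add: \<epsilon>_def)
  have eps0: "\<epsilon> \<longlonglongrightarrow> 0" unfolding \<epsilon>_def by (rule LIMSEQ_Suc[OF lim_1_over_n])
  define \<Psi> where "\<Psi> n w = (LINT t|lborel. \<Phi> (w + \<epsilon> n *\<^sub>R t) * of_real (gauss 1 t))" for n w
  have B0: "B \<ge> 0" using b[of 0] norm_ge_zero order_trans by blast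
  have gi: "integrable lborel (\<lambda>t. B * gauss 1 t)" using gauss_integral(1)[of 1] by simp
  have le: "norm (\<Phi> y * of_real (gauss 1 t)) \<le> B * gauss 1 t" for y t
    using b[of y] by (simp add: norm_mult gauss_nonneg mult_right_mono)
  have lim1: "(\<lambda>n. \<Psi> n w) \<longlonglongrightarrow> \<Phi> w" for w
  proof -
    have "(\<lambda>n. \<Psi> n w) \<longlonglongrightarrow> (LINT t|lborel. \<Phi> w * of_real (gauss 1 t))"
      unfolding \<Psi>_def
    proof (rule integral_dominated_convergence[where w="\<lambda>t. B * gauss 1 t"])
      show "AE t in lborel. (\<lambda>n. \<Phi> (w + \<epsilon> n *\<^sub>R t) * of_real (gauss 1 t)) \<longlonglongrightarrow> \<Phi> w * of_real (gauss 1 t)"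
      proof (rule AE_I2)
        fix t
        have "(\<lambda>n. w + \<epsilon> n *\<^sub>R t) \<longlonglongrightarrow> w + 0 *\<^sub>R t" by (intro tendsto_intros eps0)
        then have "(\<lambda>n. \<Phi> (w + \<epsilon> n *\<^sub>R t)) \<longlonglongrightarrow> \<Phi> w"
          using continuous_on_tendsto_compose[OF c] by simp
        then show "(\<lambda>n. \<Phi> (w + \<epsilon> n *\<^sub>R t) * of_real (gauss 1 t)) \<longlonglongrightarrow> \<Phi> w * of_real (gauss 1 t)"
          by (intro tendsto_intros)
      qed
    qed (use gi le in auto)
    also have "(LINT t|lborel. \<Phi> w * of_real (gauss 1 t)) = \<Phi> w" using gauss_integral(2)[of 1] by simp
    finally show ?thesis .
  qed
  have \<Psi>b: "norm (\<Psi> n w) \<le> B" for n w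
  proof -
    have "norm (\<Psi> n w) \<le> (LINT t|lborel. norm (\<Phi> (w + \<epsilon> n *\<^sub>R t) * of_real (gauss 1 t)))"
      unfolding \<Psi>_def by (rule integral_norm_bound)
    also have "\<dots> \<le> (LINT t|lborel. B * gauss 1 t)"
    proof (intro integral_mono gi le integrable_norm)
      show "integrable lborel (\<lambda>t. \<Phi> (w + \<epsilon> n *\<^sub>R t) * of_real (gauss 1 t))"
        by (rule Bochner_Integration.integrable_bound[OF gi _ AE_I2]) (use le in \<open>auto intro: order_trans[OF _ abs_ge_self]\<close>)
    qed
    also have "\<dots> = B" using gauss_integral(2)[of 1] by simp
    finally show ?thesis .
  qed
  have [measurable]: "(\<lambda>w. \<Psi> n w) \<in> borel_measurable borel" for n unfolding \<Psi>_def by measurable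
  have lim2: "(\<lambda>n. LINT \<omega>|\<Omega>. \<Psi> n (Z \<omega>)) \<longlonglongrightarrow> (LINT \<omega>|\<Omega>. \<Phi> (Z \<omega>))"
    by (rule integral_dominated_convergence[where w="\<lambda>_. B"]) (use lim1 \<Psi>b in auto)
  have swap: "(LINT \<omega>|\<Omega>. \<Psi> n (Z \<omega>)) = (LINT x|lborel. \<Phi> x * of_real (LINT \<omega>|\<Omega>. gauss (\<epsilon> n) (x - Z \<omega>)))" for n
  proof -
    let ?f = "\<lambda>\<omega> x. \<Phi> x * complex_of_real (gauss (\<epsilon> n) (x - Z \<omega>))"
    \<comment> \<open>The value at the centre is the maximum of the Gaussian; together with the
      integrability of \<open>\<Phi>\<close> it justifies Fubini.\<close>
    define G where "G = gauss (\<epsilon> n) 0"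
    have G: "gauss (\<epsilon> n) u \<le> G" for u unfolding G_def gauss_def
      using e[of n] by (intro mult_mono) (auto simp: normal_density_def divide_right_mono)
    have bnd: "norm (?f \<omega> x) \<le> G * norm (\<Phi> x)" for \<omega> x
      using mult_right_mono[OF G[of "x - Z \<omega>"], of "norm (\<Phi> x)"] by (simp add: norm_mult gauss_nonneg mult.commute)
    have fi: "integrable lborel (\<lambda>x. ?f \<omega> x)" for \<omega>
      by (rule Bochner_Integration.integrable_bound[OF integrable_mult_right[OF integrable_norm[OF i], of G] _ AE_I2])
         (use bnd in \<open>auto intro: order_trans[OF _ abs_ge_self]\<close>)
    have int: "integrable (\<Omega> \<Otimes>\<^sub>M lborel) (\<lambda>(\<omega>, x). ?f \<omega> x)"
    proof (rule P.Fubini_integrable)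
      show "integrable \<Omega> (\<lambda>\<omega>. LINT x|lborel. norm (case (\<omega>, x) of (\<omega>, x) \<Rightarrow> ?f \<omega> x))"
      proof (rule integrable_const_bound[where B="LINT x|lborel. G * norm (\<Phi> x)"])
        show "AE \<omega> in \<Omega>. norm (LINT x|lborel. norm (case (\<omega>, x) of (\<omega>, x) \<Rightarrow> ?f \<omega> x)) \<le> (LINT x|lborel. G * norm (\<Phi> x))"
        proof (rule AE_I2)
          fix \<omega>
          have "(LINT x|lborel. norm (?f \<omega> x)) \<le> (LINT x|lborel. G * norm (\<Phi> x))"
            by (intro integral_mono integrable_norm fi bnd integrable_mult_right i)
          moreover have "(LINT x|lborel. norm (?f \<omega> x)) \<ge> 0" by (rule integral_nonneg_AE) simp
          ultimately show "norm (LINT x|lborel. norm (case (\<omega>, x) of (\<omega>, x) \<Rightarrow> ?f \<omega> x)) \<le> (LINT x|lborel. G * norm (\<Phi> x))"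
            by (simp only: prod.case real_norm_def abs_of_nonneg)
        qed
      qed simp
      show "AE \<omega> in \<Omega>. integrable lborel (\<lambda>x. case (\<omega>, x) of (\<omega>, x) \<Rightarrow> ?f \<omega> x)" using fi by simp
    qed measurable
    have "(LINT \<omega>|\<Omega>. \<Psi> n (Z \<omega>)) = (LINT \<omega>|\<Omega>. LINT x|lborel. ?f \<omega> x)"
      unfolding \<Psi>_def by (subst gauss_convolution[OF e]) auto
    also have "\<dots> = (LINT x|lborel. LINT \<omega>|\<Omega>. ?f \<omega> x)" by (rule P.Fubini_integral[OF int, symmetric])
    also have "\<dots> = (LINT x|lborel. \<Phi> x * of_real (LINT \<omega>|\<Omega>. gauss (\<epsilon> n) (x - Z \<omega>)))" by simp
    finally show ?thesis .
  qed
  have lim3: "(\<lambda>n. LINT x|lborel. \<Phi> x * of_real (LINT \<omega>|\<Omega>. gauss (\<epsilon> n) (x - Z \<omega>))) \<longlonglongrightarrow> (LINT x|lborel. \<Phi> x * of_real (dens x))"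
  proof (rule integral_dominated_convergence[where w="\<lambda>x. norm (\<Phi> x) * ((LINT y|lborel. norm (cf y)) / (4 * pi\<^sup>2))"])
    show "integrable lborel (\<lambda>x. norm (\<Phi> x) * ((LINT y|lborel. norm (cf y)) / (4 * pi\<^sup>2)))"
      by (intro integrable_mult_left integrable_norm i)
    show "AE x in lborel. (\<lambda>n. \<Phi> x * of_real (LINT \<omega>|\<Omega>. gauss (\<epsilon> n) (x - Z \<omega>))) \<longlonglongrightarrow> \<Phi> x * of_real (dens x)"
      unfolding \<epsilon>_def by (intro AE_I2 tendsto_intros dens_limit)
    show "AE x in lborel. norm (\<Phi> x * of_real (LINT \<omega>|\<Omega>. gauss (\<epsilon> n) (x - Z \<omega>))) \<le> norm (\<Phi> x) * ((LINT y|lborel. norm (cf y)) / (4 * pi\<^sup>2))" for n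
    proof (rule AE_I2)
      fix x
      have "(LINT \<omega>|\<Omega>. gauss (\<epsilon> n) (x - Z \<omega>)) \<ge> 0" by (intro integral_nonneg_AE AE_I2 gauss_nonneg)
      then show "norm (\<Phi> x * of_real (LINT \<omega>|\<Omega>. gauss (\<epsilon> n) (x - Z \<omega>))) \<le> norm (\<Phi> x) * ((LINT y|lborel. norm (cf y)) / (4 * pi\<^sup>2))"
        using gauss_average_bound[where n=n and x=x] unfolding norm_mult norm_of_real \<epsilon>_def by (intro mult_left_mono) auto
    qed
  qed measurable
  show ?thesis using LIMSEQ_unique[OF lim2] lim3 unfolding swap by blast
qed

text \<open>A continuous \<open>\<Phi>\<close> need be neither bounded nor integrable, so
  \<open>dens_expectation\<close> is applied to \<open>\<Phi>\<close> times this function. For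
  \<open>r \<ge> R\<close> the product agrees with \<open>\<Phi>\<close> at all values of
  \<open>Z\<close>.\<close>

definition cutoff :: "real \<Rightarrow> complex \<Rightarrow> real" where "cutoff r w = max 0 (min 1 (r + 1 - norm w))"

lemma cutoff_continuous: "continuous_on UNIV (cutoff r)"
  unfolding cutoff_def[abs_def] by (intro continuous_intros)

lemma cutoff_simps: "norm w \<le> r \<Longrightarrow> cutoff r w = 1" "norm w \<ge> r + 1 \<Longrightarrow> cutoff r w = 0" "0 \<le> cutoff r w" "cutoff r w \<le> 1"
  by (auto simp: cutoff_def)

lemma cutoff_times:
  fixes \<Phi> :: "complex \<Rightarrow> complex"
  assumes c: "continuous_on UNIV \<Phi>"
  shows "integrable lborel (\<lambda>x. \<Phi> x * of_real (cutoff r x))" "\<exists>B. \<forall>x. norm (\<Phi> x * of_real (cutoff r x)) \<le> B"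
    "continuous_on UNIV (\<lambda>x. \<Phi> x * of_real (cutoff r x))"
proof -
  show cc: "continuous_on UNIV (\<lambda>x. \<Phi> x * of_real (cutoff r x))"
    by (intro continuous_intros c cutoff_continuous)
  have "compact (\<Phi> ` cball 0 (r + 1))" by (rule compact_continuous_image[OF continuous_on_subset[OF c]]) auto
  then obtain B where B: "B > 0" "\<And>x. x \<in> cball 0 (r + 1) \<Longrightarrow> norm (\<Phi> x) \<le> B"
    using compact_imp_bounded bounded_pos by (metis imageI)
  have le: "norm (\<Phi> x * of_real (cutoff r x)) \<le> B * indicator (cball 0 (r + 1)) x" for x
  proof (cases "norm x \<le> r + 1")
    case True
    then have "norm (\<Phi> x) * cutoff r x \<le> B * 1" using B cutoff_simps(3,4)[of r x] by (intro mult_mono) auto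
    then show ?thesis using True cutoff_simps(3)[of r x] by (simp add: norm_mult)
  next
    case False
    then show ?thesis using cutoff_simps(2)[of r x] by simp
  qed
  show "\<exists>B. \<forall>x. norm (\<Phi> x * of_real (cutoff r x)) \<le> B"
  proof (intro exI allI)
    fix x
    show "norm (\<Phi> x * of_real (cutoff r x)) \<le> B" using le[of x] B(1) by (rule_tac order_trans[OF le]) (simp add: indicator_def)
  qed
  show "integrable lborel (\<lambda>x. \<Phi> x * of_real (cutoff r x))"
  proof (rule Bochner_Integration.integrable_bound)
    show "integrable lborel (\<lambda>x. B * indicator (cball (0::complex) (r + 1)) x :: real)"
      using emeasure_lborel_cball_finite[of "0 :: complex" "r + 1"] by (intro integrable_mult_right integrable_real_indicator) auto
  qed (use borel_measurable_continuous_onI[OF cc] le in \<open>auto intro!: AE_I2 intro: order_trans[OF _ abs_ge_self]\<close>)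
qed

lemma expectation_cutoff:
  fixes \<Phi> :: "complex \<Rightarrow> complex"
  assumes c: "continuous_on UNIV \<Phi>" and r: "r \<ge> R"
  shows "(LINT x|lborel. \<Phi> x * of_real (cutoff r x) * of_real (dens x)) = (LINT \<omega>|\<Omega>. \<Phi> (Z \<omega>))"
    "integrable lborel (\<lambda>x. \<Phi> x * of_real (cutoff r x) * of_real (dens x))"
proof -
  obtain B where B: "\<And>x. norm (\<Phi> x * of_real (cutoff r x)) \<le> B" using cutoff_times(2)[OF c, of r] by blast
  have "cutoff r (Z \<omega>) = 1" for \<omega> using Z_bound[of \<omega>] r cutoff_simps(1)[of "Z \<omega>" r] by simp
  then show "(LINT x|lborel. \<Phi> x * of_real (cutoff r x) * of_real (dens x)) = (LINT \<omega>|\<Omega>. \<Phi> (Z \<omega>))"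
    using dens_expectation[OF cutoff_times(3)[OF c, of r] cutoff_times(1)[OF c, of r] B] by simp
  have "continuous_on UNIV (\<lambda>x. \<Phi> x * of_real (dens x))" by (intro continuous_intros c dens_continuous)
  from cutoff_times(1)[OF this, of r]
  show "integrable lborel (\<lambda>x. \<Phi> x * of_real (cutoff r x) * of_real (dens x))" by (simp add: mult_ac)
qed

text \<open>For every \<open>r \<ge> R\<close> the integral of \<open>cutoff r x * dens x\<close> is
  \<open>1\<close>. The difference for two radii is nonnegative with integral zero, hence vanishes
  almost everywhere; letting the radius grow shows that \<open>dens\<close> has no mass outside the
  cutoff.\<close>

lemma dens_cutoff: "AE x in lborel. dens x = cutoff R x * dens x"
proof -
  have int: "integrable lborel (\<lambda>x. cutoff r x * dens x)" "(LINT x|lborel. cutoff r x * dens x) = 1" if "r \<ge> R" for r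
  proof -
    have "integrable lborel (\<lambda>x. complex_of_real (cutoff r x * dens x))"
      using expectation_cutoff(2)[of "\<lambda>_. 1" r] that by simp
    then show "integrable lborel (\<lambda>x. cutoff r x * dens x)" by (simp only: complex_of_real_integrable_eq)
    have "complex_of_real (LINT x|lborel. cutoff r x * dens x) = (LINT x|lborel. complex_of_real (cutoff r x * dens x))"
      by (simp only: integral_complex_of_real)
    also have "\<dots> = 1" using expectation_cutoff(1)[of "\<lambda>_. 1" r] that prob_space by simp
    finally show "(LINT x|lborel. cutoff r x * dens x) = 1" by simp
  qed
  have "AE x in lborel. (cutoff (R + real n) x - cutoff R x) * dens x = 0" for n
  proof -
    have nn: "0 \<le> (cutoff (R + real n) x - cutoff R x) * dens x" for x
      using dens_nonneg by (intro mult_nonneg_nonneg) (auto simp: cutoff_def)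
    have i: "integrable lborel (\<lambda>x. (cutoff (R + real n) x - cutoff R x) * dens x)"
      using Bochner_Integration.integrable_diff[OF int(1)[of "R + real n"] int(1)[of R]] by (simp add: left_diff_distrib)
    moreover have "(LINT x|lborel. (cutoff (R + real n) x - cutoff R x) * dens x) = 0"
      using Bochner_Integration.integral_diff[OF int(1)[of "R + real n"] int(1)[of R]] int(2)[of "R + real n"] int(2)[of R]
      by (simp add: left_diff_distrib)
    ultimately show ?thesis using integral_nonneg_eq_0_iff_AE[OF i] nn by auto
  qed
  then have "AE x in lborel. \<forall>n::nat. (cutoff (R + real n) x - cutoff R x) * dens x = 0" by (subst AE_all_countable) blast
  then show ?thesis
  proof (rule AE_mp, intro AE_I2 impI)
    fix x assume a: "\<forall>n::nat. (cutoff (R + real n) x - cutoff R x) * dens x = 0"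
    obtain n :: nat where "norm x - R \<le> real n" using real_arch_simple by blast
    then have "cutoff (R + real n) x = 1" by (intro cutoff_simps) simp
    moreover have "(cutoff (R + real n) x - cutoff R x) * dens x = 0" using a by blast
    ultimately show "dens x = cutoff R x * dens x" by (simp add: left_diff_distrib)
  qed
qed

theorem smooth_density:
  "\<exists>M :: complex \<Rightarrow> real. C_infinity M \<and> (\<forall>w. M w \<ge> 0) \<and> integrable abs_dw M \<and> (LINT w|abs_dw. M w) = 1 \<and>
    (\<forall>\<Phi> :: complex \<Rightarrow> complex. continuous_on UNIV \<Phi> \<longrightarrow>
      integrable abs_dw (\<lambda>w. of_real (M w) * \<Phi> w) \<and> (LINT w|abs_dw. of_real (M w) * \<Phi> w) = (LINT \<omega>|\<Omega>. \<Phi> (Z \<omega>)))"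
proof -
  \<comment> \<open>The factor \<open>2 * pi\<close> compensates the density of
    \<open>abs_dw\<close> with respect to Lebesgue measure.\<close>
  define M where "M w = 2 * pi * dens w" for w
  have [measurable]: "M \<in> borel_measurable borel" by (simp add: M_def[abs_def])
  have main: "integrable abs_dw (\<lambda>w. of_real (M w) * \<Phi> w)" "(LINT w|abs_dw. of_real (M w) * \<Phi> w) = (LINT \<omega>|\<Omega>. \<Phi> (Z \<omega>))"
    if c: "continuous_on UNIV \<Phi>" for \<Phi> :: "complex \<Rightarrow> complex"
  proof -
    have [measurable]: "\<Phi> \<in> borel_measurable borel" using c by (rule borel_measurable_continuous_onI)
    have "continuous_on UNIV (\<lambda>x. of_real (cutoff R x) :: complex)" by (intro continuous_intros cutoff_continuous)
    then have [measurable]: "cutoff R \<in> borel_measurable borel" using cutoff_continuous by (intro borel_measurable_continuous_onI)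
    have e: "(1 / (2 * pi)) *\<^sub>R (of_real (M w) * \<Phi> w) = of_real (dens w) * \<Phi> w" for w
      by (simp add: M_def scaleR_conv_of_real)
    have ae: "AE x in lborel. of_real (dens x) * \<Phi> x = \<Phi> x * of_real (cutoff R x) * of_real (dens x)"
      using dens_cutoff by (rule AE_mp) (intro AE_I2 impI, simp add: mult_ac flip: of_real_mult)
    have i: "integrable lborel (\<lambda>x. of_real (dens x) * \<Phi> x)"
      using expectation_cutoff(2)[OF c order_refl] by (subst integrable_cong_AE[OF _ _ ae]) auto
    show "integrable abs_dw (\<lambda>w. of_real (M w) * \<Phi> w)"
      unfolding abs_dw_def using i by (subst integrable_density) (auto simp only: e, auto)
    have "(LINT w|abs_dw. of_real (M w) * \<Phi> w) = (LINT x|lborel. of_real (dens x) * \<Phi> x)"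
      unfolding abs_dw_def by (subst integral_density) (auto simp only: e, auto)
    also have "\<dots> = (LINT x|lborel. \<Phi> x * of_real (cutoff R x) * of_real (dens x))" by (rule integral_cong_AE[OF _ _ ae]) auto
    finally show "(LINT w|abs_dw. of_real (M w) * \<Phi> w) = (LINT \<omega>|\<Omega>. \<Phi> (Z \<omega>))"
      using expectation_cutoff(1)[OF c order_refl] by simp
  qed
  have "C_k n M" for n unfolding M_def[abs_def] by (rule dens_C_k)
  moreover have "integrable abs_dw M" using main(1)[of "\<lambda>_. 1"] by (simp add: complex_of_real_integrable_eq)
  moreover have "(LINT w|abs_dw. M w) = 1"
  proof -
    have "complex_of_real (LINT w|abs_dw. M w) = 1" using main(2)[of "\<lambda>_. 1"] prob_space by simp
    then show ?thesis by simp
  qed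
  moreover have "M w \<ge> 0" for w using dens_nonneg by (simp add: M_def)
  ultimately show ?thesis using main unfolding C_infinity_def by blast
qed

end

section \<open>Decay of the Fourier transform of a single factor\<close>

text \<open>A smooth branch of the antiderivative of \<open>a b / (a\<^sup>2 cos\<^sup>2 x + b\<^sup>2 sin\<^sup>2 x)\<close>.\<close>

definition elliptic_angle :: "real \<Rightarrow> real \<Rightarrow> real \<Rightarrow> real" where
  "elliptic_angle a b x = x - arctan ((a - b) * (sin x * cos x) / (a * (cos x)\<^sup>2 + b * (sin x)\<^sup>2))"

text \<open>Up to multiples of \<open>pi\<close> the function is
  \<open>arctan (b / a * tan x)\<close>: the addition theorem of the tangent turns its difference
  from \<open>x\<close> into the \<open>arctan\<close> of a quotient whose denominator never
  vanishes. This removes the jumps at the poles of the tangent.\<close>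

lemma elliptic_angle_deriv:
  assumes "a > 0" "b > 0"
  shows "(elliptic_angle a b has_real_derivative a * b / (a\<^sup>2 * (cos x)\<^sup>2 + b\<^sup>2 * (sin x)\<^sup>2)) (at x)"
proof -
  define s c where "s = sin x" and "c = cos x"
  have sc: "s\<^sup>2 = 1 - c\<^sup>2" by (simp add: s_def c_def sin_squared_eq)
  have pos: "\<And>p q. p > 0 \<Longrightarrow> q > 0 \<Longrightarrow> p * c\<^sup>2 + q * s\<^sup>2 > 0"
  proof -
    fix p q :: real assume "p > 0" "q > 0"
    show "p * c\<^sup>2 + q * s\<^sup>2 > 0"
    proof (cases "c = 0")
      case True
      then show ?thesis using sc \<open>q > 0\<close> by simp
    next
      case False
      then show ?thesis using \<open>p > 0\<close> \<open>q > 0\<close> by (intro add_pos_nonneg) auto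
    qed
  qed
  define N E where "N = (a - b) * (s * c)" and "E = a * c\<^sup>2 + b * s\<^sup>2"
  have E: "E > 0" unfolding E_def by (rule pos[OF assms])
  define Q where "Q = a\<^sup>2 * c\<^sup>2 + b\<^sup>2 * s\<^sup>2"
  have Q: "Q > 0" unfolding Q_def using assms by (intro pos) auto
  have NE: "E\<^sup>2 + N\<^sup>2 = Q"
  proof -
    have "E\<^sup>2 + N\<^sup>2 = (a\<^sup>2 * c\<^sup>2 + b\<^sup>2 * s\<^sup>2) * (c\<^sup>2 + s\<^sup>2)"
      by (simp add: E_def N_def power2_eq_square algebra_simps)
    then show ?thesis by (simp add: Q_def sc)
  qed
  have dN: "((\<lambda>x. (a - b) * (sin x * cos x)) has_real_derivative (a - b) * (c\<^sup>2 - s\<^sup>2)) (at x)"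
    by (rule derivative_eq_intros refl)+ (simp add: s_def c_def power2_eq_square algebra_simps)
  have dE: "((\<lambda>x. a * (cos x)\<^sup>2 + b * (sin x)\<^sup>2) has_real_derivative 2 * (b - a) * (s * c)) (at x)"
    by (rule derivative_eq_intros refl)+ (simp add: s_def c_def power2_eq_square algebra_simps)
  have "((\<lambda>x. (a - b) * (sin x * cos x) / (a * (cos x)\<^sup>2 + b * (sin x)\<^sup>2)) has_real_derivative
      ((a - b) * (c\<^sup>2 - s\<^sup>2) * E - N * (2 * (b - a) * (s * c))) / (E * E)) (at x)"
    using DERIV_divide[OF dN dE] E by (simp add: E_def N_def s_def c_def)
  from DERIV_chain2[OF DERIV_arctan this]
  have "((\<lambda>x. arctan ((a - b) * (sin x * cos x) / (a * (cos x)\<^sup>2 + b * (sin x)\<^sup>2))) has_real_derivative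
      inverse (1 + (N / E)\<^sup>2) * (((a - b) * (c\<^sup>2 - s\<^sup>2) * E - N * (2 * (b - a) * (s * c))) / (E * E))) (at x)"
    by (simp add: E_def N_def s_def c_def)
  also have "inverse (1 + (N / E)\<^sup>2) * (((a - b) * (c\<^sup>2 - s\<^sup>2) * E - N * (2 * (b - a) * (s * c))) / (E * E))
    = ((a - b) * (c\<^sup>2 - s\<^sup>2) * E - N * (2 * (b - a) * (s * c))) / Q"
  proof -
    have "1 + (N / E)\<^sup>2 = Q / (E * E)" using E by (simp add: NE[symmetric] power_divide add_divide_distrib power2_eq_square)
    then show ?thesis using E Q by simp
  qed
  also have "(a - b) * (c\<^sup>2 - s\<^sup>2) * E - N * (2 * (b - a) * (s * c)) = (a - b) * (a * c\<^sup>2 - b * s\<^sup>2) * (c\<^sup>2 + s\<^sup>2)"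
    by (simp add: E_def N_def power2_eq_square algebra_simps)
  also have "\<dots> = (a - b) * (a * c\<^sup>2 - b * s\<^sup>2)" by (simp add: sc)
  finally have "(elliptic_angle a b has_real_derivative 1 - (a - b) * (a * c\<^sup>2 - b * s\<^sup>2) / Q) (at x)"
    unfolding elliptic_angle_def[abs_def] by (intro DERIV_diff DERIV_ident)
  also have "1 - (a - b) * (a * c\<^sup>2 - b * s\<^sup>2) / Q = (Q - (a - b) * (a * c\<^sup>2 - b * s\<^sup>2)) / Q"
    using Q by (simp add: diff_divide_distrib)
  also have "Q - (a - b) * (a * c\<^sup>2 - b * s\<^sup>2) = a * b * (c\<^sup>2 + s\<^sup>2)"
    by (simp add: Q_def power2_eq_square algebra_simps)
  also have "\<dots> = a * b" by (simp add: sc)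
  finally show ?thesis by (simp add: Q_def s_def c_def)
qed

text \<open>The increase over one turn is \<open>2 * pi\<close> whatever \<open>a\<close> and
  \<open>b\<close> are; this is the source of uniformity in the stationary phase estimate.\<close>

lemma elliptic_angle_period: "elliptic_angle a b (x + 2 * pi) = elliptic_angle a b x + 2 * pi"
  by (simp add: elliptic_angle_def)

text \<open>The Koebe function, with power series \<open>\<Sum>k. k * z ^ k\<close>. Up to the
  factor \<open>(ln N)\<^sup>2\<close> it is what two differentiations in \<open>s\<close> make of
  \<open>- Ln (1 - w)\<close> for \<open>w = a * N powr (- s)\<close>.\<close>

definition koebe :: "complex \<Rightarrow> complex" where "koebe z = z / (1 - z)\<^sup>2"

text \<open>With \<open>W(\<theta>) = exp (\<Lambda> \<theta>)\<close>, minus its real part is the derivative of the phase divided by \<open>\<mu>\<close>. As the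
  argument of \<open>W\<close> increases with speed at least \<open>1/2\<close>, the phase is stationary only on a small set.\<close>

lemma koebe_circle_decay:
  assumes r: "0 < r" "r \<le> 1 / 10" and l: "l > 0" and y: "y \<noteq> 0"
  shows "norm (integral {0..2 * pi} (\<lambda>\<theta>. cis (- ((of_real l * koebe (of_real r * cis \<theta>)) \<bullet> y)))) \<le> 16 * pi / (r * sqrt (l * norm y))"
proof -
  define \<mu> where "\<mu> = l * norm y"
  have \<mu>: "\<mu> > 0" using l y by (simp add: \<mu>_def)
  \<comment> \<open>The conjugate direction of \<open>y\<close>, turned by \<open>\<i>\<close>.
    Since \<open>koebe\<close> has derivative \<open>\<i> * (z * (1 + z) / (1 - z) ^ 3)\<close>
    along the circle, the phase has derivative \<open>- \<mu> * Re (W \<theta>)\<close> with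
    \<open>W = u * (z * (1 + z) / (1 - z) ^ 3)\<close>.\<close>
  define u where "u = \<i> * cnj y / of_real (norm y)"
  have nu: "norm u = 1" using y by (simp add: u_def norm_mult norm_divide)
  define \<beta> where "\<beta> = Arg u"
  have \<beta>: "cis \<beta> = u" unfolding \<beta>_def using nu y by (subst cis_Arg) (auto simp: sgn_div_norm)
  define z where "z \<theta> = of_real r * exp (\<i> * \<theta>)" for \<theta>
  have zc: "z (of_real \<theta>) = of_real r * cis \<theta>" for \<theta> by (simp add: z_def cis_conv_exp)
  have nz: "norm (z (of_real \<theta>)) = r" for \<theta> using r by (simp add: zc norm_mult)
  have z1: "1 + z (of_real \<theta>) \<noteq> 0" "1 - z (of_real \<theta>) \<noteq> 0" "1 + z (of_real \<theta>) \<notin> \<real>\<^sub>\<le>\<^sub>0" "1 - z (of_real \<theta>) \<notin> \<real>\<^sub>\<le>\<^sub>0" for \<theta>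
  proof -
    have "\<bar>Re (z (of_real \<theta>))\<bar> \<le> 1 / 10" using abs_Re_le_cmod[of "z (of_real \<theta>)"] r nz[of \<theta>] by simp
    then have "Re (1 + z (of_real \<theta>)) > 0" "Re (1 - z (of_real \<theta>)) > 0" by simp_all
    then show "1 + z (of_real \<theta>) \<noteq> 0" "1 - z (of_real \<theta>) \<noteq> 0" "1 + z (of_real \<theta>) \<notin> \<real>\<^sub>\<le>\<^sub>0" "1 - z (of_real \<theta>) \<notin> \<real>\<^sub>\<le>\<^sub>0"
      using complex_nonpos_Reals_iff by force+
  qed
  \<comment> \<open>The logarithmic derivative of \<open>W\<close> in \<open>\<theta>\<close>,
    divided by \<open>\<i>\<close>. For \<open>r \<le> 1 / 10\<close> the two fractions have modulus
    at most \<open>1 / 9\<close> and \<open>3 / 9\<close>, so \<open>\<kappa> \<theta>\<close> stays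
    within \<open>4 / 9\<close> of \<open>1\<close> and the argument of \<open>W\<close> never stops
    turning.\<close>
  define \<kappa> where "\<kappa> \<theta> = 1 + z (of_real \<theta>) / (1 + z (of_real \<theta>)) + 3 * z (of_real \<theta>) / (1 - z (of_real \<theta>))" for \<theta> :: real
  have n1: "norm (1 + z (of_real \<theta>)) \<ge> 1 - r" "norm (1 - z (of_real \<theta>)) \<ge> 1 - r"
    "norm (1 + z (of_real \<theta>)) \<le> 1 + r" "norm (1 - z (of_real \<theta>)) \<le> 1 + r" for \<theta>
    using norm_triangle_ineq2[of 1 "- z (of_real \<theta>)"] norm_triangle_ineq2[of 1 "z (of_real \<theta>)"]
      norm_triangle_ineq[of 1 "z (of_real \<theta>)"] norm_triangle_ineq4[of 1 "z (of_real \<theta>)"] nz[of \<theta>] by auto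
  have kd: "norm (\<kappa> \<theta> - 1) \<le> 4 / 9" for \<theta>
  proof -
    have "norm (z (of_real \<theta>) / (1 + z (of_real \<theta>))) \<le> (1 / 10) / (9 / 10)"
      unfolding norm_divide nz using r n1[of \<theta>] by (intro frac_le) auto
    moreover have "norm (3 * z (of_real \<theta>) / (1 - z (of_real \<theta>))) \<le> (3 / 10) / (9 / 10)"
      unfolding norm_divide norm_mult nz using r n1[of \<theta>] by (intro frac_le) auto
    moreover have "norm (\<kappa> \<theta> - 1) \<le> norm (z (of_real \<theta>) / (1 + z (of_real \<theta>))) + norm (3 * z (of_real \<theta>) / (1 - z (of_real \<theta>)))"
      unfolding \<kappa>_def using norm_triangle_ineq by (simp add: add.assoc)
    ultimately show ?thesis by simp
  qed
  have kre: "Re (\<kappa> \<theta>) \<ge> 1 / 2" for \<theta> using abs_Re_le_cmod[of "\<kappa> \<theta> - 1"] kd[of \<theta>] by simp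
  have kn: "norm (\<kappa> \<theta>) \<le> 3 / 2" for \<theta> using norm_triangle_ineq[of "\<kappa> \<theta> - 1" 1] kd[of \<theta>] by simp
  \<comment> \<open>An explicit logarithm of \<open>W\<close>, built from principal logarithms of
    numbers in the right half-plane. Its imaginary part is an argument of \<open>W\<close> that is
    smooth in \<open>\<theta>\<close> and grows by \<open>2 * pi\<close> in one turn.\<close>
  define \<Lambda> where "\<Lambda> \<theta> = of_real (ln r) + \<i> * of_real \<beta> + \<i> * \<theta> + Ln (1 + z \<theta>) - 3 * Ln (1 - z \<theta>)" for \<theta>
  define W where "W \<theta> = exp (\<Lambda> (of_real \<theta>))" for \<theta> :: real
  have er: "exp (complex_of_real (ln r)) = of_real r" using r by (simp add: exp_of_real)
  have Wform: "W \<theta> = u * (z (of_real \<theta>) * (1 + z (of_real \<theta>)) / (1 - z (of_real \<theta>)) ^ 3)" for \<theta>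
  proof -
    have "exp (3 * Ln (1 - z (of_real \<theta>))) = (1 - z (of_real \<theta>)) ^ 3"
      using exp_of_nat_mult[of 3 "Ln (1 - z (of_real \<theta>))"] z1(2)[of \<theta>] by simp
    then have "W \<theta> = of_real r * u * exp (\<i> * of_real \<theta>) * (1 + z (of_real \<theta>)) / (1 - z (of_real \<theta>)) ^ 3"
      unfolding W_def \<Lambda>_def using er z1[of \<theta>] \<beta> by (simp add: exp_add exp_diff cis_conv_exp)
    then show ?thesis by (simp add: z_def)
  qed
  have dz: "(z has_field_derivative \<i> * z \<theta>) (at \<theta>)" for \<theta>
    unfolding z_def by (rule derivative_eq_intros refl)+ simp
  have dL: "((\<lambda>\<theta>. \<Lambda> (of_real \<theta>)) has_vector_derivative \<i> * \<kappa> \<theta>) (at \<theta>)" for \<theta> :: real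
  proof (rule has_vector_derivative_real_field)
    show "(\<Lambda> has_field_derivative \<i> * \<kappa> \<theta>) (at (complex_of_real \<theta>))"
      unfolding \<Lambda>_def using z1[of \<theta>]
      by (auto intro!: derivative_eq_intros dz simp: \<kappa>_def field_simps)
  qed
  have dW: "(W has_vector_derivative \<i> * \<kappa> \<theta> * W \<theta>) (at \<theta>)" for \<theta>
  proof -
    have "(exp has_field_derivative exp (\<Lambda> (of_real \<theta>))) (at (\<Lambda> (of_real \<theta>)))" by (rule DERIV_exp)
    from field_vector_diff_chain_at[OF dL this] show ?thesis by (simp add: W_def[abs_def] o_def)
  qed
  define q where "q \<theta> = - Re (W \<theta>)" for \<theta>
  define q' where "q' \<theta> = - Re (\<i> * \<kappa> \<theta> * W \<theta>)" for \<theta>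
  have dq: "(q has_real_derivative q' \<theta>) (at \<theta>)" for \<theta>
  proof -
    have "((\<lambda>\<theta>. - Re (W \<theta>)) has_vector_derivative - Re (\<i> * \<kappa> \<theta> * W \<theta>)) (at \<theta>)"
      by (intro has_vector_derivative_minus bounded_linear.has_vector_derivative[OF bounded_linear_Re] dW)
    then show ?thesis by (simp add: q_def[abs_def] q'_def has_real_derivative_iff_has_vector_derivative)
  qed
  \<comment> \<open>The upper bound \<open>2 / 3\<close> is matched to
    \<open>norm (\<kappa> \<theta>) \<le> 3 / 2\<close>, so that \<open>q'\<close> is bounded by
    \<open>1\<close>.\<close>
  have Wn: "norm (W \<theta>) \<ge> r / 2" "norm (W \<theta>) \<le> 2 / 3" for \<theta>
  proof -
    have W: "norm (W \<theta>) = r * norm (1 + z (of_real \<theta>)) / norm (1 - z (of_real \<theta>)) ^ 3"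
      unfolding Wform by (simp add: norm_mult norm_divide norm_power nu nz)
    have "norm (1 - z (of_real \<theta>)) ^ 3 \<le> (11 / 10) ^ 3" using n1[of \<theta>] r by (intro power_mono) auto
    then have "r * (9 / 10) / (11 / 10) ^ 3 \<le> norm (W \<theta>)" unfolding W
      using n1[of \<theta>] r z1[of \<theta>] by (intro frac_le mult_left_mono) auto
    then show "norm (W \<theta>) \<ge> r / 2" using r by (simp add: power3_eq_cube)
    have "norm (1 - z (of_real \<theta>)) ^ 3 \<ge> (9 / 10) ^ 3" using n1[of \<theta>] r by (intro power_mono) auto
    moreover have "r * norm (1 + z (of_real \<theta>)) \<le> (1 / 10) * (11 / 10)" using n1[of \<theta>] r by (intro mult_mono) auto
    ultimately have "norm (W \<theta>) \<le> ((1 / 10) * (11 / 10)) / (9 / 10) ^ 3" unfolding W by (intro frac_le) auto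
    then show "norm (W \<theta>) \<le> 2 / 3" by (simp add: power3_eq_cube)
  qed
  have q'b: "\<bar>q' \<theta>\<bar> \<le> 1" for \<theta>
  proof -
    have "\<bar>q' \<theta>\<bar> \<le> norm (\<i> * \<kappa> \<theta> * W \<theta>)" unfolding q'_def by (metis abs_Re_le_cmod abs_minus_cancel)
    also have "\<dots> = norm (\<kappa> \<theta>) * norm (W \<theta>)" by (simp add: norm_mult)
    also have "\<dots> \<le> (3 / 2) * (2 / 3)" using kn[of \<theta>] Wn[of \<theta>] by (intro mult_mono) auto
    finally show ?thesis by simp
  qed
  define \<phi> where "\<phi> \<theta> = - ((of_real l * koebe (of_real r * cis \<theta>)) \<bullet> y)" for \<theta>
  have dphi: "(\<phi> has_real_derivative \<mu> * q \<theta>) (at \<theta>)" for \<theta>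
  proof -
    have "((\<lambda>\<theta>. koebe (z \<theta>)) has_field_derivative \<i> * (z (of_real \<theta>) * (1 + z (of_real \<theta>)) / (1 - z (of_real \<theta>)) ^ 3)) (at (of_real \<theta>))"
    proof -
      have "((\<lambda>\<theta>. koebe (z \<theta>)) has_field_derivative
         (\<i> * z (of_real \<theta>) * (1 - z (of_real \<theta>))\<^sup>2 - z (of_real \<theta>) * (2 * (1 - z (of_real \<theta>)) * (- (\<i> * z (of_real \<theta>))))) / ((1 - z (of_real \<theta>))\<^sup>2 * (1 - z (of_real \<theta>))\<^sup>2)) (at (of_real \<theta>))"
        unfolding koebe_def using z1[of \<theta>] by (auto intro!: derivative_eq_intros dz)
      also have "(\<i> * z (of_real \<theta>) * (1 - z (of_real \<theta>))\<^sup>2 - z (of_real \<theta>) * (2 * (1 - z (of_real \<theta>)) * (- (\<i> * z (of_real \<theta>))))) / ((1 - z (of_real \<theta>))\<^sup>2 * (1 - z (of_real \<theta>))\<^sup>2)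
        = \<i> * (z (of_real \<theta>) * (1 + z (of_real \<theta>)) / (1 - z (of_real \<theta>)) ^ 3)"
      proof -
        have gen: "(\<i> * a * c\<^sup>2 - a * (2 * c * (- (\<i> * a)))) / (c\<^sup>2 * c\<^sup>2) = \<i> * (a * (c + 2 * a) / c ^ 3)" if "c \<noteq> 0" for a c :: complex
          using that by (simp add: field_simps power2_eq_square power3_eq_cube)
        have "1 - z (of_real \<theta>) + 2 * z (of_real \<theta>) = 1 + z (of_real \<theta>)" by simp
        then show ?thesis using gen[OF z1(2)[of \<theta>], of "z (of_real \<theta>)"] by simp
      qed
      finally show ?thesis .
    qed
    from has_vector_derivative_real_field[OF this, of UNIV]
    have "((\<lambda>\<theta>. koebe (of_real r * cis \<theta>)) has_vector_derivative \<i> * (z (of_real \<theta>) * (1 + z (of_real \<theta>)) / (1 - z (of_real \<theta>)) ^ 3)) (at \<theta>)"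
      by (simp add: zc)
    then have "((\<lambda>\<theta>. of_real l * cnj y * koebe (of_real r * cis \<theta>)) has_vector_derivative of_real l * cnj y * (\<i> * (z (of_real \<theta>) * (1 + z (of_real \<theta>)) / (1 - z (of_real \<theta>)) ^ 3))) (at \<theta>)"
      by (rule has_vector_derivative_mult_right)
    then have "((\<lambda>\<theta>. - Re (of_real l * cnj y * koebe (of_real r * cis \<theta>))) has_vector_derivative - Re (of_real l * cnj y * (\<i> * (z (of_real \<theta>) * (1 + z (of_real \<theta>)) / (1 - z (of_real \<theta>)) ^ 3)))) (at \<theta>)"
      by (intro has_vector_derivative_minus bounded_linear.has_vector_derivative[OF bounded_linear_Re])
    moreover have "of_real l * cnj y * (\<i> * (z (of_real \<theta>) * (1 + z (of_real \<theta>)) / (1 - z (of_real \<theta>)) ^ 3)) = of_real \<mu> * W \<theta>"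
      unfolding Wform u_def \<mu>_def using y by simp
    moreover have "- Re (of_real l * cnj y * koebe (of_real r * cis \<theta>)) = \<phi> \<theta>" for \<theta>
      by (simp add: \<phi>_def inner_complex_def algebra_simps)
    ultimately have "(\<phi> has_vector_derivative \<mu> * q \<theta>) (at \<theta>)" by (simp add: q_def)
    then show ?thesis by (simp add: has_real_derivative_iff_has_vector_derivative)
  qed
  \<comment> \<open>The size of \<open>q\<close> below which the phase counts as stationary. The
    choice \<open>\<mu> * \<epsilon>\<^sup>2 = 1\<close> gives the two parts of the error
    \<open>E\<close> the same bound.\<close>
  define \<epsilon> where "\<epsilon> = 1 / sqrt \<mu>"
  have \<epsilon>: "\<epsilon> > 0" "\<mu> * \<epsilon>\<^sup>2 = 1" using \<mu> by (simp_all add: \<epsilon>_def power_divide)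
  have qe: "(q \<theta>)\<^sup>2 + \<epsilon>\<^sup>2 > 0" for \<theta> using \<epsilon>(1) by (intro add_nonneg_pos) auto
  \<comment> \<open>A smoothed version of \<open>1 / q \<theta>\<close>: integration by parts with
    the exact reciprocal would break down at the zeros of \<open>q\<close>.\<close>
  define \<rho> where "\<rho> \<theta> = q \<theta> / ((q \<theta>)\<^sup>2 + \<epsilon>\<^sup>2)" for \<theta>
  define \<rho>' where "\<rho>' \<theta> = q' \<theta> * (\<epsilon>\<^sup>2 - (q \<theta>)\<^sup>2) / ((q \<theta>)\<^sup>2 + \<epsilon>\<^sup>2)\<^sup>2" for \<theta>
  have drho: "(\<rho> has_real_derivative \<rho>' \<theta>) (at \<theta>)" for \<theta>
    unfolding \<rho>_def[abs_def] \<rho>'_def using qe[of \<theta>]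
    by (auto intro!: derivative_eq_intros dq simp: power2_eq_square algebra_simps)
  have rhob: "\<bar>\<rho>' \<theta>\<bar> \<le> 1 / ((q \<theta>)\<^sup>2 + \<epsilon>\<^sup>2)" for \<theta>
  proof -
    have "\<bar>q' \<theta>\<bar> * \<bar>\<epsilon>\<^sup>2 - (q \<theta>)\<^sup>2\<bar> \<le> 1 * ((q \<theta>)\<^sup>2 + \<epsilon>\<^sup>2)" using q'b[of \<theta>]
      by (intro mult_mono) (auto simp: abs_le_iff)
    then show ?thesis using qe[of \<theta>] by (simp add: \<rho>'_def abs_mult power2_eq_square[of "(q \<theta>)\<^sup>2 + \<epsilon>\<^sup>2"] divide_simps)
  qed
  define V where "V \<theta> = cis (\<phi> \<theta>) * of_real (\<rho> \<theta>)" for \<theta>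
  define V' where "V' \<theta> = \<i> * of_real (\<mu> * q \<theta>) * cis (\<phi> \<theta>) * of_real (\<rho> \<theta>) + cis (\<phi> \<theta>) * of_real (\<rho>' \<theta>)" for \<theta>
  have dV: "(V has_vector_derivative V' \<theta>) (at \<theta>)" for \<theta>
  proof -
    have "(cis has_vector_derivative \<i> * cis x) (at x)" for x
      using has_vector_derivative_iexp[of x UNIV] unfolding cis_conv_exp[abs_def] by simp
    from vector_diff_chain_at[OF dphi[of \<theta>, unfolded has_real_derivative_iff_has_vector_derivative] this]
    have "((\<lambda>\<theta>. cis (\<phi> \<theta>)) has_vector_derivative (\<mu> * q \<theta>) *\<^sub>R (\<i> * cis (\<phi> \<theta>))) (at \<theta>)" by (simp add: o_def)
    moreover have "((\<lambda>\<theta>. complex_of_real (\<rho> \<theta>)) has_vector_derivative of_real (\<rho>' \<theta>)) (at \<theta>)"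
      by (rule has_vector_derivative_of_real[OF drho])
    ultimately have "(V has_vector_derivative cis (\<phi> \<theta>) * of_real (\<rho>' \<theta>) + (\<mu> * q \<theta>) *\<^sub>R (\<i> * cis (\<phi> \<theta>)) * of_real (\<rho> \<theta>)) (at \<theta>)"
      unfolding V_def[abs_def] by (rule has_vector_derivative_mult)
    then show ?thesis by (simp add: V'_def scaleR_conv_of_real algebra_simps)
  qed
  have per: "V (2 * pi) = V 0"
  proof -
    have "z (of_real (2 * pi)) = z (of_real 0)" unfolding zc by simp
    then have "W (2 * pi) = W 0" unfolding Wform by (simp only:)
    moreover have "\<phi> (2 * pi) = \<phi> 0" by (simp add: \<phi>_def)
    ultimately show ?thesis by (simp add: V_def \<rho>_def q_def)
  qed
  have V0: "(V' has_integral 0) {0..2 * pi}"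
    using fundamental_theorem_of_calculus[of 0 "2 * pi" V V'] dV per has_vector_derivative_at_within by fastforce
  \<comment> \<open>What remains of \<open>cis (\<phi> \<theta>)\<close> after subtracting the exact
    derivative \<open>V' \<theta> / (\<i> * of_real \<mu>)\<close>, whose integral over a period is
    zero. Each of the two terms is bounded by \<open>\<epsilon>\<^sup>2 / ((q \<theta>)\<^sup>2 +
    \<epsilon>\<^sup>2)\<close>.\<close>
  define E where "E \<theta> = cis (\<phi> \<theta>) * of_real (\<epsilon>\<^sup>2 / ((q \<theta>)\<^sup>2 + \<epsilon>\<^sup>2)) - cis (\<phi> \<theta>) * of_real (\<rho>' \<theta>) / (\<i> * of_real \<mu>)" for \<theta>
  have split: "cis (\<phi> \<theta>) = V' \<theta> / (\<i> * of_real \<mu>) + E \<theta>" for \<theta>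
  proof -
    have "q \<theta> * \<rho> \<theta> + \<epsilon>\<^sup>2 / ((q \<theta>)\<^sup>2 + \<epsilon>\<^sup>2) = 1" using qe[of \<theta>] \<epsilon>(1) unfolding \<rho>_def
      by (simp only: times_divide_eq_right power2_eq_square[symmetric] add_divide_distrib[symmetric]) simp
    then have one: "of_real (q \<theta>) * of_real (\<rho> \<theta>) + of_real (\<epsilon>\<^sup>2 / ((q \<theta>)\<^sup>2 + \<epsilon>\<^sup>2)) = (1 :: complex)"
      by (metis of_real_1 of_real_add of_real_mult)
    have "V' \<theta> / (\<i> * of_real \<mu>) = cis (\<phi> \<theta>) * (of_real (q \<theta>) * of_real (\<rho> \<theta>)) + cis (\<phi> \<theta>) * of_real (\<rho>' \<theta>) / (\<i> * of_real \<mu>)"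
      using \<mu> by (simp add: V'_def add_divide_distrib)
    then have "V' \<theta> / (\<i> * of_real \<mu>) + E \<theta> = cis (\<phi> \<theta>) * (of_real (q \<theta>) * of_real (\<rho> \<theta>) + of_real (\<epsilon>\<^sup>2 / ((q \<theta>)\<^sup>2 + \<epsilon>\<^sup>2)))"
      by (simp add: E_def distrib_left)
    then show ?thesis by (simp only: one mult_1_right)
  qed
  have cphi: "continuous_on {0..2 * pi} (\<lambda>\<theta>. cis (\<phi> \<theta>))"
  proof -
    have "continuous_on {0..2 * pi} \<phi>" using dphi by (meson DERIV_isCont continuous_at_imp_continuous_on)
    then show ?thesis by (intro continuous_intros)
  qed
  have iV: "((\<lambda>\<theta>. V' \<theta> / (\<i> * of_real \<mu>)) has_integral 0) {0..2 * pi}"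
    using has_integral_divide[OF V0, of "\<i> * of_real \<mu>"] by simp
  have iphi: "((\<lambda>\<theta>. cis (\<phi> \<theta>)) has_integral integral {0..2 * pi} (\<lambda>\<theta>. cis (\<phi> \<theta>))) {0..2 * pi}"
    by (intro integrable_integral integrable_continuous_interval cphi)
  have "((\<lambda>\<theta>. cis (\<phi> \<theta>) - V' \<theta> / (\<i> * of_real \<mu>)) has_integral integral {0..2 * pi} (\<lambda>\<theta>. cis (\<phi> \<theta>)) - 0) {0..2 * pi}"
    by (rule has_integral_diff[OF iphi iV])
  moreover have "cis (\<phi> \<theta>) - V' \<theta> / (\<i> * of_real \<mu>) = E \<theta>" for \<theta> using split[of \<theta>] by (simp add: algebra_simps)
  ultimately have iE: "(E has_integral integral {0..2 * pi} (\<lambda>\<theta>. cis (\<phi> \<theta>))) {0..2 * pi}" by simp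
  \<comment> \<open>Chosen so that \<open>a\<^sup>2 * (cos x)\<^sup>2 + \<epsilon>\<^sup>2 * (sin
    x)\<^sup>2\<close> equals \<open>r\<^sup>2 / 4 * (cos x)\<^sup>2 + \<epsilon>\<^sup>2\<close>,
    which at \<open>x = \<Psi> \<theta>\<close> is a lower bound for
    \<open>(q \<theta>)\<^sup>2 + \<epsilon>\<^sup>2\<close>. The reciprocal then integrates to an
    elliptic angle.\<close>
  define a where "a = sqrt (r\<^sup>2 / 4 + \<epsilon>\<^sup>2)"
  have a: "a > 0" "a\<^sup>2 = r\<^sup>2 / 4 + \<epsilon>\<^sup>2" "a \<ge> r / 2"
  proof -
    show "a > 0" unfolding a_def using r by (simp add: add_pos_nonneg)
    show "a\<^sup>2 = r\<^sup>2 / 4 + \<epsilon>\<^sup>2" unfolding a_def by simp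
    show "a \<ge> r / 2" unfolding a_def using r by (intro real_le_rsqrt) (simp add: power_divide)
  qed
  define \<Psi> where "\<Psi> \<theta> = Im (\<Lambda> (of_real \<theta>))" for \<theta> :: real
  define T where "T \<theta> = elliptic_angle a \<epsilon> (\<Psi> \<theta>)" for \<theta>
  define T' where "T' \<theta> = a * \<epsilon> / (a\<^sup>2 * (cos (\<Psi> \<theta>))\<^sup>2 + \<epsilon>\<^sup>2 * (sin (\<Psi> \<theta>))\<^sup>2) * Re (\<kappa> \<theta>)" for \<theta>
  have dPsi: "(\<Psi> has_real_derivative Re (\<kappa> \<theta>)) (at \<theta>)" for \<theta>
  proof -
    have "((\<lambda>\<theta>. Im (\<Lambda> (of_real \<theta>))) has_vector_derivative Im (\<i> * \<kappa> \<theta>)) (at \<theta>)"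
      by (rule bounded_linear.has_vector_derivative[OF bounded_linear_Im dL])
    then show ?thesis by (simp add: \<Psi>_def[abs_def] has_real_derivative_iff_has_vector_derivative)
  qed
  have dT: "(T has_real_derivative T' \<theta>) (at \<theta>)" for \<theta>
    unfolding T_def[abs_def] T'_def by (rule DERIV_chain2[OF elliptic_angle_deriv[OF a(1) \<epsilon>(1)] dPsi])
  have den: "a\<^sup>2 * (cos x)\<^sup>2 + \<epsilon>\<^sup>2 * (sin x)\<^sup>2 = r\<^sup>2 / 4 * (cos x)\<^sup>2 + \<epsilon>\<^sup>2" for x
    unfolding a sin_squared_eq by (simp add: algebra_simps)
  have denp: "r\<^sup>2 / 4 * (cos x)\<^sup>2 + \<epsilon>\<^sup>2 > 0" for x using \<epsilon>(1) by (intro add_nonneg_pos) auto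
  \<comment> \<open>Since \<open>Re (\<kappa> \<theta>) \<ge> 1 / 2\<close>, integration over
    \<open>\<theta>\<close> can be exchanged for integration over the argument
    \<open>\<Psi> \<theta>\<close> at the cost of a factor \<open>2\<close>.\<close>
  have qT: "1 / ((q \<theta>)\<^sup>2 + \<epsilon>\<^sup>2) \<le> 2 / (a * \<epsilon>) * T' \<theta>" for \<theta>
  proof -
    have "Re (W \<theta>) = norm (W \<theta>) * cos (\<Psi> \<theta>)" by (simp add: W_def \<Psi>_def Re_exp norm_exp_eq_Re)
    then have "(q \<theta>)\<^sup>2 = (norm (W \<theta>))\<^sup>2 * (cos (\<Psi> \<theta>))\<^sup>2" by (simp add: q_def power_mult_distrib)
    moreover have "(r / 2)\<^sup>2 \<le> (norm (W \<theta>))\<^sup>2" using Wn(1)[of \<theta>] r by (intro power_mono) auto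
    then have "(r / 2)\<^sup>2 * (cos (\<Psi> \<theta>))\<^sup>2 \<le> (norm (W \<theta>))\<^sup>2 * (cos (\<Psi> \<theta>))\<^sup>2" by (rule mult_right_mono) simp
    ultimately have "r\<^sup>2 / 4 * (cos (\<Psi> \<theta>))\<^sup>2 + \<epsilon>\<^sup>2 \<le> (q \<theta>)\<^sup>2 + \<epsilon>\<^sup>2" by (simp add: power_divide)
    then have "1 / ((q \<theta>)\<^sup>2 + \<epsilon>\<^sup>2) \<le> 1 / (r\<^sup>2 / 4 * (cos (\<Psi> \<theta>))\<^sup>2 + \<epsilon>\<^sup>2)" using denp by (intro divide_left_mono mult_pos_pos qe) auto
    also have "\<dots> = 1 / (r\<^sup>2 / 4 * (cos (\<Psi> \<theta>))\<^sup>2 + \<epsilon>\<^sup>2) * 1" by simp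
    also have "\<dots> \<le> 1 / (r\<^sup>2 / 4 * (cos (\<Psi> \<theta>))\<^sup>2 + \<epsilon>\<^sup>2) * (2 * Re (\<kappa> \<theta>))"
      using kre[of \<theta>] denp[of "\<Psi> \<theta>"] by (intro mult_left_mono) auto
    also have "\<dots> = 2 / (a * \<epsilon>) * T' \<theta>" unfolding T'_def den using a(1) \<epsilon>(1) by simp
    finally show ?thesis .
  qed
  have Eb: "norm (E \<theta>) \<le> 4 * \<epsilon> / a * T' \<theta>" for \<theta>
  proof -
    have "norm (E \<theta>) \<le> norm (cis (\<phi> \<theta>) * of_real (\<epsilon>\<^sup>2 / ((q \<theta>)\<^sup>2 + \<epsilon>\<^sup>2))) + norm (cis (\<phi> \<theta>) * of_real (\<rho>' \<theta>) / (\<i> * of_real \<mu>))"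
      unfolding E_def by (rule norm_triangle_ineq4)
    also have "\<dots> = \<epsilon>\<^sup>2 / ((q \<theta>)\<^sup>2 + \<epsilon>\<^sup>2) + \<bar>\<rho>' \<theta>\<bar> / \<mu>"
      using \<mu> qe[of \<theta>] by (simp add: norm_mult norm_divide del: of_real_divide of_real_power of_real_add)
    also have "\<dots> \<le> \<epsilon>\<^sup>2 / ((q \<theta>)\<^sup>2 + \<epsilon>\<^sup>2) + (1 / ((q \<theta>)\<^sup>2 + \<epsilon>\<^sup>2)) / \<mu>"
      using rhob[of \<theta>] \<mu> by (intro add_left_mono divide_right_mono) auto
    also have "\<dots> = 2 * \<epsilon>\<^sup>2 * (1 / ((q \<theta>)\<^sup>2 + \<epsilon>\<^sup>2))"
    proof -
      have "1 / \<mu> = \<epsilon>\<^sup>2" using \<epsilon>(2) \<mu> by (simp add: field_simps)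
      then have "(1 / ((q \<theta>)\<^sup>2 + \<epsilon>\<^sup>2)) / \<mu> = \<epsilon>\<^sup>2 * (1 / ((q \<theta>)\<^sup>2 + \<epsilon>\<^sup>2))" by (metis divide_divide_eq_left' mult.commute times_divide_eq_left mult.left_neutral)
      then show ?thesis by simp
    qed
    also have "\<dots> \<le> 2 * \<epsilon>\<^sup>2 * (2 / (a * \<epsilon>) * T' \<theta>)" by (intro mult_left_mono qT) auto
    also have "\<dots> = 4 * \<epsilon> / a * T' \<theta>" using \<epsilon>(1) by (simp add: power2_eq_square)
    finally show ?thesis .
  qed
  have iT: "(T' has_integral T (2 * pi) - T 0) {0..2 * pi}"
    using fundamental_theorem_of_calculus[of 0 "2 * pi" T T'] dT
    by (simp add: has_real_derivative_iff_has_vector_derivative has_vector_derivative_at_within)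
  have Tper: "T (2 * pi) - T 0 = 2 * pi"
  proof -
    have "z (of_real (2 * pi)) = z (of_real 0)" unfolding zc by simp
    then have "z (2 * complex_of_real pi) = z 0" by simp
    then have "\<Psi> (2 * pi) = \<Psi> 0 + 2 * pi" by (simp add: \<Psi>_def \<Lambda>_def)
    then show ?thesis by (simp add: T_def elliptic_angle_period)
  qed
  have iT': "((\<lambda>\<theta>. 4 * \<epsilon> / a * T' \<theta>) has_integral 4 * \<epsilon> / a * (2 * pi)) {0..2 * pi}"
    using has_integral_mult_right[OF iT, of "4 * \<epsilon> / a"] Tper by simp
  have "norm (integral {0..2 * pi} E) \<le> integral {0..2 * pi} (\<lambda>\<theta>. 4 * \<epsilon> / a * T' \<theta>)"
    by (rule integral_norm_bound_integral) (use iE iT' Eb in auto)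
  then have "norm (integral {0..2 * pi} (\<lambda>\<theta>. cis (\<phi> \<theta>))) \<le> 4 * \<epsilon> / a * (2 * pi)"
    unfolding integral_unique[OF iE] integral_unique[OF iT'] .
  also have "\<dots> \<le> 4 * \<epsilon> / (r / 2) * (2 * pi)"
    using a r \<epsilon>(1) by (intro mult_right_mono divide_left_mono mult_pos_pos) auto
  also have "\<dots> = 16 * pi / (r * sqrt (l * norm y))" using r by (simp add: \<epsilon>_def \<mu>_def)
  finally show ?thesis by (simp add: \<phi>_def)
qed

section \<open>The infinite torus\<close>

text \<open>The index type is general because monomials occur both in numbered coordinates and in
  the values of a character at prime ideals.\<close>

definition torus_monomial :: "'i multiset \<Rightarrow> 'i multiset \<Rightarrow> ('i \<Rightarrow> complex) \<Rightarrow> complex" where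
  "torus_monomial A B t = (\<Prod>P\<in>#A. t P) * (\<Prod>P\<in>#B. cnj (t P))"

definition circle :: "real measure" where
  "circle = density lborel (\<lambda>x. ennreal (indicator {0..2 * pi} x / (2 * pi)))"

text \<open>Points are sequences of angles; the point of the polydisc that belongs to
  \<open>\<theta>\<close> is \<open>\<lambda>n. cis (\<theta> n)\<close>. With real angles the
  factors become integrals over an interval.\<close>

definition torus :: "(nat \<Rightarrow> real) measure" where
  "torus = PiM UNIV (\<lambda>_. circle)"

lemma sets_circle [measurable_cong, simp]: "sets circle = sets borel"
  by (simp add: circle_def)

lemma space_circle [simp]: "space circle = UNIV"
  by (simp add: circle_def)

lemma borel_measurable_circle: "continuous_on UNIV f \<Longrightarrow> f \<in> borel_measurable circle"
  using borel_measurable_continuous_onI measurable_cong_sets[OF sets_circle refl] by blast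

lemma integral_circle:
  fixes f :: "real \<Rightarrow> complex"
  assumes c: "continuous_on UNIV f"
  shows "integral\<^sup>L circle f = integral {0..2 * pi} f / of_real (2 * pi)"
proof -
  have [measurable]: "f \<in> borel_measurable borel" using c by (rule borel_measurable_continuous_onI)
  have "integral\<^sup>L circle f = (LINT x|lborel. (indicator {0..2 * pi} x / (2 * pi)) *\<^sub>R f x)"
    unfolding circle_def by (subst integral_density) auto
  also have "\<dots> = (LINT x|lborel. (1 / (2 * pi)) *\<^sub>R (indicator {0..2 * pi} x *\<^sub>R f x))" by simp
  also have "\<dots> = (1 / (2 * pi)) *\<^sub>R (LINT x:{0..2 * pi}|lborel. f x)"
    unfolding set_lebesgue_integral_def by (rule integral_scaleR_right)
  also have "(LINT x:{0..2 * pi}|lborel. f x) = integral {0..2 * pi} f"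
    by (intro set_borel_integral_eq_integral borel_integrable_atLeastAtMost' continuous_on_subset[OF c]) auto
  finally show ?thesis by (simp add: scaleR_conv_of_real)
qed

lemma prob_space_circle: "prob_space circle"
proof
  have "emeasure circle (space circle) = (\<integral>\<^sup>+x. ennreal (1 / (2 * pi)) * indicator {0..2 * pi} x \<partial>lborel)"
    unfolding circle_def by (subst emeasure_density) (auto intro!: nn_integral_cong split: split_indicator)
  also have "\<dots> = ennreal (1 / (2 * pi)) * ennreal (2 * pi)"
    by (subst nn_integral_cmult_indicator) auto
  also have "\<dots> = 1" by (subst ennreal_mult[symmetric]) auto
  finally show "emeasure circle (space circle) = 1" .
qed

lemma prob_space_torus: "prob_space torus"
  unfolding torus_def by (rule prob_space_PiM) (rule prob_space_circle)

lemma space_torus [simp]: "space torus = UNIV"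
  by (simp add: torus_def space_PiM)

lemma sets_torus [measurable_cong]: "sets torus = sets borel"
proof -
  have "sets torus = sets (PiM UNIV (\<lambda>_::nat. borel :: real measure))"
    unfolding torus_def by (rule sets_PiM_cong) auto
  then show ?thesis by (simp add: sets_PiM_equal_borel)
qed

lemma measurable_torus_coordinate [measurable]: "(\<lambda>\<theta>. \<theta> n) \<in> borel_measurable torus"
proof -
  have "(\<lambda>\<theta>. \<theta> n) \<in> measurable torus circle" unfolding torus_def by (rule measurable_component_singleton) simp
  then show ?thesis by (simp add: measurable_def)
qed

text \<open>The integrand depends on the coordinates in \<open>J\<close> only, so the infinite
  product measure can be replaced by its finite marginal, where the integral factorises.\<close>

lemma integral_torus_prod:
  fixes f :: "nat \<Rightarrow> real \<Rightarrow> complex"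
  assumes J: "finite J" and f: "\<And>n. continuous_on UNIV (f n)" and b: "\<And>n x. norm (f n x) \<le> 1"
  shows "(LINT \<theta>|torus. (\<Prod>n\<in>J. f n (\<theta> n))) = (\<Prod>n\<in>J. integral\<^sup>L circle (f n))"
proof -
  interpret C: prob_space circle by (rule prob_space_circle)
  interpret product_prob_space "\<lambda>_::nat. circle" UNIV ..
  interpret product_sigma_finite "\<lambda>_::nat. circle" ..
  have m: "f n \<in> borel_measurable circle" for n using f by (rule borel_measurable_circle)
  have mp: "(\<lambda>x. \<Prod>n\<in>J. f n (x n)) \<in> borel_measurable (PiM J (\<lambda>_. circle))"
    by (intro borel_measurable_prod measurable_compose[OF measurable_component_singleton[of _ J "\<lambda>_. circle"] m]) auto
  have mr: "(\<lambda>\<theta>. restrict \<theta> J) \<in> measurable (PiM UNIV (\<lambda>_. circle)) (PiM J (\<lambda>_. circle))"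
    by (rule measurable_restrict_subset) simp
  have int: "integrable circle (f n)" for n
    by (rule C.integrable_const_bound[of _ 1]) (use b m in auto)
  have "(LINT x|PiM J (\<lambda>_. circle). (\<Prod>n\<in>J. f n (x n))) = (LINT x|distr torus (PiM J (\<lambda>_. circle)) (\<lambda>x. restrict x J). (\<Prod>n\<in>J. f n (x n)))"
    unfolding torus_def using distr_PiM_restrict_finite[OF J] by simp
  also have "\<dots> = (LINT \<theta>|torus. (\<Prod>n\<in>J. f n (restrict \<theta> J n)))"
    unfolding torus_def by (rule integral_distr[OF mr mp])
  also have "\<dots> = (LINT \<theta>|torus. (\<Prod>n\<in>J. f n (\<theta> n)))" by simp
  finally show ?thesis using product_integral_prod[OF J, of f] int by simp
qed

lemma integral_cis_multiple:
  "integral {0..2 * pi} (\<lambda>x. cis (of_int k * x)) = (if k = 0 then of_real (2 * pi) else 0)"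
proof (cases "k = 0")
  case True
  then show ?thesis by (simp add: scaleR_conv_of_real)
next
  case False
  have d: "((\<lambda>x. cis (of_int k * x) / (\<i> * of_int k)) has_vector_derivative cis (of_int k * x)) (at x within {0..2 * pi})" for x
  proof -
    have "((\<lambda>x. exp (\<i> * (of_int k * x)) / (\<i> * of_int k)) has_field_derivative exp (\<i> * (of_int k * of_real x))) (at (of_real x))"
      using False by (auto intro!: derivative_eq_intros simp: mult.left_commute[of \<i>])
    from has_vector_derivative_real_field[OF this, of "{0..2 * pi}"] show ?thesis by (simp add: cis_conv_exp)
  qed
  have "((\<lambda>x. cis (of_int k * x)) has_integral cis (of_int k * (2 * pi)) / (\<i> * of_int k) - cis (of_int k * 0) / (\<i> * of_int k)) {0..2 * pi}"
    by (rule fundamental_theorem_of_calculus) (use d in auto)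
  moreover have "cis (of_int k * (2 * pi)) = 1" using cis_multiple_2pi[of "of_int k"] by (simp add: mult_ac)
  ultimately show ?thesis using False by (simp add: integral_unique)
qed

lemma prod_mset_eq_prod:
  assumes "finite S" "set_mset A \<subseteq> S" shows "(\<Prod>n\<in>#A. t n) = (\<Prod>n\<in>S. t n ^ count A n :: complex)"
  unfolding image_prod_mset_multiplicity
  by (rule prod.mono_neutral_left) (use assms in \<open>auto simp: not_in_iff\<close>)

lemma integral_torus_monomial:
  "(LINT \<theta>|torus. torus_monomial A B (\<lambda>n. cis (\<theta> n))) = (if A = B then 1 else 0)"
proof -
  define S where "S = set_mset A \<union> set_mset B"
  define k where "k n = int (count A n) - int (count B n)" for n
  have eq: "torus_monomial A B (\<lambda>n. cis (\<theta> n)) = (\<Prod>n\<in>S. cis (of_int (k n) * \<theta> n))" for \<theta>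
  proof -
    have "torus_monomial A B (\<lambda>n. cis (\<theta> n)) = (\<Prod>n\<in>S. cis (\<theta> n) ^ count A n) * (\<Prod>n\<in>S. cnj (cis (\<theta> n)) ^ count B n)"
      unfolding torus_monomial_def by (subst (1 2) prod_mset_eq_prod[of S]) (auto simp: S_def)
    also have "\<dots> = (\<Prod>n\<in>S. cis (of_int (k n) * \<theta> n))"
      unfolding prod.distrib[symmetric]
      by (intro prod.cong refl) (simp add: k_def Complex.DeMoivre cis_cnj cis_mult algebra_simps)
    finally show ?thesis .
  qed
  have "(LINT \<theta>|torus. torus_monomial A B (\<lambda>n. cis (\<theta> n))) = (\<Prod>n\<in>S. integral\<^sup>L circle (\<lambda>x. cis (of_int (k n) * x)))"
    unfolding eq by (rule integral_torus_prod) (auto simp: S_def intro!: continuous_intros)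
  also have "\<dots> = (\<Prod>n\<in>S. if k n = 0 then 1 else 0)"
  proof (rule prod.cong[OF refl])
    fix n
    have "integral\<^sup>L circle (\<lambda>x. cis (of_int (k n) * x)) = integral {0..2 * pi} (\<lambda>x. cis (of_int (k n) * x)) / of_real (2 * pi)"
      by (rule integral_circle) (intro continuous_intros)
    then show "integral\<^sup>L circle (\<lambda>x. cis (of_int (k n) * x)) = (if k n = 0 then 1 else 0)"
      unfolding integral_cis_multiple by simp
  qed
  also have "\<dots> = (if A = B then 1 else 0)"
  proof (cases "A = B")
    case False
    then obtain n where "count A n \<noteq> count B n" by (auto simp: multiset_eq_iff)
    moreover from this have "n \<in> S" unfolding S_def by (metis UnCI count_eq_zero_iff)
    ultimately show ?thesis using False by (auto simp: k_def S_def intro!: prod_zero bexI[of _ n])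
  qed (simp add: k_def)
  finally show ?thesis .
qed

section \<open>Equidistribution on the infinite torus\<close>

text \<open>Closed discs instead of circles, because a character vanishes at its conductor. The
  product is still compact, by Tychonoff.\<close>

definition polydisc :: "(nat \<Rightarrow> complex) set" where "polydisc = {t. \<forall>n. norm (t n) \<le> 1}"

lemma compact_polydisc: "compact polydisc"
proof -
  have eq: "polydisc = PiE UNIV (\<lambda>_. cball 0 1)" by (auto simp: polydisc_def)
  have "compactin (product_topology (\<lambda>_::nat. euclidean :: complex topology) UNIV) (PiE UNIV (\<lambda>_. cball 0 1))"
    by (subst compactin_PiE) auto
  then show ?thesis unfolding eq euclidean_product_topology by simp
qed

text \<open>Polynomials in the coordinates and their conjugates; the conjugates bring in the real
  and imaginary parts of the coordinates, which separate points.\<close>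

inductive torus_poly :: "((nat \<Rightarrow> complex) \<Rightarrow> complex) \<Rightarrow> bool" where
  mono: "torus_poly (\<lambda>t. c * torus_monomial A B t)"
| add: "torus_poly p \<Longrightarrow> torus_poly q \<Longrightarrow> torus_poly (\<lambda>t. p t + q t)"

lemma torus_poly_mult_mono: "torus_poly q \<Longrightarrow> torus_poly (\<lambda>t. c * torus_monomial A B t * q t)"
proof (induction rule: torus_poly.induct)
  case (mono d A' B')
  have "(\<lambda>t. c * torus_monomial A B t * (d * torus_monomial A' B' t)) = (\<lambda>t. (c * d) * torus_monomial (A + A') (B + B') t)"
    by (simp add: torus_monomial_def fun_eq_iff mult_ac)
  then show ?case using torus_poly.mono by metis
next
  case (add p q)
  then show ?case using torus_poly.add by (simp add: distrib_left)
qed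

lemma torus_poly_mult: "torus_poly p \<Longrightarrow> torus_poly q \<Longrightarrow> torus_poly (\<lambda>t. p t * q t)"
proof (induction rule: torus_poly.induct)
  case (mono c A B)
  then show ?case by (rule torus_poly_mult_mono)
next
  case (add p q')
  then show ?case using torus_poly.add by (simp add: distrib_right)
qed

lemma torus_poly_const: "torus_poly (\<lambda>_. c)"
  using torus_poly.mono[of c "{#}" "{#}"] by (simp add: torus_monomial_def)

lemma torus_poly_coord: "torus_poly (\<lambda>t. c * t n)" "torus_poly (\<lambda>t. c * cnj (t n))"
  using torus_poly.mono[of c "{#n#}" "{#}"] torus_poly.mono[of c "{#}" "{#n#}"] by (simp_all add: torus_monomial_def)

lemma continuous_torus_monomial: "continuous_on UNIV (torus_monomial A B :: (nat \<Rightarrow> complex) \<Rightarrow> complex)"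
proof -
  have "continuous_on UNIV (\<lambda>t :: nat \<Rightarrow> complex. \<Prod>P\<in>#A. t P)"
    by (induction A) (auto intro!: continuous_intros)
  moreover have "continuous_on UNIV (\<lambda>t :: nat \<Rightarrow> complex. \<Prod>P\<in>#B. cnj (t P))"
    by (induction B) (auto intro!: continuous_intros)
  ultimately show ?thesis unfolding torus_monomial_def[abs_def] by (rule continuous_on_mult)
qed

lemma continuous_torus_poly: "torus_poly p \<Longrightarrow> continuous_on UNIV p"
  by (induction rule: torus_poly.induct) (auto intro!: continuous_intros continuous_torus_monomial)

lemma torus_eval:
  fixes \<phi> :: "(nat \<Rightarrow> complex) \<Rightarrow> complex"
  assumes c: "continuous_on polydisc \<phi>"
  shows "(\<lambda>\<theta>. \<phi> (\<lambda>n. cis (\<theta> n))) \<in> borel_measurable torus" "integrable torus (\<lambda>\<theta>. \<phi> (\<lambda>n. cis (\<theta> n)))"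
proof -
  interpret prob_space torus by (rule prob_space_torus)
  have "continuous_on UNIV (\<lambda>(\<theta> :: nat \<Rightarrow> real) n. cis (\<theta> n))"
    by (intro continuous_intros continuous_on_product_coordinates)
  then have "continuous_on UNIV (\<lambda>\<theta>. \<phi> (\<lambda>n. cis (\<theta> n)))"
    by (rule continuous_on_compose2[OF c]) (auto simp: polydisc_def)
  then have "(\<lambda>\<theta>. \<phi> (\<lambda>n. cis (\<theta> n))) \<in> borel_measurable borel" by (rule borel_measurable_continuous_onI)
  then show m: "(\<lambda>\<theta>. \<phi> (\<lambda>n. cis (\<theta> n))) \<in> borel_measurable torus"
    using measurable_cong_sets[OF sets_torus refl] by blast
  have "bounded (\<phi> ` polydisc)" by (intro compact_imp_bounded compact_continuous_image c compact_polydisc)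
  then obtain b where "\<And>t. t \<in> polydisc \<Longrightarrow> norm (\<phi> t) \<le> b" by (auto simp: bounded_iff)
  then show "integrable torus (\<lambda>\<theta>. \<phi> (\<lambda>n. cis (\<theta> n)))"
    by (intro integrable_const_bound[of _ b] m) (auto simp: polydisc_def)
qed

text \<open>Weyl's criterion for an infinite torus. \<open>L\<close> abstracts the averages over the
  family, and \<open>L_bound\<close> is contractivity in the supremum norm of the polydisc, which
  carries the limit from polynomials to their uniform limits. The limit measure lives on the
  circles, although \<open>L\<close> may see the interior of the discs.\<close>

theorem torus_equidistribution:
  fixes L :: "nat \<Rightarrow> ((nat \<Rightarrow> complex) \<Rightarrow> complex) \<Rightarrow> complex"
  assumes L_add: "\<And>m p q. L m (\<lambda>t. p t + q t) = L m p + L m q"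
    and L_scale: "\<And>m c p. L m (\<lambda>t. c * p t) = c * L m p"
    and L_bound: "\<And>m p b. b \<ge> 0 \<Longrightarrow> (\<And>t. t \<in> polydisc \<Longrightarrow> norm (p t) \<le> b) \<Longrightarrow> norm (L m p) \<le> b"
    and L_mono: "\<And>A B. (\<lambda>m. L m (torus_monomial A B)) \<longlonglongrightarrow> (if A = B then 1 else 0)"
    and \<phi>: "continuous_on polydisc \<phi>"
  shows "(\<lambda>m. L m \<phi>) \<longlonglongrightarrow> (LINT \<theta>|torus. \<phi> (\<lambda>n. cis (\<theta> n)))"
proof -
  interpret prob_space torus by (rule prob_space_torus)
  define E where "E p = (LINT \<theta>|torus. p (\<lambda>n. cis (\<theta> n)))" for p :: "(nat \<Rightarrow> complex) \<Rightarrow> complex"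
  have poly: "(\<lambda>m. L m p) \<longlonglongrightarrow> E p" if "torus_poly p" for p
    using that
  proof (induction rule: torus_poly.induct)
    case (mono c A B)
    have "E (\<lambda>t. c * torus_monomial A B t) = c * (if A = B then 1 else 0)"
      unfolding E_def by (simp only: Bochner_Integration.integral_mult_right_zero integral_torus_monomial)
    then show ?case unfolding L_scale using tendsto_mult_left[OF L_mono] by metis
  next
    case (add p q)
    have "E (\<lambda>t. p t + q t) = E p + E q"
      unfolding E_def using add(1,2) continuous_torus_poly
      by (intro Bochner_Integration.integral_add torus_eval) (auto intro: continuous_on_subset)
    then show ?case unfolding L_add using tendsto_add[OF add(3,4)] by metis
  qed
  \<comment> \<open>Real functions, because Stone-Weierstrass is applied to the real and imaginary
    parts of \<open>\<phi>\<close> separately.\<close>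
  define R where "R = {g :: (nat \<Rightarrow> complex) \<Rightarrow> real. torus_poly (\<lambda>t. of_real (g t))}"
  interpret FR: function_ring_on R polydisc
  proof
    show "compact polydisc" by (rule compact_polydisc)
    show "continuous_on polydisc f" if "f \<in> R" for f
    proof -
      have "continuous_on UNIV (\<lambda>t. Re (of_real (f t)))"
        using that by (intro continuous_on_Re continuous_torus_poly) (simp add: R_def)
      then have "continuous_on UNIV f" by simp
      then show ?thesis by (rule continuous_on_subset) simp
    qed
    show "(\<lambda>x. f x + g x) \<in> R" if "f \<in> R" "g \<in> R" for f g
      using that torus_poly.add by (simp add: R_def)
    show "(\<lambda>x. f x * g x) \<in> R" if "f \<in> R" "g \<in> R" for f g
      using that torus_poly_mult by (simp add: R_def)
    show "(\<lambda>_. c) \<in> R" for c using torus_poly_const by (simp add: R_def)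
    show "\<exists>f\<in>R. f x \<noteq> f y" if "x \<noteq> y" for x y
    proof -
      from that obtain n where n: "x n \<noteq> y n" by (meson ext)
      have re_eq: "(\<lambda>t. complex_of_real (Re (t n))) = (\<lambda>t. 1 / 2 * t n + 1 / 2 * cnj (t n))"
        by (rule ext) (simp add: complex_eq_iff)
      have re: "(\<lambda>t. Re (t n)) \<in> R" unfolding R_def mem_Collect_eq re_eq
        by (rule torus_poly.add[OF torus_poly_coord(1) torus_poly_coord(2)])
      have im_eq: "(\<lambda>t. complex_of_real (Im (t n))) = (\<lambda>t. - \<i> / 2 * t n + \<i> / 2 * cnj (t n))"
        by (rule ext) (simp add: complex_eq_iff)
      have im: "(\<lambda>t. Im (t n)) \<in> R" unfolding R_def mem_Collect_eq im_eq
        by (rule torus_poly.add[OF torus_poly_coord(1) torus_poly_coord(2)])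
      show ?thesis using n re im by (metis complex_eq_iff)
    qed
  qed
  have real: "(\<lambda>m. L m (\<lambda>t. of_real (\<psi> t))) \<longlonglongrightarrow> E (\<lambda>t. of_real (\<psi> t))" if \<psi>: "continuous_on polydisc \<psi>" for \<psi> :: "(nat \<Rightarrow> complex) \<Rightarrow> real"
  proof (rule LIMSEQ_I)
    fix e :: real assume e: "e > 0"
    then obtain g where g: "g \<in> R" "\<And>t. t \<in> polydisc \<Longrightarrow> \<bar>\<psi> t - g t\<bar> < e / 3"
      using FR.Stone_Weierstrass_basic[OF \<psi>, of "e / 3"] by auto
    define d where "d t = complex_of_real (\<psi> t) - of_real (g t)" for t
    have split: "(\<lambda>t. of_real (\<psi> t)) = (\<lambda>t. d t + of_real (g t))" by (simp add: d_def fun_eq_iff)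
    have dle: "norm (d t) \<le> e / 3" if "t \<in> polydisc" for t
      using g(2)[OF that] unfolding d_def of_real_diff[symmetric] norm_of_real by simp
    have Ld: "norm (L m d) \<le> e / 3" for m using e dle by (intro L_bound) auto
    have gc: "continuous_on polydisc (\<lambda>t. complex_of_real (g t))" using FR.continuous[OF g(1)] by (intro continuous_intros)
    have dc: "continuous_on polydisc d" unfolding d_def[abs_def] by (intro continuous_intros gc \<psi>)
    have Ed: "norm (E d) \<le> e / 3"
    proof -
      have "norm (E d) \<le> (LINT \<theta>|torus. norm (d (\<lambda>n. cis (\<theta> n))))" unfolding E_def by (rule integral_norm_bound)
      also have "\<dots> \<le> (LINT \<theta>|torus. e / 3)"
        by (intro integral_mono integrable_norm torus_eval dc dle) (auto simp: polydisc_def)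
      also have "\<dots> = e / 3" using prob_space by simp
      finally show ?thesis .
    qed
    have Es: "E (\<lambda>t. of_real (\<psi> t)) = E d + E (\<lambda>t. of_real (g t))"
      unfolding split E_def by (intro Bochner_Integration.integral_add torus_eval dc gc)
    have "torus_poly (\<lambda>t. of_real (g t))" using g(1) by (simp add: R_def)
    from LIMSEQ_D[OF poly[OF this], of "e / 3"] e
    obtain N where N: "\<And>m. m \<ge> N \<Longrightarrow> norm (L m (\<lambda>t. of_real (g t)) - E (\<lambda>t. of_real (g t))) < e / 3" by auto
    have "norm (L m (\<lambda>t. of_real (\<psi> t)) - E (\<lambda>t. of_real (\<psi> t))) < e" if "m \<ge> N" for m
    proof -
      have "L m (\<lambda>t. of_real (\<psi> t)) - E (\<lambda>t. of_real (\<psi> t)) = (L m d - E d) + (L m (\<lambda>t. of_real (g t)) - E (\<lambda>t. of_real (g t)))"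
        unfolding Es by (subst split, subst L_add) simp
      then have "norm (L m (\<lambda>t. of_real (\<psi> t)) - E (\<lambda>t. of_real (\<psi> t))) \<le> norm (L m d - E d) + norm (L m (\<lambda>t. of_real (g t)) - E (\<lambda>t. of_real (g t)))"
        by (simp only: norm_triangle_ineq)
      moreover have "norm (L m d - E d) \<le> norm (L m d) + norm (E d)" by (rule norm_triangle_ineq4)
      ultimately show ?thesis using Ld[of m] Ed N[OF that] by simp
    qed
    then show "\<exists>N. \<forall>m\<ge>N. norm (L m (\<lambda>t. of_real (\<psi> t)) - E (\<lambda>t. of_real (\<psi> t))) < e" by blast
  qed
  have c: "continuous_on polydisc (\<lambda>t. Re (\<phi> t))" "continuous_on polydisc (\<lambda>t. Im (\<phi> t))" by (intro continuous_intros \<phi>)+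
  have split: "\<phi> = (\<lambda>t. of_real (Re (\<phi> t)) + \<i> * of_real (Im (\<phi> t)))" by (simp add: fun_eq_iff complex_eq[symmetric])
  have cc: "continuous_on polydisc (\<lambda>t. complex_of_real (Re (\<phi> t)))" "continuous_on polydisc (\<lambda>t. complex_of_real (Im (\<phi> t)))"
    by (intro continuous_intros c)+
  have "E \<phi> = E (\<lambda>t. of_real (Re (\<phi> t))) + \<i> * E (\<lambda>t. of_real (Im (\<phi> t)))"
    unfolding E_def Bochner_Integration.integral_mult_right_zero[symmetric]
    by (subst split, intro Bochner_Integration.integral_add torus_eval integrable_mult_right cc)
  moreover have "L m \<phi> = L m (\<lambda>t. of_real (Re (\<phi> t))) + \<i> * L m (\<lambda>t. of_real (Im (\<phi> t)))" for m
    by (subst split, subst L_add, subst L_scale) simp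
  moreover have "(\<lambda>m. L m (\<lambda>t. of_real (Re (\<phi> t))) + \<i> * L m (\<lambda>t. of_real (Im (\<phi> t)))) \<longlonglongrightarrow>
    E (\<lambda>t. of_real (Re (\<phi> t))) + \<i> * E (\<lambda>t. of_real (Im (\<phi> t)))"
    by (intro tendsto_intros real c)
  ultimately show ?thesis unfolding E_def[symmetric] by simp
qed

section \<open>The random series\<close>

text \<open>To be instantiated, for the prime ideal with number \<open>n\<close> and norm
  \<open>N n\<close>, by \<open>r n = N n powr (- \<sigma>)\<close> and
  \<open>l n = (ln (N n))\<^sup>2\<close>.\<close>

locale torus_series =
  fixes r l :: "nat \<Rightarrow> real"
  assumes r: "\<And>n. 0 < r n" "\<And>n. r n \<le> 1 / 2" and l: "\<And>n. 0 < l n"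
    and summable_r: "summable r" and summable_lr: "summable (\<lambda>n. l n * r n)"
begin

definition summand :: "nat \<Rightarrow> complex \<Rightarrow> complex" where
  "summand n t = of_real (l n) * koebe (of_real (r n) * t)"

definition series :: "(nat \<Rightarrow> complex) \<Rightarrow> complex" where
  "series t = (\<Sum>n. summand n (t n))"

lemma norm_summand: assumes "norm t \<le> 1" shows "norm (summand n t) \<le> 4 * (l n * r n)"
proof -
  have t: "norm (of_real (r n) * t) \<le> r n" using assms r[of n] by (simp add: norm_mult mult_left_le)
  have "norm (1 - of_real (r n) * t) \<ge> 1 - norm (of_real (r n) * t)" using norm_triangle_ineq2[of 1 "of_real (r n) * t"] by simp
  then have "norm (1 - of_real (r n) * t) \<ge> 1 / 2" using t r[of n] by simp
  then have "norm (1 - of_real (r n) * t) ^ 2 \<ge> (1 / 2) ^ 2" by (intro power_mono) auto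
  then have "norm (koebe (of_real (r n) * t)) \<le> r n / (1 / 2) ^ 2"
    unfolding koebe_def norm_divide norm_power using t r[of n] by (intro frac_le) auto
  then have "l n * norm (koebe (of_real (r n) * t)) \<le> l n * (4 * r n)" using l[of n] by (intro mult_left_mono) (auto simp: power2_eq_square)
  then show ?thesis using l[of n] by (simp add: summand_def norm_mult)
qed

lemma summable_bound: "summable (\<lambda>n. 4 * (l n * r n))"
  using summable_lr by (rule summable_mult)

lemma series_sums: assumes "t \<in> polydisc" shows "(\<lambda>n. summand n (t n)) sums series t" "norm (series t) \<le> (\<Sum>n. 4 * (l n * r n))"
proof -
  have s: "summable (\<lambda>n. norm (summand n (t n)))"
    by (rule summable_comparison_test_ev[OF _ summable_bound]) (use assms norm_summand in \<open>auto simp: polydisc_def\<close>)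
  then show "(\<lambda>n. summand n (t n)) sums series t" unfolding series_def by (rule summable_sums[OF summable_norm_cancel])
  have "norm (series t) \<le> (\<Sum>n. norm (summand n (t n)))" unfolding series_def by (rule summable_norm[OF s])
  also have "\<dots> \<le> (\<Sum>n. 4 * (l n * r n))"
    by (rule suminf_le[OF _ s summable_bound]) (use assms norm_summand in \<open>simp add: polydisc_def\<close>)
  finally show "norm (series t) \<le> (\<Sum>n. 4 * (l n * r n))" .
qed

lemma summand_continuous: "continuous_on (cball 0 1) (summand n)"
proof -
  have "1 - of_real (r n) * t \<noteq> 0" if "t \<in> cball 0 1" for t :: complex
  proof
    assume "1 - of_real (r n) * t = 0"
    then have "norm (of_real (r n) * t) = 1" by (metis eq_iff_diff_eq_0 norm_one)
    then show False using that r[of n] by (simp add: norm_mult) (smt (verit) mult_left_le)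
  qed
  then show ?thesis unfolding summand_def[abs_def] koebe_def by (intro continuous_intros) auto
qed

lemma series_continuous: "continuous_on polydisc series"
proof (rule uniform_limit_theorem)
  have "uniform_limit polydisc (\<lambda>n t. \<Sum>i<n. summand i (t i)) (\<lambda>t. \<Sum>i. summand i (t i)) sequentially"
    by (rule Weierstrass_m_test[OF _ summable_bound]) (auto simp: polydisc_def intro: norm_summand)
  then show "uniform_limit polydisc (\<lambda>n t. \<Sum>i<n. summand i (t i)) series sequentially" by (simp add: series_def[abs_def])
  have "continuous_on polydisc (\<lambda>t. summand i (t i))" for i
    by (rule continuous_on_compose2[OF summand_continuous continuous_on_subset[OF continuous_on_product_coordinates]]) (auto simp: polydisc_def)
  then show "\<forall>\<^sub>F n in sequentially. continuous_on polydisc (\<lambda>t. \<Sum>i<n. summand i (t i))"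
    by (intro always_eventually allI continuous_on_sum)
qed auto

definition Z :: "(nat \<Rightarrow> real) \<Rightarrow> complex" where "Z \<theta> = series (\<lambda>n. cis (\<theta> n))"

sublocale bounded_variable torus Z "\<Sum>n. 4 * (l n * r n)"
proof (intro bounded_variable.intro bounded_variable_axioms.intro prob_space_torus)
  show "Z \<in> borel_measurable torus" unfolding Z_def[abs_def] by (rule torus_eval(1)[OF series_continuous])
  show "norm (Z \<theta>) \<le> (\<Sum>n. 4 * (l n * r n))" for \<theta> unfolding Z_def by (rule series_sums(2)) (simp add: polydisc_def)
qed

definition factor :: "nat \<Rightarrow> complex \<Rightarrow> complex" where
  "factor n y = integral\<^sup>L circle (\<lambda>x. cis (- (summand n (cis x) \<bullet> y)))"

lemma summand_cis_continuous: "continuous_on UNIV (\<lambda>x. summand n (cis x))"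
  by (rule continuous_on_compose2[OF summand_continuous]) (auto intro!: continuous_intros)

lemma norm_factor: "norm (factor n y) \<le> 1"
proof -
  interpret C: prob_space circle by (rule prob_space_circle)
  have "norm (factor n y) \<le> (LINT x|circle. norm (cis (- (summand n (cis x) \<bullet> y))))" unfolding factor_def by (rule integral_norm_bound)
  then show ?thesis using C.prob_space by simp
qed

lemma cf_bound: assumes "finite J" shows "norm (cf y) \<le> (\<Prod>n\<in>J. norm (factor n y))"
proof -
  have lim: "(\<lambda>K. LINT \<theta>|torus. cis (- ((\<Sum>n<K. summand n (cis (\<theta> n))) \<bullet> y))) \<longlonglongrightarrow> cf y"
    unfolding cf_def
  proof (rule integral_dominated_convergence[where w="\<lambda>_. 1"])
    show "AE \<theta> in torus. (\<lambda>K. cis (- ((\<Sum>n<K. summand n (cis (\<theta> n))) \<bullet> y))) \<longlonglongrightarrow> cis (- (Z \<theta> \<bullet> y))"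
    proof (rule AE_I2)
      fix \<theta> :: "nat \<Rightarrow> real"
      have "(\<lambda>K. \<Sum>n<K. summand n (cis (\<theta> n))) \<longlonglongrightarrow> Z \<theta>"
        using series_sums(1)[of "\<lambda>n. cis (\<theta> n)"] by (simp add: polydisc_def Z_def sums_def)
      then show "(\<lambda>K. cis (- ((\<Sum>n<K. summand n (cis (\<theta> n))) \<bullet> y))) \<longlonglongrightarrow> cis (- (Z \<theta> \<bullet> y))"
        unfolding cis_conv_exp by (intro tendsto_exp tendsto_mult tendsto_of_real tendsto_minus tendsto_inner tendsto_const)
    qed
    have "(\<lambda>\<theta>. summand n (cis (\<theta> n))) \<in> borel_measurable torus" for n
      using measurable_compose[OF measurable_torus_coordinate borel_measurable_continuous_onI[OF summand_cis_continuous]] .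
    then have "(\<lambda>\<theta>. \<Sum>n<K. summand n (cis (\<theta> n))) \<in> borel_measurable torus" for K by (rule borel_measurable_sum)
    from measurable_compose[OF this, where g="\<lambda>z. cis (- (z \<bullet> y))"]
    show "(\<lambda>\<theta>. cis (- ((\<Sum>n<K. summand n (cis (\<theta> n))) \<bullet> y))) \<in> borel_measurable torus" for K
      by (auto intro!: borel_measurable_continuous_onI continuous_intros)
  qed auto
  have prod: "(LINT \<theta>|torus. cis (- ((\<Sum>n<K. summand n (cis (\<theta> n))) \<bullet> y))) = (\<Prod>n<K. factor n y)" for K
  proof -
    have "cis (- ((\<Sum>n<K. summand n (cis (\<theta> n))) \<bullet> y)) = (\<Prod>n<K. cis (- (summand n (cis (\<theta> n)) \<bullet> y)))" for \<theta>
      by (induction K) (simp_all only: sum.lessThan_Suc prod.lessThan_Suc inner_add_left minus_add_distrib cis_mult[symmetric], simp)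
    then show ?thesis unfolding factor_def
      by (simp only:) (rule integral_torus_prod, auto intro!: continuous_intros summand_cis_continuous)
  qed
  show ?thesis
  proof (rule LIMSEQ_le_const2)
    show "(\<lambda>K. norm (\<Prod>n<K. factor n y)) \<longlonglongrightarrow> norm (cf y)" using tendsto_norm[OF lim] unfolding prod .
    obtain K0 where K0: "J \<subseteq> {..<K0}" using assms finite_nat_bounded by auto
    have "norm (\<Prod>n<K. factor n y) \<le> (\<Prod>n\<in>J. norm (factor n y))" if "K \<ge> K0" for K
    proof -
      have sub: "J \<subseteq> {..<K}" using K0 that by auto
      have "norm (\<Prod>n<K. factor n y) = (\<Prod>n\<in>J. norm (factor n y)) * (\<Prod>n\<in>{..<K} - J. norm (factor n y))"
        unfolding prod_norm[symmetric] by (subst prod.subset_diff[OF sub]) (auto simp: mult.commute)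
      also have "\<dots> \<le> (\<Prod>n\<in>J. norm (factor n y)) * 1"
        by (intro mult_left_mono prod_le_1 prod_nonneg) (auto simp: norm_factor)
      finally show ?thesis by simp
    qed
    then show "\<exists>N. \<forall>K\<ge>N. norm (\<Prod>n<K. factor n y) \<le> (\<Prod>n\<in>J. norm (factor n y))" by blast
  qed
qed

text \<open>A factor decays like the inverse square root of \<open>norm y\<close>, so its square
  pays for one power of \<open>norm y\<close>. The constant \<open>8\<close> is the
  \<open>16 * pi\<close> of the circle estimate divided by the length \<open>2 * pi\<close>.\<close>

lemma factor_decay:
  assumes "r n \<le> 1 / 10"
  shows "\<exists>C. \<forall>y. (1 + norm y) * (norm (factor n y))\<^sup>2 \<le> C"
proof (intro exI allI)
  fix y :: complex
  define C where "C = 8 / (r n * sqrt (l n))"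
  have C0: "C \<ge> 0" using r[of n] l[of n] by (simp add: C_def)
  have n1: "(norm (factor n y))\<^sup>2 \<le> 1" using norm_factor[of n y] by (simp add: abs_square_le_1)
  have "norm y * (norm (factor n y))\<^sup>2 \<le> C\<^sup>2"
  proof (cases "y = 0")
    case False
    have "factor n y = integral {0..2 * pi} (\<lambda>x. cis (- (summand n (cis x) \<bullet> y))) / of_real (2 * pi)"
      unfolding factor_def by (intro integral_circle continuous_intros summand_cis_continuous)
    then have "norm (factor n y) = norm (integral {0..2 * pi} (\<lambda>x. cis (- (summand n (cis x) \<bullet> y)))) / (2 * pi)"
      by (simp add: norm_divide)
    also have "\<dots> \<le> (16 * pi / (r n * sqrt (l n * norm y))) / (2 * pi)"
      unfolding summand_def using koebe_circle_decay[OF r(1)[of n] assms l[of n] False] by (intro divide_right_mono) auto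
    also have "\<dots> = C / sqrt (norm y)" by (simp add: C_def real_sqrt_mult)
    finally have "(norm (factor n y))\<^sup>2 \<le> (C / sqrt (norm y))\<^sup>2" by (intro power_mono) auto
    then show ?thesis using False by (simp add: power_divide field_simps)
  qed simp
  then show "(1 + norm y) * (norm (factor n y))\<^sup>2 \<le> 1 + (8 / (r n * sqrt (l n)))\<^sup>2"
    using n1 by (simp add: distrib_right C_def)
qed

sublocale decaying_variable torus Z "\<Sum>n. 4 * (l n * r n)"
proof
  fix k :: nat
  have "r \<longlonglongrightarrow> 0" by (rule summable_LIMSEQ_zero[OF summable_r])
  then have "\<forall>\<^sub>F n in sequentially. r n < 1 / 10" by (rule order_tendstoD) simp
  then obtain N where "\<forall>n\<ge>N. r n < 1 / 10" unfolding eventually_sequentially by blast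
  then have N: "r n \<le> 1 / 10" if "n \<ge> N" for n using that less_imp_le by blast
  have "\<forall>n\<in>{N..<N + 2 * k}. \<exists>C. \<forall>y. (1 + norm y) * (norm (factor n y))\<^sup>2 \<le> C" using factor_decay N by auto
  then obtain C where C: "\<And>n y. n \<in> {N..<N + 2 * k} \<Longrightarrow> (1 + norm y) * (norm (factor n y))\<^sup>2 \<le> C n" by metis
  show "\<exists>C. \<forall>y. (1 + norm y) ^ k * norm (cf y) \<le> C"
  proof (intro exI allI)
    fix y :: complex
    \<comment> \<open>Two factors pay for one power of \<open>norm y\<close> in \<open>cf\<close>
      squared-free form as one square, so \<open>2 * k\<close> factors with
      \<open>r n \<le> 1 / 10\<close> give exponent \<open>k\<close>.\<close>
    let ?J = "{N..<N + 2 * k}"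
    have "((1 + norm y) ^ k * norm (cf y))\<^sup>2 \<le> ((1 + norm y) ^ k * (\<Prod>n\<in>?J. norm (factor n y)))\<^sup>2"
      by (intro power_mono mult_left_mono cf_bound) auto
    also have "\<dots> = (1 + norm y) ^ (2 * k) * (\<Prod>n\<in>?J. (norm (factor n y))\<^sup>2)"
      by (simp add: power_mult_distrib power_mult[symmetric] mult.commute prod_power_distrib)
    also have "\<dots> = (\<Prod>n\<in>?J. (1 + norm y) * (norm (factor n y))\<^sup>2)" by (simp add: prod.distrib)
    also have "\<dots> \<le> (\<Prod>n\<in>?J. C n)" by (intro prod_mono) (auto intro: C)
    also have "\<dots> \<le> (sqrt \<bar>\<Prod>n\<in>?J. C n\<bar>)\<^sup>2" by simp
    finally show "(1 + norm y) ^ k * norm (cf y) \<le> sqrt \<bar>\<Prod>n\<in>?J. C n\<bar>" by (rule power2_le_imp_le) simp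
  qed
qed

end

section \<open>The derivative of the logarithmic derivative\<close>

locale euler_product =
  fixes N :: "nat \<Rightarrow> real" and a :: "nat \<Rightarrow> complex"
  assumes N_ge: "\<And>n. N n \<ge> 2" and a_le: "\<And>n. norm (a n) \<le> 1"
    and summable_N: "\<And>\<sigma>. \<sigma> > 1 \<Longrightarrow> summable (\<lambda>n. N n powr (- \<sigma>))"
begin

definition w :: "nat \<Rightarrow> complex \<Rightarrow> complex" where
  "w n z = a n * exp (- (z * of_real (ln (N n))))"

lemma norm_w: "norm (w n z) \<le> N n powr (- Re z)"
proof -
  have "norm (w n z) = norm (a n) * N n powr (- Re z)" using N_ge[of n] by (simp add: w_def norm_mult powr_def)
  also have "\<dots> \<le> 1 * N n powr (- Re z)" by (intro mult_right_mono a_le) auto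
  finally show ?thesis by simp
qed

lemma N_powr_less: assumes "\<sigma> > 1" shows "N n powr (- \<sigma>) < 1 / 2"
proof -
  have "N n powr (- \<sigma>) \<le> 2 powr (- \<sigma>)" using N_ge[of n] assms by (intro powr_mono2') auto
  also have "\<dots> < 2 powr (- 1)" using assms by (intro powr_less_mono) auto
  also have "\<dots> = 1 / 2" by (simp add: powr_minus_divide)
  finally show ?thesis .
qed

lemma norm_w_less: assumes "Re z > 1" shows "norm (w n z) < 1 / 2"
  using norm_w[of n z] N_powr_less[OF assms, of n] by linarith

lemma one_minus_w: assumes "Re z > 1" shows "Re (1 - w n z) > 0" "1 - w n z \<noteq> 0" "norm (1 - w n z) \<ge> 1 / 2"
proof -
  show "Re (1 - w n z) > 0" using norm_w_less[OF assms, of n] complex_Re_le_cmod[of "w n z"] by simp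
  then show "1 - w n z \<noteq> 0" by auto
  show "norm (1 - w n z) \<ge> 1 / 2" using norm_w_less[OF assms, of n] norm_triangle_ineq2[of 1 "w n z"] by simp
qed

lemma ln_N_nonneg: "ln (N n) \<ge> 0"
  using N_ge[of n] by (intro ln_ge_zero) linarith

text \<open>A power of the logarithm costs an arbitrarily small power of \<open>N n\<close>;
  \<open>\<delta>\<close> is chosen so that the loss \<open>k * \<delta>\<close> is at most half of
  \<open>\<sigma> - 1\<close>.\<close>

lemma summable_ln_power:
  assumes "\<sigma> > 1" shows "summable (\<lambda>n. ln (N n) ^ k * N n powr (- \<sigma>))"
proof -
  define \<delta> where "\<delta> = (\<sigma> - 1) / (2 * (real k + 1))"
  have \<delta>: "\<delta> > 0" "k * \<delta> \<le> (\<sigma> - 1) / 2" using assms by (auto simp: \<delta>_def field_simps)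
  have "summable (\<lambda>n. (1 / \<delta>) ^ k * N n powr (- (\<sigma> - k * \<delta>)))"
    using \<delta> assms by (intro summable_mult summable_N) (simp add: field_simps)
  then show ?thesis
  proof (rule summable_comparison_test'[where N=0])
    fix n
    have "ln (N n) \<le> N n powr \<delta> / \<delta>" using N_ge[of n] \<delta>(1) by (intro ln_powr_bound) auto
    then have "ln (N n) ^ k \<le> (N n powr \<delta> / \<delta>) ^ k" by (intro power_mono ln_N_nonneg)
    also have "\<dots> = (1 / \<delta>) ^ k * N n powr (k * \<delta>)" using N_ge[of n]
      by (simp add: power_divide powr_power mult.commute)
    finally have "ln (N n) ^ k * N n powr (- \<sigma>) \<le> (1 / \<delta>) ^ k * N n powr (k * \<delta>) * N n powr (- \<sigma>)"
      by (intro mult_right_mono) auto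
    also have "\<dots> = (1 / \<delta>) ^ k * N n powr (- (\<sigma> - k * \<delta>))" by (simp add: powr_add[symmetric])
    finally show "norm (ln (N n) ^ k * N n powr (- \<sigma>)) \<le> (1 / \<delta>) ^ k * N n powr (- (\<sigma> - k * \<delta>))"
      using ln_N_nonneg[of n] by simp
  qed
qed

lemma w_deriv: "(w n has_field_derivative - of_real (ln (N n)) * w n z) (at z)"
  unfolding w_def by (auto intro!: derivative_eq_intros)

text \<open>Termwise differentiation needs a summable majorant that is uniform near
  \<open>z\<close>. On the ball of radius \<open>d = (Re z - 1) / 2\<close> real parts are at least
  \<open>1 + d\<close>, which supplies one.\<close>

lemma series_derivative:
  assumes d: "\<And>n z. Re z > 1 \<Longrightarrow> (f n has_field_derivative f' n z) (at z)"
    and b: "\<And>n z. Re z > 1 \<Longrightarrow> norm (f n z) \<le> 2 * (ln (N n) ^ k * N n powr (- Re z))"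
  obtains g g' where "\<And>z. Re z > 1 \<Longrightarrow> (\<lambda>n. f n z) sums g z" "\<And>z. Re z > 1 \<Longrightarrow> (\<lambda>n. f' n z) sums g' z"
    "\<And>z. Re z > 1 \<Longrightarrow> (g has_field_derivative g' z) (at z)"
proof -
  have "\<exists>g g'. \<forall>z \<in> {z. Re z > 1}. ((\<lambda>n. f n z) sums g z) \<and> ((\<lambda>n. f' n z) sums g' z) \<and> (g has_field_derivative g' z) (at z)"
  proof (rule series_and_derivative_comparison_complex)
    show "open {z. Re z > 1}" by (rule open_halfspace_Re_gt)
    show "(f n has_field_derivative f' n z) (at z)" if "z \<in> {z. Re z > 1}" for n z using d that by simp
    fix z assume "z \<in> {z. Re z > 1}"
    then have z: "Re z > 1" by simp
    define d where "d = (Re z - 1) / 2"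
    define h where "h n = 2 * (ln (N n) ^ k * N n powr (- (1 + d)))" for n
    have h0: "h n \<ge> 0" for n using ln_N_nonneg[of n] by (simp add: h_def)
    have d0: "d > 0" using z by (simp add: d_def)
    have "summable h" unfolding h_def using d0 by (intro summable_mult summable_ln_power) simp
    then have sh: "summable (\<lambda>n. complex_of_real (h n))" by (simp add: summable_of_real)
    have le: "norm (f n y) \<le> norm (complex_of_real (h n))" if "y \<in> ball z d \<inter> {z. Re z > 1}" for n y
    proof -
      have "\<bar>Re (z - y)\<bar> \<le> norm (z - y)" by (rule abs_Re_le_cmod)
      then have "Re z - Re y \<le> norm (z - y)" by simp
      moreover have "norm (z - y) < d" using that by (simp add: dist_norm)
      ultimately have "1 + d \<le> Re y" by (simp add: d_def field_simps)
      then have "N n powr (- Re y) \<le> N n powr (- (1 + d))" using N_ge[of n] by (intro powr_mono) auto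
      then have "2 * (ln (N n) ^ k * N n powr (- Re y)) \<le> h n"
        unfolding h_def using ln_N_nonneg[of n] by (intro mult_left_mono) auto
      then show ?thesis using b[of y n] that h0[of n] by simp
    qed
    show "\<exists>d (h :: nat \<Rightarrow> complex). 0 < d \<and> summable h \<and> range h \<subseteq> \<real>\<^sub>\<ge>\<^sub>0 \<and>
      (\<forall>\<^sub>F n in sequentially. \<forall>y\<in>ball z d \<inter> {z. Re z > 1}. norm (f n y) \<le> norm (h n))"
    proof (intro exI[of _ d] exI[of _ "\<lambda>n. complex_of_real (h n)"] conjI)
      show "range (\<lambda>n. complex_of_real (h n)) \<subseteq> \<real>\<^sub>\<ge>\<^sub>0" using h0 by auto
      show "\<forall>\<^sub>F n in sequentially. \<forall>y\<in>ball z d \<inter> {z. Re z > 1}. norm (f n y) \<le> norm (complex_of_real (h n))"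
        using le by (intro always_eventually) blast
    qed (use d0 sh in auto)
  qed
  then show thesis using that by (metis mem_Collect_eq)
qed

definition local_log :: "nat \<Rightarrow> complex \<Rightarrow> complex" where
  "local_log n z = - Ln (1 - w n z)"

lemma local_log_le: assumes "Re z > 1" shows "norm (local_log n z) \<le> 2 * N n powr (- Re z)"
proof -
  have "norm (Ln (1 + - w n z)) \<le> 2 * norm (- w n z)" using norm_w_less[OF assms, of n] by (intro norm_Ln_le) simp
  then show ?thesis using norm_w[of n z] by (simp add: local_log_def)
qed

lemma local_log_deriv:
  assumes "Re z > 1"
  shows "(local_log n has_field_derivative - of_real (ln (N n)) * (w n z / (1 - w n z))) (at z)"
proof -
  have "1 - w n z \<notin> \<real>\<^sub>\<le>\<^sub>0" using one_minus_w(1)[OF assms, of n] by (auto simp: complex_nonpos_Reals_iff)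
  then show ?thesis unfolding local_log_def[abs_def]
    by (auto intro!: derivative_eq_intros w_deriv simp: field_simps)
qed

lemma local_log_deriv2:
  assumes "Re z > 1"
  shows "((\<lambda>z. - of_real (ln (N n)) * (w n z / (1 - w n z))) has_field_derivative
    of_real ((ln (N n))\<^sup>2) * koebe (w n z)) (at z)"
proof -
  have nz: "1 - w n z \<noteq> 0" by (rule one_minus_w(2)[OF assms])
  have "((\<lambda>z. w n z / (1 - w n z)) has_field_derivative - of_real (ln (N n)) * koebe (w n z)) (at z)"
  proof -
    have "((\<lambda>z. w n z / (1 - w n z)) has_field_derivative
       ((- of_real (ln (N n)) * w n z) * (1 - w n z) - w n z * (0 - - of_real (ln (N n)) * w n z)) / ((1 - w n z) * (1 - w n z))) (at z)"
      by (intro DERIV_divide DERIV_diff DERIV_const w_deriv nz)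
    moreover have "((- of_real (ln (N n)) * w n z) * (1 - w n z) - w n z * (0 - - of_real (ln (N n)) * w n z)) / ((1 - w n z) * (1 - w n z))
       = - of_real (ln (N n)) * koebe (w n z)"
      by (simp add: koebe_def power2_eq_square algebra_simps)
    ultimately show ?thesis by simp
  qed
  from DERIV_cmult[OF this, of "- of_real (ln (N n))"] show ?thesis by (simp add: power2_eq_square mult.assoc)
qed

text \<open>\<open>g\<close> is a logarithm of the Euler product. Its series is given as
  \<open>has_sum\<close>, since the product is defined as a limit over finite sets of primes,
  whereas for the second derivative an ordinary series in the fixed enumeration is enough.\<close>

lemma log_series:
  obtains g g' g'' where "\<And>z. Re z > 1 \<Longrightarrow> ((\<lambda>n. local_log n z) has_sum g z) UNIV"
    "\<And>z. Re z > 1 \<Longrightarrow> (g has_field_derivative g' z) (at z)"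
    "\<And>z. Re z > 1 \<Longrightarrow> (g' has_field_derivative g'' z) (at z)"
    "\<And>z. Re z > 1 \<Longrightarrow> (\<lambda>n. of_real ((ln (N n))\<^sup>2) * koebe (w n z)) sums g'' z"
proof -
  obtain g g' where g: "\<And>z. Re z > 1 \<Longrightarrow> (\<lambda>n. local_log n z) sums g z"
    "\<And>z. Re z > 1 \<Longrightarrow> (\<lambda>n. - of_real (ln (N n)) * (w n z / (1 - w n z))) sums g' z"
    "\<And>z. Re z > 1 \<Longrightarrow> (g has_field_derivative g' z) (at z)"
    using series_derivative[of local_log "\<lambda>n z. - of_real (ln (N n)) * (w n z / (1 - w n z))" 0, OF local_log_deriv]
      local_log_le by auto
  have b: "norm (- of_real (ln (N n)) * (w n z / (1 - w n z))) \<le> 2 * (ln (N n) ^ 1 * N n powr (- Re z))" if "Re z > 1" for n z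
  proof -
    have "norm (w n z) / norm (1 - w n z) \<le> N n powr (- Re z) / (1 / 2)"
      by (intro frac_le norm_w one_minus_w(3)[OF that]) auto
    from mult_left_mono[OF this ln_N_nonneg[of n]] show ?thesis using ln_N_nonneg[of n]
      by (simp add: norm_mult norm_divide)
  qed
  obtain k k' where k: "\<And>z. Re z > 1 \<Longrightarrow> (\<lambda>n. - of_real (ln (N n)) * (w n z / (1 - w n z))) sums k z"
    "\<And>z. Re z > 1 \<Longrightarrow> (\<lambda>n. of_real ((ln (N n))\<^sup>2) * koebe (w n z)) sums k' z"
    "\<And>z. Re z > 1 \<Longrightarrow> (k has_field_derivative k' z) (at z)"
    using series_derivative[OF local_log_deriv2 b] by blast
  \<comment> \<open>Both applications of \<open>series_derivative\<close> sum the same first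
    derivatives, so \<open>k\<close> is identified with \<open>g'\<close> by uniqueness of
    sums.\<close>
  have eq: "g' z = k z" if "Re z > 1" for z using sums_unique2[OF g(2)[OF that] k(1)[OF that]] .
  have "((\<lambda>n. local_log n z) has_sum g z) UNIV" if z: "Re z > 1" for z
  proof (rule norm_summable_imp_has_sum[OF _ g(1)[OF z]])
    show "summable (\<lambda>n. norm (local_log n z))"
      by (rule summable_comparison_test'[OF summable_mult[OF summable_N[OF z]], of 0 _ 2]) (use local_log_le[OF z] in simp)
  qed
  moreover have "(g' has_field_derivative k' z) (at z)" if "Re z > 1" for z
    by (rule has_field_derivative_transform_within_open[OF k(3)[OF that] open_halfspace_Re_gt[of 1]]) (use that eq in auto)
  ultimately show thesis using g(3) k(2) that by blast
qed

end

text \<open>On the half-plane the Euler product is \<open>exp (g z)\<close>, so its logarithmic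
  derivative is \<open>g'\<close>, with no choice of branch for a logarithm of the product
  itself.\<close>

theorem log_deriv_L'_sums:
  fixes \<psi> :: "'k :: field_char_0 set \<Rightarrow> complex" and p :: "nat \<Rightarrow> 'k set"
  assumes p: "bij_betw p UNIV prime_divisors" and ge2: "\<And>n. ideal_norm (p n) \<ge> 2"
    and sm: "\<And>\<sigma>. \<sigma> > 1 \<Longrightarrow> summable (\<lambda>n. real (ideal_norm (p n)) powr (- \<sigma>))"
    and \<psi>: "\<And>n. norm (\<psi> (p n)) \<le> 1" and s: "Re s > 1"
  shows "(\<lambda>n. of_real ((ln (real (ideal_norm (p n))))\<^sup>2) * koebe (\<psi> (p n) * of_nat (ideal_norm (p n)) powr (- s)))
    sums log_deriv_L' s \<psi>"
proof -
  define N where "N n = real (ideal_norm (p n))" for n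
  have N2: "N n \<ge> 2" for n using ge2[of n] by (simp add: N_def)
  interpret E: euler_product N "\<lambda>n. \<psi> (p n)"
    by standard (use N2 \<psi> sm in \<open>auto simp: N_def\<close>)
  obtain g g' g'' where g: "\<And>z. Re z > 1 \<Longrightarrow> ((\<lambda>n. E.local_log n z) has_sum g z) UNIV"
    "\<And>z. Re z > 1 \<Longrightarrow> (g has_field_derivative g' z) (at z)"
    "\<And>z. Re z > 1 \<Longrightarrow> (g' has_field_derivative g'' z) (at z)"
    "\<And>z. Re z > 1 \<Longrightarrow> (\<lambda>n. of_real ((ln (N n))\<^sup>2) * koebe (E.w n z)) sums g'' z"
    using E.log_series by blast
  have w: "E.w n z = \<psi> (p n) * of_nat (ideal_norm (p n)) powr (- z)" for n z
  proof -
    have "complex_of_real (N n) powr (- z) = exp (- (z * of_real (ln (N n))))"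
      using N2[of n] by (simp add: powr_def Ln_of_real)
    then show ?thesis by (simp add: E.w_def N_def)
  qed
  have L: "L_function z \<psi> = exp (g z)" if z: "Re z > 1" for z
  proof -
    let ?v = "\<lambda>P. - Ln (1 - \<psi> P * of_nat (ideal_norm P) powr (- z))"
    have "((\<lambda>n. ?v (p n)) has_sum g z) UNIV" using g(1)[OF z] by (simp add: E.local_log_def w)
    then have "(?v has_sum g z) prime_divisors" using has_sum_reindex_bij_betw[OF p, of ?v "g z"] by simp
    then have "((\<lambda>F. exp (sum ?v F)) \<longlongrightarrow> exp (g z)) (finite_subsets_at_top prime_divisors)"
      unfolding has_sum_def by (rule tendsto_exp)
    moreover have "\<forall>\<^sub>F F in finite_subsets_at_top prime_divisors.
      exp (sum ?v F) = (\<Prod>P\<in>F. inverse (1 - \<psi> P * of_nat (ideal_norm P) powr (- z)))"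
    proof (rule eventually_finite_subsets_at_top_weakI)
      fix F assume F: "finite F" "F \<subseteq> (prime_divisors :: 'k set set)"
      have "exp (?v P) = inverse (1 - \<psi> P * of_nat (ideal_norm P) powr (- z))" if "P \<in> F" for P
      proof -
        have "P \<in> range p" using that F(2) p by (auto simp: bij_betw_def)
        then obtain n where "P = p n" by blast
        then show ?thesis using E.one_minus_w(2)[OF z, of n] by (simp add: exp_minus w)
      qed
      then show "exp (sum ?v F) = (\<Prod>P\<in>F. inverse (1 - \<psi> P * of_nat (ideal_norm P) powr (- z)))"
        unfolding exp_sum[OF F(1)] by (rule prod.cong[OF refl])
    qed
    ultimately have "((\<lambda>F. \<Prod>P\<in>F. inverse (1 - \<psi> P * of_nat (ideal_norm P) powr (- z))) \<longlongrightarrow> exp (g z)) (finite_subsets_at_top prime_divisors)"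
      by (rule Lim_transform_eventually)
    then show ?thesis unfolding L_function_def by (intro tendsto_Lim) auto
  qed
  have S: "open {z. Re z > 1}" by (rule open_halfspace_Re_gt)
  have log: "log_deriv_L z \<psi> = g' z" if z: "Re z > 1" for z
  proof -
    have "((\<lambda>z. exp (g z)) has_field_derivative exp (g z) * g' z) (at z)" by (rule DERIV_fun_exp[OF g(2)[OF z]])
    then have "((\<lambda>z. L_function z \<psi>) has_field_derivative exp (g z) * g' z) (at z)"
      by (rule has_field_derivative_transform_within_open[OF _ S]) (use z L in auto)
    then have "deriv (\<lambda>z. L_function z \<psi>) z = exp (g z) * g' z" by (rule DERIV_imp_deriv)
    then show ?thesis unfolding log_deriv_L_def by (simp add: L[OF z])
  qed
  have "((\<lambda>z. log_deriv_L z \<psi>) has_field_derivative g'' s) (at s)"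
    by (rule has_field_derivative_transform_within_open[OF g(3)[OF s] S]) (use s log in auto)
  then have "log_deriv_L' s \<psi> = g'' s" unfolding log_deriv_L'_def by (rule DERIV_imp_deriv)
  then show ?thesis using g(4)[OF s] by (simp add: w N_def)
qed

section \<open>The conjugation and the integers of \<open>K\<close>\<close>

text \<open>Both kinds of fields at once: \<open>e = 0\<close>, \<open>D = 0\<close> gives \<open>\<rat>\<close>, and \<open>e = \<surd>(- D)\<close> an imaginary
  quadratic field, with complex conjugation \<open>cj\<close>.\<close>

locale quad_field =
  fixes cj :: "'k::field_char_0 \<Rightarrow> 'k" and e :: 'k and D :: nat
  assumes e2: "e * e = - of_nat D"
    and repr: "\<exists>a b. x = of_rat a + of_rat b * e"
    and cj_repr: "cj (of_rat a + of_rat b * e) = of_rat a - of_rat b * e"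

lemma ring_of_integers_simps [simp]:
  "carrier ring_of_integers = {x. algebraic_int x}"
  "x \<otimes>\<^bsub>ring_of_integers\<^esub> y = x * y"
  "x \<oplus>\<^bsub>ring_of_integers\<^esub> y = x + y"
  "\<zero>\<^bsub>ring_of_integers\<^esub> = 0"
  "\<one>\<^bsub>ring_of_integers\<^esub> = 1"
  by (simp_all add: ring_of_integers_def ring_of_type_algebra_def)

lemma ring_of_type_algebra_simps [simp]:
  "carrier ring_of_type_algebra = UNIV"
  "x \<otimes>\<^bsub>ring_of_type_algebra\<^esub> y = x * y"
  "x \<oplus>\<^bsub>ring_of_type_algebra\<^esub> y = x + y"
  "\<zero>\<^bsub>ring_of_type_algebra\<^esub> = 0"
  "\<one>\<^bsub>ring_of_type_algebra\<^esub> = 1"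
  by (simp_all add: ring_of_type_algebra_def)

section \<open>The rational and the imaginary quadratic case\<close>

lemma quad_field_rat:
  assumes "(\<rat> :: 'k :: field_char_0 set) = UNIV"
  shows "quad_field id (0::'k) 0"
proof
  fix x :: 'k
  have "x \<in> \<rat>" using assms by auto
  then obtain q where "x = of_rat q" by (auto elim: Rats_cases)
  then show "\<exists>a b. x = of_rat a + of_rat b * 0" by auto
qed auto

lemma quad_rep_unique:
  fixes z :: "'k :: field_char_0"
  assumes "z \<notin> \<rat>" "of_rat a + of_rat b * z = of_rat c + of_rat d * z"
  shows "a = c \<and> b = d"
proof -
  have "b = d"
  proof (rule ccontr)
    assume "b \<noteq> d"
    then have "of_rat (b - d) \<noteq> (0::'k)" by simp
    moreover have "of_rat (b - d) * z = of_rat (c - a)"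
      using assms(2) by (simp add: of_rat_diff algebra_simps)
    ultimately have "z = of_rat ((c - a) / (b - d))"
      by (simp add: of_rat_divide field_simps)
    then show False using assms(1) by auto
  qed
  then show ?thesis using assms(2) by simp
qed

lemma imaginary_quadratic_generator:
  assumes "imaginary_quadratic TYPE('k :: field_char_0)"
  obtains z :: "'k :: field_char_0" where "z \<notin> \<rat>" "\<And>x. \<exists>a b. x = of_rat a + of_rat b * z"
proof -
  interpret vs: vector_space "\<lambda>(q :: rat) (x :: 'k). of_rat q * x"
    by unfold_locales (auto simp: algebra_simps of_rat_add of_rat_mult)
  have d: "vs.dim UNIV = 2"
    using assms by (simp add: imaginary_quadratic_def)
  obtain B where B: "vs.independent B" "vs.span B = UNIV" "card B = 2"
    using vs.basis_exists[of UNIV] d by (metis UNIV_I subsetI subset_antisym)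
  obtain u v where uv: "B = {u, v}" "u \<noteq> v" using B(3) by (auto simp: card_2_iff)
  have u0: "u \<noteq> 0" using B(1) uv vs.dependent_zero by auto
  have sp: "\<exists>a b. x = of_rat a * u + of_rat b * v" for x
  proof -
    have "x \<in> vs.span {u, v}" using B uv by auto
    then obtain k where "x - of_rat k * u \<in> vs.span {v}" by (auto simp: vs.span_breakdown_eq)
    then obtain l where "x - of_rat k * u - of_rat l * v \<in> vs.span {}" by (auto simp: vs.span_breakdown_eq)
    then have "x = of_rat k * u + of_rat l * v" by (simp add: diff_diff_add)
    then show ?thesis by (intro exI)
  qed
  show ?thesis
  proof
    show "v / u \<notin> \<rat>"
    proof
      assume "v / u \<in> \<rat>"
      then obtain q where "v / u = of_rat q" by (auto elim: Rats_cases)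
      then have "v = of_rat q * u" using u0 by (simp add: field_simps)
      then have "v \<in> vs.span {u}" by (auto simp: vs.span_breakdown_eq intro: exI[of _ q])
      moreover have "vs.independent (insert v {u})" using B(1) uv by (simp add: insert_commute)
      ultimately show False using uv(2) by (simp add: vs.independent_insert)
    qed
    show "\<exists>a b. x = of_rat a + of_rat b * (v / u)" for x
    proof -
      obtain a b where "x * u = of_rat a * u + of_rat b * v" using sp by blast
      then have "x = of_rat a + of_rat b * (v / u)" using u0 by (simp add: field_simps)
      then show ?thesis by blast
    qed
  qed
qed

text \<open>Completing the square in the quadratic equation of a generator gives \<open>z\<close>
  with rational square \<open>r\<close>. If \<open>r\<close> were nonnegative, sending
  \<open>z\<close> to the real square root of \<open>r\<close> would define a real embedding; so
  \<open>r\<close> is negative, and clearing denominators turns \<open>z\<close> into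
  \<open>e\<close>.\<close>

lemma quad_field_imaginary_quadratic:
  assumes "imaginary_quadratic TYPE('k :: field_char_0)"
  shows "\<exists>cj (e::'k::field_char_0) D. quad_field cj e D"
proof -
  obtain y :: 'k where y: "y \<notin> \<rat>" "\<And>x. \<exists>a b. x = of_rat a + of_rat b * y"
    using imaginary_quadratic_generator[OF assms] by blast
  obtain p q where pq': "y * y = of_rat q + of_rat p * y" using y(2) by blast
  define h where "h = p / 2"
  have "of_rat p = (2 * of_rat h :: 'k)" by (simp add: h_def of_rat_divide)
  then have pq: "y * y = of_rat q + 2 * of_rat h * y" using pq' by simp
  define z where "z = y - of_rat h"
  define r where "r = q + h * h"
  have "z * z = y * y - 2 * of_rat h * y + of_rat (h * h)"
    by (simp add: z_def of_rat_mult algebra_simps)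
  then have zz: "z * z = of_rat r"
    unfolding pq by (simp add: r_def of_rat_add)
  have z: "z \<notin> \<rat>"
  proof
    assume "z \<in> \<rat>"
    then have "z + of_rat h \<in> \<rat>" by (intro Rats_add) auto
    then show False using y(1) by (simp add: z_def)
  qed
  have rz: "\<exists>a b. x = of_rat a + of_rat b * z" for x
  proof -
    obtain a b where "x = of_rat a + of_rat b * y" using y(2) by blast
    then have "x = of_rat (a + b * h) + of_rat b * z"
      by (simp add: z_def of_rat_add of_rat_mult algebra_simps)
    then show ?thesis by blast
  qed
  define A where "A x = (SOME t. \<exists>b. x = of_rat t + of_rat b * z)" for x
  define B where "B x = (SOME b. x = of_rat (A x) + of_rat b * z)" for x
  have AB: "x = of_rat (A x) + of_rat (B x) * z" for x
  proof -
    have "\<exists>b. x = of_rat (A x) + of_rat b * z"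
      unfolding A_def by (rule someI_ex) (rule rz)
    then show ?thesis unfolding B_def by (rule someI_ex)
  qed
  have ABu: "A (of_rat a + of_rat b * z) = a" "B (of_rat a + of_rat b * z) = b" for a b
    using quad_rep_unique[OF z AB[of "of_rat a + of_rat b * z", symmetric]] by auto
  have Aadd: "A (x + x') = A x + A x'" "B (x + x') = B x + B x'" for x x'
  proof -
    have *: "x + x' = of_rat (A x + A x') + of_rat (B x + B x') * z"
      using AB[of x] AB[of x'] by (simp add: of_rat_add algebra_simps)
    show "A (x + x') = A x + A x'" "B (x + x') = B x + B x'" 
      by (subst *, rule ABu)+
  qed
  have mul: "x * x' = of_rat (A x * A x' + r * (B x * B x')) + of_rat (A x * B x' + A x' * B x) * z" for x x'
  proof -
    have "x * x' = (of_rat (A x) + of_rat (B x) * z) * (of_rat (A x') + of_rat (B x') * z)"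
      using AB[of x] AB[of x'] by simp
    also have "\<dots> = of_rat (A x) * of_rat (A x') + of_rat (B x) * of_rat (B x') * (z * z) + (of_rat (A x) * of_rat (B x') + of_rat (A x') * of_rat (B x)) * z"
      by (simp add: algebra_simps)
    finally show ?thesis unfolding zz by (simp add: of_rat_add of_rat_mult algebra_simps)
  qed
  have Amul: "A (x * x') = A x * A x' + r * (B x * B x')" "B (x * x') = A x * B x' + A x' * B x" for x x'
    by (subst mul, rule ABu)+
  have "r < 0"
  proof (rule ccontr)
    assume "\<not> r < 0"
    then have r0: "real_of_rat r \<ge> 0" by simp
    define \<tau> where "\<tau> x = real_of_rat (A x) + real_of_rat (B x) * sqrt (real_of_rat r)" for x
    have "\<tau> (x * x') = \<tau> x * \<tau> x'" for x x'
    proof -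
      have "\<tau> x * \<tau> x' = real_of_rat (A x) * real_of_rat (A x') + real_of_rat (B x) * real_of_rat (B x') * (sqrt (real_of_rat r) * sqrt (real_of_rat r)) + (real_of_rat (A x) * real_of_rat (B x') + real_of_rat (A x') * real_of_rat (B x)) * sqrt (real_of_rat r)"
        by (simp add: \<tau>_def algebra_simps)
      then show ?thesis using r0 by (simp add: \<tau>_def Amul of_rat_add of_rat_mult algebra_simps)
    qed
    moreover have "\<tau> (x + x') = \<tau> x + \<tau> x'" for x x'
      by (simp add: \<tau>_def Aadd of_rat_add algebra_simps)
    moreover have "\<tau> 1 = 1" using ABu[of 1 0] by (simp add: \<tau>_def)
    ultimately have "\<tau> \<in> real_embeddings"
      by (simp add: real_embeddings_def ring_hom_def)
    then show False using assms by (auto simp: imaginary_quadratic_def)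
  qed
  obtain m n where mn: "r = of_int m / of_int n" "n > 0"
    by (cases r) (auto simp: Fract_of_int_quotient)
  have m: "m < 0" using \<open>r < 0\<close> mn by (simp add: divide_less_0_iff)
  \<comment> \<open>With \<open>r = m / n\<close> the square becomes
    \<open>e * e = n\<^sup>2 * r = m * n\<close>, a negative integer.\<close>
  define e where "e = of_int n * z"
  define D where "D = nat (- m * n)"
  define cj where "cj x = of_rat (A x) - of_rat (B x) * z" for x
  have "quad_field cj e D"
  proof
    have "e * e = of_int n * of_int n * (z * z)" by (simp add: e_def algebra_simps)
    also have "\<dots> = of_rat (of_int n * of_int n * r)" by (simp add: zz of_rat_mult)
    also have "of_int n * of_int n * r = of_int (m * n)" using mn by simp
    also have "m * n = - int D" using m mn(2) by (simp add: D_def mult_nonpos_nonneg)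
    finally show "e * e = - of_nat D" by (simp add: of_rat_minus)
    fix x :: 'k and a b :: rat
    have "x = of_rat (A x) + of_rat (B x / of_int n) * e"
      using AB[of x] mn(2) by (simp add: e_def of_rat_divide)
    then show "\<exists>a b. x = of_rat a + of_rat b * e" by blast
    have "of_rat a + of_rat b * e = of_rat a + of_rat (b * of_int n) * z"
      by (simp add: e_def of_rat_mult)
    then show "cj (of_rat a + of_rat b * e) = of_rat a - of_rat b * e"
      by (simp only: cj_def ABu) (simp add: e_def of_rat_mult)
  qed
  then show ?thesis by blast
qed

context quad_field
begin

section \<open>Conjugation, norm and trace\<close>

lemma cj_of_rat [simp]: "cj (of_rat a) = of_rat a"
  using cj_repr[of a 0] by simp

lemma cj_of_nat [simp]: "cj (of_nat a) = of_nat a"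
  using cj_of_rat[of "of_nat a"] by simp

lemma cj_0 [simp]: "cj 0 = 0" and cj_1 [simp]: "cj 1 = 1"
  using cj_of_rat[of 0] cj_of_rat[of 1] by auto

lemma cj_add: "cj (x + y) = cj x + cj y"
proof -
  obtain a b c d where x: "x = of_rat a + of_rat b * e" and y: "y = of_rat c + of_rat d * e"
    using repr by meson
  have "x + y = of_rat (a + c) + of_rat (b + d) * e"
    by (simp add: x y of_rat_add algebra_simps)
  then show ?thesis by (simp only: cj_repr x y) (simp add: of_rat_add algebra_simps)
qed

lemma cj_mult: "cj (x * y) = cj x * cj y"
proof -
  obtain a b c d where x: "x = of_rat a + of_rat b * e" and y: "y = of_rat c + of_rat d * e"
    using repr by meson
  have "x * y = of_rat a * of_rat c + of_rat b * of_rat d * (e * e) + (of_rat a * of_rat d + of_rat b * of_rat c) * e"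
    by (simp add: x y algebra_simps)
  then have xy: "x * y = of_rat (a * c - b * d * of_nat D) + of_rat (a * d + b * c) * e"
    by (simp add: e2 of_rat_add of_rat_mult of_rat_diff)
  have "cj x * cj y = of_rat a * of_rat c + of_rat b * of_rat d * (e * e) - (of_rat a * of_rat d + of_rat b * of_rat c) * e"
    by (simp only: cj_repr x y) (simp add: algebra_simps)
  then show ?thesis unfolding xy cj_repr
    by (simp add: e2 of_rat_add of_rat_mult of_rat_diff)
qed

lemma cj_cj [simp]: "cj (cj x) = x"
proof -
  obtain a b where x: "x = of_rat a + of_rat b * e" using repr by meson
  have "cj x = of_rat a + of_rat (- b) * e" by (simp add: x cj_repr of_rat_minus)
  then show ?thesis by (simp only: cj_repr x) (simp add: of_rat_minus)
qed

lemma cj_e: "cj e = - e"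
  using cj_repr[of 0 1] by simp

lemma cj_power: "cj (x ^ n) = cj x ^ n"
  by (induction n) (auto simp: cj_mult)

lemma cj_eq_0_iff [simp]: "cj x = 0 \<longleftrightarrow> x = 0"
  by (metis cj_0 cj_cj)

definition nrm :: "'k \<Rightarrow> rat" where "nrm x = (THE q. of_rat q = x * cj x)"
definition trc :: "'k \<Rightarrow> rat" where "trc x = (THE q. of_rat q = x + cj x)"

lemma nrm_repr: "nrm (of_rat a + of_rat b * e) = a\<^sup>2 + of_nat D * b\<^sup>2"
  and of_rat_nrm: "of_rat (nrm x) = x * cj x"
proof -
  have *: "of_rat (a\<^sup>2 + of_nat D * b\<^sup>2) = (of_rat a + of_rat b * e) * cj (of_rat a + of_rat b * e)" for a b
  proof -
    have "(of_rat a + of_rat b * e) * cj (of_rat a + of_rat b * e) = of_rat a ^ 2 - of_rat b ^ 2 * (e * e)"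
      unfolding cj_repr by (simp add: algebra_simps power2_eq_square)
    then show ?thesis by (simp add: e2 of_rat_add of_rat_mult of_rat_power)
  qed
  have eq: "nrm x = q" if "of_rat q = x * cj x" for x q
    unfolding nrm_def
  proof (rule the_equality)
    show "q' = q" if "of_rat q' = x * cj x" for q' using that \<open>of_rat q = _\<close> by (metis of_rat_eq_iff)
  qed (use that in auto)
  show "nrm (of_rat a + of_rat b * e) = a\<^sup>2 + of_nat D * b\<^sup>2" by (rule eq[OF *])
  obtain a b where "x = of_rat a + of_rat b * e" using repr by meson
  then show "of_rat (nrm x) = x * cj x" using eq * by metis
qed

lemma of_rat_trc: "of_rat (trc x) = x + cj x"
proof -
  obtain a b where x: "x = of_rat a + of_rat b * e" using repr by meson
  have "of_rat (2 * a) = x + cj x" unfolding x cj_repr by (simp add: of_rat_mult)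
  then have "\<exists>!q. of_rat q = x + cj x" by (metis of_rat_eq_iff)
  then show ?thesis unfolding trc_def by (rule theI')
qed

lemma nrm_mult: "nrm (x * y) = nrm x * nrm y"
proof -
  have "of_rat (nrm (x * y)) = (of_rat (nrm x * nrm y) :: 'k)"
    by (simp add: of_rat_nrm of_rat_mult cj_mult algebra_simps)
  then show ?thesis by simp
qed

lemma nrm_nonneg: "nrm x \<ge> 0"
proof -
  obtain a b where x: "x = of_rat a + of_rat b * e" using repr by meson
  show ?thesis unfolding x nrm_repr by simp
qed

lemma nrm_eq_0_iff [simp]: "nrm x = 0 \<longleftrightarrow> x = 0"
proof -
  have "nrm x = 0 \<longleftrightarrow> (of_rat (nrm x) :: 'k) = 0" by simp
  then show ?thesis by (simp add: of_rat_nrm)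
qed

lemma nrm_pos: "x \<noteq> 0 \<Longrightarrow> nrm x > 0"
  using nrm_nonneg[of x] by (metis nrm_eq_0_iff order_le_less)

lemma nrm_of_rat: "nrm (of_rat a) = a\<^sup>2"
  using nrm_repr[of a 0] by simp

lemma nrm_1 [simp]: "nrm 1 = 1" using nrm_of_rat[of 1] by simp

text \<open>The order generated by \<open>e\<close>, in general smaller than the ring of integers.
  It has explicit integer coordinates and serves as a reference lattice.\<close>

definition lat :: "'k set" where "lat = {of_int a + of_int b * e | a b. True}"

lemma lat_add: "x \<in> lat \<Longrightarrow> y \<in> lat \<Longrightarrow> x + y \<in> lat"
  unfolding lat_def
proof clarify
  fix a b c d :: int
  have "of_int a + of_int b * e + (of_int c + of_int d * e) = of_int (a + c) + of_int (b + d) * e"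
    by (simp add: algebra_simps)
  then show "\<exists>a' b'. of_int a + of_int b * e + (of_int c + of_int d * e) = of_int a' + of_int b' * e \<and> True" by blast
qed

lemma lat_mult: "x \<in> lat \<Longrightarrow> y \<in> lat \<Longrightarrow> x * y \<in> lat"
  unfolding lat_def
proof clarify
  fix a b c d :: int
  have "(of_int a + of_int b * e) * (of_int c + of_int d * e) = of_int a * of_int c + of_int b * of_int d * (e * e) + (of_int a * of_int d + of_int b * of_int c) * e"
    by (simp add: algebra_simps)
  also have "\<dots> = of_int (a * c - b * d * int D) + of_int (a * d + b * c) * e"
    unfolding e2 by simp
  finally show "\<exists>a' b'. (of_int a + of_int b * e) * (of_int c + of_int d * e) = of_int a' + of_int b' * e \<and> True" by blast
qed

lemma lat_int [simp]: "of_int a \<in> lat"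
proof -
  have "of_int a = of_int a + of_int 0 * e" by simp
  then show ?thesis unfolding lat_def by blast
qed

lemma lat_nat [simp]: "of_nat a \<in> lat"
  using lat_int[of "int a"] by simp

lemma lat_0 [simp]: "0 \<in> lat" using lat_int[of 0] by simp

lemma lat_sum: "(\<And>i. i \<in> A \<Longrightarrow> f i \<in> lat) \<Longrightarrow> sum f A \<in> lat"
  by (induction A rule: infinite_finite_induct) (auto intro: lat_add)

lemma lat_cj: "x \<in> lat \<Longrightarrow> cj x \<in> lat"
  unfolding lat_def
proof clarify
  fix a b :: int
  have "cj (of_int a + of_int b * e) = of_int a + of_int (- b) * e"
    using cj_repr[of "of_int a" "of_int b"] by simp
  then show "\<exists>a' b'. cj (of_int a + of_int b * e) = of_int a' + of_int b' * e \<and> True" by blast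
qed

lemma e_notin_Rats: "e \<noteq> 0 \<Longrightarrow> e \<notin> \<rat>"
proof
  assume "e \<noteq> 0" "e \<in> \<rat>"
  then obtain q where "e = of_rat q" by (auto elim: Rats_cases)
  then have "cj e = e" by simp
  then show False using cj_e \<open>e \<noteq> 0\<close> by (metis add.inverse_neutral equation_minus_iff eq_neg_iff_add_eq_0 mult_2 mult_eq_0_iff zero_neq_numeral)
qed

lemma lat_Rats: "of_rat q \<in> lat \<Longrightarrow> q \<in> \<int>"
proof -
  assume "of_rat q \<in> lat"
  then obtain a b where ab: "of_rat q = of_int a + of_int b * e" by (auto simp: lat_def)
  show "q \<in> \<int>"
  proof (cases "e = 0")
    case True
    then have "of_rat q = (of_rat (of_int a) :: 'k)" using ab by simp
    then have "q = of_int a" by (metis of_rat_eq_iff)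
    then show ?thesis by auto
  next
    case False
    have "of_rat q + of_rat 0 * e = of_rat (of_int a) + of_rat (of_int b) * e" using ab by simp
    from quad_rep_unique[OF e_notin_Rats[OF False] this] show ?thesis by auto
  qed
qed

lemma denom_rat: "\<exists>d>0. \<exists>a. of_nat d * q = (of_int a :: rat)"
proof (cases q)
  case (Fract a b)
  then show ?thesis
    by (intro exI[of _ "nat b"] conjI exI[of _ a]) (auto simp: Fract_of_int_quotient)
qed

lemma denom_lat: "\<exists>d>0. of_nat d * x \<in> lat"
proof -
  obtain a b where x: "x = of_rat a + of_rat b * e" using repr by meson
  obtain d a' where d: "d > 0" "of_nat d * a = of_int a'" using denom_rat by blast
  obtain f b' where f: "f > 0" "of_nat f * b = of_int b'" using denom_rat by blast
  have "of_nat (d * f) * x = of_rat (of_nat f * (of_nat d * a)) + of_rat (of_nat d * (of_nat f * b)) * e"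
    by (simp add: x of_rat_mult algebra_simps)
  also have "\<dots> = of_int (int f * a') + of_int (int d * b') * e"
    unfolding d f by (simp add: of_rat_mult)
  finally have "of_nat (d * f) * x \<in> lat" unfolding lat_def by blast
  then show ?thesis using d f by (intro exI[of _ "d * f"]) auto
qed

text \<open>All powers of \<open>x\<close> have a common denominator with respect to
  \<open>lat\<close>. This is equivalent to integrality, and common denominators of two elements
  multiply, so closure under sums and products follows without resultants or finitely generated
  modules.\<close>

definition almost_int :: "'k \<Rightarrow> bool" where
  "almost_int x \<longleftrightarrow> (\<exists>d::nat. d > 0 \<and> (\<forall>i. of_nat d * x ^ i \<in> lat))"

lemma almost_int_mult:
  assumes "almost_int x" "almost_int y" shows "almost_int (x * y)"
proof -
  obtain d where d: "d > 0" "\<And>i. of_nat d * x ^ i \<in> lat" using assms(1) by (auto simp: almost_int_def)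
  obtain f where f: "f > 0" "\<And>i. of_nat f * y ^ i \<in> lat" using assms(2) by (auto simp: almost_int_def)
  have "of_nat (d * f) * (x * y) ^ i = (of_nat d * x ^ i) * (of_nat f * y ^ i)" for i
    by (simp add: power_mult_distrib algebra_simps)
  then have "of_nat (d * f) * (x * y) ^ i \<in> lat" for i using lat_mult[OF d(2)[of i] f(2)[of i]] by metis
  then show ?thesis unfolding almost_int_def using d f by (intro exI[of _ "d * f"]) auto
qed

lemma almost_int_add:
  assumes "almost_int x" "almost_int y" shows "almost_int (x + y)"
proof -
  obtain d where d: "d > 0" "\<And>i. of_nat d * x ^ i \<in> lat" using assms(1) by (auto simp: almost_int_def)
  obtain f where f: "f > 0" "\<And>i. of_nat f * y ^ i \<in> lat" using assms(2) by (auto simp: almost_int_def)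
  have "of_nat (d * f) * (x + y) ^ n = (\<Sum>i\<le>n. of_nat (n choose i) * ((of_nat d * x ^ i) * (of_nat f * y ^ (n - i))))" for n
    unfolding binomial_ring sum_distrib_left by (intro sum.cong) (auto simp: algebra_simps)
  then have "of_nat (d * f) * (x + y) ^ i \<in> lat" for i
    by (auto intro!: lat_sum lat_mult[OF lat_nat] lat_mult[OF d(2) f(2)])
  then show ?thesis unfolding almost_int_def using d f by (intro exI[of _ "d * f"]) auto
qed

lemma almost_int_cj: "almost_int x \<Longrightarrow> almost_int (cj x)"
proof -
  assume "almost_int x"
  then obtain d where d: "d > 0" "\<And>i. of_nat d * x ^ i \<in> lat" by (auto simp: almost_int_def)
  have "of_nat d * cj x ^ i = cj (of_nat d * x ^ i)" for i by (simp add: cj_mult cj_power)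
  then show ?thesis unfolding almost_int_def using d lat_cj by (intro exI[of _ d]) auto
qed

text \<open>In lowest terms every power of the denominator divides the fixed number
  \<open>d\<close>, which forces the denominator to be \<open>1\<close>.\<close>

lemma almost_int_rat:
  assumes "almost_int (of_rat q)" shows "q \<in> \<int>"
proof -
  obtain d where d: "d > 0" "\<And>i. of_nat d * of_rat q ^ i \<in> lat" using assms(1) by (auto simp: almost_int_def)
  have di: "of_nat d * q ^ i \<in> \<int>" for i
    using d(2)[of i] by (intro lat_Rats) (simp add: of_rat_mult of_rat_power)
  obtain a b where ab: "q = of_int a / of_int b" "b > 0" "coprime a b"
    by (cases q) (auto simp: Fract_of_int_quotient)
  have "b ^ i dvd int d" for i
  proof -
    obtain c where c: "of_nat d * q ^ i = of_int c" using di[of i] by (auto elim: Ints_cases)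
    have "(of_int (int d * a ^ i) :: rat) = of_int (c * b ^ i)"
      using c ab(2) by (simp add: ab(1) power_divide field_simps)
    then have "int d * a ^ i = c * b ^ i" by (simp only: of_int_eq_iff)
    then have "b ^ i dvd int d * a ^ i" by simp
    moreover have "coprime (b ^ i) (a ^ i)" using ab(3) by (simp add: coprime_commute)
    ultimately show ?thesis by (simp add: coprime_dvd_mult_left_iff)
  qed
  \<comment> \<open>The exponent \<open>d\<close> itself gives the contradiction, because
    \<open>2 ^ d\<close> exceeds \<open>d\<close>.\<close>
  then have "b ^ d \<le> int d" using d(1) by (intro zdvd_imp_le) auto
  moreover have "int d < 2 ^ d" by (metis of_nat_less_two_power)
  moreover have "2 ^ d \<le> b ^ d" if "b \<noteq> 1" using ab(2) that by (intro power_mono) auto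
  ultimately have "b = 1" by fastforce
  then show ?thesis using ab by simp
qed

lemma denom_lat_finite: "\<exists>d>0. \<forall>i<n. of_nat d * (f i :: 'k) \<in> lat" for n :: nat
proof (induction n)
  case (Suc n)
  then obtain d where d: "d > 0" "\<And>i. i < n \<Longrightarrow> of_nat d * f i \<in> lat" by auto
  obtain d' where d': "d' > 0" "of_nat d' * f n \<in> lat" using denom_lat by blast
  have "of_nat (d * d') * f i \<in> lat" if "i < Suc n" for i
  proof (cases "i = n")
    case True
    then show ?thesis using lat_mult[OF lat_nat[of d] d'(2)] by (simp add: algebra_simps)
  next
    case False
    then show ?thesis using lat_mult[OF lat_nat[of d'] d(2)[of i]] that by (simp add: algebra_simps)
  qed
  then show ?case using d d' by (intro exI[of _ "d * d'"]) auto
qed auto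

text \<open>A monic equation of degree \<open>n\<close> expresses every higher power through the
  first \<open>n\<close> powers with integer coefficients, so a common denominator of these works
  for all.\<close>

lemma algebraic_int_imp_almost_int:
  assumes "algebraic_int x" shows "almost_int x"
proof -
  obtain p where p: "poly (map_poly of_int p) x = 0" "Polynomial.lead_coeff p = (1::int)"
    using assms by (auto simp: algebraic_int_altdef_ipoly)
  define n where "n = Polynomial.degree p"
  have deg: "Polynomial.degree (map_poly of_int p :: 'k poly) = n" by (simp add: n_def degree_map_poly[of of_int])
  have xn: "x ^ n = (\<Sum>i<n. of_int (- Polynomial.coeff p i) * x ^ i)"
  proof -
    have "0 = (\<Sum>i\<le>n. of_int (Polynomial.coeff p i) * x ^ i)"
      using p(1) by (simp add: poly_altdef deg coeff_map_poly)
    also have "\<dots> = x ^ n + (\<Sum>i<n. of_int (Polynomial.coeff p i) * x ^ i)"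
      using p(2) by (simp add: lessThan_Suc_atMost[symmetric] n_def)
    finally show ?thesis by (simp add: sum_negf eq_neg_iff_add_eq_0)
  qed
  obtain d where d: "d > 0" "\<And>i. i < n \<Longrightarrow> of_nat d * x ^ i \<in> lat"
    using denom_lat_finite[of n "\<lambda>i. x ^ i"] by auto
  have "of_nat d * x ^ i \<in> lat" for i
  proof (induction i rule: less_induct)
    case (less i)
    show ?case
    proof (cases "i < n")
      case False
      have "x ^ i = x ^ n * x ^ (i - n)" using False by (simp add: power_add[symmetric])
      then have "of_nat d * x ^ i = (\<Sum>j<n. of_int (- Polynomial.coeff p j) * (of_nat d * x ^ (j + (i - n))))"
        by (simp add: xn sum_distrib_left sum_distrib_right power_add algebra_simps)
      also have "\<dots> \<in> lat" using False by (intro lat_sum lat_mult[OF lat_int] less) auto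
      finally show ?thesis .
    qed (use d in auto)
  qed
  then show ?thesis using d(1) by (auto simp: almost_int_def)
qed

text \<open>Trace and norm are rational and almost integral, hence integers, and \<open>x\<close> is
  a root of the monic quadratic polynomial formed from them.\<close>

lemma almost_int_imp_algebraic_int:
  assumes "almost_int x" shows "algebraic_int x" "trc x \<in> \<int>" "nrm x \<in> \<int>"
proof -
  show t: "trc x \<in> \<int>" using assms
    by (intro almost_int_rat) (auto simp: of_rat_trc intro!: almost_int_add almost_int_cj)
  show n: "nrm x \<in> \<int>" using assms
    by (intro almost_int_rat) (auto simp: of_rat_nrm intro!: almost_int_mult almost_int_cj)
  have [simp]: "(of_rat (trc x) :: 'k) \<in> \<int>" "(of_rat (nrm x) :: 'k) \<in> \<int>"
    using t n by (auto elim!: Ints_cases)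
  show "algebraic_int x"
  proof (rule algebraic_int.intros)
    show "Polynomial.lead_coeff [:of_rat (nrm x), - of_rat (trc x), 1:] = (1::'k)" by simp
    show "\<forall>i. Polynomial.coeff [:of_rat (nrm x), - of_rat (trc x), 1:] i \<in> (\<int> :: 'k set)"
      by (auto simp: coeff_pCons split: nat.split)
    show "poly [:of_rat (nrm x), - of_rat (trc x), 1:] x = 0"
      by (simp add: of_rat_nrm of_rat_trc algebra_simps)
  qed
qed

lemma algebraic_int_iff_almost_int: "algebraic_int x \<longleftrightarrow> almost_int x"
  using algebraic_int_imp_almost_int almost_int_imp_algebraic_int by blast

lemma algebraic_int_add: "algebraic_int x \<Longrightarrow> algebraic_int y \<Longrightarrow> algebraic_int (x + y :: 'k)"
  and algebraic_int_mult: "algebraic_int x \<Longrightarrow> algebraic_int y \<Longrightarrow> algebraic_int (x * y :: 'k)"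
  and algebraic_int_cj: "algebraic_int x \<Longrightarrow> algebraic_int (cj x)"
  and trc_Ints: "algebraic_int x \<Longrightarrow> trc x \<in> \<int>"
  and nrm_Ints: "algebraic_int x \<Longrightarrow> nrm x \<in> \<int>"
  and of_rat_algebraic_int: "algebraic_int (of_rat q :: 'k) \<Longrightarrow> q \<in> \<int>"
  by (auto simp: algebraic_int_iff_almost_int intro: almost_int_add almost_int_mult almost_int_cj
      almost_int_imp_algebraic_int almost_int_rat)

lemma algebraic_int_quadratic:
  assumes "trc x \<in> \<int>" "nrm x \<in> \<int>" shows "algebraic_int x"
proof -
  have [simp]: "(of_rat (trc x) :: 'k) \<in> \<int>" "(of_rat (nrm x) :: 'k) \<in> \<int>"
    using assms by (auto elim!: Ints_cases)
  show "algebraic_int x"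
  proof (rule algebraic_int.intros)
    show "Polynomial.lead_coeff [:of_rat (nrm x), - of_rat (trc x), 1:] = (1::'k)" by simp
    show "\<forall>i. Polynomial.coeff [:of_rat (nrm x), - of_rat (trc x), 1:] i \<in> (\<int> :: 'k set)"
      by (auto simp: coeff_pCons split: nat.split)
    show "poly [:of_rat (nrm x), - of_rat (trc x), 1:] x = 0"
      by (simp add: of_rat_nrm of_rat_trc algebra_simps)
  qed
qed

lemma algebraic_int_diff: "algebraic_int x \<Longrightarrow> algebraic_int y \<Longrightarrow> algebraic_int (x - y :: 'k)"
  using algebraic_int_add[of x "- y"] by simp

lemma algebraic_int_e: "algebraic_int e"
proof (rule algebraic_int_root[of "- of_nat D" "Polynomial.monom 1 2"])
  show "poly (Polynomial.monom 1 2) e = - of_nat D" by (simp add: poly_monom e2 power2_eq_square)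
qed (auto simp: degree_monom_eq)

lemma algebraic_int_lat: "x \<in> lat \<Longrightarrow> algebraic_int x"
  unfolding lat_def by (auto intro!: algebraic_int_add algebraic_int_mult algebraic_int_e)

lemma denom_int: "\<exists>d>0. algebraic_int (of_nat d * x :: 'k)"
  using denom_lat[of x] algebraic_int_lat by blast

text \<open>For \<open>x\<close> with coordinates \<open>a\<close> and \<open>b\<close> the trace
  shows that \<open>2 * a\<close> is an integer. Then
  \<open>(2 * D * b)\<^sup>2 = 4 * D * nrm x - D * (2 * a)\<^sup>2\<close> is an integer with a
  rational root, so \<open>2 * D\<close> clears both denominators.\<close>

lemma int_lat_index: "\<exists>k>0. \<forall>x. algebraic_int x \<longrightarrow> of_nat k * x \<in> lat"
proof (cases "e = 0")
  case True
  have "x \<in> lat" if "algebraic_int x" for x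
  proof -
    obtain a where a: "x = of_rat a" using repr[of x] True by auto
    then have "a \<in> \<int>" using that of_rat_algebraic_int by simp
    then show ?thesis using a by (auto elim!: Ints_cases)
  qed
  then show ?thesis by (intro exI[of _ 1]) auto
next
  case False
  then have D: "D > 0" using e2 by (auto intro: ccontr)
  show ?thesis
  proof (intro exI[of _ "2 * D"] conjI allI impI)
    fix x :: 'k assume x: "algebraic_int x"
    obtain a b where ab: "x = of_rat a + of_rat b * e" using repr by meson
    have "of_rat (2 * a) = x + cj x" unfolding ab cj_repr by (simp add: of_rat_mult)
    then have "trc x = 2 * a" by (metis of_rat_trc of_rat_eq_iff)
    then have "2 * a \<in> \<int>" using trc_Ints[OF x] by simp
    have "(of_nat D * 4) * nrm x - of_nat D * (2 * a)\<^sup>2 \<in> \<int>"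
      by (rule Ints_diff Ints_mult Ints_power nrm_Ints[OF x] \<open>2 * a \<in> \<int>\<close> Ints_of_nat Ints_numeral)+
    also have "(of_nat D * 4) * nrm x - of_nat D * (2 * a)\<^sup>2 = (2 * of_nat D * b)\<^sup>2"
      unfolding ab nrm_repr by (simp add: algebra_simps power2_eq_square)
    finally have sq: "(2 * of_nat D * b)\<^sup>2 \<in> \<int>" .
    have b: "2 * of_nat D * b \<in> \<int>"
    proof -
      have "algebraic_int (2 * of_nat D * b)"
      proof (rule algebraic_int_root[of "(2 * of_nat D * b)\<^sup>2" "Polynomial.monom 1 2"])
        show "poly (Polynomial.monom 1 2) (2 * of_nat D * b) = (2 * of_nat D * b)\<^sup>2" by (simp add: poly_monom)
      qed (auto simp: degree_monom_eq sq int_imp_algebraic_int)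
      moreover have "2 * of_nat D * b \<in> \<rat>" by (metis Rats_of_rat of_rat_eq_id id_apply)
      ultimately show ?thesis by (rule rational_algebraic_int_is_int)
    qed
    obtain m where m: "2 * a = of_int m" using \<open>2 * a \<in> \<int>\<close> by (auto elim: Ints_cases)
    obtain n where n: "2 * of_nat D * b = of_int n" using b by (auto elim: Ints_cases)
    have "of_nat (2 * D) * x = of_rat (of_nat D * (2 * a)) + of_rat (2 * of_nat D * b) * e"
      by (simp add: ab of_rat_mult algebra_simps)
    also have "\<dots> = of_int (int D * m) + of_int n * e" unfolding m n by (simp add: of_rat_mult)
    finally show "of_nat (2 * D) * x \<in> lat" unfolding lat_def by blast
  qed (use D in simp)
qed

end

section \<open>Ideals\<close>

context quad_field
begin

abbreviation OK :: "'k set" where "OK \<equiv> {x. algebraic_int x}"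

lemma cring_ring_of_integers: "cring (ring_of_integers :: 'k ring)"
proof -
  have "\<exists>y. algebraic_int y \<and> y + x = 0" if "algebraic_int x" for x :: 'k
    using that by (intro exI[of _ "- x"]) auto
  then show ?thesis
    by unfold_locales (auto simp: Units_def algebra_simps intro: algebraic_int_add algebraic_int_mult)
qed

lemma a_inv_ring_of_integers:
  assumes "algebraic_int x" shows "\<ominus>\<^bsub>ring_of_integers\<^esub> x = - (x::'k)"
proof -
  interpret cring "ring_of_integers :: 'k ring" by (rule cring_ring_of_integers)
  show ?thesis using assms by (intro minus_equality) auto
qed

text \<open>Submodules of the field over its ring of integers: the common core of integral and
  fractional ideals, so that one calculus of products covers both.\<close>

definition submod :: "'k set \<Rightarrow> bool" where
  "submod J \<longleftrightarrow> 0 \<in> J \<and> (\<forall>x\<in>J. \<forall>y\<in>J. x + y \<in> J) \<and> (\<forall>a\<in>OK. \<forall>x\<in>J. a * x \<in> J)"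

lemma submodD:
  assumes "submod J"
  shows "0 \<in> J" "x \<in> J \<Longrightarrow> y \<in> J \<Longrightarrow> x + y \<in> J" "algebraic_int a \<Longrightarrow> x \<in> J \<Longrightarrow> a * x \<in> J"
    "x \<in> J \<Longrightarrow> - x \<in> J" "x \<in> J \<Longrightarrow> y \<in> J \<Longrightarrow> x - y \<in> J" "algebraic_int a \<Longrightarrow> x \<in> J \<Longrightarrow> x * a \<in> J"
proof -
  show 1: "0 \<in> J" "x \<in> J \<Longrightarrow> y \<in> J \<Longrightarrow> x + y \<in> J" "algebraic_int a \<Longrightarrow> x \<in> J \<Longrightarrow> a * x \<in> J" for x y a
    using assms by (auto simp: submod_def)
  show 2: "x \<in> J \<Longrightarrow> - x \<in> J" for x using 1(3)[of "-1" x] by simp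
  show "x \<in> J \<Longrightarrow> y \<in> J \<Longrightarrow> x - y \<in> J" using 1(2)[of x "- y"] 2[of y] by simp
  show "algebraic_int a \<Longrightarrow> x \<in> J \<Longrightarrow> x * a \<in> J" using 1(3)[of a x] by (simp add: mult.commute)
qed

lemma ideal_iff: "ideal I (ring_of_integers :: 'k ring) \<longleftrightarrow> submod I \<and> I \<subseteq> OK"
proof
  assume I: "ideal I ring_of_integers"
  interpret ideal I "ring_of_integers :: 'k ring" by (rule I)
  show "submod I \<and> I \<subseteq> OK"
  proof
    show "I \<subseteq> OK" using a_subset by simp
    have "0 \<in> I" using additive_subgroup.zero_closed[OF is_additive_subgroup] by simp
    moreover have "x + y \<in> I" if "x \<in> I" "y \<in> I" for x y
      using additive_subgroup.a_closed[OF is_additive_subgroup that] by simp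
    moreover have "a * x \<in> I" if "algebraic_int a" "x \<in> I" for a x
      using I_l_closed[of x a] that by simp
    ultimately show "submod I" by (auto simp: submod_def)
  qed
next
  assume I: "submod I \<and> I \<subseteq> OK"
  interpret cring "ring_of_integers :: 'k ring" by (rule cring_ring_of_integers)
  have "subgroup I (add_monoid ring_of_integers)"
  proof (rule add.subgroupI)
    show "\<ominus>\<^bsub>ring_of_integers\<^esub> a \<in> I" if "a \<in> I" for a
      using I that submodD(4)[of I a] a_inv_ring_of_integers[of a] by auto
    show "I \<noteq> {}" using I submodD(1) by blast
  qed (use I submodD(2) in auto)
  then show "ideal I (ring_of_integers :: 'k ring)"
    using I by (intro idealI ring_axioms) (auto intro: submodD)
qed

lemma additive_subgroup_iff:
  "additive_subgroup J (ring_of_type_algebra :: 'k ring) \<longleftrightarrow>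
     0 \<in> J \<and> (\<forall>x\<in>J. \<forall>y\<in>J. x + y \<in> J) \<and> (\<forall>x\<in>J. - x \<in> J)"
proof -
  interpret R: cring "ring_of_type_algebra :: 'k ring" by (rule cring_from_type_algebra)
  have neg: "\<ominus>\<^bsub>ring_of_type_algebra\<^esub> x = - x" for x :: 'k
    by (intro R.minus_equality) auto
  then have inv: "inv\<^bsub>add_monoid ring_of_type_algebra\<^esub> x = - x" for x :: 'k
    by (simp add: a_inv_def)
  show ?thesis
  proof
    assume "additive_subgroup J (ring_of_type_algebra :: 'k ring)"
    then have J: "subgroup J (add_monoid (ring_of_type_algebra :: 'k ring))" by (simp add: additive_subgroup_def)
    have "- x \<in> J" if "x \<in> J" for x
      using subgroup.m_inv_closed[OF J that] unfolding inv .
    then show "0 \<in> J \<and> (\<forall>x\<in>J. \<forall>y\<in>J. x + y \<in> J) \<and> (\<forall>x\<in>J. - x \<in> J)"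
      using subgroup.one_closed[OF J] subgroup.m_closed[OF J] by simp
  next
    assume J: "0 \<in> J \<and> (\<forall>x\<in>J. \<forall>y\<in>J. x + y \<in> J) \<and> (\<forall>x\<in>J. - x \<in> J)"
    have "subgroup J (add_monoid (ring_of_type_algebra :: 'k ring))"
    proof (rule R.add.subgroupI)
      show "\<ominus>\<^bsub>ring_of_type_algebra\<^esub> x \<in> J" if "x \<in> J" for x
        unfolding neg using J that by blast
    qed (use J in auto)
    then show "additive_subgroup J (ring_of_type_algebra :: 'k ring)"
      by (simp add: additive_subgroup_def)
  qed
qed

lemma fractional_ideal_iff:
  "fractional_ideal J \<longleftrightarrow> submod J \<and> J \<noteq> {0} \<and> (\<exists>d. d \<noteq> 0 \<and> algebraic_int d \<and> (\<forall>x\<in>J. algebraic_int (d * x)))"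
proof -
  have "submod J \<longleftrightarrow> additive_subgroup J (ring_of_type_algebra :: 'k ring) \<and> (\<forall>a\<in>OK. \<forall>x\<in>J. a * x \<in> J)"
    using submodD(4)[of J] unfolding additive_subgroup_iff submod_def by blast
  then show ?thesis unfolding fractional_ideal_def by auto
qed

text \<open>The product is formed in the field and not in the ring of integers, which makes it
  available for fractional ideals.\<close>

abbreviation iprod (infixl "\<bullet>\<^sub>i" 70) where "I \<bullet>\<^sub>i J \<equiv> ideal_prod (ring_of_type_algebra :: 'k ring) I J"

lemma iprod_mult: "i \<in> I \<Longrightarrow> j \<in> J \<Longrightarrow> i * j \<in> I \<bullet>\<^sub>i J"
  using ideal_prod.prod[of i I j J "ring_of_type_algebra :: 'k ring"] by simp

lemma iprod_add: "x \<in> I \<bullet>\<^sub>i J \<Longrightarrow> y \<in> I \<bullet>\<^sub>i J \<Longrightarrow> x + y \<in> I \<bullet>\<^sub>i J"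
  using ideal_prod.sum[of x "ring_of_type_algebra :: 'k ring" I J y] by simp

lemma iprod_subset:
  assumes "\<And>i j. i \<in> I \<Longrightarrow> j \<in> J \<Longrightarrow> i * j \<in> K" "\<And>x y. x \<in> K \<Longrightarrow> y \<in> K \<Longrightarrow> x + y \<in> K"
  shows "I \<bullet>\<^sub>i J \<subseteq> K"
proof
  fix x assume "x \<in> I \<bullet>\<^sub>i J"
  then show "x \<in> K" by (induction rule: ideal_prod.induct) (auto intro: assms)
qed

lemma iprod_commute: "I \<bullet>\<^sub>i J = J \<bullet>\<^sub>i I"
proof -
  have "I \<bullet>\<^sub>i J \<subseteq> J \<bullet>\<^sub>i I" for I J
  proof (rule iprod_subset)
    show "i * j \<in> J \<bullet>\<^sub>i I" if "i \<in> I" "j \<in> J" for i j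
      using iprod_mult[OF that(2,1)] by (simp add: mult.commute)
  qed (rule iprod_add)
  then show ?thesis by blast
qed

lemma iprod_assoc_aux: "(I \<bullet>\<^sub>i J) \<bullet>\<^sub>i K \<subseteq> I \<bullet>\<^sub>i (J \<bullet>\<^sub>i K)"
proof (rule iprod_subset)
  fix x k assume "x \<in> I \<bullet>\<^sub>i J" and k: "k \<in> K"
  then show "x * k \<in> I \<bullet>\<^sub>i (J \<bullet>\<^sub>i K)"
  proof (induction rule: ideal_prod.induct)
    case (prod i j)
    then have "i * (j * k) \<in> I \<bullet>\<^sub>i (J \<bullet>\<^sub>i K)" using k by (intro iprod_mult)
    then show ?case by (simp add: mult.assoc)
  next
    case (sum x y)
    then show ?case using iprod_add by (simp add: distrib_right)
  qed
qed (rule iprod_add)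

lemma iprod_assoc: "(I \<bullet>\<^sub>i J) \<bullet>\<^sub>i K = I \<bullet>\<^sub>i (J \<bullet>\<^sub>i K)"
proof
  show "I \<bullet>\<^sub>i (J \<bullet>\<^sub>i K) \<subseteq> (I \<bullet>\<^sub>i J) \<bullet>\<^sub>i K"
    using iprod_assoc_aux[of K J I] by (simp add: iprod_commute)
qed (rule iprod_assoc_aux)

lemma submod_iprod:
  assumes "submod I" "submod J" shows "submod (I \<bullet>\<^sub>i J)"
proof -
  have "0 * 0 \<in> I \<bullet>\<^sub>i J" using assms submodD(1) by (intro iprod_mult) auto
  moreover have "a * x \<in> I \<bullet>\<^sub>i J" if a: "algebraic_int a" and x: "x \<in> I \<bullet>\<^sub>i J" for a x
    using x
  proof (induction rule: ideal_prod.induct)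
    case (prod i j)
    then have "(a * i) * j \<in> I \<bullet>\<^sub>i J" using a assms submodD(3) by (intro iprod_mult) auto
    then show ?case by (simp add: mult.assoc)
  next
    case (sum x y)
    then show ?case using iprod_add by (simp add: distrib_left)
  qed
  ultimately show ?thesis by (auto simp: submod_def intro: iprod_add)
qed

lemma principal_ideal_mem: "(x :: 'k) \<in> principal_ideal \<alpha> \<longleftrightarrow> (\<exists>a. algebraic_int a \<and> x = \<alpha> * a)"
  by (auto simp: principal_ideal_def)

lemma submod_principal: "submod (principal_ideal \<alpha>)"
  unfolding submod_def
proof (intro conjI ballI)
  show "0 \<in> principal_ideal \<alpha>" unfolding principal_ideal_mem by (intro exI[of _ 0]) auto
  fix x y assume "x \<in> principal_ideal \<alpha>" "y \<in> principal_ideal \<alpha>"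
  then obtain a b where "algebraic_int a" "algebraic_int b" "x = \<alpha> * a" "y = \<alpha> * b"
    by (auto simp: principal_ideal_mem)
  then show "x + y \<in> principal_ideal \<alpha>" unfolding principal_ideal_mem
    by (intro exI[of _ "a + b"]) (auto simp: distrib_left intro: algebraic_int_add)
next
  fix a x assume "a \<in> OK" "x \<in> principal_ideal \<alpha>"
  then obtain b where "algebraic_int a" "algebraic_int b" "x = \<alpha> * b"
    by (auto simp: principal_ideal_mem)
  then show "a * x \<in> principal_ideal \<alpha>" unfolding principal_ideal_mem
    by (intro exI[of _ "a * b"]) (auto intro: algebraic_int_mult)
qed

lemma principal_1: "principal_ideal 1 = OK"
  by (auto simp: principal_ideal_mem)

lemma submod_OK: "submod OK"
  using submod_principal[of 1] by (simp add: principal_1)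

lemma iprod_principal: "submod J \<Longrightarrow> principal_ideal \<alpha> \<bullet>\<^sub>i J = (\<lambda>x. \<alpha> * x) ` J"
proof
  assume J: "submod J"
  show "principal_ideal \<alpha> \<bullet>\<^sub>i J \<subseteq> (\<lambda>x. \<alpha> * x) ` J"
  proof (rule iprod_subset)
    fix i j assume "i \<in> principal_ideal \<alpha>" "j \<in> J"
    then obtain a where "algebraic_int a" "i = \<alpha> * a" by (auto simp: principal_ideal_mem)
    then show "i * j \<in> (\<lambda>x. \<alpha> * x) ` J" using submodD(3)[OF J, of a j] \<open>j \<in> J\<close> by (auto simp: mult.assoc)
  next
    fix x y assume "x \<in> (\<lambda>x. \<alpha> * x) ` J" "y \<in> (\<lambda>x. \<alpha> * x) ` J"
    then obtain a b where "a \<in> J" "b \<in> J" "x = \<alpha> * a" "y = \<alpha> * b" by auto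
    then have "x + y = \<alpha> * (a + b)" "a + b \<in> J" using submodD(2)[OF J] by (auto simp: distrib_left)
    then show "x + y \<in> (\<lambda>x. \<alpha> * x) ` J" by auto
  qed
  show "(\<lambda>x. \<alpha> * x) ` J \<subseteq> principal_ideal \<alpha> \<bullet>\<^sub>i J"
  proof
    fix x assume "x \<in> (\<lambda>x. \<alpha> * x) ` J"
    moreover have "\<alpha> \<in> principal_ideal \<alpha>" unfolding principal_ideal_mem by (intro exI[of _ 1]) auto
    ultimately show "x \<in> principal_ideal \<alpha> \<bullet>\<^sub>i J" by (auto intro: iprod_mult)
  qed
qed

lemma iprod_OK: "submod J \<Longrightarrow> OK \<bullet>\<^sub>i J = J"
  using iprod_principal[of J 1] by (simp add: principal_1)

lemma iprod_principal_principal: "principal_ideal \<alpha> \<bullet>\<^sub>i principal_ideal \<beta> = principal_ideal (\<alpha> * \<beta>)"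
  by (subst iprod_principal[OF submod_principal]) (auto simp: principal_ideal_def image_image mult.assoc)

lemma submod_nonzero: "submod J \<Longrightarrow> J \<noteq> {0} \<Longrightarrow> \<exists>x\<in>J. x \<noteq> 0"
  using submodD(1) by blast

lemma principal_nonzero: "(\<alpha> :: 'k) \<noteq> 0 \<Longrightarrow> principal_ideal \<alpha> \<noteq> {0}"
proof -
  assume "\<alpha> \<noteq> 0"
  moreover have "\<alpha> \<in> principal_ideal \<alpha>" unfolding principal_ideal_mem by (intro exI[of _ 1]) auto
  ultimately show ?thesis by blast
qed

lemma iprod_nonzero:
  assumes "submod I" "submod J" "I \<noteq> {0}" "J \<noteq> {0}" shows "I \<bullet>\<^sub>i J \<noteq> {0}"
proof -
  obtain x y where "x \<in> I" "x \<noteq> 0" "y \<in> J" "y \<noteq> 0" using submod_nonzero assms by metis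
  then have "x * y \<in> I \<bullet>\<^sub>i J" "x * y \<noteq> 0" by (auto intro: iprod_mult)
  then show ?thesis by blast
qed

lemma fractional_ideal_iprod:
  assumes "fractional_ideal I" "fractional_ideal J" shows "fractional_ideal (I \<bullet>\<^sub>i J)"
proof -
  obtain c where c: "c \<noteq> 0" "algebraic_int c" "\<And>x. x \<in> I \<Longrightarrow> algebraic_int (c * x)"
    using assms(1) by (auto simp: fractional_ideal_iff)
  obtain d where d: "d \<noteq> 0" "algebraic_int d" "\<And>x. x \<in> J \<Longrightarrow> algebraic_int (d * x)"
    using assms(2) by (auto simp: fractional_ideal_iff)
  have "I \<bullet>\<^sub>i J \<subseteq> {x. algebraic_int (c * d * x)}"
  proof (rule iprod_subset)
    fix i j assume "i \<in> I" "j \<in> J"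
    then have "algebraic_int ((c * i) * (d * j))" using algebraic_int_mult[OF c(3) d(3)] by blast
    then show "i * j \<in> {x. algebraic_int (c * d * x)}" by (simp add: algebra_simps)
  qed (auto simp: distrib_left intro: algebraic_int_add)
  then have "\<exists>d. d \<noteq> 0 \<and> algebraic_int d \<and> (\<forall>x\<in>I \<bullet>\<^sub>i J. algebraic_int (d * x))"
    using c d algebraic_int_mult by (intro exI[of _ "c * d"]) auto
  then show ?thesis using assms submod_iprod[of I J] iprod_nonzero[of I J]
    unfolding fractional_ideal_iff by blast
qed

lemma fractional_ideal_principal: "(\<alpha> :: 'k) \<noteq> 0 \<Longrightarrow> fractional_ideal (principal_ideal \<alpha>)"
proof -
  assume a: "\<alpha> \<noteq> 0"
  obtain d where d: "d > 0" "algebraic_int (of_nat d * \<alpha>)" using denom_int[of \<alpha>] by blast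
  have "algebraic_int (of_nat d * x)" if x: "x \<in> principal_ideal \<alpha>" for x
  proof -
    obtain a where "algebraic_int a" "x = \<alpha> * a" using x by (auto simp: principal_ideal_mem)
    then show ?thesis using algebraic_int_mult[OF d(2), of a] by (simp add: mult.assoc)
  qed
  then have "\<exists>d. d \<noteq> 0 \<and> algebraic_int d \<and> (\<forall>x\<in>principal_ideal \<alpha>. algebraic_int (d * x))"
    using d by (intro exI[of _ "of_nat d"]) auto
  then show ?thesis using submod_principal[of \<alpha>] principal_nonzero[OF a]
    unfolding fractional_ideal_iff by blast
qed

lemma fractional_ideal_integral: "submod A \<Longrightarrow> A \<subseteq> OK \<Longrightarrow> A \<noteq> {0} \<Longrightarrow> fractional_ideal A"
  by (auto simp: fractional_ideal_iff intro!: exI[of _ 1])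

section \<open>Invertibility of ideals\<close>

lemma trc_scale: "trc (of_rat q * x) = q * trc x"
proof -
  have "of_rat (trc (of_rat q * x)) = (of_rat (q * trc x) :: 'k)"
    by (simp add: of_rat_trc of_rat_mult cj_mult distrib_left)
  then show ?thesis by simp
qed

lemma nrm_scale: "nrm (of_rat q * x) = q\<^sup>2 * nrm x"
  by (simp add: nrm_mult nrm_of_rat)

lemma nrm_cj: "nrm (cj x) = nrm x"
proof -
  have "of_rat (nrm (cj x)) = (of_rat (nrm x) :: 'k)" by (simp add: of_rat_nrm mult.commute)
  then show ?thesis by simp
qed

lemma submod_cj: "submod A \<Longrightarrow> submod (cj ` A)"
  unfolding submod_def
proof (intro conjI ballI, goal_cases)
  case 1
  then show ?case by (metis cj_0 imageI)
next
  case (2 x y)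
  then show ?case by (auto simp: cj_add[symmetric])
next
  case (3 a x)
  then obtain y where y: "y \<in> A" "x = cj y" by auto
  have "a * x = cj (cj a * y)" by (simp add: y cj_mult)
  then show ?case using 3 y algebraic_int_cj by auto
qed

text \<open>The generator \<open>n\<close> is the greatest common divisor of all norms and traces
  \<open>x y' + x' y\<close> with \<open>x, y \<in> A\<close>: each \<open>x y' / n\<close> then has integral trace and norm.\<close>

lemma ideal_times_conjugate:
  assumes A: "submod A" "A \<subseteq> OK" "A \<noteq> {0}"
  shows "\<exists>n>0. A \<bullet>\<^sub>i cj ` A = principal_ideal (of_nat n)"
proof -
  let ?P = "A \<bullet>\<^sub>i cj ` A"
  have P: "submod ?P" using A by (intro submod_iprod submod_cj)
  have cross: "x * cj y \<in> ?P" if "x \<in> A" "y \<in> A" for x y using that by (intro iprod_mult) auto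
  obtain x0 where x0: "x0 \<in> A" "x0 \<noteq> 0" using submod_nonzero A by blast
  have "nrm x0 \<in> \<int>" using nrm_Ints A(2) x0 by blast
  then obtain n0 where n0: "nrm x0 = of_int n0" by (auto elim: Ints_cases)
  have "of_int n0 \<in> ?P"
    using cross[OF x0(1) x0(1)] n0 of_rat_nrm[of x0] by simp
  moreover have "n0 > 0" using nrm_pos[OF x0(2)] n0 by simp
  ultimately have ex: "\<exists>n::nat. n > 0 \<and> of_nat n \<in> ?P"
    by (intro exI[of _ "nat n0"]) auto
  \<comment> \<open>The least positive integer in the product. By division with remainder it divides
    every integer there, in particular all the norms and traces in question.\<close>
  define n where "n = (LEAST n::nat. n > 0 \<and> of_nat n \<in> ?P)"
  have n: "n > 0" "of_nat n \<in> ?P" using LeastI_ex[OF ex] by (auto simp: n_def)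
  have nmin: "n \<le> m" if "m > 0" "of_nat m \<in> ?P" for m
    unfolding n_def using that by (intro Least_le) auto
  have ndvd: "int n dvd m" if "of_int m \<in> ?P" for m
  proof -
    have "of_int (m mod int n) = of_int m - of_int (m div int n) * (of_nat n :: 'k)"
      by (simp add: minus_div_mult_eq_mod [symmetric])
    also have "\<dots> \<in> ?P" using that n by (intro submodD(5)[OF P] submodD(3)[OF P]) auto
    finally have "of_nat (nat (m mod int n)) \<in> ?P" using n(1) by simp
    moreover have "nat (m mod int n) < n" using n(1) by (simp add: nat_less_iff)
    ultimately have "nat (m mod int n) = 0" using nmin by (metis gr0I leD)
    then show ?thesis using n(1) by (simp add: dvd_eq_mod_eq_0 le_less_trans nat_eq_iff)
  qed
  have div_int: "of_int m / of_nat n \<in> (\<int> :: rat set)" if m: "of_int m \<in> ?P" for m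
  proof -
    obtain l where "m = int n * l" using ndvd[OF m] by (auto elim: dvdE)
    then show ?thesis using n(1) by simp
  qed
  have key: "algebraic_int (x * cj y / of_nat n)" if xy: "x \<in> A" "y \<in> A" for x y
  proof (rule algebraic_int_quadratic)
    have eq: "x * cj y / of_nat n = of_rat (1 / of_nat n) * (x * cj y)"
      by (simp add: of_rat_divide)
    have xyi: "algebraic_int (x * cj y)" using A xy algebraic_int_mult algebraic_int_cj by blast
    obtain t where t: "trc (x * cj y) = of_int t" using trc_Ints[OF xyi] by (auto elim: Ints_cases)
    have "of_int t = x * cj y + cj (x * cj y)" using t of_rat_trc[of "x * cj y"] by simp
    also have "\<dots> = x * cj y + y * cj x" by (simp add: cj_mult mult.commute)
    also have "\<dots> \<in> ?P" using cross xy submodD(2)[OF P] by blast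
    finally have "of_int t / of_nat n \<in> (\<int> :: rat set)" by (rule div_int)
    then show "trc (x * cj y / of_nat n) \<in> \<int>" unfolding eq trc_scale t by simp
    have N: "nrm z / of_nat n \<in> \<int>" if "z \<in> A" for z
    proof -
      have "nrm z \<in> \<int>" using nrm_Ints A(2) that by blast
      then obtain m where m: "nrm z = of_int m" by (auto elim: Ints_cases)
      have "of_int m \<in> ?P" using cross[OF that that] m of_rat_nrm[of z] by simp
      then show ?thesis using div_int m by simp
    qed
    have "nrm (x * cj y / of_nat n) = (nrm x / of_nat n) * (nrm y / of_nat n)"
      unfolding eq nrm_scale by (simp add: nrm_mult nrm_cj power2_eq_square)
    then show "nrm (x * cj y / of_nat n) \<in> \<int>" using Ints_mult[OF N[OF xy(1)] N[OF xy(2)]] by simp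
  qed
  have "?P \<subseteq> principal_ideal (of_nat n)"
  proof (rule iprod_subset)
    fix i j assume "i \<in> A" "j \<in> cj ` A"
    then have "algebraic_int (i * j / of_nat n)" using key by auto
    then show "i * j \<in> principal_ideal (of_nat n)" using n(1)
      by (auto simp: principal_ideal_mem intro!: exI[of _ "i * j / of_nat n"])
  qed (auto intro: submodD(2)[OF submod_principal])
  moreover have "principal_ideal (of_nat n) \<subseteq> ?P"
    using n(2) submodD(6)[OF P] by (auto simp: principal_ideal_mem)
  ultimately show ?thesis using n(1) by blast
qed

lemma OK_nonzero: "OK \<noteq> {0}"
proof -
  have "(1::'k) \<in> OK" by simp
  then show ?thesis using zero_neq_one by (metis singletonD)
qed

lemma fractional_submod: "fractional_ideal J \<Longrightarrow> submod J"
  by (simp add: fractional_ideal_iff)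

lemma fractional_ideal_scale:
  assumes "fractional_ideal J"
  obtains d where "d \<noteq> 0" "algebraic_int d" "submod (principal_ideal d \<bullet>\<^sub>i J)" "principal_ideal d \<bullet>\<^sub>i J \<subseteq> OK"
    "principal_ideal d \<bullet>\<^sub>i J \<noteq> {0}"
proof -
  obtain d where d: "d \<noteq> 0" "algebraic_int d" "\<And>x. x \<in> J \<Longrightarrow> algebraic_int (d * x)"
    using assms by (auto simp: fractional_ideal_iff)
  have J: "submod J" "J \<noteq> {0}" using assms by (auto simp: fractional_ideal_iff)
  show ?thesis
  proof (rule that[OF d(1,2)])
    show "principal_ideal d \<bullet>\<^sub>i J \<subseteq> OK" using d by (auto simp: iprod_principal[OF J(1)])
    show "submod (principal_ideal d \<bullet>\<^sub>i J)" by (rule submod_iprod[OF submod_principal J(1)])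
    show "principal_ideal d \<bullet>\<^sub>i J \<noteq> {0}"
      by (rule iprod_nonzero[OF submod_principal J(1) principal_nonzero[OF d(1)] J(2)])
  qed
qed

text \<open>After scaling to an integral ideal \<open>A\<close>, the conjugate of \<open>A\<close>
  divided by the integer of \<open>ideal_times_conjugate\<close> is inverse to
  \<open>A\<close>.\<close>

lemma fractional_ideal_inverse:
  assumes "fractional_ideal J" shows "\<exists>J'. fractional_ideal J' \<and> J' \<bullet>\<^sub>i J = OK"
proof -
  obtain d where d: "d \<noteq> 0" "algebraic_int d" "submod (principal_ideal d \<bullet>\<^sub>i J)"
    "principal_ideal d \<bullet>\<^sub>i J \<subseteq> OK" "principal_ideal d \<bullet>\<^sub>i J \<noteq> {0}"
    using fractional_ideal_scale[OF assms] .
  define A where "A = principal_ideal d \<bullet>\<^sub>i J"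
  have A: "submod A" "A \<subseteq> OK" "A \<noteq> {0}" using d by (auto simp: A_def)
  obtain n where n: "n > 0" "A \<bullet>\<^sub>i cj ` A = principal_ideal (of_nat n)"
    using ideal_times_conjugate[OF A] by blast
  obtain x where "x \<in> A" "x \<noteq> 0" using submod_nonzero A by blast
  then have "cj x \<in> cj ` A" "cj x \<noteq> 0" by auto
  then have "cj ` A \<noteq> {0}" by blast
  then have "fractional_ideal (cj ` A)" using A
    by (intro fractional_ideal_integral submod_cj) (auto intro: algebraic_int_cj)
  then have *: "fractional_ideal (principal_ideal (1 / of_nat n) \<bullet>\<^sub>i (cj ` A \<bullet>\<^sub>i principal_ideal d))"
    using n(1) d(1) by (intro fractional_ideal_iprod fractional_ideal_principal) auto
  have "principal_ideal (1 / of_nat n) \<bullet>\<^sub>i (cj ` A \<bullet>\<^sub>i principal_ideal d) \<bullet>\<^sub>i J =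
    principal_ideal (1 / of_nat n) \<bullet>\<^sub>i (A \<bullet>\<^sub>i cj ` A)"
    unfolding A_def by (metis iprod_assoc iprod_commute)
  also have "\<dots> = OK" using n(1) by (simp add: n(2) iprod_principal_principal principal_1)
  finally show ?thesis using * by blast
qed

end

section \<open>Class number and prime ideals\<close>

context quad_field
begin

text \<open>\<open>\<rho>\<close> reads the coordinates of \<open>k * x\<close> in
  \<open>lat\<close> modulo \<open>k * n\<close>, where \<open>k\<close> carries all integers into
  \<open>lat\<close>. Its finite range stands in for the finiteness of residue rings in the counting
  arguments.\<close>

lemma residue_map:
  assumes "n > 0"
  obtains \<rho> :: "'k \<Rightarrow> int \<times> int" where "finite (range \<rho>)"
    "\<And>x y. algebraic_int x \<Longrightarrow> algebraic_int y \<Longrightarrow> \<rho> x = \<rho> y \<Longrightarrow> \<exists>z. algebraic_int z \<and> x - y = of_nat n * z"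
proof -
  obtain k where k: "k > 0" "\<And>x. algebraic_int x \<Longrightarrow> of_nat k * x \<in> lat"
    using int_lat_index by auto
  define ab where "ab x = (SOME p. of_nat k * x = of_int (fst p) + of_int (snd p) * e)" for x
  have ab: "of_nat k * x = of_int (fst (ab x)) + of_int (snd (ab x)) * e" if x: "algebraic_int x" for x
    unfolding ab_def
  proof (rule someI_ex)
    obtain a b where "of_nat k * x = of_int a + of_int b * e" using k(2)[OF x] by (auto simp: lat_def)
    then show "\<exists>p. of_nat k * x = of_int (fst p) + of_int (snd p) * e" by (intro exI[of _ "(a, b)"]) simp
  qed
  define m where "m = int (k * n)"
  have m: "m > 0" using k(1) assms by (simp add: m_def)
  define \<rho> where "\<rho> x = (fst (ab x) mod m, snd (ab x) mod m)" for x
  show ?thesis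
  proof (rule that)
    have "range \<rho> \<subseteq> {0..m} \<times> {0..m}" using m by (auto simp: \<rho>_def less_imp_le)
    then show "finite (range \<rho>)" by (rule finite_subset) simp
    fix x y assume xy: "algebraic_int x" "algebraic_int y" "\<rho> x = \<rho> y"
    have "m dvd fst (ab x) - fst (ab y)" "m dvd snd (ab x) - snd (ab y)"
      using xy(3) by (auto simp: \<rho>_def mod_eq_dvd_iff)
    then obtain p q where pq: "fst (ab x) - fst (ab y) = m * p" "snd (ab x) - snd (ab y) = m * q"
      by (auto elim!: dvdE)
    have "of_nat k * (x - y) = of_int (fst (ab x) - fst (ab y)) + of_int (snd (ab x) - snd (ab y)) * e"
      using ab[OF xy(1)] ab[OF xy(2)] by (simp add: algebra_simps)
    also have "\<dots> = of_nat k * (of_nat n * (of_int p + of_int q * e))"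
      unfolding pq by (simp add: m_def algebra_simps)
    finally have "x - y = of_nat n * (of_int p + of_int q * e)" using k(1) by simp
    moreover have "algebraic_int (of_int p + of_int q * e)"
      by (intro algebraic_int_add algebraic_int_mult algebraic_int_e) auto
    ultimately show "\<exists>z. algebraic_int z \<and> x - y = of_nat n * z" by blast
  qed
qed

text \<open>Such an ideal is a union of residue classes modulo \<open>n\<close>, so its image under
  \<open>\<rho>\<close> determines it.\<close>

lemma finite_ideals_containing:
  assumes "n > 0" shows "finite {B. submod B \<and> B \<subseteq> OK \<and> of_nat n \<in> B}"
proof -
  obtain \<rho> :: "'k \<Rightarrow> int \<times> int" where \<rho>: "finite (range \<rho>)"
    "\<And>x y. algebraic_int x \<Longrightarrow> algebraic_int y \<Longrightarrow> \<rho> x = \<rho> y \<Longrightarrow> \<exists>z. algebraic_int z \<and> x - y = of_nat n * z"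
    using residue_map[OF assms] by blast
  let ?S = "{B. submod B \<and> B \<subseteq> OK \<and> of_nat n \<in> B}"
  have sub: "B \<subseteq> B'" if B: "B \<in> ?S" "B' \<in> ?S" "\<rho> ` B = \<rho> ` B'" for B B'
  proof
    fix x assume x: "x \<in> B"
    then obtain y where y: "y \<in> B'" "\<rho> x = \<rho> y" using B(3) by (metis imageE imageI)
    then obtain z where "algebraic_int z" "x - y = of_nat n * z" using \<rho>(2)[of x y] B x by auto
    then have "x = y + z * of_nat n" by (simp add: algebra_simps)
    then show "x \<in> B'" using B(2) y(1) \<open>algebraic_int z\<close> submodD(2,3)[of B'] by auto
  qed
  have "inj_on (\<lambda>B. \<rho> ` B) ?S"
  proof (rule inj_onI)
    fix B B' assume "B \<in> ?S" "B' \<in> ?S" "\<rho> ` B = \<rho> ` B'"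
    then show "B = B'" using sub[of B B'] sub[of B' B] by blast
  qed
  moreover have "finite ((\<lambda>B. \<rho> ` B) ` ?S)"
    by (rule finite_subset[of _ "Pow (range \<rho>)"]) (use \<rho>(1) in auto)
  ultimately show ?thesis using finite_imageD by blast
qed

text \<open>Dirichlet's box principle. Among \<open>M * M + 1\<close> multiples of \<open>x\<close>
  there are two whose coordinates have fractional parts in the same box of side
  \<open>1 / M\<close>. Up to an integer of the field their difference has norm at most
  \<open>(D + 1) / M\<^sup>2\<close>, and \<open>M = D + 2\<close> makes this less than
  \<open>1\<close>.\<close>

lemma approximation:
  "\<exists>\<tau>>0. \<forall>x. \<exists>t\<in>{1..\<tau>}. \<exists>w. algebraic_int w \<and> nrm (of_nat t * x - w) < 1"
proof -
  define M where "M = D + 2"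
  show ?thesis
  proof (intro exI[of _ "M * M"] conjI allI)
    fix x
    obtain a b where x: "x = of_rat a + of_rat b * e" using repr by meson
    define g where "g i c = nat \<lfloor>of_nat M * frac (of_nat i * c)\<rfloor>" for i :: nat and c :: rat
    have g: "g i c < M" "real_of_rat (frac (of_nat i * c)) = real_of_rat (frac (of_nat i * c))" for i c
    proof -
      have "frac (of_nat i * c) < 1" by (rule frac_lt_1)
      then have "of_nat M * frac (of_nat i * c) < of_nat M * 1" by (intro mult_strict_left_mono) (auto simp: M_def)
      then have "\<lfloor>of_nat M * frac (of_nat i * c)\<rfloor> < int M" by (simp add: floor_less_iff)
      then show "g i c < M" unfolding g_def by (subst nat_less_iff) auto
    qed simp
    have "card ((\<lambda>i. (g i a, g i b)) ` {0..M * M}) \<le> card ({..<M} \<times> {..<M})"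
      by (intro card_mono) (auto simp: g)
    also have "\<dots> < card {0..M * M}" by simp
    finally have "\<not> inj_on (\<lambda>i. (g i a, g i b)) {0..M * M}" by (rule pigeonhole)
    then obtain i' j' where ij': "i' \<le> M * M" "j' \<le> M * M" "i' \<noteq> j'" "g i' a = g j' a" "g i' b = g j' b"
      by (auto simp: inj_on_def)
    obtain i j where ij: "i < j" "j \<le> M * M" "g i a = g j a" "g i b = g j b"
      using ij' by (metis nat_neq_iff)
    have close: "(of_nat (j - i) * c - of_int (\<lfloor>of_nat j * c\<rfloor> - \<lfloor>of_nat i * c\<rfloor>))\<^sup>2 \<le> 1 / (of_nat M)\<^sup>2"
      if "g i c = g j c" for c :: rat
    proof -
      let ?u = "of_nat M * frac (of_nat i * c)" and ?v = "of_nat M * frac (of_nat j * c)"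
      have uv: "?u \<ge> 0" "?v \<ge> 0" by simp_all
      then have "\<lfloor>?u\<rfloor> = \<lfloor>?v\<rfloor>" using that by (simp add: g_def eq_nat_nat_iff)
      then have "\<bar>?v - ?u\<bar> \<le> 1" by linarith
      then have "(?v - ?u)\<^sup>2 \<le> 1" by (simp add: abs_square_le_1)
      also have "?v - ?u = of_nat M * (of_nat (j - i) * c - of_int (\<lfloor>of_nat j * c\<rfloor> - \<lfloor>of_nat i * c\<rfloor>))"
        using ij(1) by (simp add: frac_def of_nat_diff algebra_simps)
      finally have "(of_nat M)\<^sup>2 * (of_nat (j - i) * c - of_int (\<lfloor>of_nat j * c\<rfloor> - \<lfloor>of_nat i * c\<rfloor>))\<^sup>2 \<le> 1"
        by (simp only: power_mult_distrib)
      moreover have "(of_nat M :: rat)\<^sup>2 > 0" by (simp add: M_def)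
      ultimately show ?thesis by (simp only: pos_le_divide_eq mult.commute)
    qed
    define w where "w = of_int (\<lfloor>of_nat j * a\<rfloor> - \<lfloor>of_nat i * a\<rfloor>) + of_int (\<lfloor>of_nat j * b\<rfloor> - \<lfloor>of_nat i * b\<rfloor>) * e"
    have w: "algebraic_int w" unfolding w_def by (intro algebraic_int_add algebraic_int_mult algebraic_int_e algebraic_int_of_int)
    have "of_nat (j - i) * x - w = of_rat (of_nat (j - i) * a - of_int (\<lfloor>of_nat j * a\<rfloor> - \<lfloor>of_nat i * a\<rfloor>))
      + of_rat (of_nat (j - i) * b - of_int (\<lfloor>of_nat j * b\<rfloor> - \<lfloor>of_nat i * b\<rfloor>)) * e"
      by (simp add: x w_def of_rat_add of_rat_diff of_rat_mult algebra_simps)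
    then have "nrm (of_nat (j - i) * x - w) = (of_nat (j - i) * a - of_int (\<lfloor>of_nat j * a\<rfloor> - \<lfloor>of_nat i * a\<rfloor>))\<^sup>2
      + of_nat D * (of_nat (j - i) * b - of_int (\<lfloor>of_nat j * b\<rfloor> - \<lfloor>of_nat i * b\<rfloor>))\<^sup>2"
      by (simp only: nrm_repr)
    also have "\<dots> \<le> 1 / (of_nat M)\<^sup>2 + of_nat D * (1 / (of_nat M)\<^sup>2)"
      by (intro add_mono mult_left_mono close ij) auto
    also have "\<dots> = (of_nat D + 1) / (of_nat M)\<^sup>2" by (simp add: add_divide_distrib)
    also have "\<dots> < 1"
    proof -
      have "D + 1 < M ^ 2" by (simp add: M_def power2_eq_square)
      then have "rat_of_nat (D + 1) < rat_of_nat (M ^ 2)" by (simp only: of_nat_less_iff)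
      then show ?thesis by (simp add: M_def divide_less_eq)
    qed
    finally show "\<exists>t\<in>{1..M * M}. \<exists>w. algebraic_int w \<and> nrm (of_nat t * x - w) < 1"
      using w ij(1,2) by (intro bexI[of _ "j - i"] exI[of _ w]) auto
  qed (simp add: M_def)
qed

text \<open>Hurwitz's argument. If \<open>\<beta>\<close> is a nonzero element of least norm in an
  integral ideal \<open>A\<close>, approximating \<open>\<alpha> / \<beta>\<close> for
  \<open>\<alpha>\<close> in \<open>A\<close> shows that \<open>t * \<alpha>\<close> is an integral
  multiple of \<open>\<beta>\<close> for some \<open>t \<le> \<tau>\<close>. Hence \<open>A\<close>
  multiplied by \<open>T / \<beta>\<close> with \<open>T = fact \<tau>\<close> is an integral ideal
  containing \<open>T\<close>, and there are only finitely many of these.\<close>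

lemma finite_class_number:
  "\<exists>R. finite R \<and> (\<forall>J. fractional_ideal J \<longrightarrow> (\<exists>B\<in>R. fractional_ideal B \<and> (\<exists>\<gamma>. \<gamma> \<noteq> 0 \<and> J = principal_ideal \<gamma> \<bullet>\<^sub>i B)))"
proof -
  obtain \<tau> where \<tau>: "\<tau> > 0" "\<And>x. \<exists>t\<in>{1..\<tau>}. \<exists>w. algebraic_int w \<and> nrm (of_nat t * x - w) < 1"
    using approximation by blast
  define T where "T = (fact \<tau> :: nat)"
  have T: "T > 0" by (simp add: T_def)
  define R where "R = {B. submod B \<and> B \<subseteq> OK \<and> of_nat T \<in> B}"
  have "\<exists>B\<in>R. fractional_ideal B \<and> (\<exists>\<gamma>. \<gamma> \<noteq> 0 \<and> J = principal_ideal \<gamma> \<bullet>\<^sub>i B)" if J: "fractional_ideal J" for J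
  proof -
    obtain d where d: "d \<noteq> 0" "algebraic_int d" "submod (principal_ideal d \<bullet>\<^sub>i J)"
      "principal_ideal d \<bullet>\<^sub>i J \<subseteq> OK" "principal_ideal d \<bullet>\<^sub>i J \<noteq> {0}"
      by (rule fractional_ideal_scale[OF J])
    define A where "A = principal_ideal d \<bullet>\<^sub>i J"
    have A: "submod A" "A \<subseteq> OK" "A \<noteq> {0}" using d by (auto simp: A_def)
    obtain x0 where x0: "x0 \<in> A" "x0 \<noteq> 0" using submod_nonzero A by blast
    obtain \<beta> where \<beta>: "\<beta> \<in> A" "\<beta> \<noteq> 0" "\<And>y. y \<in> A \<Longrightarrow> y \<noteq> 0 \<Longrightarrow> nat \<lfloor>nrm \<beta>\<rfloor> \<le> nat \<lfloor>nrm y\<rfloor>"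
      using ex_has_least_nat[of "\<lambda>x. x \<in> A \<and> x \<noteq> 0" x0 "\<lambda>x. nat \<lfloor>nrm x\<rfloor>"] x0 by blast
    have min: "nrm \<beta> \<le> nrm y" if y: "y \<in> A" "y \<noteq> 0" for y
    proof -
      have "nrm \<beta> \<in> \<int>" "nrm y \<in> \<int>" using nrm_Ints A(2) \<beta>(1) y(1) by blast+
      then obtain m n where "nrm \<beta> = of_int m" "nrm y = of_int n" by (auto elim!: Ints_cases)
      then show ?thesis using \<beta>(3)[OF y] nrm_nonneg[of y] by simp
    qed
    have key: "algebraic_int (of_nat T * (\<alpha> / \<beta>))" if \<alpha>: "\<alpha> \<in> A" for \<alpha>
    proof -
      obtain t w where t: "t \<in> {1..\<tau>}" "algebraic_int w" "nrm (of_nat t * (\<alpha> / \<beta>) - w) < 1"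
        using \<tau>(2) by blast
      have "of_nat t * \<alpha> - w * \<beta> \<in> A" using t \<alpha> \<beta> A by (intro submodD(5) submodD(3)) auto
      moreover have "nrm (of_nat t * \<alpha> - w * \<beta>) < nrm \<beta>"
      proof -
        have "of_nat t * \<alpha> - w * \<beta> = (of_nat t * (\<alpha> / \<beta>) - w) * \<beta>" using \<beta>(2) by (simp add: field_simps)
        then have "nrm (of_nat t * \<alpha> - w * \<beta>) = nrm (of_nat t * (\<alpha> / \<beta>) - w) * nrm \<beta>" by (simp only: nrm_mult)
        also have "\<dots> < 1 * nrm \<beta>" using t(3) nrm_pos[OF \<beta>(2)] by (intro mult_strict_right_mono)
        finally show ?thesis by simp
      qed
      ultimately have "of_nat t * \<alpha> - w * \<beta> = 0" using min by fastforce
      then have eq: "of_nat t * (\<alpha> / \<beta>) = w" using \<beta>(2) by (simp add: field_simps)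
      have "t dvd T" using t(1) by (auto simp: T_def dvd_fact)
      then obtain l where "T = t * l" by blast
      then have "of_nat T * (\<alpha> / \<beta>) = of_nat l * w" using eq by (simp add: algebra_simps)
      then show ?thesis using t(2) algebraic_int_mult by simp
    qed
    define B where "B = principal_ideal (of_nat T / \<beta>) \<bullet>\<^sub>i A"
    have Beq: "B = (\<lambda>x. of_nat T / \<beta> * x) ` A" unfolding B_def by (rule iprod_principal[OF A(1)])
    have fB: "fractional_ideal B" unfolding B_def using T \<beta>(2) A
      by (intro fractional_ideal_iprod fractional_ideal_principal fractional_ideal_integral) auto
    have "B \<subseteq> OK" using key by (auto simp: Beq)
    moreover have "of_nat T \<in> B" using \<beta> by (auto simp: Beq image_iff intro!: bexI[of _ \<beta>])
    ultimately have "B \<in> R" using fractional_submod[OF fB] by (simp add: R_def)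
    moreover have "J = principal_ideal (\<beta> / (of_nat T * d)) \<bullet>\<^sub>i B"
    proof -
      have "principal_ideal (\<beta> / (of_nat T * d)) \<bullet>\<^sub>i B
        = (principal_ideal (\<beta> / (of_nat T * d)) \<bullet>\<^sub>i principal_ideal (of_nat T / \<beta>) \<bullet>\<^sub>i principal_ideal d) \<bullet>\<^sub>i J"
        unfolding B_def A_def by (simp add: iprod_assoc)
      also have "\<dots> = J" using T d(1) \<beta>(2) fractional_submod[OF J]
        by (simp add: iprod_principal_principal principal_1 iprod_OK)
      finally show ?thesis by simp
    qed
    moreover have "\<beta> / (of_nat T * d) \<noteq> 0" using \<beta> T d by simp
    ultimately show ?thesis using fB by blast
  qed
  moreover have "finite R" unfolding R_def by (rule finite_ideals_containing[OF T])
  ultimately show ?thesis by blast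
qed

section \<open>Prime ideals and the rational primes below them\<close>

lemma prime_divisors_iff:
  "P \<in> prime_divisors \<longleftrightarrow> submod P \<and> P \<subseteq> OK \<and> P \<noteq> {0} \<and> 1 \<notin> P \<and>
     (\<forall>a b. algebraic_int a \<longrightarrow> algebraic_int b \<longrightarrow> a * b \<in> P \<longrightarrow> a \<in> P \<or> b \<in> P)"
proof -
  have one: "P \<noteq> OK \<longleftrightarrow> 1 \<notin> P" if "submod P" "P \<subseteq> OK"
  proof
    assume "P \<noteq> OK"
    show "1 \<notin> P"
    proof
      assume "1 \<in> P"
      then have "OK \<subseteq> P" using submodD(3)[OF that(1), of _ 1] by auto
      then show False using that \<open>P \<noteq> OK\<close> by blast
    qed
  qed auto
  show ?thesis
  proof
    assume "P \<in> prime_divisors"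
    then have P: "primeideal P ring_of_integers" "P \<noteq> {0}" by (auto simp: prime_divisors_def)
    interpret primeideal P "ring_of_integers :: 'k ring" by (rule P(1))
    have i: "submod P" "P \<subseteq> OK" using is_ideal by (auto simp: ideal_iff)
    have "1 \<notin> P" using I_notcarr one[OF i] by auto
    moreover have "a \<in> P \<or> b \<in> P" if "algebraic_int a" "algebraic_int b" "a * b \<in> P" for a b
      using I_prime[of a b] that by simp
    ultimately show "submod P \<and> P \<subseteq> OK \<and> P \<noteq> {0} \<and> 1 \<notin> P \<and>
     (\<forall>a b. algebraic_int a \<longrightarrow> algebraic_int b \<longrightarrow> a * b \<in> P \<longrightarrow> a \<in> P \<or> b \<in> P)" using i P(2) by blast
  next
    assume P: "submod P \<and> P \<subseteq> OK \<and> P \<noteq> {0} \<and> 1 \<notin> P \<and>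
     (\<forall>a b. algebraic_int a \<longrightarrow> algebraic_int b \<longrightarrow> a * b \<in> P \<longrightarrow> a \<in> P \<or> b \<in> P)"
    then have "primeideal P (ring_of_integers :: 'k ring)"
      using cring_ring_of_integers one by (intro primeidealI) (auto simp: ideal_iff)
    then show "P \<in> prime_divisors" using P by (simp add: prime_divisors_def)
  qed
qed

lemma prime_divisorsD:
  assumes "P \<in> prime_divisors"
  shows "submod P" "P \<subseteq> OK" "P \<noteq> {0}" "1 \<notin> P"
    "algebraic_int a \<Longrightarrow> algebraic_int b \<Longrightarrow> a * b \<in> P \<Longrightarrow> a \<in> P \<or> b \<in> P"
  using assms unfolding prime_divisors_iff by blast+

lemma norm_mem_ideal:
  assumes "submod A" "A \<subseteq> OK" "x \<in> A" "x \<noteq> 0"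
  shows "\<exists>n>0. of_nat n \<in> A \<and> of_nat n = x * cj x"
proof -
  have "algebraic_int x" using assms by blast
  then have "nrm x \<in> \<int>" by (rule nrm_Ints)
  then obtain n where n: "nrm x = of_int n" by (auto elim: Ints_cases)
  have "n > 0" using nrm_pos[OF assms(4)] n by simp
  have "x * cj x = of_int n" using of_rat_nrm[of x] n by simp
  also have "\<dots> = of_nat (nat n)" using \<open>n > 0\<close> by simp
  finally have eq: "x * cj x = of_nat (nat n)" .
  moreover have "x * cj x \<in> A" using assms algebraic_int_cj \<open>algebraic_int x\<close> submodD(6) by blast
  ultimately show ?thesis using \<open>n > 0\<close> by (intro exI[of _ "nat n"]) auto
qed

lemma prime_contains_prime:
  assumes P: "(P :: 'k set) \<in> prime_divisors" and "n > 0" "of_nat n \<in> P"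
  shows "\<exists>p. Factorial_Ring.prime p \<and> of_nat p \<in> P"
  using assms(2,3)
proof (induction n rule: less_induct)
  case (less n)
  have "n \<noteq> 1" using less prime_divisorsD(4)[OF P] by auto
  then obtain p where p: "Factorial_Ring.prime p" "p dvd n" using prime_factor_nat by blast
  then obtain m where m: "n = p * m" by blast
  have "of_nat p * of_nat m \<in> P" using less m by simp
  then have "of_nat p \<in> P \<or> of_nat m \<in> P" using prime_divisorsD(5)[OF P] by auto
  then show ?case
  proof
    assume "of_nat m \<in> P"
    moreover have "0 < m" "m < n" using less(2) m p(1) prime_gt_1_nat[of p] by auto
    ultimately show ?thesis using less(1) by blast
  qed (use p in blast)
qed

text \<open>Otherwise Bezout's identity would put \<open>1\<close> into \<open>P\<close>.\<close>

lemma prime_mem_dvd: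
  assumes P: "(P :: 'k set) \<in> prime_divisors" and p: "Factorial_Ring.prime p" "of_nat p \<in> P" and "of_int m \<in> P"
  shows "int p dvd m"
proof (rule ccontr)
  assume "\<not> int p dvd m"
  then have "coprime (int p) m" using p(1) by (simp add: prime_imp_coprime)
  then obtain u v where "u * int p + v * m = 1" by (metis bezout_int coprime_iff_gcd_eq_1)
  then have "(1::'k) = of_int (u * int p + v * m)" by simp
  also have "\<dots> = of_int u * of_nat p + of_int v * of_int m" by simp
  also have "\<dots> \<in> P" using p assms(4) prime_divisorsD(1)[OF P] by (intro submodD(2) submodD(3)) auto
  finally show False using prime_divisorsD(4)[OF P] by blast
qed

lemma exists_prime_below: "(P :: 'k set) \<in> prime_divisors \<Longrightarrow> \<exists>p. Factorial_Ring.prime p \<and> of_nat p \<in> P"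
proof -
  assume P: "(P :: 'k set) \<in> prime_divisors"
  obtain x where x: "x \<in> P" "x \<noteq> 0" using submod_nonzero prime_divisorsD[OF P] by blast
  obtain n where "n > 0" "of_nat n \<in> P" using norm_mem_ideal[OF prime_divisorsD(1,2)[OF P] x] by blast
  then show ?thesis using prime_contains_prime[OF P] by blast
qed

definition below :: "'k set \<Rightarrow> nat" where
  "below P = (SOME p. Factorial_Ring.prime p \<and> of_nat p \<in> P)"

lemma below: assumes "(P :: 'k set) \<in> prime_divisors" shows "Factorial_Ring.prime (below P)" "of_nat (below P) \<in> P"
  using someI_ex[OF exists_prime_below[OF assms]] by (auto simp: below_def)

lemma below_unique:
  assumes "P \<in> prime_divisors" "Factorial_Ring.prime p" "of_nat p \<in> P" shows "below P = p"
proof -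
  have "int (below P) dvd int p"
    using prime_mem_dvd[OF assms(1) below[OF assms(1)], of "int p"] assms(3) by simp
  then show ?thesis using assms(2) below(1)[OF assms(1)] by (simp add: primes_dvd_imp_eq)
qed

text \<open>Some power of an element outside \<open>f\<close> is congruent to \<open>1\<close> modulo \<open>f\<close>, as residue rings are finite.\<close>

lemma prime_maximal:
  assumes f: "f \<in> prime_divisors" and g: "submod g" "g \<subseteq> OK" "f \<subset> g"
  shows "1 \<in> g"
proof -
  obtain x where x: "x \<in> g" "x \<notin> f" using g by blast
  have xi: "algebraic_int (x ^ i)" for i
    by (induction i) (use x g algebraic_int_mult in auto)
  have "below f > 0" using below(1)[OF f] prime_gt_0_nat by blast
  then obtain \<rho> :: "'k \<Rightarrow> int \<times> int" where \<rho>: "finite (range \<rho>)"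
    "\<And>x y. algebraic_int x \<Longrightarrow> algebraic_int y \<Longrightarrow> \<rho> x = \<rho> y \<Longrightarrow> \<exists>z. algebraic_int z \<and> x - y = of_nat (below f) * z"
    using residue_map by blast
  have "\<not> inj (\<lambda>i::nat. \<rho> (x ^ i))"
  proof
    assume "inj (\<lambda>i::nat. \<rho> (x ^ i))"
    then have "finite (UNIV :: nat set)" by (rule inj_on_finite[OF _ _ \<rho>(1)]) auto
    then show False by simp
  qed
  then obtain i' j' :: nat where ij': "i' \<noteq> j'" "\<rho> (x ^ i') = \<rho> (x ^ j')" by (auto simp: inj_on_def)
  then obtain i j :: nat where ij: "i < j" "\<rho> (x ^ i) = \<rho> (x ^ j)" by (metis nat_neq_iff)
  obtain z where z: "algebraic_int z" "x ^ i - x ^ j = of_nat (below f) * z" using \<rho>(2) xi ij by blast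
  then have "x ^ i - x ^ j \<in> f" using submodD(6)[OF prime_divisorsD(1)[OF f]] below(2)[OF f] by simp
  moreover have "x ^ i - x ^ j = x ^ i * (1 - x ^ (j - i))" using ij(1) by (simp add: algebra_simps power_add[symmetric])
  ultimately have "x ^ i * (1 - x ^ (j - i)) \<in> f" by simp
  then have "x ^ i \<in> f \<or> 1 - x ^ (j - i) \<in> f"
    using prime_divisorsD(5)[OF f] xi algebraic_int_diff algebraic_int_1 by blast
  moreover have "x ^ i \<notin> f" for i
  proof (induction i)
    case 0
    then show ?case using prime_divisorsD(4)[OF f] by simp
  next
    case (Suc i)
    then show ?case using prime_divisorsD(5)[OF f, of x "x ^ i"] x(2) xi[of 1] xi[of i] by auto
  qed
  ultimately have "1 - x ^ (j - i) \<in> g" using g(3) by blast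
  moreover have "x ^ (j - i) \<in> g"
  proof -
    obtain k where "j - i = Suc k" using ij(1) by (metis Suc_diff_Suc)
    then show ?thesis using submodD(6)[OF g(1), of "x ^ k" x] xi x(1) by simp
  qed
  ultimately have "(1 - x ^ (j - i)) + x ^ (j - i) \<in> g" by (rule submodD(2)[OF g(1)])
  then show ?thesis by simp
qed

lemma prime_subset_eq: "(P :: 'k set) \<in> prime_divisors \<Longrightarrow> Q \<in> prime_divisors \<Longrightarrow> P \<subseteq> Q \<Longrightarrow> P = Q"
  using prime_maximal[of P Q] prime_divisorsD[of Q] by blast

lemma prime_cj: "(P :: 'k set) \<in> prime_divisors \<Longrightarrow> cj ` P \<in> prime_divisors"
proof -
  assume P: "P \<in> prime_divisors"
  note D = prime_divisorsD[OF P]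
  have mem: "x \<in> cj ` P \<longleftrightarrow> cj x \<in> P" for x by (metis cj_cj image_iff)
  obtain x where "x \<in> P" "x \<noteq> 0" using submod_nonzero D by blast
  then have "cj x \<in> cj ` P" "cj x \<noteq> 0" by auto
  then have "cj ` P \<noteq> {0}" by blast
  then show ?thesis unfolding prime_divisors_iff
    using D submod_cj[OF D(1)] algebraic_int_cj by (auto simp: mem cj_mult)
qed

text \<open>For \<open>x\<close> in \<open>P\<close> the norm \<open>x * cj x\<close> is divisible
  by the common prime below, so \<open>x\<close> or \<open>cj x\<close> lies in \<open>Q\<close>.
  Thus \<open>P\<close> is covered by \<open>Q\<close> and its conjugate, and an additive group
  covered by two subgroups lies in one of them.\<close>

lemma primes_above:
  assumes P: "P \<in> prime_divisors" and Q: "Q \<in> prime_divisors" and "below P = below Q"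
  shows "P = Q \<or> P = cj ` Q"
proof (rule ccontr)
  assume neg: "\<not> ?thesis"
  note DP = prime_divisorsD[OF P] and DQ = prime_divisorsD[OF Q]
  have Q': "cj ` Q \<in> prime_divisors" by (rule prime_cj[OF Q])
  have *: "x \<in> Q \<or> x \<in> cj ` Q" if x: "x \<in> P" for x
  proof (cases "x = 0")
    case False
    obtain n where n: "of_nat n \<in> P" "of_nat n = x * cj x"
      using norm_mem_ideal[OF DP(1,2) x False] by blast
    have "int (below P) dvd int n" using prime_mem_dvd[OF P below[OF P], of "int n"] n(1) by simp
    then obtain m where m: "n = below Q * m" using assms(3) by auto
    have "x * cj x = of_nat m * of_nat (below Q)" using n(2)[symmetric] m by simp
    also have "\<dots> \<in> Q" using submodD(3)[OF DQ(1)] below(2)[OF Q] by simp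
    finally have "x \<in> Q \<or> cj x \<in> Q" using DQ(5) x DP(2) algebraic_int_cj by blast
    then show ?thesis by (metis cj_cj imageI)
  qed (use submodD(1)[OF DQ(1)] in simp)
  obtain x where x: "x \<in> P" "x \<notin> Q" using neg prime_subset_eq[OF P Q] by blast
  obtain y where y: "y \<in> P" "y \<notin> cj ` Q" using neg prime_subset_eq[OF P Q'] by blast
  have xy: "x \<in> cj ` Q" "y \<in> Q" using * x y by blast+
  have "x + y \<in> Q \<or> x + y \<in> cj ` Q" using *[OF submodD(2)[OF DP(1) x(1) y(1)]] .
  then show False
  proof
    assume "x + y \<in> Q"
    then have "x + y - y \<in> Q" using xy(2) by (rule submodD(5)[OF DQ(1)])
    then show False using x by simp
  next
    assume "x + y \<in> cj ` Q"
    then have "x + y - x \<in> cj ` Q" using xy(1) by (rule submodD(5)[OF prime_divisorsD(1)[OF Q']])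
    then show False using y by simp
  qed
qed

lemma card_primes_above: "finite {P \<in> prime_divisors. below P = p}" "card {P \<in> prime_divisors. below P = p} \<le> 2"
proof -
  have "\<exists>Q. {P \<in> prime_divisors. below P = p} \<subseteq> {Q, cj ` Q}"
  proof (cases "{P \<in> prime_divisors. below P = p} = {}")
    case False
    then obtain Q where "Q \<in> prime_divisors" "below Q = p" by blast
    then have "P \<in> {Q, cj ` Q}" if "P \<in> prime_divisors" "below P = p" for P
      using primes_above[of P Q] that by auto
    then have "{P \<in> prime_divisors. below P = p} \<subseteq> {Q, cj ` Q}" by blast
    then show ?thesis by blast
  qed auto
  then obtain Q where Q: "{P \<in> prime_divisors. below P = p} \<subseteq> {Q, cj ` Q}" by blast
  show "finite {P \<in> prime_divisors. below P = p}" by (rule finite_subset[OF Q]) simp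
  have "card {P \<in> prime_divisors. below P = p} \<le> card {Q, cj ` Q}" by (rule card_mono[OF _ Q]) simp
  also have "\<dots> \<le> 2" by (simp add: card_insert_if)
  finally show "card {P \<in> prime_divisors. below P = p} \<le> 2" .
qed

section \<open>Norms of prime ideals and their summability\<close>

definition coset :: "'k set \<Rightarrow> 'k \<Rightarrow> 'k set" where "coset I a = (\<lambda>i. i + a) ` I"

lemma ideal_norm_coset: "ideal_norm I = card (coset I ` OK)"
proof -
  have "carrier (ring_of_integers Quot I) = coset I ` OK"
    by (auto simp: FactRing_def A_RCOSETS_def RCOSETS_def r_coset_def coset_def)
  then show ?thesis by (simp add: ideal_norm_def)
qed

lemma coset_eq_iff:
  assumes "submod I" shows "coset I a = coset I b \<longleftrightarrow> a - b \<in> I"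
proof
  assume "coset I a = coset I b"
  moreover have "a \<in> coset I a" using submodD(1)[OF assms] by (auto simp: coset_def image_iff intro!: bexI[of _ 0])
  ultimately obtain i where "i \<in> I" "a = i + b" by (auto simp: coset_def)
  then show "a - b \<in> I" by simp
next
  have sub: "coset I a \<subseteq> coset I b" if "a - b \<in> I" for a b
  proof
    fix x assume "x \<in> coset I a"
    then obtain i where i: "i \<in> I" "x = i + a" by (auto simp: coset_def)
    have "i + (a - b) \<in> I" using submodD(2)[OF assms i(1) that] .
    moreover have "x = (i + (a - b)) + b" using i by simp
    ultimately show "x \<in> coset I b" unfolding coset_def by blast
  qed
  assume "a - b \<in> I"
  moreover from this have "b - a \<in> I" using submodD(4)[OF assms, of "a - b"] by simp
  ultimately show "coset I a = coset I b" using sub by blast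
qed

text \<open>The bound is uniform over all ideals containing \<open>n\<close>; this later turns
  membership of a fixed nonzero number in \<open>f\<close> into a bound for the norm of
  \<open>f\<close>.\<close>

lemma ideal_norm_bounded:
  assumes "n > 0"
  obtains C where "\<And>I. submod I \<Longrightarrow> of_nat n \<in> I \<Longrightarrow> finite (coset I ` OK)"
    "\<And>I. submod I \<Longrightarrow> of_nat n \<in> I \<Longrightarrow> ideal_norm I \<le> C"
proof -
  obtain \<rho> :: "'k \<Rightarrow> int \<times> int" where \<rho>: "finite (range \<rho>)"
    "\<And>x y. algebraic_int x \<Longrightarrow> algebraic_int y \<Longrightarrow> \<rho> x = \<rho> y \<Longrightarrow> \<exists>z. algebraic_int z \<and> x - y = of_nat n * z"
    using residue_map[OF assms] by blast
  define h where "h r = (SOME x. algebraic_int x \<and> \<rho> x = r)" for r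
  have fin: "finite (\<rho> ` OK)" using \<rho>(1) by (rule finite_subset[rotated]) auto
  have sub: "coset I ` OK \<subseteq> (\<lambda>r. coset I (h r)) ` (\<rho> ` OK)" if I: "submod I" "of_nat n \<in> I" for I
  proof
    fix c assume "c \<in> coset I ` OK"
    then obtain x where x: "algebraic_int x" "c = coset I x" by blast
    have "algebraic_int (h (\<rho> x)) \<and> \<rho> (h (\<rho> x)) = \<rho> x" unfolding h_def by (rule someI_ex) (use x in blast)
    then obtain z where "algebraic_int z" "x - h (\<rho> x) = of_nat n * z" using \<rho>(2)[of x "h (\<rho> x)"] x(1) by auto
    then have "x - h (\<rho> x) \<in> I" using submodD(6)[OF I(1)] I(2) by simp
    then have "c = coset I (h (\<rho> x))" using x coset_eq_iff[OF I(1)] by simp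
    then show "c \<in> (\<lambda>r. coset I (h r)) ` (\<rho> ` OK)" using x(1) by blast
  qed
  show ?thesis
  proof (rule that)
    fix I assume I: "submod I" "of_nat n \<in> I"
    show "finite (coset I ` OK)" by (rule finite_subset[OF sub[OF I]]) (use fin in simp)
    have "card (coset I ` OK) \<le> card ((\<lambda>r. coset I (h r)) ` (\<rho> ` OK))"
      by (rule card_mono[OF _ sub[OF I]]) (use fin in simp)
    also have "\<dots> \<le> card (\<rho> ` OK)" by (rule card_image_le[OF fin])
    finally show "ideal_norm I \<le> card (\<rho> ` OK)" by (simp add: ideal_norm_coset)
  qed
qed

lemma ideal_norm_ge:
  assumes P: "(P :: 'k set) \<in> prime_divisors" shows "below P \<le> ideal_norm P"
proof -
  note DP = prime_divisorsD[OF P]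
  have "below P > 0" using below(1)[OF P] prime_gt_0_nat by blast
  then have fin: "finite (coset P ` OK)" using ideal_norm_bounded DP(1) below(2)[OF P] by metis
  have "inj_on (\<lambda>i. coset P (of_nat i)) {..<below P}"
  proof (rule inj_onI)
    fix i j assume ij: "i \<in> {..<below P}" "j \<in> {..<below P}" "coset P (of_nat i) = coset P (of_nat j)"
    then have "of_int (int i - int j) \<in> P" by (simp add: coset_eq_iff[OF DP(1)])
    then have "int (below P) dvd int i - int j" by (rule prime_mem_dvd[OF P below[OF P]])
    then have "int i mod int (below P) = int j mod int (below P)" by (simp add: mod_eq_dvd_iff)
    then show "i = j" using ij by simp
  qed
  then have "card ((\<lambda>i. coset P (of_nat i)) ` {..<below P}) = below P" by (simp add: card_image)
  moreover have "card ((\<lambda>i. coset P (of_nat i)) ` {..<below P}) \<le> card (coset P ` OK)"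
    by (rule card_mono[OF fin]) auto
  ultimately show ?thesis by (simp add: ideal_norm_coset)
qed

lemma ideal_norm_ge2: "(P :: 'k set) \<in> prime_divisors \<Longrightarrow> ideal_norm P \<ge> 2"
  using ideal_norm_ge[of P] below(1)[of P] prime_ge_2_nat[of "below P"] by simp

lemma finite_primes_norm_le: "finite {P :: 'k set. P \<in> prime_divisors \<and> ideal_norm P \<le> m}"
proof (rule finite_subset)
  show "{P :: 'k set. P \<in> prime_divisors \<and> ideal_norm P \<le> m} \<subseteq> (\<Union>p\<le>m. {P \<in> prime_divisors. below P = p})"
    using ideal_norm_ge by fastforce
  show "finite (\<Union>p\<le>m. {P \<in> prime_divisors. below P = p})" using card_primes_above(1) by auto
qed

text \<open>A maximal one among the finitely many proper ideals containing \<open>p\<close> is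
  prime. That \<open>p\<close> generates a proper ideal holds because \<open>1 / p\<close> is not an
  algebraic integer.\<close>

lemma prime_above_exists:
  assumes "Factorial_Ring.prime p" shows "\<exists>P\<in>(prime_divisors :: 'k set set). of_nat p \<in> P"
proof -
  have p: "p > 0" using assms prime_gt_0_nat by blast
  define S where "S = {B. submod B \<and> B \<subseteq> OK \<and> of_nat p \<in> B} \<inter> {B. 1 \<notin> B}"
  have finS: "finite S" unfolding S_def using finite_ideals_containing[OF p] by (rule finite_subset[rotated]) blast
  have "1 \<notin> principal_ideal (of_nat p :: 'k)"
  proof
    assume "1 \<in> principal_ideal (of_nat p :: 'k)"
    then obtain a :: 'k where a: "algebraic_int a" "1 = of_nat p * a" by (auto simp: principal_ideal_mem)
    then have "a = of_rat (1 / of_nat p)" using p by (simp add: of_rat_divide field_simps)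
    then have "1 / rat_of_nat p \<in> \<int>" using a(1) of_rat_algebraic_int by simp
    then obtain m where "1 / rat_of_nat p = of_int m" by (auto elim: Ints_cases)
    then have "rat_of_int 1 = of_int (m * int p)" using p by (simp add: field_simps)
    then have "m * int p = 1" by (simp only: of_int_eq_iff)
    then have "int p dvd 1" by (metis dvd_triv_right)
    then show False using assms by (metis int_dvd_int_iff not_prime_unit of_nat_1)
  qed
  moreover have "principal_ideal (of_nat p :: 'k) \<subseteq> OK"
    by (auto simp: principal_ideal_mem intro!: algebraic_int_mult)
  moreover have "of_nat p \<in> principal_ideal (of_nat p :: 'k)" unfolding principal_ideal_mem by (intro exI[of _ 1]) auto
  ultimately have "principal_ideal (of_nat p) \<in> S" using submod_principal by (simp add: S_def)
  then obtain P where P: "P \<in> S" "\<And>B. B \<in> S \<Longrightarrow> P \<subseteq> B \<Longrightarrow> P = B"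
    using finite_has_maximal[OF finS] by blast
  have Ps: "submod P" "P \<subseteq> OK" "of_nat p \<in> P" "1 \<notin> P" using P(1) by (auto simp: S_def)
  have ext: "\<exists>y\<in>P. \<exists>c. algebraic_int c \<and> 1 = y + c * a" if a: "algebraic_int a" "a \<notin> P" for a
  proof -
    define B where "B = {y + c * a | y c. y \<in> P \<and> algebraic_int c}"
    have memB: "y + c * a \<in> B" if "y \<in> P" "algebraic_int c" for y c using that by (auto simp: B_def)
    have "submod B" unfolding submod_def
    proof (intro conjI ballI)
      show "0 \<in> B" using memB[of 0 0] submodD(1)[OF Ps(1)] by simp
      fix x y assume "x \<in> B" "y \<in> B"
      then obtain u c v d where uv: "u \<in> P" "v \<in> P" "algebraic_int c" "algebraic_int d" "x = u + c * a" "y = v + d * a"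
        by (auto simp: B_def)
      have "x + y = (u + v) + (c + d) * a" using uv by (simp add: algebra_simps)
      then show "x + y \<in> B" using memB[OF submodD(2)[OF Ps(1) uv(1,2)] algebraic_int_add[OF uv(3,4)]] by simp
    next
      fix l x assume "l \<in> OK" "x \<in> B"
      then obtain u c where uv: "algebraic_int l" "u \<in> P" "algebraic_int c" "x = u + c * a"
        by (auto simp: B_def)
      have "l * x = l * u + (l * c) * a" using uv by (simp add: algebra_simps)
      then show "l * x \<in> B" using memB[OF submodD(3)[OF Ps(1) uv(1,2)] algebraic_int_mult[OF uv(1,3)]] by simp
    qed
    moreover have "B \<subseteq> OK" using Ps(2) a(1) by (auto simp: B_def intro!: algebraic_int_add algebraic_int_mult)
    moreover have PB: "P \<subseteq> B" using memB[of _ 0] by auto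
    moreover have "a \<in> B" using memB[of 0 1] submodD(1)[OF Ps(1)] by simp
    ultimately have "1 \<in> B" using P(2)[of B] a(2) Ps(3) by (auto simp: S_def)
    then show ?thesis by (auto simp: B_def)
  qed
  have "a \<in> P \<or> b \<in> P" if ab: "algebraic_int a" "algebraic_int b" "a * b \<in> P" for a b
  proof (rule ccontr)
    assume "\<not> (a \<in> P \<or> b \<in> P)"
    then obtain y c z d where yz: "y \<in> P" "algebraic_int c" "1 = y + c * a" "z \<in> P" "algebraic_int d" "1 = z + d * b"
      using ext ab by meson
    have "1 = y + c * a * (z + d * b)" using yz by simp
    also have "\<dots> = y + (c * a * z + c * d * (a * b))" by (simp add: algebra_simps)
    also have "\<dots> \<in> P"
      by (intro submodD(2)[OF Ps(1)] submodD(3)[OF Ps(1)] algebraic_int_mult yz ab)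
    finally show False using Ps(4) by blast
  qed
  moreover have "P \<noteq> {0}" using Ps(3) p by auto
  ultimately have "P \<in> prime_divisors" unfolding prime_divisors_iff using Ps by blast
  then show ?thesis using Ps(3) by blast
qed

lemma infinite_prime_divisors: "infinite (prime_divisors :: 'k set set)"
proof
  assume "finite (prime_divisors :: 'k set set)"
  then have "finite (below ` prime_divisors)" by simp
  moreover have "{p. Factorial_Ring.prime p} \<subseteq> below ` prime_divisors"
    using prime_above_exists below_unique by blast
  ultimately show False using primes_infinite finite_subset by blast
qed

text \<open>At most two primes lie above a rational prime \<open>p\<close>, each of norm at least
  \<open>p\<close>, so the sum is at most twice the zeta series.\<close>

lemma inverse_norm_summable:
  assumes "\<sigma> > 1"
  shows "(\<lambda>P :: 'k set. real (ideal_norm P) powr (- \<sigma>)) summable_on prime_divisors"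
proof (rule nonneg_bdd_above_summable_on)
  have sm: "summable (\<lambda>n. real n powr (- \<sigma>))" using assms by (simp add: summable_real_powr_iff)
  show "bdd_above (sum (\<lambda>P :: 'k set. real (ideal_norm P) powr (- \<sigma>)) ` {F. F \<subseteq> prime_divisors \<and> finite F})"
  proof (rule bdd_aboveI2)
    fix F :: "'k set set" assume "F \<in> {F. F \<subseteq> prime_divisors \<and> finite F}"
    then have F: "F \<subseteq> prime_divisors" "finite F" by auto
    have "(\<Sum>P\<in>F. real (ideal_norm P) powr (- \<sigma>)) \<le> (\<Sum>P\<in>F. real (below P) powr (- \<sigma>))"
    proof (rule sum_mono)
      fix P assume "P \<in> F"
      then have P: "P \<in> prime_divisors" using F by blast
      then have "below P > 0" using below(1) prime_gt_0_nat by blast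
      then show "real (ideal_norm P) powr (- \<sigma>) \<le> real (below P) powr (- \<sigma>)"
        using ideal_norm_ge[OF P] assms by (intro powr_mono2') auto
    qed
    also have "\<dots> = (\<Sum>p\<in>below ` F. \<Sum>P\<in>{P \<in> F. below P = p}. real (below P) powr (- \<sigma>))"
      by (rule sum.image_gen[OF F(2)])
    also have "\<dots> \<le> (\<Sum>p\<in>below ` F. 2 * real p powr (- \<sigma>))"
    proof (rule sum_mono)
      fix p
      have "(\<Sum>P\<in>{P \<in> F. below P = p}. real (below P) powr (- \<sigma>)) = real (card {P \<in> F. below P = p}) * real p powr (- \<sigma>)"
        by simp
      also have "card {P \<in> F. below P = p} \<le> card {P \<in> prime_divisors. below P = p}"
        using F by (intro card_mono card_primes_above(1)) auto
      then have "card {P \<in> F. below P = p} \<le> 2" using card_primes_above(2)[of p] by simp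
      then have "real (card {P \<in> F. below P = p}) * real p powr (- \<sigma>) \<le> 2 * real p powr (- \<sigma>)"
        by (intro mult_right_mono) auto
      finally show "(\<Sum>P\<in>{P \<in> F. below P = p}. real (below P) powr (- \<sigma>)) \<le> 2 * real p powr (- \<sigma>)" .
    qed
    also have "\<dots> = 2 * (\<Sum>p\<in>below ` F. real p powr (- \<sigma>))" by (simp add: sum_distrib_left)
    also have "\<dots> \<le> 2 * (\<Sum>n. real n powr (- \<sigma>))"
      using F(2) by (intro mult_left_mono sum_le_suminf sm) auto
    finally show "(\<Sum>P\<in>F. real (ideal_norm P) powr (- \<sigma>)) \<le> 2 * (\<Sum>n. real n powr (- \<sigma>))" .
  qed
qed simp

end

section \<open>Characters of a group with a subgroup of finite index\<close>

text \<open>The finite range of the classifying map \<open>\<kappa>\<close> witnesses that \<open>N\<close> has finite index in \<open>G\<close>.\<close>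

locale finite_index = comm_group G for G (structure) +
  fixes N and \<kappa> :: "'a \<Rightarrow> 'c"
  assumes subgroup_N: "subgroup N G"
    and finite_classes: "finite (\<kappa> ` carrier G)"
    and classes: "a \<in> carrier G \<Longrightarrow> b \<in> carrier G \<Longrightarrow> \<kappa> a = \<kappa> b \<Longrightarrow> a \<otimes> inv b \<in> N"
begin

section \<open>Extension of characters from subgroups\<close>

definition char_on :: "'a set \<Rightarrow> ('a \<Rightarrow> complex) \<Rightarrow> bool" where
  "char_on H \<psi> \<longleftrightarrow> (\<forall>x\<in>H. \<psi> x \<noteq> 0) \<and> (\<forall>x\<in>H. \<forall>y\<in>H. \<psi> (x \<otimes> y) = \<psi> x * \<psi> y)"

lemma subgroup_pow_mem: "subgroup H G \<Longrightarrow> x \<in> H \<Longrightarrow> x [^] (n::nat) \<in> H"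
  by (induction n) (auto intro: subgroup.one_closed subgroup.m_closed)

lemma char_on_one: "subgroup H G \<Longrightarrow> char_on H \<psi> \<Longrightarrow> \<psi> \<one> = 1"
  unfolding char_on_def by (metis mult_cancel_left1 r_one one_closed subgroup.one_closed)

lemma char_on_pow:
  assumes "subgroup H G" "char_on H \<psi>" "x \<in> H" shows "\<psi> (x [^] (n::nat)) = \<psi> x ^ n"
proof (induction n)
  case 0
  then show ?case using char_on_one[OF assms(1,2)] by simp
next
  case (Suc n)
  have "x [^] n \<in> H" by (rule subgroup_pow_mem[OF assms(1,3)])
  then show ?case using Suc assms by (simp add: char_on_def)
qed

lemma torsion:
  assumes x: "x \<in> carrier G" shows "\<exists>n::nat. n > 0 \<and> x [^] n \<in> N"
proof -
  have "\<not> inj (\<lambda>i::nat. \<kappa> (x [^] i))"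
  proof
    assume "inj (\<lambda>i::nat. \<kappa> (x [^] i))"
    then have "finite (UNIV :: nat set)" by (rule inj_on_finite[OF _ _ finite_classes]) (use x in auto)
    then show False by simp
  qed
  then obtain i' j' :: nat where ij': "i' \<noteq> j'" "\<kappa> (x [^] i') = \<kappa> (x [^] j')" by (auto simp: inj_on_def)
  then obtain i j :: nat where ij: "i < j" "\<kappa> (x [^] j) = \<kappa> (x [^] i)" by (metis nat_neq_iff)
  have "x [^] j \<otimes> inv (x [^] i) \<in> N" using classes ij x by auto
  moreover have "x [^] j = x [^] (j - i) \<otimes> x [^] i" using x ij(1) by (simp add: nat_pow_mult)
  ultimately have "x [^] (j - i) \<in> N" using x by (simp add: m_assoc)
  then show ?thesis using ij(1) by (intro exI[of _ "j - i"]) auto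
qed

text \<open>\<open>n\<close> is the order of \<open>x\<close> modulo \<open>H\<close>, and any
  \<open>n\<close>-th root \<open>c\<close> of \<open>\<psi> (x [^] n)\<close> may be prescribed at
  \<open>x\<close>. Well-definedness rests on \<open>n\<close> dividing every exponent
  \<open>m\<close> with \<open>x [^] m \<in> H\<close>.\<close>

lemma extend_character:
  assumes H: "subgroup H G" "N \<subseteq> H" and \<psi>: "char_on H \<psi>" and x: "x \<in> carrier G"
    and n: "n > 0" "x [^] (n::nat) \<in> H" "\<And>m. 0 < m \<Longrightarrow> m < n \<Longrightarrow> x [^] m \<notin> H" and c: "c ^ n = \<psi> (x [^] n)"
  shows "\<exists>H' \<psi>'. subgroup H' G \<and> H \<subseteq> H' \<and> x \<in> H' \<and> char_on H' \<psi>' \<and> (\<forall>h\<in>H. \<psi>' h = \<psi> h) \<and> \<psi>' x = c"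
proof -
  have HG: "h \<in> carrier G" if "h \<in> H" for h using subgroup.mem_carrier[OF H(1) that] .
  have cH: "h \<otimes> h' \<in> H" "inv h \<in> H" if "h \<in> H" "h' \<in> H" for h h'
    using subgroup.m_closed[OF H(1)] subgroup.m_inv_closed[OF H(1)] that by auto
  have c0: "c \<noteq> 0" using c n(1,2) \<psi> by (auto simp: char_on_def zero_power)
  have dvd: "\<exists>q. m = n * q" if m: "x [^] m \<in> H" for m :: nat
  proof -
    have "x [^] m = x [^] (m mod n) \<otimes> (x [^] n) [^] (m div n)"
      using x by (simp add: nat_pow_pow nat_pow_mult)
    then have "x [^] m \<otimes> inv ((x [^] n) [^] (m div n)) = x [^] (m mod n)"
      using x by (simp add: m_assoc)
    moreover have "(x [^] n) [^] (m div n) \<in> H" by (rule subgroup_pow_mem[OF H(1) n(2)])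
    ultimately have "x [^] (m mod n) \<in> H" using cH m by metis
    then have "m mod n = 0" using n(1,3) by (metis gr0I mod_less_divisor)
    then show ?thesis by (metis mult_div_mod_eq add.right_neutral)
  qed
  have wd1: "\<psi> h * c ^ i = \<psi> h' * c ^ j"
    if h: "h \<in> H" "h' \<in> H" "h \<otimes> x [^] i = h' \<otimes> x [^] j" "i \<le> j" for h h' and i j :: nat
  proof -
    have "x [^] j = x [^] (j - i) \<otimes> x [^] i" using x h(4) by (simp add: nat_pow_mult)
    then have "h \<otimes> x [^] i = (h' \<otimes> x [^] (j - i)) \<otimes> x [^] i" using h x HG by (simp add: m_assoc)
    then have eq: "h = h' \<otimes> x [^] (j - i)" using h x HG by simp
    then have "inv h' \<otimes> h = x [^] (j - i)" using h x HG by (simp add: m_assoc[symmetric])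
    then have xm: "x [^] (j - i) \<in> H" using cH h by metis
    then obtain q where q: "j - i = n * q" using dvd by blast
    have "\<psi> h = \<psi> h' * \<psi> (x [^] (j - i))" using \<psi> eq h xm by (simp add: char_on_def)
    also have "x [^] (j - i) = (x [^] n) [^] q" using x q by (simp add: nat_pow_pow)
    also have "\<psi> \<dots> = c ^ (j - i)"
      using char_on_pow[OF H(1) \<psi> n(2), of q] c q by (simp add: power_mult)
    finally show ?thesis using h(4) by (simp add: power_add[symmetric])
  qed
  have wd: "\<psi> h * c ^ i = \<psi> h' * c ^ j"
    if "h \<in> H" "h' \<in> H" "h \<otimes> x [^] i = h' \<otimes> x [^] j" for h h' and i j :: nat
    using wd1[of h h' i j] wd1[of h' h j i] that by (cases "i \<le> j") auto
  define H' where "H' = {h \<otimes> x [^] (i::nat) | h i. h \<in> H}"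
  define \<psi>' where "\<psi>' y = (SOME v. \<exists>h i. h \<in> H \<and> y = h \<otimes> x [^] (i::nat) \<and> v = \<psi> h * c ^ i)" for y
  have mem: "h \<otimes> x [^] i \<in> H'" if "h \<in> H" for h and i :: nat using that by (auto simp: H'_def)
  have val: "\<psi>' (h \<otimes> x [^] i) = \<psi> h * c ^ i" if h: "h \<in> H" for h and i :: nat
  proof -
    have "\<exists>h' i'. h' \<in> H \<and> h \<otimes> x [^] i = h' \<otimes> x [^] (i'::nat) \<and> \<psi>' (h \<otimes> x [^] i) = \<psi> h' * c ^ i'"
      unfolding \<psi>'_def by (rule someI_ex) (use h in blast)
    then show ?thesis using wd h by metis
  qed
  have mult: "(h \<otimes> x [^] i) \<otimes> (h' \<otimes> x [^] j) = (h \<otimes> h') \<otimes> x [^] (i + j)" if "h \<in> H" "h' \<in> H" for h h' and i j :: nat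
    using that HG x by (simp add: nat_pow_mult[symmetric] m_ac)
  have one: "\<one> \<in> H" by (rule subgroup.one_closed[OF H(1)])
  have inv: "inv (h \<otimes> x [^] i) \<in> H'" if h: "h \<in> H" for h and i :: nat
  proof -
    have k: "inv h \<otimes> inv ((x [^] n) [^] i) \<in> H" using cH h subgroup_pow_mem[OF H(1) n(2)] by blast
    have rearrange: "p \<otimes> q \<otimes> r \<otimes> (s \<otimes> t) = (p \<otimes> s) \<otimes> (q \<otimes> (t \<otimes> r))"
      if "p \<in> carrier G" "q \<in> carrier G" "r \<in> carrier G" "s \<in> carrier G" "t \<in> carrier G" for p q r s t
      using that by (simp add: m_ac)
    have i: "i + (n - 1) * i = n * i" using n(1) by (cases n) auto
    \<comment> \<open>An inverse without negative powers of \<open>x\<close>: the inverse of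
      \<open>x [^] i\<close> is \<open>x [^] ((n - 1) * i)\<close> times the inverse of
      \<open>x [^] (n * i)\<close>, and the latter lies in \<open>H\<close>.\<close>
    have "(inv h \<otimes> inv ((x [^] n) [^] i)) \<otimes> x [^] ((n - 1) * i) = inv (h \<otimes> x [^] i)"
    proof (rule inv_equality[symmetric])
      have "inv h \<otimes> inv ((x [^] n) [^] i) \<otimes> x [^] ((n - 1) * i) \<otimes> (h \<otimes> x [^] i)
        = (inv h \<otimes> h) \<otimes> (inv ((x [^] n) [^] i) \<otimes> (x [^] i \<otimes> x [^] ((n - 1) * i)))"
        by (rule rearrange) (use h x HG in auto)
      also have "x [^] i \<otimes> x [^] ((n - 1) * i) = (x [^] n) [^] i"
        using x i by (simp add: nat_pow_mult nat_pow_pow)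
      finally show "inv h \<otimes> inv ((x [^] n) [^] i) \<otimes> x [^] ((n - 1) * i) \<otimes> (h \<otimes> x [^] i) = \<one>"
        using h x HG by simp
    qed (use h x HG in auto)
    then show ?thesis using mem[OF k, of "(n - 1) * i"] by simp
  qed
  have "subgroup H' G"
  proof (rule subgroupI)
    show "H' \<subseteq> carrier G" using HG x by (auto simp: H'_def)
    show "H' \<noteq> {}" using one mem by blast
    show "inv a \<in> H'" if "a \<in> H'" for a using that inv by (auto simp: H'_def)
    show "a \<otimes> b \<in> H'" if "a \<in> H'" "b \<in> H'" for a b
      using that mult mem cH by (auto simp: H'_def)
  qed
  moreover have "char_on H' \<psi>'" unfolding char_on_def
  proof (intro conjI ballI)
    fix a assume "a \<in> H'"
    then show "\<psi>' a \<noteq> 0" using val \<psi> c0 by (auto simp: H'_def char_on_def)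
    fix b assume "b \<in> H'"
    obtain h i h' j where hi: "h \<in> H" "h' \<in> H" "a = h \<otimes> x [^] (i::nat)" "b = h' \<otimes> x [^] (j::nat)"
      using \<open>a \<in> H'\<close> \<open>b \<in> H'\<close> by (auto simp: H'_def)
    have "\<psi>' (a \<otimes> b) = \<psi> (h \<otimes> h') * c ^ (i + j)" unfolding hi mult[OF hi(1,2)] by (rule val) (use cH hi in auto)
    also have "\<psi> (h \<otimes> h') = \<psi> h * \<psi> h'" using \<psi> hi by (auto simp: char_on_def)
    finally show "\<psi>' (a \<otimes> b) = \<psi>' a * \<psi>' b" by (simp add: hi val power_add)
  qed
  moreover have "H \<subseteq> H'" using mem[of _ 0] HG by fastforce
  moreover have "x \<in> H'" using mem[OF one, of 1] x by simp
  moreover have "\<psi>' h = \<psi> h" if "h \<in> H" for h using val[OF that, of 0] HG[OF that] by simp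
  moreover have "\<psi>' x = c" using val[OF one, of 1] char_on_one[OF H(1) \<psi>] x by simp
  ultimately show ?thesis by blast
qed

lemma least_power:
  assumes "N \<subseteq> H" "x \<in> carrier G"
  obtains n :: nat where "n > 0" "x [^] n \<in> H" "\<And>m. 0 < m \<Longrightarrow> m < n \<Longrightarrow> x [^] m \<notin> H"
proof -
  define n where "n = (LEAST n::nat. n > 0 \<and> x [^] n \<in> H)"
  have ex: "\<exists>n::nat. n > 0 \<and> x [^] n \<in> H" using torsion assms by blast
  show ?thesis
  proof (rule that)
    show "n > 0" "x [^] n \<in> H" using LeastI_ex[OF ex] by (auto simp: n_def)
    show "\<And>m. 0 < m \<Longrightarrow> m < n \<Longrightarrow> x [^] m \<notin> H" unfolding n_def using not_less_Least by blast
  qed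
qed

text \<open>With \<open>n\<close> the order of \<open>x\<close> modulo \<open>N\<close>, the element
  \<open>x\<close> is sent to a primitive \<open>n\<close>-th root of unity. The extension to the
  whole group takes finitely many steps, since it is enough to reach one representative of each
  class.\<close>

lemma separating_character:
  assumes x: "x \<in> carrier G" "x \<notin> N"
  shows "\<exists>\<psi>. char_on (carrier G) \<psi> \<and> (\<forall>h\<in>N. \<psi> h = 1) \<and> \<psi> x \<noteq> 1"
proof -
  obtain n :: nat where n: "n > 0" "x [^] n \<in> N" "\<And>m. 0 < m \<Longrightarrow> m < n \<Longrightarrow> x [^] m \<notin> N"
    using least_power[OF subset_refl x(1)] by blast
  have "n \<noteq> 1" using n(2) x by auto
  define c where "c = cis (2 * pi / n)"
  have cn: "c ^ n = 1" using n(1) by (simp add: c_def Complex.DeMoivre)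
  have c1: "c \<noteq> 1"
  proof
    assume "c = 1"
    then have "cos (2 * pi / n) = 1" by (simp add: c_def complex_eq_iff)
    then obtain k :: int where k: "2 * pi / n = of_int k * 2 * pi" unfolding cos_one_2pi_int by blast
    then have "(2 * pi) * (1 / real n) = (2 * pi) * of_int k" by (simp add: mult_ac)
    then have "1 / real n = of_int k" by (subst (asm) mult_left_cancel) auto
    then have "real_of_int 1 = of_int (k * int n)" using n(1) by (simp add: field_simps)
    then have "k * int n = 1" by (simp only: of_int_eq_iff)
    then have "int n dvd 1" by (metis dvd_triv_right)
    then show False using \<open>n \<noteq> 1\<close> by simp
  qed
  have "char_on N (\<lambda>_. 1)" by (simp add: char_on_def)
  then obtain H0 \<psi>0 where H0: "subgroup H0 G" "N \<subseteq> H0" "x \<in> H0" "char_on H0 \<psi>0" "\<And>h. h \<in> N \<Longrightarrow> \<psi>0 h = 1" "\<psi>0 x = c"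
    using extend_character[OF subgroup_N subset_refl _ x(1) n, of "\<lambda>_. 1" c] cn by auto
  have ext: "\<exists>H \<psi>. subgroup H G \<and> H0 \<subseteq> H \<and> F \<subseteq> H \<and> char_on H \<psi> \<and> (\<forall>h\<in>H0. \<psi> h = \<psi>0 h)"
    if "finite F" "F \<subseteq> carrier G" for F
    using that
  proof (induction F)
    case empty
    then show ?case using H0 by blast
  next
    case (insert y F)
    then obtain H \<psi> where H: "subgroup H G" "H0 \<subseteq> H" "F \<subseteq> H" "char_on H \<psi>" "\<forall>h\<in>H0. \<psi> h = \<psi>0 h" by auto
    have NH: "N \<subseteq> H" using H0(2) H(2) by blast
    have y: "y \<in> carrier G" using insert by auto
    obtain l :: nat where l: "l > 0" "y [^] l \<in> H" "\<And>m. 0 < m \<Longrightarrow> m < l \<Longrightarrow> y [^] m \<notin> H"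
      using least_power[OF NH y] by blast
    have "\<psi> (y [^] l) \<noteq> 0" using H(4) l(2) by (auto simp: char_on_def)
    then have "(exp (Ln (\<psi> (y [^] l)) / of_nat l)) ^ l = \<psi> (y [^] l)"
      using l(1) by (simp add: exp_of_nat_mult[symmetric])
    from extend_character[OF H(1) NH H(4) y l this] show ?case using H(2,3,5) by (metis insert_subset subset_iff)
  qed
  define r where "r k = (SOME g. g \<in> carrier G \<and> \<kappa> g = k)" for k
  have r: "r (\<kappa> g) \<in> carrier G \<and> \<kappa> (r (\<kappa> g)) = \<kappa> g" if "g \<in> carrier G" for g
    unfolding r_def by (rule someI_ex) (use that in blast)
  obtain H \<psi> where H: "subgroup H G" "H0 \<subseteq> H" "r ` \<kappa> ` carrier G \<subseteq> H" "char_on H \<psi>" "\<forall>h\<in>H0. \<psi> h = \<psi>0 h"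
    using ext[of "r ` \<kappa> ` carrier G"] finite_classes r by blast
  have "g \<in> H" if g: "g \<in> carrier G" for g
  proof -
    have "g \<otimes> inv (r (\<kappa> g)) \<in> H" using classes[of g "r (\<kappa> g)"] r[OF g] g H0(2) H(2) by auto
    moreover have "r (\<kappa> g) \<in> H" using H(3) g by blast
    ultimately have "g \<otimes> inv (r (\<kappa> g)) \<otimes> r (\<kappa> g) \<in> H" using subgroup.m_closed[OF H(1)] by blast
    then show ?thesis using g r[OF g] by (simp add: m_assoc)
  qed
  then have "H = carrier G" using subgroup.subset[OF H(1)] by blast
  then show ?thesis using H H0 c1 by (intro exI[of _ \<psi>]) auto
qed

text \<open>Extension by \<open>0\<close> outside the group makes characters unique as functions and
  matches the convention for ray class characters.\<close>

definition chars :: "('a \<Rightarrow> complex) set" where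
  "chars = {\<psi>. char_on (carrier G) \<psi> \<and> (\<forall>h\<in>N. \<psi> h = 1) \<and> (\<forall>x. x \<notin> carrier G \<longrightarrow> \<psi> x = 0)}"

lemma chars_mult: "\<psi> \<in> chars \<Longrightarrow> x \<in> carrier G \<Longrightarrow> y \<in> carrier G \<Longrightarrow> \<psi> (x \<otimes> y) = \<psi> x * \<psi> y"
  and chars_nonzero: "\<psi> \<in> chars \<Longrightarrow> x \<in> carrier G \<Longrightarrow> \<psi> x \<noteq> 0"
  by (auto simp: chars_def char_on_def)

lemma norm_chars: assumes "\<psi> \<in> chars" "x \<in> carrier G" shows "norm (\<psi> x) = 1"
proof -
  obtain n :: nat where n: "n > 0" "x [^] n \<in> N" using torsion assms by blast
  have "\<psi> x ^ n = 1" using char_on_pow[OF subgroup_self _ assms(2), of \<psi> n] assms n by (simp add: chars_def)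
  then have "norm (\<psi> x) ^ n = 1" by (metis norm_one norm_power)
  then show ?thesis using n(1) by (metis norm_ge_zero power_eq_1_iff less_not_refl2 abs_of_nonneg real_norm_def)
qed

lemma chars_inv: assumes "\<psi> \<in> chars" "x \<in> carrier G" shows "\<psi> (inv x) = cnj (\<psi> x)"
proof -
  have "\<psi> (inv x) * \<psi> x = 1"
    using chars_mult[of \<psi> "inv x" x] char_on_one[OF subgroup_self, of \<psi>] assms by (simp add: chars_def)
  moreover have "cnj (\<psi> x) * \<psi> x = 1" using norm_chars[OF assms] by (metis complex_norm_square mult.commute of_real_1 power_one)
  ultimately show ?thesis using chars_nonzero[OF assms] by (metis mult_right_cancel)
qed

text \<open>A character is determined by its values at representatives of the classes, and these are
  roots of unity of bounded order.\<close>

lemma finite_chars: "finite chars"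
proof -
  define r where "r k = (SOME g. g \<in> carrier G \<and> \<kappa> g = k)" for k
  have r: "r (\<kappa> g) \<in> carrier G \<and> \<kappa> (r (\<kappa> g)) = \<kappa> g" if "g \<in> carrier G" for g
    unfolding r_def by (rule someI_ex) (use that in blast)
  have "\<forall>k\<in>\<kappa> ` carrier G. \<exists>n::nat. n > 0 \<and> r k [^] n \<in> N" using torsion r by blast
  then obtain n :: "'c \<Rightarrow> nat" where n: "\<And>k. k \<in> \<kappa> ` carrier G \<Longrightarrow> n k > 0 \<and> r k [^] n k \<in> N" by metis
  let ?f = "\<lambda>\<psi>. restrict (\<lambda>k. \<psi> (r k) :: complex) (\<kappa> ` carrier G)"
  have "?f ` chars \<subseteq> PiE (\<kappa> ` carrier G) (\<lambda>k. {z. z ^ n k = 1})"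
  proof (intro image_subsetI PiE_I)
    fix \<psi> k assume \<psi>: "\<psi> \<in> chars" and k: "k \<in> \<kappa> ` carrier G"
    have "\<psi> (r k) ^ n k = \<psi> (r k [^] n k)"
      using char_on_pow[OF subgroup_self, of \<psi> "r k" "n k"] \<psi> r k by (auto simp: chars_def)
    then show "?f \<psi> k \<in> {z. z ^ n k = 1}" using n[OF k] \<psi> k by (auto simp: chars_def)
  qed auto
  moreover have "finite (PiE (\<kappa> ` carrier G) (\<lambda>k. {z::complex. z ^ n k = 1}))"
    using n finite_classes by (intro finite_PiE finite_roots_unity) (auto simp: Suc_le_eq)
  ultimately have "finite (?f ` chars)" by (rule finite_subset)
  moreover have "inj_on ?f chars"
  proof (rule inj_onI)
    fix \<psi> \<psi>' assume *: "\<psi> \<in> chars" "\<psi>' \<in> chars" "?f \<psi> = ?f \<psi>'"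
    have "\<psi> g = \<psi>' g" for g
    proof (cases "g \<in> carrier G")
      case g: True
      have rg: "r (\<kappa> g) \<in> carrier G" using r[OF g] by simp
      have gi: "g = (g \<otimes> inv (r (\<kappa> g))) \<otimes> r (\<kappa> g)" using g rg by (simp add: m_assoc)
      have "g \<otimes> inv (r (\<kappa> g)) \<in> N" using classes[of g "r (\<kappa> g)"] r[OF g] g by auto
      then have "\<phi> g = \<phi> (r (\<kappa> g))" if "\<phi> \<in> chars" for \<phi>
        using that gi g rg chars_mult[OF that, of "g \<otimes> inv (r (\<kappa> g))" "r (\<kappa> g)"] by (simp add: chars_def)
      moreover have "\<psi> (r (\<kappa> g)) = \<psi>' (r (\<kappa> g))" using fun_cong[OF *(3), of "\<kappa> g"] g by simp
      ultimately show ?thesis using * by metis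
    qed (use * in \<open>auto simp: chars_def\<close>)
    then show "\<psi> = \<psi>'" by blast
  qed
  ultimately show ?thesis by (rule finite_imageD)
qed

text \<open>Multiplication by a character that is trivial on \<open>N\<close> but not at
  \<open>x\<close> permutes the characters and multiplies the sum by a number different from
  \<open>1\<close>.\<close>

lemma sum_chars:
  assumes x: "x \<in> carrier G" "x \<notin> N" shows "(\<Sum>\<psi>\<in>chars. \<psi> x) = 0"
proof -
  obtain \<phi>' where \<phi>': "char_on (carrier G) \<phi>'" "\<forall>h\<in>N. \<phi>' h = 1" "\<phi>' x \<noteq> 1"
    using separating_character[OF x] by blast
  define \<phi> where "\<phi> g = (if g \<in> carrier G then \<phi>' g else 0)" for g
  have \<phi>: "\<phi> \<in> chars" "\<phi> x \<noteq> 1" using \<phi>' x subgroup.subset[OF subgroup_N] by (auto simp: \<phi>_def chars_def char_on_def)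
  have "bij_betw (\<lambda>\<psi> g. \<phi> g * \<psi> g) chars chars"
  proof -
    have im: "(\<lambda>\<psi> g. \<phi> g * \<psi> g) ` chars \<subseteq> chars" using \<phi>(1) by (auto simp: chars_def char_on_def)
    have "inj_on (\<lambda>\<psi> g. \<phi> g * \<psi> g) chars"
    proof (rule inj_onI, rule ext)
      fix \<psi> \<psi>' g assume *: "\<psi> \<in> chars" "\<psi>' \<in> chars" "(\<lambda>g. \<phi> g * \<psi> g) = (\<lambda>g. \<phi> g * \<psi>' g)"
      show "\<psi> g = \<psi>' g"
        using fun_cong[OF *(3), of g] * chars_nonzero[OF \<phi>(1), of g] by (cases "g \<in> carrier G") (auto simp: chars_def)
    qed
    then show ?thesis using im endo_inj_surj[OF finite_chars im] by (auto simp: bij_betw_def)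
  qed
  then have "(\<Sum>\<psi>\<in>chars. \<psi> x) = (\<Sum>\<psi>\<in>chars. \<phi> x * \<psi> x)"
    by (rule sum.reindex_bij_betw[symmetric])
  also have "\<dots> = \<phi> x * (\<Sum>\<psi>\<in>chars. \<psi> x)" by (rule sum_distrib_left[symmetric])
  finally have "(\<Sum>\<psi>\<in>chars. \<psi> x) = \<phi> x * (\<Sum>\<psi>\<in>chars. \<psi> x)" .
  then show ?thesis using \<phi>(2) by simp
qed

text \<open>The mean square of \<open>\<Sum>a\<in>A. \<psi> a\<close> over all characters is \<open>card A\<close>, whereas each character
  that is trivial on \<open>A\<close> contributes \<open>(card A)\<^sup>2\<close>.\<close>

lemma card_chars_trivial_on:
  assumes A: "finite A" "A \<subseteq> carrier G" "\<And>a b. a \<in> A \<Longrightarrow> b \<in> A \<Longrightarrow> a \<noteq> b \<Longrightarrow> a \<otimes> inv b \<notin> N"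
  shows "card A * card {\<psi> \<in> chars. \<forall>a\<in>A. \<psi> a = 1} \<le> card chars"
proof (cases "A = {}")
  case False
  define k where "k = card A"
  have k: "k > 0" using False A by (simp add: k_def card_gt_0_iff)
  let ?Y = "{\<psi> \<in> chars. \<forall>a\<in>A. \<psi> a = 1}"
  have eq: "of_real (norm (\<Sum>a\<in>A. \<psi> a) ^ 2) = (\<Sum>a\<in>A. \<Sum>b\<in>A. \<psi> (a \<otimes> inv b))" if "\<psi> \<in> chars" for \<psi>
  proof -
    have "of_real (norm (\<Sum>a\<in>A. \<psi> a) ^ 2) = (\<Sum>a\<in>A. \<psi> a) * cnj (\<Sum>b\<in>A. \<psi> b)"
      by (simp only: complex_norm_square[symmetric] of_real_power)
    also have "\<dots> = (\<Sum>a\<in>A. \<Sum>b\<in>A. \<psi> a * cnj (\<psi> b))" by (simp add: sum_product)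
    also have "\<dots> = (\<Sum>a\<in>A. \<Sum>b\<in>A. \<psi> (a \<otimes> inv b))"
      using A(2) that by (intro sum.cong refl) (auto simp: chars_mult chars_inv subset_iff)
    finally show ?thesis .
  qed
  have "of_real (\<Sum>\<psi>\<in>chars. norm (\<Sum>a\<in>A. \<psi> a) ^ 2) = (\<Sum>\<psi>\<in>chars. \<Sum>a\<in>A. \<Sum>b\<in>A. \<psi> (a \<otimes> inv b))"
    unfolding of_real_sum by (intro sum.cong refl eq)
  also have "\<dots> = (\<Sum>a\<in>A. \<Sum>b\<in>A. \<Sum>\<psi>\<in>chars. \<psi> (a \<otimes> inv b))"
    by (subst sum.swap, intro sum.cong refl, rule sum.swap)
  also have "\<dots> = (\<Sum>a\<in>A. \<Sum>b\<in>A. if b = a then of_nat (card chars) else 0)"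
  proof (intro sum.cong refl)
    fix a b assume ab: "a \<in> A" "b \<in> A"
    then have aG: "a \<in> carrier G" "b \<in> carrier G" using A(2) by auto
    show "(\<Sum>\<psi>\<in>chars. \<psi> (a \<otimes> inv b)) = (if b = a then of_nat (card chars) else (0::complex))"
    proof (cases "b = a")
      case True
      have "\<psi> \<one> = 1" if "\<psi> \<in> chars" for \<psi> using that char_on_one[OF subgroup_self, of \<psi>] by (simp add: chars_def)
      then have "(\<Sum>\<psi>\<in>chars. \<psi> \<one>) = (\<Sum>\<psi>\<in>chars. 1)" by (intro sum.cong refl)
      then show ?thesis using True aG by simp
    next
      case False
      then show ?thesis using sum_chars[of "a \<otimes> inv b"] A(3)[of a b] ab aG by auto
    qed
  qed
  also have "\<dots> = of_nat (k * card chars)" using A(1) by (simp add: k_def)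
  finally have tot: "(\<Sum>\<psi>\<in>chars. norm (\<Sum>a\<in>A. \<psi> a) ^ 2) = real (k * card chars)"
    by (metis of_real_eq_iff of_real_of_nat_eq)
  have "real (k\<^sup>2 * card ?Y) = (\<Sum>\<psi>\<in>?Y. norm (\<Sum>a\<in>A. \<psi> a) ^ 2)"
    by (simp add: k_def)
  also have "\<dots> \<le> (\<Sum>\<psi>\<in>chars. norm (\<Sum>a\<in>A. \<psi> a) ^ 2)"
    by (rule sum_mono2[OF finite_chars]) auto
  also note tot
  finally have "k\<^sup>2 * card ?Y \<le> k * card chars" by (simp only: of_nat_le_iff)
  then show ?thesis using k by (simp add: power2_eq_square k_def mult.assoc)
qed auto

end

section \<open>Ray class groups\<close>

context quad_field
begin

definition prime_to :: "'k set \<Rightarrow> 'k set \<Rightarrow> bool" where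
  "prime_to f A \<longleftrightarrow> submod A \<and> A \<subseteq> OK \<and> \<not> A \<subseteq> f"

text \<open>A prime \<open>f\<close> is maximal, so the sum of \<open>A\<close> and \<open>f\<close>
  is everything as soon as \<open>A\<close> is not contained in \<open>f\<close>.\<close>

lemma coprime_ideal_iff:
  assumes f: "(f :: 'k set) \<in> prime_divisors" shows "coprime_ideal f A \<longleftrightarrow> prime_to f A"
proof -
  note F = prime_divisorsD[OF f]
  have add: "A <+>\<^bsub>ring_of_integers\<^esub> f = {a + b |a b. a \<in> A \<and> b \<in> f}"
    by (auto simp: set_add_def set_mult_def)
  show ?thesis
  proof
    assume A: "coprime_ideal f A"
    then have i: "submod A" "A \<subseteq> OK" by (auto simp: coprime_ideal_def ideal_iff)
    have "\<not> A \<subseteq> f"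
    proof
      assume "A \<subseteq> f"
      moreover have "(1::'k) \<in> A <+>\<^bsub>ring_of_integers\<^esub> f" using A by (simp add: coprime_ideal_def)
      then obtain a b where "a \<in> A" "b \<in> f" "1 = a + b" unfolding add by blast
      ultimately show False using submodD(2)[OF F(1), of a b] F(4) by auto
    qed
    then show "prime_to f A" using i by (simp add: prime_to_def)
  next
    assume "prime_to f A"
    then have A: "submod A" "A \<subseteq> OK" "\<not> A \<subseteq> f" by (auto simp: prime_to_def)
    define S where "S = {a + b |a b. a \<in> A \<and> b \<in> f}"
    have mem: "a + b \<in> S" if "a \<in> A" "b \<in> f" for a b using that by (auto simp: S_def)
    have S: "submod S" unfolding submod_def
    proof (intro conjI ballI)
      show "0 \<in> S" using mem[of 0 0] submodD(1) A(1) F(1) by simp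
      fix x y assume "x \<in> S" "y \<in> S"
      then obtain a b c d where *: "a \<in> A" "b \<in> f" "c \<in> A" "d \<in> f" "x = a + b" "y = c + d" by (auto simp: S_def)
      have "x + y = (a + c) + (b + d)" using * by (simp add: algebra_simps)
      then show "x + y \<in> S" using mem[OF submodD(2)[OF A(1) *(1,3)] submodD(2)[OF F(1) *(2,4)]] by simp
    next
      fix r x assume "r \<in> OK" "x \<in> S"
      then obtain a b where *: "algebraic_int r" "a \<in> A" "b \<in> f" "x = a + b" by (auto simp: S_def)
      have "r * x = r * a + r * b" using * by (simp add: algebra_simps)
      then show "r * x \<in> S" using mem[OF submodD(3)[OF A(1) *(1,2)] submodD(3)[OF F(1) *(1,3)]] by simp
    qed
    have SO: "S \<subseteq> OK" using A(2) F(2) by (auto simp: S_def intro!: algebraic_int_add)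
    have "f \<subseteq> S" using mem[OF submodD(1)[OF A(1)]] by auto
    moreover have "A \<subseteq> S" using mem[OF _ submodD(1)[OF F(1)]] by auto
    ultimately have "f \<subset> S" using A(3) by blast
    then have "1 \<in> S" by (rule prime_maximal[OF f S SO])
    then have "OK \<subseteq> S" using submodD(3)[OF S, of _ 1] by auto
    then have "S = OK" using SO by blast
    moreover have "A \<noteq> {0}" using A(3) submodD(1)[OF F(1)] by auto
    ultimately show "coprime_ideal f A" using A by (auto simp: coprime_ideal_def ideal_iff add S_def)
  qed
qed

lemma iprod_OK_right: "submod J \<Longrightarrow> J \<bullet>\<^sub>i OK = J"
  using iprod_OK[of J] iprod_commute[of J OK] by simp

lemma principal_ideal_0: "principal_ideal 0 = {0 :: 'k}"
proof -
  have "(0 :: 'k) \<in> OK" by simp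
  then show ?thesis unfolding principal_ideal_def ring_of_integers_simps by auto
qed

lemma prime_to_OK: "f \<in> prime_divisors \<Longrightarrow> prime_to f OK"
  using prime_divisorsD(4)[of f] submod_OK by (auto simp: prime_to_def)

lemma prime_to_iprod:
  assumes f: "(f :: 'k set) \<in> prime_divisors" and A: "prime_to f A" and B: "prime_to f B"
  shows "prime_to f (A \<bullet>\<^sub>i B)"
proof -
  obtain a b where ab: "a \<in> A" "a \<notin> f" "b \<in> B" "b \<notin> f" using A B by (auto simp: prime_to_def)
  have "a * b \<notin> f" using prime_divisorsD(5)[OF f, of a b] ab A B by (auto simp: prime_to_def)
  then have "\<not> A \<bullet>\<^sub>i B \<subseteq> f" using iprod_mult[OF ab(1,3)] by blast
  moreover have "A \<bullet>\<^sub>i B \<subseteq> OK" using A B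
    by (intro iprod_subset) (auto simp: prime_to_def subset_iff intro: algebraic_int_mult algebraic_int_add)
  ultimately show ?thesis using A B submod_iprod by (auto simp: prime_to_def)
qed

lemma prime_to_principal:
  assumes f: "(f :: 'k set) \<in> prime_divisors" and a: "algebraic_int a"
  shows "prime_to f (principal_ideal a) \<longleftrightarrow> a \<notin> f"
proof -
  have "a \<in> principal_ideal a" unfolding principal_ideal_mem by (intro exI[of _ 1]) auto
  moreover have "principal_ideal a \<subseteq> f" if "a \<in> f"
    using submodD(6)[OF prime_divisorsD(1)[OF f]] that by (auto simp: principal_ideal_mem)
  moreover have "principal_ideal a \<subseteq> OK" using a algebraic_int_mult by (auto simp: principal_ideal_mem)
  ultimately show ?thesis using submod_principal by (auto simp: prime_to_def)
qed

lemma prime_to_fractional: "prime_to f A \<Longrightarrow> f \<in> prime_divisors \<Longrightarrow> fractional_ideal A"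
  using submodD(1)[OF prime_divisorsD(1)[of f]] by (intro fractional_ideal_integral) (auto simp: prime_to_def)

lemma cong_one_iff:
  assumes f: "(f :: 'k set) \<in> prime_divisors"
  shows "cong_one f \<alpha> \<longleftrightarrow> (\<exists>a b. algebraic_int a \<and> algebraic_int b \<and> a \<notin> f \<and> b \<notin> f \<and> a - b \<in> f \<and> \<alpha> = a / b)"
  unfolding cong_one_def coprime_ideal_iff[OF f] using prime_to_principal[OF f] by auto

lemma carrier_ideal_group:
  assumes f: "(f :: 'k set) \<in> prime_divisors"
  shows "carrier (ideal_group f) = {J. fractional_ideal J \<and> (\<exists>A B. prime_to f A \<and> prime_to f B \<and> J \<bullet>\<^sub>i B = A)}"
  unfolding ideal_group_def coprime_ideal_iff[OF f] by simp

lemma ideal_group_simps [simp]: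
  "I \<otimes>\<^bsub>ideal_group f\<^esub> J = I \<bullet>\<^sub>i J" "\<one>\<^bsub>ideal_group f\<^esub> = OK"
  by (simp_all add: ideal_group_def)

lemma prime_to_carrier:
  assumes "f \<in> prime_divisors" "prime_to f A" shows "A \<in> carrier (ideal_group f)"
proof -
  have "A \<bullet>\<^sub>i OK = A" using iprod_OK_right[of A] assms by (simp add: prime_to_def)
  then show ?thesis using assms prime_to_OK prime_to_fractional unfolding carrier_ideal_group[OF assms(1)] by blast
qed

lemma comm_group_ideal_group:
  assumes f: "(f :: 'k set) \<in> prime_divisors" shows "comm_group (ideal_group f)"
proof (rule comm_groupI)
  note C = carrier_ideal_group[OF f]
  show "\<one>\<^bsub>ideal_group f\<^esub> \<in> carrier (ideal_group f)" using prime_to_carrier[OF f prime_to_OK[OF f]] by simp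
  fix I J K assume I: "I \<in> carrier (ideal_group f)" and J: "J \<in> carrier (ideal_group f)"
  obtain A B where AB: "fractional_ideal I" "prime_to f A" "prime_to f B" "I \<bullet>\<^sub>i B = A" using I by (auto simp: C)
  obtain A' B' where AB': "fractional_ideal J" "prime_to f A'" "prime_to f B'" "J \<bullet>\<^sub>i B' = A'" using J by (auto simp: C)
  have "(I \<bullet>\<^sub>i J) \<bullet>\<^sub>i (B \<bullet>\<^sub>i B') = A \<bullet>\<^sub>i A'" using AB(4) AB'(4) by (metis iprod_assoc iprod_commute)
  then show "I \<otimes>\<^bsub>ideal_group f\<^esub> J \<in> carrier (ideal_group f)"
    using prime_to_iprod[OF f AB(2) AB'(2)] prime_to_iprod[OF f AB(3) AB'(3)] fractional_ideal_iprod[OF AB(1) AB'(1)]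
    unfolding C ideal_group_simps by blast
  show "I \<otimes>\<^bsub>ideal_group f\<^esub> J = J \<otimes>\<^bsub>ideal_group f\<^esub> I" by (simp add: iprod_commute)
  show "I \<otimes>\<^bsub>ideal_group f\<^esub> J \<otimes>\<^bsub>ideal_group f\<^esub> K = I \<otimes>\<^bsub>ideal_group f\<^esub> (J \<otimes>\<^bsub>ideal_group f\<^esub> K)"
    by (simp add: iprod_assoc)
  show "\<one>\<^bsub>ideal_group f\<^esub> \<otimes>\<^bsub>ideal_group f\<^esub> I = I" using iprod_OK[OF fractional_submod[OF AB(1)]] by simp
  obtain I' where I': "fractional_ideal I'" "I' \<bullet>\<^sub>i I = OK" using fractional_ideal_inverse[OF AB(1)] by blast
  have "I' \<bullet>\<^sub>i A = (I' \<bullet>\<^sub>i I) \<bullet>\<^sub>i B" using AB(4) by (simp add: iprod_assoc)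
  also have "\<dots> = B" using I'(2) AB(3) iprod_OK by (simp add: prime_to_def)
  finally have "I' \<in> carrier (ideal_group f)" using I' AB unfolding C by blast
  then show "\<exists>y\<in>carrier (ideal_group f). y \<otimes>\<^bsub>ideal_group f\<^esub> I = \<one>\<^bsub>ideal_group f\<^esub>" using I' by auto
qed

lemma principal_div_carrier:
  assumes f: "(f :: 'k set) \<in> prime_divisors" and ab: "algebraic_int a" "algebraic_int b" "a \<notin> f" "b \<notin> f"
  shows "principal_ideal (a / b) \<in> carrier (ideal_group f)"
    "inv\<^bsub>ideal_group f\<^esub> (principal_ideal (a / b)) = principal_ideal (b / a)"
proof -
  interpret G: comm_group "ideal_group f" by (rule comm_group_ideal_group[OF f])
  have z: "a \<noteq> 0" "b \<noteq> 0" using ab submodD(1)[OF prime_divisorsD(1)[OF f]] by auto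
  have carr: "principal_ideal (c / d) \<in> carrier (ideal_group f)"
    if "algebraic_int c" "algebraic_int d" "c \<notin> f" "d \<notin> f" "c \<noteq> 0" "d \<noteq> 0" for c d
  proof -
    have "principal_ideal (c / d) \<bullet>\<^sub>i principal_ideal d = principal_ideal c"
      using that by (simp add: iprod_principal_principal)
    then show ?thesis using that fractional_ideal_principal[of "c / d"] prime_to_principal[OF f]
      unfolding carrier_ideal_group[OF f] by auto
  qed
  show "principal_ideal (a / b) \<in> carrier (ideal_group f)" using carr ab z by blast
  moreover have "principal_ideal (b / a) \<in> carrier (ideal_group f)" using carr ab z by blast
  moreover have "principal_ideal (b / a) \<bullet>\<^sub>i principal_ideal (a / b) = OK"
    using z by (simp add: iprod_principal_principal principal_1)
  ultimately show "inv\<^bsub>ideal_group f\<^esub> (principal_ideal (a / b)) = principal_ideal (b / a)"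
    by (intro G.inv_equality) auto
qed

text \<open>Take \<open>b\<close> in \<open>B\<close> outside \<open>f\<close>, and
  \<open>b'\<close> in \<open>B\<close> with \<open>\<alpha> * b'\<close> outside \<open>f\<close>.
  Then \<open>b' * (\<alpha> * b) = b * (\<alpha> * b')\<close> is outside \<open>f\<close>, hence
  so is \<open>\<alpha> * b\<close>, and \<open>\<alpha> = \<alpha> * b / b\<close> is the quotient
  sought.\<close>

lemma principal_in_carrier:
  assumes f: "(f :: 'k set) \<in> prime_divisors" and J: "principal_ideal \<alpha> \<in> carrier (ideal_group f)"
  shows "\<exists>a b. algebraic_int a \<and> algebraic_int b \<and> a \<notin> f \<and> b \<notin> f \<and> \<alpha> = a / b"
proof -
  obtain A B where AB: "prime_to f A" "prime_to f B" "principal_ideal \<alpha> \<bullet>\<^sub>i B = A" "fractional_ideal (principal_ideal \<alpha>)"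
    using J by (auto simp: carrier_ideal_group[OF f])
  have \<alpha>: "\<alpha> \<noteq> 0" using AB(4) principal_ideal_0 by (auto simp: fractional_ideal_iff)
  have A: "A = (\<lambda>x. \<alpha> * x) ` B" using AB iprod_principal by (auto simp: prime_to_def)
  obtain b where b: "b \<in> B" "b \<notin> f" using AB(2) by (auto simp: prime_to_def)
  obtain b' where b': "b' \<in> B" "\<alpha> * b' \<notin> f" using AB(1) A by (auto simp: prime_to_def)
  have i: "algebraic_int b" "algebraic_int b'" "algebraic_int (\<alpha> * b)" "algebraic_int (\<alpha> * b')"
    using AB(1,2) A b b' by (auto simp: prime_to_def)
  have "b * (\<alpha> * b') \<notin> f" using prime_divisorsD(5)[OF f, of b "\<alpha> * b'"] i b b' by blast
  then have "\<alpha> * b \<notin> f" using submodD(6)[OF prime_divisorsD(1)[OF f] i(2), of "\<alpha> * b"] by (auto simp: algebra_simps)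
  moreover have "\<alpha> = \<alpha> * b / b" using b submodD(1)[OF prime_divisorsD(1)[OF f]] by auto
  ultimately show ?thesis using i b by blast
qed

text \<open>No positivity is imposed on \<open>\<alpha>\<close>, so that the characters of the
  quotient are those of modulus \<open>f\<close> that are trivial at infinity.\<close>

definition ray :: "'k set \<Rightarrow> 'k set set" where
  "ray f = {principal_ideal \<alpha> | \<alpha>. cong_one f \<alpha>}"

lemma subgroup_ray:
  assumes f: "(f :: 'k set) \<in> prime_divisors" shows "subgroup (ray f) (ideal_group f)"
proof -
  interpret G: comm_group "ideal_group f" by (rule comm_group_ideal_group[OF f])
  note F = prime_divisorsD[OF f]
  show ?thesis
  proof (rule G.subgroupI)
    show "ray f \<subseteq> carrier (ideal_group f)"
      unfolding ray_def cong_one_iff[OF f] using principal_div_carrier(1)[OF f] by blast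
    have "cong_one f 1" unfolding cong_one_iff[OF f] using F submodD(1)[OF F(1)] by (intro exI[of _ 1]) auto
    then show "ray f \<noteq> {}" by (auto simp: ray_def)
    fix I assume "I \<in> ray f"
    then obtain a b where ab: "algebraic_int a" "algebraic_int b" "a \<notin> f" "b \<notin> f" "a - b \<in> f" "I = principal_ideal (a / b)"
      unfolding ray_def cong_one_iff[OF f] by blast
    have "b - a \<in> f" using submodD(4)[OF F(1) ab(5)] by simp
    then have "cong_one f (b / a)" unfolding cong_one_iff[OF f] using ab by blast
    then show "inv\<^bsub>ideal_group f\<^esub> I \<in> ray f" using principal_div_carrier(2)[OF f ab(1-4)] ab(6) by (auto simp: ray_def)
    fix J assume "J \<in> ray f"
    then obtain c d where cd: "algebraic_int c" "algebraic_int d" "c \<notin> f" "d \<notin> f" "c - d \<in> f" "J = principal_ideal (c / d)"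
      unfolding ray_def cong_one_iff[OF f] by blast
    have "a * c - b * d = a * (c - d) + d * (a - b)" by (simp add: algebra_simps)
    also have "\<dots> \<in> f" by (intro submodD(2)[OF F(1)] submodD(3)[OF F(1)] ab cd)
    finally have "a * c - b * d \<in> f" .
    moreover have "a * c \<notin> f" "b * d \<notin> f" using F(5) ab cd by blast+
    moreover have "algebraic_int (a * c)" "algebraic_int (b * d)" using ab cd algebraic_int_mult by auto
    ultimately have "cong_one f (a * c / (b * d))" unfolding cong_one_iff[OF f] by blast
    then show "I \<otimes>\<^bsub>ideal_group f\<^esub> J \<in> ray f" using ab(6) cd(6)
      by (auto simp: ray_def iprod_principal_principal)
  qed
qed

text \<open>\<open>\<kappa> J\<close> records the ideal class of \<open>J\<close> and the residues
  of a numerator and a denominator of the number relating \<open>J\<close> to a fixed ideal of that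
  class. The fixed ideal \<open>base\<close> is chosen inside the ideal group, so that numerator and
  denominator can be taken outside \<open>f\<close>.\<close>

lemma finite_index_ideal_group:
  assumes f: "(f :: 'k set) \<in> prime_divisors"
  shows "\<exists>\<kappa> :: 'k set \<Rightarrow> 'k set \<times> (int \<times> int) \<times> (int \<times> int). finite_index (ideal_group f) (ray f) \<kappa>"
proof -
  interpret G: comm_group "ideal_group f" by (rule comm_group_ideal_group[OF f])
  note F = prime_divisorsD[OF f]
  obtain R where R: "finite R" "\<And>J. fractional_ideal J \<Longrightarrow> \<exists>B\<in>R. fractional_ideal B \<and> (\<exists>\<gamma>. \<gamma> \<noteq> 0 \<and> J = principal_ideal \<gamma> \<bullet>\<^sub>i B)"
    using finite_class_number by blast
  have "below f > 0" using below(1)[OF f] prime_gt_0_nat by blast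
  then obtain \<rho> :: "'k \<Rightarrow> int \<times> int" where \<rho>: "finite (range \<rho>)"
    "\<And>x y. algebraic_int x \<Longrightarrow> algebraic_int y \<Longrightarrow> \<rho> x = \<rho> y \<Longrightarrow> \<exists>z. algebraic_int z \<and> x - y = of_nat (below f) * z"
    using residue_map by blast
  have \<rho>f: "x - y \<in> f" if "algebraic_int x" "algebraic_int y" "\<rho> x = \<rho> y" for x y
    using \<rho>(2)[OF that] submodD(6)[OF F(1) _ below(2)[OF f]] by auto
  define cl where "cl J = (SOME B. B \<in> R \<and> fractional_ideal B \<and> (\<exists>\<gamma>. \<gamma> \<noteq> 0 \<and> J = principal_ideal \<gamma> \<bullet>\<^sub>i B))" for J
  have cl: "cl J \<in> R \<and> fractional_ideal (cl J) \<and> (\<exists>\<gamma>. \<gamma> \<noteq> 0 \<and> J = principal_ideal \<gamma> \<bullet>\<^sub>i cl J)"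
    if J: "fractional_ideal J" for J
    unfolding cl_def by (rule someI_ex) (use R(2)[OF J] in blast)
  define base where "base B = (SOME J. J \<in> carrier (ideal_group f) \<and> cl J = B)" for B
  have base: "base (cl J) \<in> carrier (ideal_group f) \<and> cl (base (cl J)) = cl J" if "J \<in> carrier (ideal_group f)" for J
    unfolding base_def by (rule someI_ex) (use that in blast)
  have frac: "fractional_ideal J" if "J \<in> carrier (ideal_group f)" for J using that by (simp add: carrier_ideal_group[OF f])
  have ex: "\<exists>p. algebraic_int (fst p) \<and> algebraic_int (snd p) \<and> fst p \<notin> f \<and> snd p \<notin> f \<and>
      J = principal_ideal (fst p / snd p) \<bullet>\<^sub>i base (cl J)" if J: "J \<in> carrier (ideal_group f)" for J
  proof -
    let ?I = "base (cl J)"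
    have I: "?I \<in> carrier (ideal_group f)" "cl ?I = cl J" using base[OF J] by auto
    obtain \<gamma> where \<gamma>: "\<gamma> \<noteq> 0" "J = principal_ideal \<gamma> \<bullet>\<^sub>i cl J" using cl[OF frac[OF J]] by blast
    obtain \<delta> where \<delta>: "\<delta> \<noteq> 0" "?I = principal_ideal \<delta> \<bullet>\<^sub>i cl J" using cl[OF frac[OF I(1)]] I(2) by metis
    have "principal_ideal (\<gamma> / \<delta>) \<bullet>\<^sub>i ?I = (principal_ideal (\<gamma> / \<delta>) \<bullet>\<^sub>i principal_ideal \<delta>) \<bullet>\<^sub>i cl J"
      by (subst \<delta>(2)) (simp add: iprod_assoc)
    also have "\<dots> = J" using \<gamma> \<delta> by (simp add: iprod_principal_principal)
    finally have eq: "J = principal_ideal (\<gamma> / \<delta>) \<bullet>\<^sub>i ?I" by simp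
    have "J \<bullet>\<^sub>i inv\<^bsub>ideal_group f\<^esub> ?I = principal_ideal (\<gamma> / \<delta>) \<bullet>\<^sub>i (?I \<bullet>\<^sub>i inv\<^bsub>ideal_group f\<^esub> ?I)"
      by (subst eq) (simp add: iprod_assoc)
    also have "\<dots> = principal_ideal (\<gamma> / \<delta>)"
      using G.r_inv[OF I(1)] iprod_OK_right[OF submod_principal] by simp
    finally have "principal_ideal (\<gamma> / \<delta>) \<in> carrier (ideal_group f)"
      using G.m_closed[OF J G.inv_closed[OF I(1)]] by simp
    then obtain a b where "algebraic_int a" "algebraic_int b" "a \<notin> f" "b \<notin> f" "\<gamma> / \<delta> = a / b"
      using principal_in_carrier[OF f] by metis
    then show ?thesis using eq by (intro exI[of _ "(a, b)"]) auto
  qed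
  define ab where "ab J = (SOME p. algebraic_int (fst p) \<and> algebraic_int (snd p) \<and> fst p \<notin> f \<and> snd p \<notin> f \<and>
      J = principal_ideal (fst p / snd p) \<bullet>\<^sub>i base (cl J))" for J
  have ab: "algebraic_int (fst (ab J)) \<and> algebraic_int (snd (ab J)) \<and> fst (ab J) \<notin> f \<and> snd (ab J) \<notin> f \<and>
      J = principal_ideal (fst (ab J) / snd (ab J)) \<bullet>\<^sub>i base (cl J)" if J: "J \<in> carrier (ideal_group f)" for J
    unfolding ab_def by (rule someI_ex[OF ex[OF J]])
  define \<kappa> where "\<kappa> J = (cl J, \<rho> (fst (ab J)), \<rho> (snd (ab J)))" for J
  have "finite_index (ideal_group f) (ray f) \<kappa>"
  proof (intro finite_index.intro finite_index_axioms.intro comm_group_ideal_group[OF f])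
    show "subgroup (ray f) (ideal_group f)" by (rule subgroup_ray[OF f])
    have "\<kappa> ` carrier (ideal_group f) \<subseteq> R \<times> range \<rho> \<times> range \<rho>" using cl[OF frac] by (auto simp: \<kappa>_def)
    then show "finite (\<kappa> ` carrier (ideal_group f))" by (rule finite_subset) (use R(1) \<rho>(1) in auto)
    fix I J assume IJ: "I \<in> carrier (ideal_group f)" "J \<in> carrier (ideal_group f)" "\<kappa> I = \<kappa> J"
    obtain a b where a: "algebraic_int a" "algebraic_int b" "a \<notin> f" "b \<notin> f" "I = principal_ideal (a / b) \<bullet>\<^sub>i base (cl I)"
      "\<rho> a = \<rho> (fst (ab I))" "\<rho> b = \<rho> (snd (ab I))"
      using ab[OF IJ(1)] by blast
    obtain c d where c: "algebraic_int c" "algebraic_int d" "c \<notin> f" "d \<notin> f" "J = principal_ideal (c / d) \<bullet>\<^sub>i base (cl J)"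
      "\<rho> c = \<rho> (fst (ab J))" "\<rho> d = \<rho> (snd (ab J))"
      using ab[OF IJ(2)] by blast
    have z: "a \<noteq> 0" "b \<noteq> 0" "c \<noteq> 0" "d \<noteq> 0" using a c submodD(1)[OF F(1)] by auto
    have e: "cl I = cl J" "a - c \<in> f" "b - d \<in> f" using IJ(3) a c \<rho>f by (auto simp: \<kappa>_def)
    have "principal_ideal (a * d / (b * c)) \<bullet>\<^sub>i J = (principal_ideal (a * d / (b * c)) \<bullet>\<^sub>i principal_ideal (c / d)) \<bullet>\<^sub>i base (cl J)"
      by (subst c(5)) (simp add: iprod_assoc)
    also have "\<dots> = I" using z e(1) a(5) by (simp add: iprod_principal_principal)
    finally have "I = principal_ideal (a * d / (b * c)) \<bullet>\<^sub>i J" by simp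
    then have "I \<bullet>\<^sub>i inv\<^bsub>ideal_group f\<^esub> J = principal_ideal (a * d / (b * c)) \<bullet>\<^sub>i (J \<bullet>\<^sub>i inv\<^bsub>ideal_group f\<^esub> J)"
      by (simp add: iprod_assoc)
    also have "\<dots> = principal_ideal (a * d / (b * c))"
      using G.r_inv[OF IJ(2)] iprod_OK_right[OF submod_principal] by simp
    finally have eq: "I \<bullet>\<^sub>i inv\<^bsub>ideal_group f\<^esub> J = principal_ideal (a * d / (b * c))" .
    have "a * d - b * c = d * (a - c) - c * (b - d)" by (simp add: algebra_simps)
    also have "\<dots> \<in> f" by (intro submodD(5)[OF F(1)] submodD(3)[OF F(1)] c e)
    finally have "a * d - b * c \<in> f" .
    moreover have "a * d \<notin> f" "b * c \<notin> f" using F(5) a c by blast+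
    moreover have "algebraic_int (a * d)" "algebraic_int (b * c)" using a c algebraic_int_mult by auto
    ultimately have "cong_one f (a * d / (b * c))" unfolding cong_one_iff[OF f] by blast
    then show "I \<otimes>\<^bsub>ideal_group f\<^esub> inv\<^bsub>ideal_group f\<^esub> J \<in> ray f" using eq by (auto simp: ray_def)
  qed
  then show ?thesis by blast
qed

text \<open>A unit has norm \<open>1\<close>, and the norm is a positive definite form in the
  coordinates, which bounds them. Here the single archimedean prime of \<open>K\<close> makes itself
  felt.\<close>

lemma finite_units: "finite {u :: 'k. algebraic_int u \<and> algebraic_int (1 / u) \<and> u \<noteq> 0}" (is "finite ?U")
proof -
  obtain k where k: "k > 0" "\<And>x. algebraic_int x \<Longrightarrow> of_nat k * x \<in> lat" using int_lat_index by auto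
  have "?U \<subseteq> (\<lambda>(a, b). (of_int a + of_int b * e) / of_nat k) ` ({- int k..int k} \<times> {- int k..int k})"
  proof
    fix u assume "u \<in> ?U"
    then have u: "algebraic_int u" "algebraic_int (1 / u)" "u \<noteq> 0" by auto
    obtain m where m: "nrm u = of_int m" using nrm_Ints[OF u(1)] by (auto elim: Ints_cases)
    obtain n where n: "nrm (1 / u) = of_int n" using nrm_Ints[OF u(2)] by (auto elim: Ints_cases)
    have "nrm u * nrm (1 / u) = 1" using u(3) by (simp add: nrm_mult[symmetric])
    then have "of_int (m * n) = rat_of_int 1" using m n by simp
    then have "m * n = 1" by (simp only: of_int_eq_iff)
    moreover have "m > 0" using nrm_pos[OF u(3)] m by simp
    ultimately have "m = 1" by (simp add: pos_zmult_eq_1_iff)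
    then have n1: "nrm u = 1" using m by simp
    obtain a b0 where ab0: "of_nat k * u = of_int a + of_int b0 * e" using k(2)[OF u(1)] by (auto simp: lat_def)
    \<comment> \<open>For \<open>e = 0\<close> the second coordinate is arbitrary and is set to
      \<open>0\<close>.\<close>
    define b where "b = (if e = 0 then 0 else b0)"
    have ab: "of_nat k * u = of_rat (of_int a) + of_rat (of_int b) * e" using ab0 by (simp add: b_def)
    have "nrm (of_nat k * u) = of_nat k ^ 2" using nrm_scale[of "of_nat k" u] n1 by simp
    then have "(of_int a)\<^sup>2 + of_nat D * (of_int b)\<^sup>2 = (of_nat k ^ 2 :: rat)" unfolding ab nrm_repr .
    then have "rat_of_int (a\<^sup>2 + int D * b\<^sup>2) = of_int (int k ^ 2)" by simp
    then have eq: "a\<^sup>2 + int D * b\<^sup>2 = int k ^ 2" by (simp only: of_int_eq_iff)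
    have "a\<^sup>2 \<le> int k ^ 2" using eq by (smt (verit) mult_nonneg_nonneg of_nat_0_le_iff zero_le_power2)
    then have a: "\<bar>a\<bar> \<le> int k" using abs_le_square_iff[of a "int k"] by simp
    have "b\<^sup>2 \<le> int k ^ 2"
    proof (cases "e = 0")
      case False
      then have "D > 0" using e2 by (auto intro: ccontr)
      then have "1 * b\<^sup>2 \<le> int D * b\<^sup>2" by (intro mult_right_mono) auto
      then show ?thesis using eq by (smt (verit) zero_le_power2)
    qed (simp add: b_def)
    then have b: "\<bar>b\<bar> \<le> int k" using abs_le_square_iff[of b "int k"] by simp
    have "u = (of_int a + of_int b * e) / of_nat k" using ab k(1) by (simp add: field_simps)
    then show "u \<in> (\<lambda>(a, b). (of_int a + of_int b * e) / of_nat k) ` ({- int k..int k} \<times> {- int k..int k})"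
      using a b by (intro image_eqI[of _ _ "(a, b)"]) auto
  qed
  then show ?thesis by (rule finite_subset) simp
qed

lemma nonzero_mem_prime_bound:
  assumes "(x :: 'k) \<noteq> 0" "algebraic_int x"
  shows "\<exists>C. \<forall>f\<in>prime_divisors. x \<in> f \<longrightarrow> ideal_norm f \<le> C"
proof -
  obtain n where n: "n > 0" "of_nat n = x * cj x" using norm_mem_ideal[OF submod_OK subset_refl, of x] assms by auto
  obtain C where C: "\<And>I. submod I \<Longrightarrow> of_nat n \<in> I \<Longrightarrow> ideal_norm I \<le> C" using ideal_norm_bounded[OF n(1)] by blast
  have "ideal_norm f \<le> C" if "f \<in> prime_divisors" "x \<in> f" for f
  proof (rule C)
    show "submod f" using prime_divisorsD(1) that by blast
    then show "of_nat n \<in> f" unfolding n(2) using that algebraic_int_cj[OF assms(2)] by (intro submodD(6))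
  qed
  then show ?thesis by blast
qed

text \<open>Let \<open>\<beta>\<close> generate \<open>J\<close>, with
  \<open>c = of_nat d * \<beta>\<close> integral. Membership in the ray gives a unit
  \<open>u\<close> with \<open>u * \<beta> = a / b\<close> and \<open>a - b \<in> f\<close>, so
  \<open>f\<close> contains \<open>of_nat d - u * c\<close>. These finitely many numbers are nonzero
  because \<open>J \<noteq> OK\<close>, and each lies only in primes of bounded norm.\<close>

lemma not_in_ray:
  assumes J: "fractional_ideal J" "J \<noteq> OK"
  shows "\<exists>C. \<forall>f\<in>prime_divisors. ideal_norm f > C \<longrightarrow> J \<notin> ray f"
proof (cases "\<exists>\<beta>. J = principal_ideal \<beta>")
  case False
  then show ?thesis by (auto simp: ray_def)
next
  case True
  then obtain \<beta> where \<beta>: "J = principal_ideal \<beta>" by blast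
  have \<beta>0: "\<beta> \<noteq> 0" using J(1) \<beta> principal_ideal_0 by (auto simp: fractional_ideal_iff)
  obtain d where d: "d > 0" "algebraic_int (of_nat d * \<beta>)" using denom_int[of \<beta>] by blast
  define c where "c = of_nat d * \<beta>"
  let ?U = "{u :: 'k. algebraic_int u \<and> algebraic_int (1 / u) \<and> u \<noteq> 0}"
  have ne: "of_nat d - u * c \<noteq> 0" if u: "u \<in> ?U" for u
  proof
    assume "of_nat d - u * c = 0"
    then have "of_nat d * (1 - u * \<beta>) = 0" by (simp add: c_def algebra_simps)
    then have "u * \<beta> = 1" using d(1) by simp
    then have "principal_ideal u \<bullet>\<^sub>i J = OK" unfolding \<beta> by (simp add: iprod_principal_principal principal_1)
    moreover have "principal_ideal u = OK"
    proof
      show "principal_ideal u \<subseteq> OK" using u algebraic_int_mult by (auto simp: principal_ideal_mem)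
      show "OK \<subseteq> principal_ideal u"
      proof
        fix x assume "x \<in> OK"
        then have "algebraic_int (x * (1 / u))" using u by (auto simp del: times_divide_eq_right intro: algebraic_int_mult)
        then show "x \<in> principal_ideal u" unfolding principal_ideal_mem using u by (intro exI[of _ "x * (1 / u)"]) auto
      qed
    qed
    ultimately show False using J iprod_OK[OF fractional_submod[OF J(1)]] by simp
  qed
  have "\<forall>u\<in>?U. \<exists>C. \<forall>f\<in>prime_divisors. of_nat d - u * c \<in> f \<longrightarrow> ideal_norm f \<le> C"
  proof
    fix u assume u: "u \<in> ?U"
    have "algebraic_int (of_nat d - u * c)" using u d by (intro algebraic_int_diff algebraic_int_mult) (auto simp: c_def)
    then show "\<exists>C. \<forall>f\<in>prime_divisors. of_nat d - u * c \<in> f \<longrightarrow> ideal_norm f \<le> C"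
      using nonzero_mem_prime_bound[OF ne[OF u]] by blast
  qed
  then obtain C where C: "\<And>u f. u \<in> ?U \<Longrightarrow> f \<in> prime_divisors \<Longrightarrow> of_nat d - u * c \<in> f \<Longrightarrow> ideal_norm f \<le> C u" by metis
  have fin: "finite (C ` ?U)" using finite_units by simp
  have "ideal_norm f \<le> Max (C ` ?U)" if f: "f \<in> prime_divisors" "J \<in> ray f" for f
  proof -
    note F = prime_divisorsD[OF f(1)]
    obtain a b where ab: "algebraic_int a" "algebraic_int b" "a \<notin> f" "b \<notin> f" "a - b \<in> f" "J = principal_ideal (a / b)"
      using f(2) unfolding ray_def cong_one_iff[OF f(1)] by blast
    have z: "a \<noteq> 0" "b \<noteq> 0" using ab submodD(1)[OF F(1)] by auto
    define u where "u = a / b / \<beta>"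
    have quot: "algebraic_int (\<alpha> / \<gamma>)" if eq: "principal_ideal \<alpha> = principal_ideal \<gamma>" and \<gamma>: "\<gamma> \<noteq> 0" for \<alpha> \<gamma> :: 'k
    proof -
      have "\<alpha> \<in> principal_ideal \<gamma>" unfolding eq[symmetric] principal_ideal_mem by (intro exI[of _ 1]) auto
      then obtain x where "algebraic_int x" "\<alpha> = \<gamma> * x" unfolding principal_ideal_mem by blast
      then show ?thesis using \<gamma> by simp
    qed
    have eq: "principal_ideal (a / b) = principal_ideal \<beta>" using ab(6) \<beta> by simp
    have "algebraic_int u" unfolding u_def by (rule quot[OF eq \<beta>0])
    moreover have "algebraic_int (\<beta> / (a / b))" by (rule quot[OF eq[symmetric]]) (use z in simp)
    then have "algebraic_int (1 / u)" using z \<beta>0 by (simp add: u_def field_simps)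
    moreover have "u \<noteq> 0" using z \<beta>0 by (simp add: u_def)
    ultimately have u: "u \<in> ?U" by blast
    have ua: "u * c * b = of_nat d * a" using z \<beta>0 by (simp add: u_def c_def)
    have "b * (of_nat d - u * c) = of_nat d * (- (a - b))" using ua by (simp add: algebra_simps)
    also have "\<dots> \<in> f" using submodD(4)[OF F(1) ab(5)] by (intro submodD(3)[OF F(1)]) auto
    finally have "b * (of_nat d - u * c) \<in> f" .
    moreover have "algebraic_int (of_nat d - u * c)" using u d by (intro algebraic_int_diff algebraic_int_mult) (auto simp: c_def)
    ultimately have "of_nat d - u * c \<in> f" using F(5) ab(2,4) by blast
    then have "ideal_norm f \<le> C u" using C u f(1) by blast
    also have "\<dots> \<le> Max (C ` ?U)" using fin u by (intro Max_ge) auto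
    finally show ?thesis .
  qed
  then show ?thesis by (metis not_less)
qed

end

section \<open>Averages of characters\<close>

lemma real_embeddings_of_nat: "\<tau> \<in> real_embeddings \<Longrightarrow> \<tau> (of_nat n) = real n"
proof (induction n)
  case 0
  have "\<tau> (0 + 0) = \<tau> 0 + \<tau> 0" using 0 unfolding real_embeddings_def ring_hom_def by (simp del: add_0 add_0_right)
  then show ?case by simp
next
  case (Suc n)
  have "\<tau> (1 + of_nat n) = \<tau> 1 + \<tau> (of_nat n)" "\<tau> 1 = 1"
    using Suc(2) unfolding real_embeddings_def ring_hom_def by auto
  then show ?case using Suc by simp
qed

context quad_field
begin

section \<open>Primitive characters among all characters of a given modulus\<close>

definition ray_chars :: "'k set \<Rightarrow> ('k set \<Rightarrow> complex) set" where
  "ray_chars f = {\<psi>. ray_class_character f \<psi> \<and> trivial_at_infinity f \<psi>}"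

lemma ray_chars_eq:
  assumes f: "(f :: 'k set) \<in> prime_divisors" and fi: "finite_index (ideal_group f) (ray f) \<kappa>"
  shows "ray_chars f = finite_index.chars (ideal_group f) (ray f)"
proof -
  interpret finite_index "ideal_group f" "ray f" \<kappa> by (rule fi)
  show ?thesis
    unfolding chars_def char_on_def ray_chars_def ray_class_character_def trivial_at_infinity_def hom_def
    unfolding ray_def by (auto simp: Pi_iff)
qed

lemma char_family_subset: "char_family f \<subseteq> ray_chars f"
  by (auto simp: char_family_def primitive_character_def ray_chars_def)

text \<open>An imprimitive character comes from a character of modulus \<open>1\<close>, hence is trivial on all
  principal ideals generated by positive integers.\<close>

lemma imprimitive_trivial:
  assumes f: "(f :: 'k set) \<in> prime_divisors" and \<psi>: "\<psi> \<in> ray_chars f" "\<psi> \<notin> char_family f"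
    and i: "i > 0" "of_nat i \<notin> f"
  shows "\<psi> (principal_ideal (of_nat i)) = 1"
proof -
  obtain g \<psi>' where g: "ideal g ring_of_integers" "f \<subset> g" "ray_class_character g \<psi>'"
    "\<And>J. J \<in> carrier (ideal_group f) \<Longrightarrow> \<psi> J = \<psi>' J"
    using \<psi> by (auto simp: char_family_def primitive_character_def ray_chars_def)
  have gi: "submod g" "g \<subseteq> OK" using g(1) by (auto simp: ideal_iff)
  \<comment> \<open>A proper divisor of the prime ideal \<open>f\<close> can only be the unit ideal,
    so the smaller modulus imposes no congruence.\<close>
  have "1 \<in> g" by (rule prime_maximal[OF f gi g(2)])
  then have gO: "g = OK" using submodD(3)[OF gi(1), of _ 1] gi(2) by auto
  have cop: "coprime_ideal g (principal_ideal (of_nat j :: 'k))" if "j > 0" for j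
  proof -
    have "principal_ideal (of_nat j :: 'k) \<subseteq> OK" using algebraic_int_mult by (auto simp: principal_ideal_mem)
    moreover have "principal_ideal (of_nat j :: 'k) <+>\<^bsub>ring_of_integers\<^esub> OK = OK"
    proof
      show "principal_ideal (of_nat j :: 'k) <+>\<^bsub>ring_of_integers\<^esub> OK \<subseteq> OK"
        using calculation by (auto simp: set_add_def set_mult_def intro: algebraic_int_add)
      have "0 \<in> principal_ideal (of_nat j :: 'k)" by (rule submodD(1)[OF submod_principal])
      then show "OK \<subseteq> principal_ideal (of_nat j :: 'k) <+>\<^bsub>ring_of_integers\<^esub> OK"
        by (force simp: set_add_def set_mult_def)
    qed
    ultimately show ?thesis using submod_principal principal_nonzero[of "of_nat j"] that
      by (simp add: coprime_ideal_def ideal_iff gO)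
  qed
  have "cong_one g (of_nat i)" unfolding cong_one_def
  proof (rule bexI[of _ "of_nat i"], rule bexI[of _ 1], intro conjI)
    show "coprime_ideal g (principal_ideal 1)" using cop[of 1] by simp
    show "of_nat i - 1 \<in> g" unfolding gO by (auto intro: algebraic_int_diff)
  qed (use cop i in auto)
  moreover have "totally_positive (of_nat i :: 'k)" using i by (simp add: totally_positive_def real_embeddings_of_nat)
  ultimately have "\<psi>' (principal_ideal (of_nat i)) = 1" using g(3) by (simp add: ray_class_character_def)
  moreover have "principal_ideal (of_nat i) \<in> carrier (ideal_group f)"
    using prime_to_carrier[OF f] prime_to_principal[OF f] i by simp
  ultimately show ?thesis using g(4) by simp
qed

lemma ray_chars_facts:
  assumes f: "(f :: 'k set) \<in> prime_divisors"
  shows "finite (ray_chars f)" "\<psi> \<in> ray_chars f \<Longrightarrow> J \<in> carrier (ideal_group f) \<Longrightarrow> norm (\<psi> J) = 1"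
    "\<psi> \<in> ray_chars f \<Longrightarrow> norm (\<psi> J) \<le> 1"
proof -
  obtain \<kappa> :: "'k set \<Rightarrow> 'k set \<times> (int \<times> int) \<times> (int \<times> int)" where fi: "finite_index (ideal_group f) (ray f) \<kappa>"
    using finite_index_ideal_group[OF f] by blast
  interpret finite_index "ideal_group f" "ray f" \<kappa> by (rule fi)
  show "finite (ray_chars f)" using finite_chars ray_chars_eq[OF f fi] by simp
  show 1: "\<psi> \<in> ray_chars f \<Longrightarrow> J \<in> carrier (ideal_group f) \<Longrightarrow> norm (\<psi> J) = 1"
    using norm_chars ray_chars_eq[OF f fi] by simp
  show "\<psi> \<in> ray_chars f \<Longrightarrow> norm (\<psi> J) \<le> 1"
    using 1 by (cases "J \<in> carrier (ideal_group f)") (auto simp: ray_chars_def ray_class_character_def)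
qed

lemma finite_char_family: "(f :: 'k set) \<in> prime_divisors \<Longrightarrow> finite (char_family f)"
  using finite_subset[OF char_family_subset] ray_chars_facts(1) by blast

lemma principal_quotient_ne_OK:
  assumes "i > 0" "j > 0" "i \<noteq> j" shows "principal_ideal (of_nat i / of_nat j :: 'k) \<noteq> OK"
proof
  assume eq: "principal_ideal (of_nat i / of_nat j :: 'k) = OK"
  have dvd: "b dvd a" if "algebraic_int (of_nat a / of_nat b :: 'k)" "b > 0" for a b
  proof -
    have "algebraic_int (of_rat (of_nat a / of_nat b) :: 'k)" using that by (simp add: of_rat_divide)
    then have "rat_of_nat a / of_nat b \<in> \<int>" by (rule of_rat_algebraic_int)
    then obtain m where "rat_of_nat a / of_nat b = of_int m" by (auto elim: Ints_cases)
    then have "rat_of_int (int a) = of_int (m * int b)" using that(2) by (simp add: field_simps)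
    then have "int a = m * int b" by (simp only: of_int_eq_iff)
    then have "int b dvd int a" by simp
    then show ?thesis by simp
  qed
  have "of_nat i / of_nat j \<in> principal_ideal (of_nat i / of_nat j :: 'k)" unfolding principal_ideal_mem
    by (intro exI[of _ 1]) auto
  then have "j dvd i" using eq dvd assms by simp
  have "(1 :: 'k) \<in> principal_ideal (of_nat i / of_nat j)" unfolding eq by simp
  then obtain a where a: "algebraic_int a" "1 = of_nat i / of_nat j * (a :: 'k)" unfolding principal_ideal_mem by blast
  then have "a = of_nat j / of_nat i" using assms by (simp add: field_simps)
  then have "i dvd j" using dvd a assms by simp
  then show False using \<open>j dvd i\<close> assms dvd_antisym by blast
qed

text \<open>For large \<open>f\<close> the ideals generated by \<open>1, ..., k\<close> lie in
  \<open>k\<close> different ray classes, and imprimitive characters are trivial on all of them;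
  \<open>card_chars_trivial_on\<close> then bounds their proportion by \<open>1 / k\<close>.\<close>

lemma many_primitive_characters:
  assumes k: "k > 0"
  shows "\<exists>C. \<forall>f\<in>prime_divisors. ideal_norm (f :: 'k set) > C \<longrightarrow>
    ray_chars f \<noteq> {} \<and> k * card (ray_chars f - char_family f) \<le> card (ray_chars f)"
proof -
  have "\<forall>i\<in>{1..k}. \<exists>C. \<forall>f\<in>prime_divisors. (of_nat i :: 'k) \<in> f \<longrightarrow> ideal_norm f \<le> C"
    by (intro ballI nonzero_mem_prime_bound) auto
  then obtain C1 where C1: "\<And>i f. i \<in> {1..k} \<Longrightarrow> f \<in> prime_divisors \<Longrightarrow> (of_nat i :: 'k) \<in> f \<Longrightarrow> ideal_norm f \<le> C1 i" by metis
  let ?P = "{(i, j). i \<in> {1..k} \<and> j \<in> {1..k} \<and> i \<noteq> j}"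
  have "\<forall>p\<in>?P. \<exists>C. \<forall>f\<in>prime_divisors. ideal_norm (f :: 'k set) > C \<longrightarrow> principal_ideal (of_nat (fst p) / of_nat (snd p)) \<notin> ray f"
  proof
    fix p assume p: "p \<in> ?P"
    show "\<exists>C. \<forall>f\<in>prime_divisors. ideal_norm (f :: 'k set) > C \<longrightarrow> principal_ideal (of_nat (fst p) / of_nat (snd p)) \<notin> ray f"
    proof (rule not_in_ray)
      show "fractional_ideal (principal_ideal (of_nat (fst p) / of_nat (snd p) :: 'k))"
        by (rule fractional_ideal_principal) (use p in auto)
      show "principal_ideal (of_nat (fst p) / of_nat (snd p) :: 'k) \<noteq> OK"
        by (rule principal_quotient_ne_OK) (use p in auto)
    qed
  qed
  from bchoice[OF this] obtain C2 where "\<forall>p\<in>?P. \<forall>f\<in>prime_divisors. ideal_norm (f :: 'k set) > C2 p \<longrightarrow>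
    principal_ideal (of_nat (fst p) / of_nat (snd p)) \<notin> ray f" by blast
  then have C2: "\<And>p f. p \<in> ?P \<Longrightarrow> f \<in> prime_divisors \<Longrightarrow> ideal_norm (f :: 'k set) > C2 p \<Longrightarrow>
    principal_ideal (of_nat (fst p) / of_nat (snd p)) \<notin> ray f" by blast
  define C where "C = Max (insert 0 (C1 ` {1..k} \<union> C2 ` ?P))"
  have finP: "finite ?P" by (rule finite_subset[of _ "{1..k} \<times> {1..k}"]) auto
  have le1: "C1 i \<le> C" if "i \<in> {1..k}" for i unfolding C_def using that finP by (intro Max_ge) auto
  have le2: "C2 p \<le> C" if "p \<in> ?P" for p unfolding C_def using that finP by (intro Max_ge) auto
  show ?thesis
  proof (intro exI[of _ C] ballI impI conjI)
    fix f :: "'k set" assume f: "f \<in> prime_divisors" and nf: "ideal_norm f > C"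
    obtain \<kappa> :: "'k set \<Rightarrow> 'k set \<times> (int \<times> int) \<times> (int \<times> int)" where fi: "finite_index (ideal_group f) (ray f) \<kappa>"
      using finite_index_ideal_group[OF f] by blast
    interpret finite_index "ideal_group f" "ray f" \<kappa> by (rule fi)
    have notin: "of_nat i \<notin> f" if "i \<in> {1..k}" for i using C1[OF that f] le1[OF that] nf by fastforce
    have eq: "ray_chars f = chars" by (rule ray_chars_eq[OF f fi])
    have "(\<lambda>J. if J \<in> carrier (ideal_group f) then 1 else 0) \<in> chars"
      using subgroup.subset[OF subgroup_N] m_closed by (auto simp: chars_def char_on_def)
    then show "ray_chars f \<noteq> {}" unfolding eq by blast
    define A where "A = (\<lambda>i. principal_ideal (of_nat i :: 'k)) ` {1..k}"
    have inv: "principal_ideal (of_nat i) \<otimes>\<^bsub>ideal_group f\<^esub> inv\<^bsub>ideal_group f\<^esub> (principal_ideal (of_nat j)) = principal_ideal (of_nat i / of_nat j)"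
      if "j \<in> {1..k}" for i j
      using principal_div_carrier(2)[OF f, of "of_nat j" 1] notin[OF that] prime_divisorsD(4)[OF f]
      by (simp add: iprod_principal_principal)
    have car: "principal_ideal (of_nat i) \<in> carrier (ideal_group f)" if "i \<in> {1..k}" for i
      using prime_to_carrier[OF f] prime_to_principal[OF f] notin[OF that] by simp
    have not: "principal_ideal (of_nat i / of_nat j) \<notin> ray f" if "i \<in> {1..k}" "j \<in> {1..k}" "i \<noteq> j" for i j
      using C2[of "(i, j)" f] le2[of "(i, j)"] that f nf by auto
    have inj: "inj_on (\<lambda>i. principal_ideal (of_nat i :: 'k)) {1..k}"
    proof (rule inj_onI, rule ccontr)
      fix i j assume ij: "i \<in> {1..k}" "j \<in> {1..k}" "principal_ideal (of_nat i :: 'k) = principal_ideal (of_nat j)" "i \<noteq> j"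
      have "principal_ideal (of_nat i / of_nat j :: 'k) = principal_ideal (of_nat j / of_nat j)"
        using inv[OF ij(2), of i] inv[OF ij(2), of j] ij(3) by simp
      then have "principal_ideal (of_nat i / of_nat j :: 'k) = OK" using ij(2) by (simp add: principal_1)
      then show False using principal_quotient_ne_OK[of i j] ij by simp
    qed
    have "card A * card {\<psi> \<in> chars. \<forall>a\<in>A. \<psi> a = 1} \<le> card chars"
    proof (rule card_chars_trivial_on)
      show "finite A" by (simp add: A_def)
      show "A \<subseteq> carrier (ideal_group f)" using car by (auto simp: A_def)
      fix a b assume ab: "a \<in> A" "b \<in> A" "a \<noteq> b"
      obtain i where i: "i \<in> {1..k}" "a = principal_ideal (of_nat i)" using ab(1) unfolding A_def by blast
      obtain j where j: "j \<in> {1..k}" "b = principal_ideal (of_nat j)" using ab(2) unfolding A_def by blast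
      have "i \<noteq> j" using ab(3) i j by blast
      then show "a \<otimes>\<^bsub>ideal_group f\<^esub> inv\<^bsub>ideal_group f\<^esub> b \<notin> ray f" using not[OF i(1) j(1)] inv[OF j(1), of i] unfolding i j by simp
    qed
    moreover have "card A = k" using inj by (simp add: A_def card_image)
    moreover have "card (ray_chars f - char_family f) \<le> card {\<psi> \<in> chars. \<forall>a\<in>A. \<psi> a = 1}"
    proof (rule card_mono)
      show "finite {\<psi> \<in> chars. \<forall>a\<in>A. \<psi> a = 1}" using finite_chars by simp
      show "ray_chars f - char_family f \<subseteq> {\<psi> \<in> chars. \<forall>a\<in>A. \<psi> a = 1}"
        using imprimitive_trivial[OF f] notin by (auto simp: eq A_def)
    qed
    ultimately show "k * card (ray_chars f - char_family f) \<le> card (ray_chars f)"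
      unfolding eq using mult_le_mono2 order_trans by blast
  qed
qed

text \<open>The sum over all characters of modulus \<open>f\<close> vanishes, so the sum over the
  family is minus the sum over the imprimitive ones. Their number is at most
  \<open>1 / (k - 1)\<close> times the number of primitive ones.\<close>

lemma char_family_average:
  assumes J: "fractional_ideal J" "J \<noteq> OK" and k: "k > 1"
  shows "\<exists>C. \<forall>f\<in>prime_divisors. ideal_norm (f :: 'k set) > C \<and> J \<in> carrier (ideal_group f) \<longrightarrow>
    norm ((\<Sum>\<psi>\<in>char_family f. \<psi> J) / of_nat (card (char_family f))) \<le> 1 / (real k - 1)"
proof -
  obtain C1 where C1: "\<And>f. f \<in> prime_divisors \<Longrightarrow> ideal_norm (f :: 'k set) > C1 \<Longrightarrow>
    ray_chars f \<noteq> {} \<and> k * card (ray_chars f - char_family f) \<le> card (ray_chars f)"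
    using many_primitive_characters[of k] k by auto
  obtain C2 where C2: "\<And>f. f \<in> prime_divisors \<Longrightarrow> ideal_norm f > C2 \<Longrightarrow> J \<notin> ray f"
    using not_in_ray[OF J] by blast
  have "norm ((\<Sum>\<psi>\<in>char_family f. \<psi> J) / of_nat (card (char_family f))) \<le> 1 / (real k - 1)"
    if f: "(f :: 'k set) \<in> prime_divisors" and nf: "ideal_norm f > max C1 C2" and Jf: "J \<in> carrier (ideal_group f)" for f
  proof -
    obtain \<kappa> :: "'k set \<Rightarrow> 'k set \<times> (int \<times> int) \<times> (int \<times> int)" where fi: "finite_index (ideal_group f) (ray f) \<kappa>"
      using finite_index_ideal_group[OF f] by blast
    interpret finite_index "ideal_group f" "ray f" \<kappa> by (rule fi)
    have eq: "ray_chars f = chars" by (rule ray_chars_eq[OF f fi])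
    let ?Y = "ray_chars f - char_family f"
    have fin: "finite (ray_chars f)" by (rule ray_chars_facts(1)[OF f])
    have "(\<Sum>\<psi>\<in>ray_chars f. \<psi> J) = 0" unfolding eq by (rule sum_chars[OF Jf C2[OF f]]) (use nf in simp)
    then have "(\<Sum>\<psi>\<in>char_family f. \<psi> J) = - (\<Sum>\<psi>\<in>?Y. \<psi> J)"
      using sum.subset_diff[OF char_family_subset[of f] fin, of "\<lambda>\<psi>. \<psi> J"] by (simp add: add_eq_0_iff)
    then have "norm (\<Sum>\<psi>\<in>char_family f. \<psi> J) \<le> (\<Sum>\<psi>\<in>?Y. norm (\<psi> J))" by (simp add: norm_sum)
    also have "\<dots> \<le> (\<Sum>\<psi>\<in>?Y. 1)" by (intro sum_mono ray_chars_facts(3)[OF f]) auto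
    finally have le: "norm (\<Sum>\<psi>\<in>char_family f. \<psi> J) \<le> real (card ?Y)" by simp
    have X: "ray_chars f \<noteq> {}" "k * card ?Y \<le> card (ray_chars f)" using C1[OF f] nf by auto
    have card: "card (ray_chars f) = card (char_family f) + card ?Y"
      using card_Diff_subset[OF finite_char_family[OF f] char_family_subset] card_mono[OF fin char_family_subset] by simp
    have "real k * real (card ?Y) \<le> real (card (char_family f)) + real (card ?Y)"
      using X(2) unfolding card by (metis of_nat_add of_nat_le_iff of_nat_mult)
    then have le2: "(real k - 1) * real (card ?Y) \<le> real (card (char_family f))" by (simp add: algebra_simps)
    show ?thesis
    \<comment> \<open>An empty family has average \<open>0\<close>, division by zero being
      \<open>0\<close>.\<close>
    proof (cases "card (char_family f) = 0")
      case False
      have "norm ((\<Sum>\<psi>\<in>char_family f. \<psi> J) / of_nat (card (char_family f))) \<le> real (card ?Y) / real (card (char_family f))"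
        using le by (simp add: norm_divide divide_right_mono)
      also have "\<dots> \<le> 1 / (real k - 1)" using le2 False k by (simp add: field_simps)
      finally show ?thesis .
    qed (use k in simp)
  qed
  then show ?thesis by (intro exI[of _ "max C1 C2"]) blast
qed

lemma char_family_nonempty:
  "\<exists>C. \<forall>f\<in>prime_divisors. ideal_norm (f :: 'k set) > C \<longrightarrow> char_family f \<noteq> {}"
proof -
  obtain C where C: "\<And>f. f \<in> prime_divisors \<Longrightarrow> ideal_norm (f :: 'k set) > C \<Longrightarrow>
    ray_chars f \<noteq> {} \<and> 2 * card (ray_chars f - char_family f) \<le> card (ray_chars f)"
    using many_primitive_characters[of 2] by auto
  have "char_family f \<noteq> {}" if f: "f \<in> prime_divisors" "ideal_norm f > C" for f :: "'k set"
  proof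
    assume "char_family f = {}"
    then have "card (ray_chars f) = 0" using C[OF f] by simp
    then show False using C[OF f] ray_chars_facts(1)[OF f(1)] by simp
  qed
  then show ?thesis by blast
qed

text \<open>Of the product of the primes in \<open>A\<close> it is recorded only which primes
  contain it. For multisets without a common prime this already tells the products apart, so unique
  factorisation is avoided.\<close>

lemma ideal_of_multiset:
  assumes "set_mset A \<subseteq> prime_divisors"
  shows "\<exists>I. submod I \<and> I \<subseteq> OK \<and> I \<noteq> {0} \<and> (\<forall>P\<in>#A. I \<subseteq> P) \<and> (\<forall>Q\<in>prime_divisors. I \<subseteq> Q \<longrightarrow> Q \<in># A) \<and>
    (\<forall>f\<in>prime_divisors. f \<notin># A \<longrightarrow> (\<forall>\<psi>\<in>ray_chars f. (\<Prod>P\<in>#A. \<psi> P) = \<psi> I))"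
  using assms
proof (induction A)
  case empty
  have "\<psi> OK = 1" if f: "f \<in> prime_divisors" and \<psi>: "\<psi> \<in> ray_chars f" for f \<psi>
  proof -
    have c: "OK \<in> carrier (ideal_group f)" using prime_to_carrier[OF f prime_to_OK[OF f]] .
    have "\<psi> (OK \<bullet>\<^sub>i OK) = \<psi> OK * \<psi> OK"
      using \<psi> c unfolding ray_chars_def ray_class_character_def hom_def by auto
    moreover have "\<psi> OK \<noteq> 0" using ray_chars_facts(2)[OF f \<psi> c] by auto
    ultimately show ?thesis using iprod_OK[OF submod_OK] by simp
  qed
  then show ?case using submod_OK OK_nonzero prime_divisorsD(4) by (intro exI[of _ OK]) auto
next
  case (add P A)
  then obtain I where I: "submod I" "I \<subseteq> OK" "I \<noteq> {0}" "\<forall>P\<in>#A. I \<subseteq> P" "\<forall>Q\<in>prime_divisors. I \<subseteq> Q \<longrightarrow> Q \<in># A"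
    "\<forall>f\<in>prime_divisors. f \<notin># A \<longrightarrow> (\<forall>\<psi>\<in>ray_chars f. (\<Prod>P\<in>#A. \<psi> P) = \<psi> I)" by auto
  have P: "P \<in> prime_divisors" using add by auto
  note DP = prime_divisorsD[OF P]
  let ?I = "P \<bullet>\<^sub>i I"
  have sub: "?I \<subseteq> P" "?I \<subseteq> I"
  proof -
    show "?I \<subseteq> P" by (rule iprod_subset) (use submodD(2,6)[OF DP(1)] I(2) in auto)
    show "?I \<subseteq> I" by (rule iprod_subset) (use submodD(2,3)[OF I(1)] DP(2) in auto)
  qed
  have pr: "Q \<in># add_mset P A" if Q: "Q \<in> prime_divisors" "?I \<subseteq> Q" for Q
  proof (cases "P \<subseteq> Q")
    case True
    then show ?thesis using prime_subset_eq[OF P Q(1)] by simp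
  next
    case False
    then obtain p where p: "p \<in> P" "p \<notin> Q" by blast
    have "I \<subseteq> Q"
    proof
      fix x assume x: "x \<in> I"
      then have "p * x \<in> Q" using iprod_mult[OF p(1) x] Q(2) by blast
      then show "x \<in> Q" using prime_divisorsD(5)[OF Q(1), of p x] p x DP(2) I(2) by auto
    qed
    then show ?thesis using I(5) Q by simp
  qed
  have val: "(\<Prod>P\<in>#add_mset P A. \<psi> P) = \<psi> ?I" if f: "f \<in> prime_divisors" "f \<notin># add_mset P A" "\<psi> \<in> ray_chars f" for f \<psi>
  proof -
    have "\<not> P \<subseteq> f" using prime_subset_eq[OF P f(1)] f(2) by auto
    then have "P \<in> carrier (ideal_group f)" using DP by (intro prime_to_carrier[OF f(1)]) (auto simp: prime_to_def)
    moreover have "\<not> I \<subseteq> f" using I(5) f by auto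
    then have "I \<in> carrier (ideal_group f)" using I by (intro prime_to_carrier[OF f(1)]) (auto simp: prime_to_def)
    ultimately have "\<psi> ?I = \<psi> P * \<psi> I" using f(3) unfolding ray_chars_def ray_class_character_def hom_def by auto
    then show ?thesis using I(6) f by auto
  qed
  show ?case
  proof (intro exI[of _ ?I] conjI)
    show "\<forall>Pa\<in>#add_mset P A. ?I \<subseteq> Pa" using sub I(4) by auto
    show "submod ?I" by (rule submod_iprod[OF DP(1) I(1)])
    show "?I \<subseteq> OK" using sub DP by blast
    show "?I \<noteq> {0}" by (rule iprod_nonzero[OF DP(1) I(1) DP(3) I(3)])
  qed (use pr val in auto)
qed

lemma torus_monomial_cancel:
  assumes "\<And>P. P \<in># C \<Longrightarrow> norm (t P) = 1"
  shows "torus_monomial (A + C) (B + C) t = torus_monomial A B t"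
  using assms
proof (induction C)
  case empty
  then show ?case by simp
next
  case (add P C)
  have "t P * cnj (t P) = 1" using add(2)[of P] by (metis add_mset_commute complex_norm_square multi_member_this of_real_1 power_one union_single_eq_member add_mset_add_single)
  then have "torus_monomial (A + add_mset P C) (B + add_mset P C) t = torus_monomial (A + C) (B + C) t"
    by (simp add: torus_monomial_def algebra_simps)
  then show ?case using add by simp
qed

text \<open>Once the norm of \<open>f\<close> exceeds those of the primes in the monomial, common
  primes cancel, as \<open>\<psi>\<close> is unimodular there. The remaining products
  \<open>I\<close> and \<open>K\<close> have no prime in common, so \<open>I\<close> divided by
  \<open>K\<close> is the unit ideal only if both multisets are empty. The monomial is the value of
  \<open>\<psi>\<close> at this quotient.\<close>

lemma monomial_average:
  assumes AB: "set_mset A \<subseteq> prime_divisors" "set_mset B \<subseteq> prime_divisors" and \<epsilon>: "\<epsilon> > 0"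
  shows "\<exists>C. \<forall>f\<in>prime_divisors. ideal_norm (f :: 'k set) > C \<longrightarrow>
    norm ((\<Sum>\<psi>\<in>char_family f. torus_monomial A B \<psi>) / of_nat (card (char_family f)) - (if A = B then 1 else 0)) \<le> \<epsilon>"
proof -
  obtain C0 where C0: "\<And>f. f \<in> prime_divisors \<Longrightarrow> ideal_norm (f :: 'k set) > C0 \<Longrightarrow> char_family f \<noteq> {}"
    using char_family_nonempty by blast
  define C1 where "C1 = Max (insert 0 (ideal_norm ` set_mset (A + B)))"
  have C1: "f \<notin># A + B" if "ideal_norm f > C1" for f
  proof
    assume "f \<in># A + B"
    then have "ideal_norm f \<le> C1" unfolding C1_def by (intro Max_ge) auto
    then show False using that by simp
  qed
  define A' where "A' = A - A \<inter># B"
  define B' where "B' = B - A \<inter># B"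
  have A': "A = A' + A \<inter># B" and B': "B = B' + A \<inter># B" by (auto simp: A'_def B'_def multiset_eq_iff min_def)
  have unit: "norm (\<psi> P) = 1" if "f \<in> prime_divisors" "\<psi> \<in> char_family f" "P \<in> prime_divisors" "P \<noteq> f" for f P :: "'k set" and \<psi>
  proof -
    have "\<not> P \<subseteq> f" using prime_subset_eq[OF that(3,1)] that(4) by blast
    then have "P \<in> carrier (ideal_group f)" using prime_divisorsD[OF that(3)]
      by (intro prime_to_carrier[OF that(1)]) (auto simp: prime_to_def)
    then show ?thesis using ray_chars_facts(2)[OF that(1)] that(2) char_family_subset by blast
  qed
  have canc: "torus_monomial A B \<psi> = torus_monomial A' B' \<psi>"
    if f: "f \<in> prime_divisors" "ideal_norm f > C1" "\<psi> \<in> char_family f" for f \<psi>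
  proof -
    have "norm (\<psi> P) = 1" if "P \<in># A \<inter># B" for P
    proof (rule unit[OF f(1,3)])
      have "P \<in># A" using that by simp
      then show "P \<in> prime_divisors" "P \<noteq> f" using AB(1) C1[OF f(2)] by auto
    qed
    then have "torus_monomial (A' + A \<inter># B) (B' + A \<inter># B) \<psi> = torus_monomial A' B' \<psi>" by (rule torus_monomial_cancel)
    then show ?thesis using A' B' by simp
  qed
  show ?thesis
  proof (cases "A = B")
    case True
    then have e: "A' = {#}" "B' = {#}" by (simp_all add: A'_def B'_def)
    have "norm ((\<Sum>\<psi>\<in>char_family f. torus_monomial A B \<psi>) / of_nat (card (char_family f)) - (if A = B then 1 else 0)) \<le> \<epsilon>"
      if f: "f \<in> prime_divisors" "ideal_norm (f :: 'k set) > max C0 C1" for f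
    proof -
      have "(\<Sum>\<psi>\<in>char_family f. torus_monomial A B \<psi>) = (\<Sum>\<psi>\<in>char_family f. 1)"
        using canc f e by (intro sum.cong) (auto simp: torus_monomial_def)
      moreover have "card (char_family f) \<noteq> 0" using C0[OF f(1)] f finite_char_family by simp
      ultimately show ?thesis using True \<epsilon> by simp
    qed
    then show ?thesis by blast
  next
    case False
    have sub: "set_mset A' \<subseteq> prime_divisors" "set_mset B' \<subseteq> prime_divisors"
      using AB by (auto simp: A'_def B'_def dest: in_diffD)
    have disj: "P \<notin># B'" if "P \<in># A'" for P
    proof -
      have "count A P > min (count A P) (count B P)" using that by (simp add: A'_def in_diff_count)
      then show ?thesis by (simp add: B'_def in_diff_count min_def split: if_splits)
    qed
    obtain I where I: "submod I" "I \<subseteq> OK" "I \<noteq> {0}" "\<forall>P\<in>#A'. I \<subseteq> P" "\<forall>Q\<in>prime_divisors. I \<subseteq> Q \<longrightarrow> Q \<in># A'"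
      "\<forall>f\<in>prime_divisors. f \<notin># A' \<longrightarrow> (\<forall>\<psi>\<in>ray_chars f. (\<Prod>P\<in>#A'. \<psi> P) = \<psi> I)"
      using ideal_of_multiset[OF sub(1)] by auto
    obtain K where K: "submod K" "K \<subseteq> OK" "K \<noteq> {0}" "\<forall>P\<in>#B'. K \<subseteq> P" "\<forall>Q\<in>prime_divisors. K \<subseteq> Q \<longrightarrow> Q \<in># B'"
      "\<forall>f\<in>prime_divisors. f \<notin># B' \<longrightarrow> (\<forall>\<psi>\<in>ray_chars f. (\<Prod>P\<in>#B'. \<psi> P) = \<psi> K)"
      using ideal_of_multiset[OF sub(2)] by auto
    have "I \<noteq> K"
    proof
      assume "I = K"
      have "P \<in># B'" if "P \<in># A'" for P using that I(4) K(5) sub(1) \<open>I = K\<close> by (metis subsetD)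
      moreover have "P \<in># A'" if "P \<in># B'" for P using that K(4) I(5) sub(2) \<open>I = K\<close> by (metis subsetD)
      ultimately have "\<forall>P\<in>#A'. P \<in># B'" "\<forall>P\<in>#B'. P \<in># A'" by simp_all
      then have "A' = {#}" "B' = {#}" using disj by (metis multiset_nonemptyE)+
      then show False using False A' B' by simp
    qed
    obtain K' where K': "fractional_ideal K'" "K' \<bullet>\<^sub>i K = OK"
      using fractional_ideal_inverse[OF fractional_ideal_integral[OF K(1-3)]] by blast
    define J where "J = I \<bullet>\<^sub>i K'"
    have fJ: "fractional_ideal J" unfolding J_def by (intro fractional_ideal_iprod fractional_ideal_integral I K')
    have JO: "J \<noteq> OK"
    proof
      assume "J = OK"
      then have "OK \<bullet>\<^sub>i K = I \<bullet>\<^sub>i (K' \<bullet>\<^sub>i K)" by (simp add: J_def iprod_assoc[symmetric])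
      then show False using \<open>I \<noteq> K\<close> K'(2) iprod_OK[OF K(1)] iprod_OK_right[OF I(1)] by simp
    qed
    \<comment> \<open>Large enough to make \<open>1 / (real k - 1)\<close>, the bound of
      \<open>char_family_average\<close>, at most \<open>\<epsilon>\<close>.\<close>
    obtain k :: nat where k: "1 / \<epsilon> + 1 < real k" using reals_Archimedean2 by blast
    have k1: "k > 1" using k \<epsilon> by (metis less_add_same_cancel2 less_trans of_nat_1 of_nat_less_iff zero_less_divide_1_iff)
    have "1 / \<epsilon> \<le> real k - 1" using k by simp
    then have keps: "1 / (real k - 1) \<le> \<epsilon>" using \<epsilon> k1 by (simp add: field_simps)
    obtain C2 where C2: "\<And>f. f \<in> prime_divisors \<Longrightarrow> ideal_norm (f :: 'k set) > C2 \<Longrightarrow> J \<in> carrier (ideal_group f) \<Longrightarrow>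
      norm ((\<Sum>\<psi>\<in>char_family f. \<psi> J) / of_nat (card (char_family f))) \<le> 1 / (real k - 1)"
      using char_family_average[OF fJ JO k1] by blast
    have "norm ((\<Sum>\<psi>\<in>char_family f. torus_monomial A B \<psi>) / of_nat (card (char_family f)) - (if A = B then 1 else 0)) \<le> \<epsilon>"
      if f: "f \<in> prime_divisors" "ideal_norm (f :: 'k set) > max C1 C2" for f
    proof -
      have fA: "f \<notin># A'" "f \<notin># B'" using C1[of f] f by (auto simp: A'_def B'_def dest: in_diffD)
      interpret G: comm_group "ideal_group f" by (rule comm_group_ideal_group[OF f(1)])
      have IK: "I \<in> carrier (ideal_group f)" "K \<in> carrier (ideal_group f)"
      proof -
        have "\<not> I \<subseteq> f" "\<not> K \<subseteq> f" using I(5) K(5) fA f(1) by metis+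
        then have "prime_to f I" "prime_to f K" using I(1,2) K(1,2) by (simp_all add: prime_to_def)
        then show "I \<in> carrier (ideal_group f)" "K \<in> carrier (ideal_group f)"
          by (simp_all add: prime_to_carrier[OF f(1)])
      qed
      have K'i: "inv\<^bsub>ideal_group f\<^esub> K = K'"
      proof -
        have c: "inv\<^bsub>ideal_group f\<^esub> K \<bullet>\<^sub>i K = OK" using G.l_inv[OF IK(2)] by simp
        have fi: "submod (inv\<^bsub>ideal_group f\<^esub> K)" using G.inv_closed[OF IK(2)] fractional_submod
          by (simp add: carrier_ideal_group[OF f(1)])
        have "inv\<^bsub>ideal_group f\<^esub> K = inv\<^bsub>ideal_group f\<^esub> K \<bullet>\<^sub>i (K' \<bullet>\<^sub>i K)" using iprod_OK_right[OF fi] K'(2) by simp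
        also have "\<dots> = (inv\<^bsub>ideal_group f\<^esub> K \<bullet>\<^sub>i K) \<bullet>\<^sub>i K'" by (metis iprod_assoc iprod_commute)
        also have "\<dots> = K'" using c iprod_OK[OF fractional_submod[OF K'(1)]] by simp
        finally show ?thesis .
      qed
      have Jc: "J \<in> carrier (ideal_group f)"
        using G.m_closed[OF IK(1) G.inv_closed[OF IK(2)]] K'i by (simp add: J_def)
      have val: "torus_monomial A B \<psi> = \<psi> J" if \<psi>: "\<psi> \<in> char_family f" for \<psi>
      proof -
        have \<psi>X: "\<psi> \<in> ray_chars f" using \<psi> char_family_subset by blast
        have K'c: "K' \<in> carrier (ideal_group f)" using G.inv_closed[OF IK(2)] K'i by simp
        have hom: "\<psi> (x \<bullet>\<^sub>i y) = \<psi> x * \<psi> y" if "x \<in> carrier (ideal_group f)" "y \<in> carrier (ideal_group f)" for x y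
          using \<psi>X that unfolding ray_chars_def ray_class_character_def hom_def by auto
        have one: "\<psi> OK = 1"
        proof -
          have "OK \<in> carrier (ideal_group f)" using G.one_closed by simp
          then show ?thesis using hom[of OK OK] iprod_OK[OF submod_OK] ray_chars_facts(2)[OF f(1) \<psi>X, of OK] by auto
        qed
        have "\<psi> K' * \<psi> K = 1" using hom[OF K'c IK(2)] K'(2) one by simp
        moreover have "cnj (\<psi> K) * \<psi> K = 1" using ray_chars_facts(2)[OF f(1) \<psi>X IK(2)]
          by (metis complex_norm_square mult.commute of_real_1 power_one)
        moreover have "\<psi> K \<noteq> 0" using ray_chars_facts(2)[OF f(1) \<psi>X IK(2)] by auto
        ultimately have "cnj (\<psi> K) = \<psi> K'" by (metis mult_right_cancel)
        moreover have "(\<Prod>P\<in>#B'. cnj (\<psi> P)) = cnj (\<Prod>P\<in>#B'. \<psi> P)" by (induction B') auto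
        ultimately have "torus_monomial A' B' \<psi> = \<psi> I * \<psi> K'"
          using I(6) K(6) fA f(1) \<psi>X by (simp add: torus_monomial_def)
        then show ?thesis using canc[OF f(1) _ \<psi>] f(2) hom[OF IK(1) K'c] by (simp add: J_def)
      qed
      have "norm ((\<Sum>\<psi>\<in>char_family f. \<psi> J) / of_nat (card (char_family f))) \<le> \<epsilon>"
        using C2[OF f(1) _ Jc] f(2) keps by simp
      then show ?thesis using False val by simp
    qed
    then show ?thesis by blast
  qed
qed

end

section \<open>Averaging over the family\<close>

lemma norm_average_le:
  fixes f :: "'x \<Rightarrow> complex"
  assumes "\<And>x. x \<in> A \<Longrightarrow> norm (f x) \<le> b" "b \<ge> 0"
  shows "norm ((\<Sum>x\<in>A. f x) / of_nat (card A)) \<le> b"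
proof (cases "card A = 0")
  case False
  have "norm (\<Sum>x\<in>A. f x) \<le> of_nat (card A) * b" by (rule sum_norm_bound) (rule assms(1))
  then show ?thesis using False by (simp add: norm_divide divide_le_eq mult.commute)
qed (use assms(2) in simp)

lemma avg_upto_add: "avg_upto m (\<lambda>\<psi>. f \<psi> + g \<psi>) = avg_upto m f + avg_upto m g"
  by (simp add: avg_upto_def sum.distrib add_divide_distrib)

lemma avg_upto_cmult: "avg_upto m (\<lambda>\<psi>. c * f \<psi>) = c * avg_upto m f"
proof -
  have "(\<Sum>f'\<in>conductors m. (\<Sum>\<psi>\<in>char_family f'. c * f \<psi>) / of_nat (card (char_family f'))) =
    c * (\<Sum>f'\<in>conductors m. (\<Sum>\<psi>\<in>char_family f'. f \<psi>) / of_nat (card (char_family f')))"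
    by (simp add: sum_distrib_left)
  then show ?thesis by (simp add: avg_upto_def)
qed

lemma avg_upto_bound:
  assumes "\<And>\<psi> f. f \<in> prime_divisors \<Longrightarrow> \<psi> \<in> char_family f \<Longrightarrow> norm (\<phi> \<psi>) \<le> b" "b \<ge> 0"
  shows "norm (avg_upto m \<phi>) \<le> b"
  unfolding avg_upto_def by (intro norm_average_le) (auto simp: conductors_def assms)

lemma avg_upto_cong:
  assumes "\<And>\<psi> f. f \<in> prime_divisors \<Longrightarrow> \<psi> \<in> char_family f \<Longrightarrow> \<phi> \<psi> = \<phi>' \<psi>"
  shows "avg_upto m \<phi> = avg_upto m \<phi>'"
proof -
  have "(\<Sum>f\<in>conductors m. (\<Sum>\<psi>\<in>char_family f. \<phi> \<psi>) / of_nat (card (char_family f))) =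
    (\<Sum>f\<in>conductors m. (\<Sum>\<psi>\<in>char_family f. \<phi>' \<psi>) / of_nat (card (char_family f)))"
    by (intro sum.cong arg_cong2[where f="(/)"] refl) (auto simp: conductors_def assms)
  then show ?thesis by (simp add: avg_upto_def)
qed

context quad_field
begin

lemma card_conductors_unbounded: "\<exists>m0. \<forall>m\<ge>m0. n \<le> card (conductors m :: 'k set set)"
proof -
  obtain C where C: "\<And>f. f \<in> prime_divisors \<Longrightarrow> ideal_norm (f :: 'k set) > C \<Longrightarrow> char_family f \<noteq> {}"
    using char_family_nonempty by blast
  define S where "S = prime_divisors - {P :: 'k set. P \<in> prime_divisors \<and> ideal_norm P \<le> C}"
  have "infinite S" unfolding S_def using finite_primes_norm_le infinite_prime_divisors by (rule Diff_infinite_finite)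
  then obtain T where T: "finite T" "card T = n" "T \<subseteq> S" using infinite_arbitrarily_large by blast
  obtain m0 where m0: "ideal_norm ` T \<subseteq> {..m0}" using T(1) finite_nat_iff_bounded_le by blast
  have "n \<le> card (conductors m :: 'k set set)" if m: "m \<ge> m0" for m
  proof -
    have "T \<subseteq> conductors m"
    proof
      fix f assume f: "f \<in> T"
      then have "f \<in> prime_divisors" "ideal_norm f > C" "ideal_norm f \<le> m0" using T(3) m0 by (auto simp: S_def)
      then show "f \<in> conductors m" using C m by (simp add: conductors_def)
    qed
    moreover have "finite (conductors m :: 'k set set)"
      by (rule finite_subset[OF _ finite_primes_norm_le[of m]]) (auto simp: conductors_def)
    ultimately show ?thesis using card_mono T(2) by blast
  qed
  then show ?thesis by blast
qed

text \<open>A Cesaro argument: the finitely many conductors of norm at most \<open>C\<close>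
  contribute at most \<open>2 * card E\<close> to a sum that is divided by the unbounded number of
  conductors.\<close>

lemma average_tendsto:
  fixes g :: "'k set \<Rightarrow> complex"
  assumes b: "\<And>f. f \<in> prime_divisors \<Longrightarrow> norm (g f) \<le> 1" and c: "norm c \<le> 1"
    and l: "\<And>\<epsilon>. \<epsilon> > 0 \<Longrightarrow> \<exists>C. \<forall>f\<in>prime_divisors. ideal_norm f > C \<longrightarrow> norm (g f - c) \<le> \<epsilon>"
  shows "(\<lambda>m. (\<Sum>f\<in>conductors m. g f) / of_nat (card (conductors m :: 'k set set))) \<longlonglongrightarrow> c"
proof (rule LIMSEQ_I)
  fix \<epsilon> :: real assume \<epsilon>: "\<epsilon> > 0"
  then obtain C where C: "\<And>f. f \<in> prime_divisors \<Longrightarrow> ideal_norm f > C \<Longrightarrow> norm (g f - c) \<le> \<epsilon> / 2"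
    using l[of "\<epsilon> / 2"] by auto
  define E where "E = {P :: 'k set. P \<in> prime_divisors \<and> ideal_norm P \<le> C}"
  have E: "finite E" unfolding E_def by (rule finite_primes_norm_le)
  obtain n where n: "real n > 4 * card E / \<epsilon>" using reals_Archimedean2 by blast
  have n0: "n > 0"
  proof (rule ccontr)
    assume "\<not> n > 0"
    then have "4 * card E / \<epsilon> < 0" using n by simp
    then show False using \<epsilon> by (simp add: divide_less_0_iff)
  qed
  obtain m0 where m0: "\<And>m. m \<ge> m0 \<Longrightarrow> n \<le> card (conductors m :: 'k set set)" using card_conductors_unbounded by blast
  have "norm ((\<Sum>f\<in>conductors m. g f) / of_nat (card (conductors m :: 'k set set)) - c) < \<epsilon>" if m: "m \<ge> m0" for m
  proof -
    let ?S = "conductors m :: 'k set set"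
    let ?N = "real (card ?S)"
    have N: "?N > 4 * card E / \<epsilon>" "?N > 0" using n n0 m0[OF m] by auto
    have fS: "finite ?S" by (rule card_ge_0_finite) (use N(2) in simp)
    have SP: "f \<in> prime_divisors" if "f \<in> ?S" for f using that by (simp add: conductors_def)
    have "(\<Sum>f\<in>?S. g f) / of_nat (card ?S) - c = (\<Sum>f\<in>?S. g f - c) / of_nat (card ?S)"
      using N(2) by (simp add: sum_subtractf diff_divide_distrib)
    then have "norm ((\<Sum>f\<in>?S. g f) / of_nat (card ?S) - c) = norm (\<Sum>f\<in>?S. g f - c) / ?N" by (simp add: norm_divide)
    also have "norm (\<Sum>f\<in>?S. g f - c) \<le> (\<Sum>f\<in>?S. norm (g f - c))" by (rule norm_sum)
    also have "\<dots> \<le> (\<Sum>f\<in>?S. (if f \<in> E then 2 else 0) + \<epsilon> / 2)"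
    proof (rule sum_mono)
      fix f assume f: "f \<in> ?S"
      show "norm (g f - c) \<le> (if f \<in> E then 2 else 0) + \<epsilon> / 2"
      proof (cases "f \<in> E")
        case True
        then show ?thesis using norm_triangle_ineq4[of "g f" c] b[OF SP[OF f]] c \<epsilon> by simp
      next
        case False
        then show ?thesis using C[OF SP[OF f]] SP[OF f] by (simp add: E_def)
      qed
    qed
    also have "\<dots> = 2 * card (?S \<inter> E) + ?N * (\<epsilon> / 2)"
      using fS by (simp add: sum.distrib sum.If_cases Int_def)
    also have "\<dots> \<le> 2 * card E + ?N * (\<epsilon> / 2)" using card_mono[OF E, of "?S \<inter> E"] by simp
    finally have "norm ((\<Sum>f\<in>?S. g f) / of_nat (card ?S) - c) \<le> (2 * card E + ?N * (\<epsilon> / 2)) / ?N"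
      using N(2) by (simp add: divide_right_mono)
    also have "\<dots> < \<epsilon>" using N \<epsilon> by (simp add: field_simps)
    finally show ?thesis .
  qed
  then show "\<exists>m0. \<forall>m\<ge>m0. norm ((\<Sum>f\<in>conductors m. g f) / of_nat (card (conductors m :: 'k set set)) - c) < \<epsilon>" by blast
qed

lemma norm_character_le: "f \<in> prime_divisors \<Longrightarrow> \<psi> \<in> char_family f \<Longrightarrow> norm (\<psi> (J :: 'k set)) \<le> 1"
  using ray_chars_facts(3) char_family_subset by blast

lemma norm_prod_mset_le_1:
  assumes "\<And>x. x \<in># A \<Longrightarrow> norm (f x :: complex) \<le> 1" shows "norm (\<Prod>x\<in>#A. f x) \<le> 1"
  using assms
proof (induction A)
  case (add x A)
  then have "norm (f x) * norm (\<Prod>x\<in>#A. f x) \<le> 1 * 1" by (intro mult_mono) auto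
  then show ?case by (simp add: norm_mult)
qed simp

lemma avg_upto_monomial:
  assumes AB: "set_mset A \<subseteq> prime_divisors" "set_mset B \<subseteq> prime_divisors"
  shows "(\<lambda>m. avg_upto m (\<lambda>\<psi> :: 'k set \<Rightarrow> complex. torus_monomial A B \<psi>)) \<longlonglongrightarrow> (if A = B then 1 else 0)"
  unfolding avg_upto_def
proof (rule average_tendsto[OF _ _ monomial_average[OF AB]])
  fix f :: "'k set" assume f: "f \<in> prime_divisors"
  have "norm (torus_monomial A B \<psi>) \<le> 1" if \<psi>: "\<psi> \<in> char_family f" for \<psi>
  proof -
    have "norm (\<Prod>P\<in>#A. \<psi> P) * norm (\<Prod>P\<in>#B. cnj (\<psi> P)) \<le> 1 * 1"
      by (intro mult_mono norm_prod_mset_le_1) (auto simp: norm_character_le[OF f \<psi>])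
    then show ?thesis by (simp add: torus_monomial_def norm_mult)
  qed
  then show "norm ((\<Sum>\<psi>\<in>char_family f. torus_monomial A B \<psi>) / of_nat (card (char_family f))) \<le> 1"
    by (intro norm_average_le) auto
qed auto

text \<open>Countability comes from the finiteness of the primes of bounded norm. The order of the
  enumeration is arbitrary, which is harmless because the series converge absolutely.\<close>

lemma prime_enumeration:
  "\<exists>p :: nat \<Rightarrow> 'k set. bij_betw p UNIV prime_divisors \<and>
    (\<forall>\<sigma>>1. summable (\<lambda>n. real (ideal_norm (p n)) powr (- \<sigma>)))"
proof -
  have "countable (\<Union>m. {P :: 'k set. P \<in> prime_divisors \<and> ideal_norm P \<le> m})"
    by (rule countable_UN) (auto intro: countable_finite finite_primes_norm_le)
  moreover have "(\<Union>m. {P :: 'k set. P \<in> prime_divisors \<and> ideal_norm P \<le> m}) = prime_divisors" by auto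
  ultimately have "countable (prime_divisors :: 'k set set)" by simp
  then have p: "bij_betw (from_nat_into prime_divisors) UNIV (prime_divisors :: 'k set set)"
    using infinite_prime_divisors by (rule bij_betw_from_nat_into)
  have "summable (\<lambda>n. real (ideal_norm (from_nat_into prime_divisors n :: 'k set)) powr (- \<sigma>))" if "\<sigma> > 1" for \<sigma>
    using inverse_norm_summable[OF that] summable_on_reindex_bij_betw[OF p, of "\<lambda>P. real (ideal_norm P) powr (- \<sigma>)"]
    by (intro summable_on_imp_summable) simp
  then show ?thesis using p by blast
qed

theorem value_distribution:
  assumes \<sigma>: "\<sigma> > 1"
  shows "\<exists>M :: complex \<Rightarrow> real.
    C_infinity M \<and>
    (\<forall>w. M w \<ge> 0) \<and>
    integrable abs_dw M \<and> (LINT w|abs_dw. M w) = 1 \<and>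
    (\<forall>s. Re s = \<sigma> \<longrightarrow>
      (\<forall>\<Phi> :: complex \<Rightarrow> complex. continuous_on UNIV \<Phi> \<longrightarrow>
        integrable abs_dw (\<lambda>w. of_real (M w) * \<Phi> w) \<and>
        (\<lambda>m. avg_upto m (\<lambda>\<psi> :: 'k set \<Rightarrow> complex. \<Phi> (log_deriv_L' s \<psi>)))
          \<longlonglongrightarrow> (LINT w|abs_dw. of_real (M w) * \<Phi> w)))"
proof -
  obtain p :: "nat \<Rightarrow> 'k set" where p: "bij_betw p UNIV prime_divisors"
    and sm: "\<And>\<sigma>. \<sigma> > 1 \<Longrightarrow> summable (\<lambda>n. real (ideal_norm (p n)) powr (- \<sigma>))"
    using prime_enumeration by blast
  have pP: "p n \<in> prime_divisors" for n using p by (auto simp: bij_betw_def)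
  have inj: "inj p" using p by (simp add: bij_betw_def)
  define N where "N n = real (ideal_norm (p n))" for n
  have N2: "N n \<ge> 2" for n using ideal_norm_ge2[OF pP[of n]] by (simp add: N_def)
  define r where "r n = N n powr (- \<sigma>)" for n
  define l where "l n = (ln (N n))\<^sup>2" for n
  \<comment> \<open>Instantiated with zero coefficients to borrow the estimates for \<open>N\<close>
    alone.\<close>
  interpret E: euler_product N "\<lambda>_. 0" by standard (use N2 sm in \<open>auto simp: N_def\<close>)
  interpret T: torus_series r l
  proof
    fix n
    show "0 < r n" using N2[of n] by (simp add: r_def)
    show "r n \<le> 1 / 2" using E.N_powr_less[OF \<sigma>, of n] by (simp add: r_def)
    have "ln (N n) > 0" using N2[of n] by (intro ln_gt_zero) linarith
    then show "0 < l n" by (simp add: l_def)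
  next
    show "summable r" unfolding r_def[abs_def] by (rule E.summable_N[OF \<sigma>])
    show "summable (\<lambda>n. l n * r n)" unfolding r_def l_def by (rule E.summable_ln_power[OF \<sigma>])
  qed
  obtain M where M: "C_infinity M" "\<forall>w. M w \<ge> 0" "integrable abs_dw M" "(LINT w|abs_dw. M w) = 1"
    "\<And>\<Phi> :: complex \<Rightarrow> complex. continuous_on UNIV \<Phi> \<Longrightarrow> integrable abs_dw (\<lambda>w. of_real (M w) * \<Phi> w) \<and>
      (LINT w|abs_dw. of_real (M w) * \<Phi> w) = (LINT \<theta>|torus. \<Phi> (T.Z \<theta>))"
    using T.smooth_density by blast
  have "(\<lambda>m. avg_upto m (\<lambda>\<psi> :: 'k set \<Rightarrow> complex. \<Phi> (log_deriv_L' s \<psi>))) \<longlonglongrightarrow> (LINT \<theta>|torus. \<Phi> (T.Z \<theta>))"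
    if s: "Re s = \<sigma>" and \<Phi>: "continuous_on UNIV \<Phi>" for s and \<Phi> :: "complex \<Rightarrow> complex"
  proof -
    \<comment> \<open>The unimodular part of \<open>N n powr (- s)\<close>. Moving it into the
      argument of the series leaves coefficients that depend on \<open>\<sigma>\<close> only, so one
      \<open>M\<close> serves all \<open>s\<close> on the line.\<close>
    define \<rho> where "\<rho> n = cis (- (Im s * ln (N n)))" for n
    define ev where "ev \<psi> n = \<rho> n * \<psi> (p n)" for \<psi> :: "'k set \<Rightarrow> complex" and n
    have ev: "ev \<psi> \<in> polydisc" if "f \<in> prime_divisors" "\<psi> \<in> char_family f" for f and \<psi> :: "'k set \<Rightarrow> complex"
      using norm_character_le[OF that] by (simp add: polydisc_def ev_def \<rho>_def norm_mult)
    have N_powr: "of_nat (ideal_norm (p n)) powr (- s) = of_real (r n) * \<rho> n" for n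
    proof -
      have e: "- s * of_real (ln (N n)) = of_real (- \<sigma> * ln (N n)) + \<i> * of_real (- (Im s * ln (N n)))"
        using s by (simp add: complex_eq_iff)
      have "complex_of_real (N n) powr (- s) = exp (of_real (- \<sigma> * ln (N n)) + \<i> * of_real (- (Im s * ln (N n))))"
        unfolding e[symmetric] using N2[of n] by (simp add: powr_def Ln_of_real)
      also have "\<dots> = of_real (r n) * \<rho> n"
        unfolding exp_add exp_of_real using N2[of n] by (simp add: r_def \<rho>_def cis_conv_exp powr_def)
      finally show ?thesis by (simp add: N_def)
    qed
    have val: "log_deriv_L' s \<psi> = T.series (ev \<psi>)" if f: "f \<in> prime_divisors" "\<psi> \<in> char_family f" for f and \<psi> :: "'k set \<Rightarrow> complex"
    proof -
      have "(\<lambda>n. of_real ((ln (real (ideal_norm (p n))))\<^sup>2) * koebe (\<psi> (p n) * of_nat (ideal_norm (p n)) powr (- s))) sums log_deriv_L' s \<psi>"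
        by (rule log_deriv_L'_sums[OF p _ sm norm_character_le[OF f]]) (use ideal_norm_ge2[OF pP] s \<sigma> in auto)
      moreover have "of_real ((ln (real (ideal_norm (p n))))\<^sup>2) * koebe (\<psi> (p n) * of_nat (ideal_norm (p n)) powr (- s)) =
        T.summand n (ev \<psi> n)" for n
        unfolding N_powr T.summand_def by (simp add: l_def N_def ev_def mult_ac)
      ultimately show ?thesis using sums_unique2[OF _ T.series_sums(1)[OF ev[OF f]]] by simp
    qed
    have "(\<lambda>m. avg_upto m (\<lambda>\<psi> :: 'k set \<Rightarrow> complex. (\<Phi> \<circ> T.series) (ev \<psi>))) \<longlonglongrightarrow> (LINT \<theta>|torus. (\<Phi> \<circ> T.series) (\<lambda>n. cis (\<theta> n)))"
    proof (rule torus_equidistribution[where L="\<lambda>m \<phi>. avg_upto m (\<lambda>\<psi> :: 'k set \<Rightarrow> complex. \<phi> (ev \<psi>))"])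
      show "avg_upto m (\<lambda>\<psi> :: 'k set \<Rightarrow> complex. f (ev \<psi>) + g (ev \<psi>)) =
        avg_upto m (\<lambda>\<psi> :: 'k set \<Rightarrow> complex. f (ev \<psi>)) + avg_upto m (\<lambda>\<psi> :: 'k set \<Rightarrow> complex. g (ev \<psi>))" for m f g
        by (rule avg_upto_add)
      show "avg_upto m (\<lambda>\<psi> :: 'k set \<Rightarrow> complex. c * f (ev \<psi>)) = c * avg_upto m (\<lambda>\<psi> :: 'k set \<Rightarrow> complex. f (ev \<psi>))" for m c f
        by (rule avg_upto_cmult)
      show "norm (avg_upto m (\<lambda>\<psi> :: 'k set \<Rightarrow> complex. f (ev \<psi>))) \<le> b"
        if "b \<ge> 0" "\<And>t. t \<in> polydisc \<Longrightarrow> norm (f t) \<le> b" for m b f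
        using that ev by (intro avg_upto_bound) auto
      show "continuous_on polydisc (\<Phi> \<circ> T.series)"
        by (intro continuous_on_compose T.series_continuous continuous_on_subset[OF \<Phi>]) auto
      fix A B :: "nat multiset"
      \<comment> \<open>The rotation multiplies a monomial by a fixed number, which is
        \<open>1\<close> for \<open>A = B\<close>; otherwise the limit is \<open>0\<close> with or
        without it.\<close>
      have split: "torus_monomial A B (ev \<psi>) = torus_monomial A B \<rho> * torus_monomial (image_mset p A) (image_mset p B) \<psi>" for \<psi>
      proof -
        have "(\<Prod>n\<in>#C. h (ev \<psi> n)) = (\<Prod>n\<in>#C. h (\<rho> n)) * (\<Prod>P\<in>#image_mset p C. h (\<psi> P))"
          if "\<And>x y. h (x * y) = h x * h y" for C and h :: "complex \<Rightarrow> complex"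
          by (induction C) (auto simp: ev_def that mult_ac)
        from this[of "\<lambda>x. x" A] this[of cnj B] show ?thesis by (simp add: torus_monomial_def mult_ac)
      qed
      have "(\<lambda>m. torus_monomial A B \<rho> * avg_upto m (torus_monomial (image_mset p A) (image_mset p B))) \<longlonglongrightarrow>
        torus_monomial A B \<rho> * (if image_mset p A = image_mset p B then 1 else 0)"
        by (intro tendsto_mult tendsto_const avg_upto_monomial) (use pP in auto)
      moreover have "torus_monomial A B \<rho> * (if image_mset p A = image_mset p B then 1 else 0) = (if A = B then 1 else 0)"
      proof (cases "A = B")
        case True
        have "(\<Prod>n\<in>#A. \<rho> n) * (\<Prod>n\<in>#A. cnj (\<rho> n)) = 1"
          unfolding prod_mset.distrib[symmetric] by (induction A) (auto simp: \<rho>_def cis_cnj cis_mult)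
        then show ?thesis using True by (simp add: torus_monomial_def)
      next
        case False
        then have "image_mset p A \<noteq> image_mset p B" using multiset.inj_map[OF inj] by (auto dest: injD)
        then show ?thesis using False by simp
      qed
      ultimately show "(\<lambda>m. avg_upto m (\<lambda>\<psi> :: 'k set \<Rightarrow> complex. torus_monomial A B (ev \<psi>))) \<longlonglongrightarrow> (if A = B then 1 else 0)"
        unfolding split avg_upto_cmult by simp
    qed
    moreover have "avg_upto m (\<lambda>\<psi> :: 'k set \<Rightarrow> complex. \<Phi> (log_deriv_L' s \<psi>)) = avg_upto m (\<lambda>\<psi>. (\<Phi> \<circ> T.series) (ev \<psi>))" for m
      by (rule avg_upto_cong) (simp add: val)
    ultimately show ?thesis by (simp add: T.Z_def)
  qed
  then show ?thesis by (intro exI[of _ M] conjI allI impI M) (simp_all add: M(5))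
qed

end

theorem theorem1p5:
  fixes \<sigma> :: real
  assumes "(\<rat> :: 'k :: field_char_0 set) = UNIV \<or> imaginary_quadratic TYPE('k)"
    and "\<sigma> > 1"
  shows "\<exists>M :: complex \<Rightarrow> real.
    C_infinity M \<and>
    (\<forall>w. M w \<ge> 0) \<and>
    integrable abs_dw M \<and> (LINT w|abs_dw. M w) = 1 \<and>
    (\<forall>s. Re s = \<sigma> \<longrightarrow>
      (\<forall>\<Phi> :: complex \<Rightarrow> complex. continuous_on UNIV \<Phi> \<longrightarrow>
        integrable abs_dw (\<lambda>w. of_real (M w) * \<Phi> w) \<and>
        (\<lambda>m. avg_upto m (\<lambda>\<psi> :: 'k set \<Rightarrow> complex. \<Phi> (log_deriv_L' s \<psi>)))
          \<longlonglongrightarrow> (LINT w|abs_dw. of_real (M w) * \<Phi> w)))"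
proof -
  obtain cj e D where "quad_field (cj :: 'k \<Rightarrow> 'k) e D"
    using assms(1) quad_field_rat quad_field_imaginary_quadratic by blast
  then show ?thesis using assms(2) by (rule quad_field.value_distribution)
qed

end
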